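(* There exists a computable $a>0$ such that if $T$ is a triangle, then $$|T|\lambda(T)-\lambda(T_{Eq})\ge a\Big(\frac{|R(T)\,\Delta\,sT_{Eq}|}{|T|}\Big)^2,$$ where $T_{Eq}$ is the equilateral triangle with area $1$, $R$ is a rigid motion (depending on $T$) and $s=\sqrt{|T|}$. Moreover, the exponent $2$ is sharp (it cannot be replaced by a smaller exponent).
   Context: $\lambda(\Omega)$ is the first Dirichlet eigenvalue of $-\Delta$ on $\Omega$; $|\cdot|$ is area and $\Delta$ between sets is symmetric difference. *)

theory Defs
  imports "HOL-Analysis.Analysis"
begin

section \<open>Test functions\<close>

primrec k_times_differentiable :: "nat \<Rightarrow> ('a::euclidean_space \<Rightarrow> real) \<Rightarrow> bool" where
  "k_times_differentiable 0 f \<longleftrightarrow> continuous_on UNIV f"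
| "k_times_differentiable (Suc k) f \<longleftrightarrow>
     (\<forall>x. f differentiable (at x)) \<and>
     (\<forall>b\<in>Basis. k_times_differentiable k (\<lambda>x. frechet_derivative f (at x) b))"

definition smooth :: "('a::euclidean_space \<Rightarrow> real) \<Rightarrow> bool" where
  "smooth f \<longleftrightarrow> (\<forall>k. k_times_differentiable k f)"

definition gradient :: "('a::euclidean_space \<Rightarrow> real) \<Rightarrow> 'a \<Rightarrow> 'a" where
  "gradient f x = (\<Sum>b\<in>Basis. frechet_derivative f (at x) b *\<^sub>R b)"

text \<open>The space \<open>C\<^sub>c\<^sup>\<infinity>(\<Omega>)\<close> for open \<open>\<Omega>\<close>, its elements being extended by zero to the whole space.\<close>

definition test_functions :: "'a::euclidean_space set \<Rightarrow> ('a \<Rightarrow> real) set" where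
  "test_functions \<Omega> =
     {\<phi>. smooth \<phi> \<and> compact (closure {x. \<phi> x \<noteq> 0}) \<and> closure {x. \<phi> x \<noteq> 0} \<subseteq> \<Omega>}"

section \<open>The first Dirichlet eigenvalue\<close>

definition square_integrable ::
    "'a::euclidean_space set \<Rightarrow> ('a \<Rightarrow> 'b::euclidean_space) \<Rightarrow> bool" where
  "square_integrable \<Omega> u \<longleftrightarrow>
     set_borel_measurable lebesgue \<Omega> u \<and> set_integrable lebesgue \<Omega> (\<lambda>x. (norm (u x))\<^sup>2)"

definition tendsto_L2 ::
    "'a::euclidean_space set \<Rightarrow> (nat \<Rightarrow> 'a \<Rightarrow> 'b::euclidean_space) \<Rightarrow> ('a \<Rightarrow> 'b) \<Rightarrow> bool" where
  "tendsto_L2 \<Omega> F u \<longleftrightarrow> (\<lambda>n. LINT x:\<Omega>|lebesgue. (norm (F n x - u x))\<^sup>2) \<longlonglongrightarrow> 0"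

text \<open>\<open>u\<close> belongs to \<open>H\<^sub>0\<^sup>1(\<Omega>)\<close>, the closure of \<open>C\<^sub>c\<^sup>\<infinity>(\<Omega>)\<close> in the \<open>H\<^sup>1\<close> norm,
  and \<open>g\<close> is its weak gradient (which the approximation determines almost everywhere).\<close>

definition H10_with_gradient ::
    "'a::euclidean_space set \<Rightarrow> ('a \<Rightarrow> real) \<Rightarrow> ('a \<Rightarrow> 'a) \<Rightarrow> bool" where
  "H10_with_gradient \<Omega> u g \<longleftrightarrow>
     square_integrable \<Omega> u \<and> square_integrable \<Omega> g \<and>
     (\<exists>\<phi>. (\<forall>n. \<phi> n \<in> test_functions \<Omega>) \<and>
          tendsto_L2 \<Omega> \<phi> u \<and> tendsto_L2 \<Omega> (\<lambda>n. gradient (\<phi> n)) g)"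

text \<open>\<open>-\<Delta>u = \<mu>u\<close> holds weakly in \<open>\<Omega>\<close> for some nonzero \<open>u\<close> in \<open>H\<^sub>0\<^sup>1(\<Omega>)\<close>.\<close>

definition dirichlet_eigenvalue :: "'a::euclidean_space set \<Rightarrow> real \<Rightarrow> bool" where
  "dirichlet_eigenvalue \<Omega> \<mu> \<longleftrightarrow>
     (\<exists>u g. H10_with_gradient \<Omega> u g \<and>
        \<not> (AE x in lebesgue. x \<in> \<Omega> \<longrightarrow> u x = 0) \<and>
        (\<forall>\<psi>\<in>test_functions \<Omega>.
           (LINT x:\<Omega>|lebesgue. g x \<bullet> gradient \<psi> x) = \<mu> * (LINT x:\<Omega>|lebesgue. u x * \<psi> x)))"

definition first_dirichlet_eigenvalue :: "'a::euclidean_space set \<Rightarrow> real" where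
  "first_dirichlet_eigenvalue \<Omega> = (LEAST \<mu>. dirichlet_eigenvalue \<Omega> \<mu>)"

section \<open>Triangles and rigid motions of the plane\<close>

text \<open>Triangles are nondegenerate and, being domains, open.\<close>

definition plane_triangle :: "(real^2) set \<Rightarrow> bool" where
  "plane_triangle T \<longleftrightarrow> (\<exists>a b c. \<not> collinear {a, b, c} \<and> T = interior (convex hull {a, b, c}))"

definition equilateral_triangle :: "(real^2) set \<Rightarrow> bool" where
  "equilateral_triangle T \<longleftrightarrow>
     (\<exists>a b c. \<not> collinear {a, b, c} \<and> dist a b = dist b c \<and> dist b c = dist c a \<and>
        T = interior (convex hull {a, b, c}))"

text \<open>Reflections are admitted as rigid motions; since an equilateral triangle is symmetric under
  reflections, this does not affect which values \<open>|R(T) \<Delta> sT\<^sub>E\<^sub>q|\<close> can take.\<close>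

definition rigid_motion :: "(real^2 \<Rightarrow> real^2) \<Rightarrow> bool" where
  "rigid_motion R \<longleftrightarrow> (\<exists>f b. orthogonal_transformation f \<and> R = (\<lambda>x. f x + b))"

section \<open>Computable real numbers\<close>

text \<open>The total recursive functions. An argument tuple is a list, in which missing arguments are read
  as \<open>0\<close> and superfluous ones are ignored, so that functions of all arities share one type. In
  the last rule, minimisation is applied only where it always terminates.\<close>

inductive total_recursive :: "(nat list \<Rightarrow> nat) \<Rightarrow> bool" where
  zero: "total_recursive (\<lambda>xs. 0)"
| succ: "total_recursive (\<lambda>xs. case xs of [] \<Rightarrow> 1 | x # _ \<Rightarrow> Suc x)"
| proj: "total_recursive (\<lambda>xs. if i < length xs then xs ! i else 0)"
| comp: "total_recursive f \<Longrightarrow> \<forall>g\<in>set gs. total_recursive g \<Longrightarrow>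
    total_recursive (\<lambda>xs. f (map (\<lambda>g. g xs) gs))"
| prim_rec: "total_recursive f \<Longrightarrow> total_recursive g \<Longrightarrow>
    total_recursive (\<lambda>xs. case xs of [] \<Rightarrow> f []
      | n # ys \<Rightarrow> rec_nat (f ys) (\<lambda>m r. g (m # r # ys)) n)"
| minimisation: "total_recursive f \<Longrightarrow> \<forall>xs. \<exists>n. f (n # xs) = 0 \<Longrightarrow>
    total_recursive (\<lambda>xs. LEAST n. f (n # xs) = 0)"

text \<open>A recursive sequence of rationals \<open>(p(n) - m(n)) / (q(n) + 1)\<close> approximates \<open>x\<close> to
  within \<open>2\<^sup>-\<^sup>n\<close>.\<close>

definition computable_real :: "real \<Rightarrow> bool" where
  "computable_real x \<longleftrightarrow>
     (\<exists>p m q. total_recursive p \<and> total_recursive m \<and> total_recursive q \<and>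
        (\<forall>n. \<bar>x - (real (p [n]) - real (m [n])) / (real (q [n]) + 1)\<bar> \<le> 1 / 2 ^ n))"

end

theory Submission
  imports Defs "HOL-Complex_Analysis.Great_Picard"
begin

text \<open>Pull everything back to the triangle with vertices \<open>(0,0)\<close>, \<open>(1,0)\<close>, \<open>(0,1)\<close>. For a triangle \<open>T\<close> with edge vectors \<open>a\<close>, \<open>b\<close>
the Dirichlet integral becomes a quadratic form whose three coefficients are proportional to the
squared side lengths. Normalise these to \<open>4/3 (1 + x\<^sub>i)\<close> with \<open>x\<^sub>1 + x\<^sub>2 + x\<^sub>3 = 0\<close> and put
\<open>R = 2/3 (x\<^sub>1\<^sup>2 + x\<^sub>2\<^sup>2 + x\<^sub>3\<^sup>2)\<close>. If \<open>16 \<pi>\<^sup>2 M / 3\<close> is the least eigenvalue of the normalised form, then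
\<open>|T| \<lambda>(T) = (4 \<pi>\<^sup>2 / \<surd>3) M / \<surd>(1 - R)\<close>, and \<open>R = 0\<close> is the equilateral triangle with \<open>M = 1\<close>. The number
\<open>\<surd>R\<close> measures the distance to the equilateral shape to first order, so the inequality follows from
\<open>M \<ge> \<surd>(1 - R) + R / 1000\<close> (\<open>LBx_stability\<close>) and from the bound \<open>48 \<surd>R\<close> for the asymmetry
(\<open>asymmetry_upper\<close>).

The function \<open>M\<close> is concave in \<open>x\<close>, being a minimum of affine functions, so lower bounds at finitely many
triangles propagate. For \<open>R \<ge> 1/16\<close> the bounds come from triangles with a positive explicit
eigenfunction (Barta's principle): the triangle inside a strip, the half square and the half of an
equilateral triangle. For \<open>R \<le> 1/16\<close> a second order perturbation argument around the equilateral
triangle gives \<open>M \<ge> 1 - 12 R / 25\<close> (\<open>LBx_near\<close>). It needs the gap between the first three eigenvalues of the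
equilateral triangle and the rest of its spectrum (\<open>spectral_gap\<close>). This gap is obtained from Lame's
trigonometric eigenfunctions, which are shown to be dense by the Stone-Weierstrass theorem.

The defined first eigenvalue is a least element, whose existence needs a minimiser of the Rayleigh
quotient (\<open>first_dirichlet_eigenvalue_variational\<close>). The required compactness is Rellich's theorem for
triangles (\<open>Rellich_triangle\<close>), which rests on Poincare's inequality on the cells of a fine grid.
Smooth truncations of the ground state of the equilateral triangle, carried over to \<open>T\<close>, bound the
eigenvalue from above (\<open>Rayleigh_upper\<close>).

For the sharpness stretch the equilateral triangle by \<open>1 + t\<close> along a side and compensate so that the area is kept.
The upper bound shows that the deficit is at most \<open>C t\<^sup>2\<close> (\<open>stretched_energy\<close>), while second moments
show that the asymmetry is at least \<open>c t\<close> for every rigid motion (\<open>stretched_asymmetry\<close>).\<close>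

section \<open>Calculus on the standard triangle\<close>

definition std_triangle :: "(real \<times> real) set" where
  "std_triangle = {(s, t). 0 \<le> s \<and> 0 \<le> t \<and> s + t \<le> 1}"

definition tri_int :: "(real \<times> real \<Rightarrow> real) \<Rightarrow> real" where
  "tri_int f = (LINT x:std_triangle|lborel. f x)"

text \<open>Only the two partial derivatives are recorded, because all later calculus is one-dimensional along the axes.\<close>
definition C1 :: "(real \<times> real \<Rightarrow> real) \<Rightarrow> (real \<times> real \<Rightarrow> real) \<Rightarrow> (real \<times> real \<Rightarrow> real) \<Rightarrow> bool" where
  "C1 f fs ft \<longleftrightarrow> continuous_on UNIV f \<and> continuous_on UNIV fs \<and> continuous_on UNIV ft \<and>
     (\<forall>s t. ((\<lambda>s. f (s, t)) has_real_derivative fs (s, t)) (at s)) \<and>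
     (\<forall>s t. ((\<lambda>t. f (s, t)) has_real_derivative ft (s, t)) (at t))"

lemma C1_cont: "C1 f fs ft \<Longrightarrow> continuous_on UNIV f" "C1 f fs ft \<Longrightarrow> continuous_on UNIV fs"
  "C1 f fs ft \<Longrightarrow> continuous_on UNIV ft"
  by (auto simp: C1_def)

lemma C1_const: "C1 (\<lambda>x. c) (\<lambda>x. 0) (\<lambda>x. 0)"
  by (auto simp: C1_def intro!: continuous_intros)

lemma C1_add:
  assumes "C1 f fs ft" "C1 g gs gt"
  shows "C1 (\<lambda>x. f x + g x) (\<lambda>x. fs x + gs x) (\<lambda>x. ft x + gt x)"
  using assms by (auto simp: C1_def intro!: continuous_on_add DERIV_add)

lemma C1_mult:
  assumes "C1 f fs ft" "C1 g gs gt"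
  shows "C1 (\<lambda>x. f x * g x) (\<lambda>x. fs x * g x + f x * gs x) (\<lambda>x. ft x * g x + f x * gt x)"
  using assms unfolding C1_def
  by (auto intro!: continuous_on_add continuous_on_mult derivative_eq_intros)

lemma C1_cmult: "C1 f fs ft \<Longrightarrow> C1 (\<lambda>x. c * f x) (\<lambda>x. c * fs x) (\<lambda>x. c * ft x)"
  unfolding C1_def by (auto intro!: continuous_on_mult continuous_on_const DERIV_cmult)

lemma C1_diff:
  assumes "C1 f fs ft" "C1 g gs gt"
  shows "C1 (\<lambda>x. f x - g x) (\<lambda>x. fs x - gs x) (\<lambda>x. ft x - gt x)"
  using assms by (auto simp: C1_def intro!: continuous_on_diff DERIV_diff)

lemma C1_affine_sin:
  "C1 (\<lambda>x. sin (a * fst x + b * snd x + c)) (\<lambda>x. a * cos (a * fst x + b * snd x + c))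
      (\<lambda>x. b * cos (a * fst x + b * snd x + c))"
  unfolding C1_def by (auto intro!: continuous_intros derivative_eq_intros)

lemma C1_affine_cos:
  "C1 (\<lambda>x. cos (a * fst x + b * snd x + c)) (\<lambda>x. - a * sin (a * fst x + b * snd x + c))
      (\<lambda>x. - b * sin (a * fst x + b * snd x + c))"
  unfolding C1_def by (auto intro!: continuous_intros derivative_eq_intros)

lemma compact_std_triangle: "compact std_triangle"
proof -
  have "closed std_triangle"
  proof -
    have "std_triangle = {x. 0 \<le> fst x} \<inter> {x. 0 \<le> snd x} \<inter> {x. fst x + snd x \<le> 1}"
      by (auto simp: std_triangle_def)
    moreover have "closed \<dots>"
      by (intro closed_Int closed_Collect_le continuous_intros)
    ultimately show ?thesis by simp
  qed
  moreover have "std_triangle \<subseteq> cbox (0,0) (1,1)"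
    by (auto simp: std_triangle_def cbox_Pair_eq)
  ultimately show ?thesis
    by (metis compact_Int_closed compact_cbox inf.absorb_iff2)
qed

lemma tri_integrable:
  fixes f :: "real \<times> real \<Rightarrow> real"
  assumes "continuous_on UNIV f" shows "set_integrable lborel std_triangle f"
  unfolding set_integrable_def
  by (rule borel_integrable_compact[OF compact_std_triangle]) (use assms continuous_on_subset in blast)

lemma tri_int_add:
  assumes "continuous_on UNIV f" "continuous_on UNIV g"
  shows "tri_int (\<lambda>x. f x + g x) = tri_int f + tri_int g"
  unfolding tri_int_def by (rule set_integral_add) (auto intro: tri_integrable assms)

lemma tri_int_diff:
  assumes "continuous_on UNIV f" "continuous_on UNIV g"
  shows "tri_int (\<lambda>x. f x - g x) = tri_int f - tri_int g"
  unfolding tri_int_def by (rule set_integral_diff) (auto intro: tri_integrable assms)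

lemma tri_int_cmult: "tri_int (\<lambda>x. c * f x) = c * tri_int f"
  unfolding tri_int_def by simp

lemma tri_int_minus: "tri_int (\<lambda>x. - f x) = - tri_int f"
  using tri_int_cmult[of "-1" f] by simp

lemma tri_int_cong: "(\<And>x. x \<in> std_triangle \<Longrightarrow> f x = g x) \<Longrightarrow> tri_int f = tri_int g"
  unfolding tri_int_def set_lebesgue_integral_def by (rule Bochner_Integration.integral_cong) (auto simp: indicator_def)

lemma tri_int_mono:
  assumes "continuous_on UNIV f" "continuous_on UNIV g" "\<And>x. x \<in> std_triangle \<Longrightarrow> f x \<le> g x"
  shows "tri_int f \<le> tri_int g"
  unfolding tri_int_def by (rule set_integral_mono) (auto intro: tri_integrable assms)

lemma tri_int_nonneg: "(\<And>x. x \<in> std_triangle \<Longrightarrow> 0 \<le> f x) \<Longrightarrow> 0 \<le> tri_int f"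
  unfolding tri_int_def set_lebesgue_integral_def
  by (rule Bochner_Integration.integral_nonneg) (auto simp: indicator_def)

lemma tri_int_sum:
  assumes "\<And>i. i \<in> I \<Longrightarrow> continuous_on UNIV (f i)"
  shows "tri_int (\<lambda>x. \<Sum>i\<in>I. f i x) = (\<Sum>i\<in>I. tri_int (f i))"
proof (cases "finite I")
  case True
  then show ?thesis using assms
  proof (induction I)
    case empty then show ?case by (simp add: tri_int_def)
  next
    case (insert i I)
    then have "tri_int (\<lambda>x. f i x + (\<Sum>i\<in>I. f i x)) = tri_int (f i) + tri_int (\<lambda>x. \<Sum>i\<in>I. f i x)"
      by (intro tri_int_add continuous_on_sum) auto
    with insert show ?case by simp
  qed
qed (simp add: tri_int_def)

lemma tri_int_fubini:
  assumes f: "continuous_on UNIV f"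
  shows "tri_int f = (LINT s:{0..1}|lborel. LINT t:{0..1-s}|lborel. f (s, t))"
    and "tri_int f = (LINT t:{0..1}|lborel. LINT s:{0..1-t}|lborel. f (s, t))"
proof -
  define g where "g = (\<lambda>(s::real) (t::real). indicator std_triangle (s,t) *\<^sub>R f (s,t))"
  have i: "integrable (lborel \<Otimes>\<^sub>M lborel) (case_prod g)"
    using tri_integrable[OF f] unfolding set_integrable_def lborel_prod g_def
    by (simp add: case_prod_unfold)
  have e: "tri_int f = integral\<^sup>L (lborel \<Otimes>\<^sub>M lborel) (case_prod g)"
    unfolding tri_int_def set_lebesgue_integral_def lborel_prod g_def by (simp add: case_prod_unfold)
  have "(\<integral>s. (\<integral>t. g s t \<partial>lborel) \<partial>lborel) = tri_int f"
    unfolding e using lborel_pair.integral_fst'[OF i] by simp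
  moreover have "(\<integral>t. g s t \<partial>lborel) = indicator {0..1} s *\<^sub>R (LINT t:{0..1-s}|lborel. f (s, t))" for s
    unfolding set_lebesgue_integral_def g_def integral_scaleR_right[symmetric]
    by (rule Bochner_Integration.integral_cong) (auto simp: indicator_def std_triangle_def)
  ultimately show "tri_int f = (LINT s:{0..1}|lborel. LINT t:{0..1-s}|lborel. f (s, t))"
    by (simp add: set_lebesgue_integral_def)
  have "(\<integral>t. (\<integral>s. g s t \<partial>lborel) \<partial>lborel) = tri_int f"
    unfolding e using lborel_pair.integral_snd[OF i] by simp
  moreover have "(\<integral>s. g s t \<partial>lborel) = indicator {0..1} t *\<^sub>R (LINT s:{0..1-t}|lborel. f (s, t))" for t
    unfolding set_lebesgue_integral_def g_def integral_scaleR_right[symmetric]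
    by (rule Bochner_Integration.integral_cong) (auto simp: indicator_def std_triangle_def)
  ultimately show "tri_int f = (LINT t:{0..1}|lborel. LINT s:{0..1-t}|lborel. f (s, t))"
    by (simp add: set_lebesgue_integral_def)
qed

lemma tri_int_derivative:
  assumes f: "C1 f fs ft"
  shows "tri_int fs = (LINT t:{0..1}|lborel. f (1 - t, t) - f (0, t))"
    and "tri_int ft = (LINT s:{0..1}|lborel. f (s, 1 - s) - f (s, 0))"
proof -
  have "(LINT s:{0..1-t}|lborel. fs (s, t)) = f (1 - t, t) - f (0, t)" if "t \<in> {0..1}" for t
    unfolding set_lebesgue_integral_def
    by (rule integral_FTC_atLeastAtMost)
       (use f that in \<open>auto simp: C1_def has_real_derivative_iff_has_vector_derivative[symmetric]
          intro: has_field_derivative_at_within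
          intro!: continuous_on_compose2[where g=fs and f="\<lambda>s. (s, t)"] continuous_intros\<close>)
  then show "tri_int fs = (LINT t:{0..1}|lborel. f (1 - t, t) - f (0, t))"
    unfolding tri_int_fubini(2)[OF C1_cont(2)[OF f]]
    by (intro set_lebesgue_integral_cong) auto
  have "(LINT t:{0..1-s}|lborel. ft (s, t)) = f (s, 1 - s) - f (s, 0)" if "s \<in> {0..1}" for s
    unfolding set_lebesgue_integral_def
    by (rule integral_FTC_atLeastAtMost)
       (use f that in \<open>auto simp: C1_def has_real_derivative_iff_has_vector_derivative[symmetric]
          intro: has_field_derivative_at_within
          intro!: continuous_on_compose2[where g=ft and f="\<lambda>t. (s, t)"] continuous_intros\<close>)
  then show "tri_int ft = (LINT s:{0..1}|lborel. f (s, 1 - s) - f (s, 0))"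
    unfolding tri_int_fubini(1)[OF C1_cont(3)[OF f]]
    by (intro set_lebesgue_integral_cong) auto
qed

definition zero_bdry :: "(real \<times> real \<Rightarrow> real) \<Rightarrow> bool" where
  "zero_bdry f \<longleftrightarrow> (\<forall>t. f (0, t) = 0 \<and> f (t, 0) = 0 \<and> f (t, 1 - t) = 0)"

lemma tri_int_derivative_zero:
  assumes "C1 f fs ft" "zero_bdry f" shows "tri_int fs = 0" "tri_int ft = 0"
proof -
  have "f (1 - t, t) = 0" for t using assms(2) unfolding zero_bdry_def
    by (metis add.commute add_diff_cancel_left' diff_add_cancel)
  then show "tri_int fs = 0" "tri_int ft = 0"
    using tri_int_derivative[OF assms(1)] assms(2) by (auto simp: zero_bdry_def set_lebesgue_integral_def)
qed

section \<open>Quadratic forms and positive supersolutions\<close>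

text \<open>Support at positive distance from the sides.\<close>
definition core :: "(real \<times> real \<Rightarrow> real) \<Rightarrow> bool" where
  "core v \<longleftrightarrow> (\<exists>d>0. \<forall>s t. s < d \<or> t < d \<or> s + t > 1 - d \<longrightarrow> v (s, t) = 0)"

lemma core_zero_bdry: "core v \<Longrightarrow> zero_bdry v"
  by (force simp: core_def zero_bdry_def)

text \<open>The bilinear form of gradients in affine coordinates. With \<open>p\<close>, \<open>q\<close>, \<open>r\<close> proportional to the squared lengths of
  the three sides it is the Euclidean product of the gradients on the triangle with these sides; written in \<open>p\<close>, \<open>q\<close>, \<open>r\<close>,
  the form is symmetric under relabelling of the vertices.\<close>
definition bil :: "real \<Rightarrow> real \<Rightarrow> real \<Rightarrow> real \<Rightarrow> real \<Rightarrow> real \<Rightarrow> real \<Rightarrow> real" where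
  "bil p q r a b c d = p * a * c + q * b * d + (r - p - q) / 2 * (a * d + b * c)"

definition dform where
  "dform p q r vs vt ws wt = tri_int (\<lambda>x. bil p q r (vs x) (vt x) (ws x) (wt x))"

text \<open>The number \<open>\<mu>\<close> is a lower bound for the first Dirichlet eigenvalue of the form.\<close>
definition LB :: "real \<Rightarrow> real \<Rightarrow> real \<Rightarrow> real \<Rightarrow> bool" where
  "LB p q r \<mu> \<longleftrightarrow> (\<forall>v vs vt. C1 v vs vt \<and> core v \<longrightarrow>
     \<mu> * tri_int (\<lambda>x. (v x)\<^sup>2) \<le> dform p q r vs vt vs vt)"

definition psd :: "real \<Rightarrow> real \<Rightarrow> real \<Rightarrow> bool" where
  "psd p q r \<longleftrightarrow> 0 \<le> p \<and> 0 \<le> q \<and> (r - p - q)\<^sup>2 \<le> 4 * p * q"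

lemma bil_nonneg:
  assumes "psd p q r" shows "0 \<le> bil p q r a b a b"
proof -
  have e: "bil p q r a b a b = p * a\<^sup>2 + q * b\<^sup>2 + (r - p - q) * (a * b)"
    by (simp add: bil_def field_simps power2_eq_square)
  show ?thesis
  proof (cases "p = 0")
    case True
    then have "(r - p - q)\<^sup>2 \<le> 0" using assms by (simp add: psd_def)
    then have "r - p - q = 0" by simp
    then show ?thesis unfolding e using assms by (simp add: psd_def)
  next
    case False
    then have p: "p > 0" using assms by (auto simp: psd_def)
    have "4 * p * (p * a\<^sup>2 + q * b\<^sup>2 + (r - p - q) * (a * b)) =
        (2 * p * a + (r - p - q) * b)\<^sup>2 + (4 * p * q - (r - p - q)\<^sup>2) * b\<^sup>2"
      by (simp add: algebra_simps power2_eq_square)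
    also have "\<dots> \<ge> 0" using assms by (auto simp: psd_def)
    finally show ?thesis unfolding e using p by (simp add: zero_le_mult_iff)
  qed
qed

lemma core_deriv_zero:
  assumes "C1 v vs vt" "core v"
  obtains d where "d > 0" "\<And>s t. s < d \<or> t < d \<or> s + t > 1 - d \<Longrightarrow> v (s, t) = 0 \<and> vs (s, t) = 0 \<and> vt (s, t) = 0"
proof -
  obtain d where d: "d > 0" "\<And>s t. s < d \<or> t < d \<or> s + t > 1 - d \<Longrightarrow> v (s, t) = 0"
    using assms(2) by (auto simp: core_def)
  define U where "U = {x::real\<times>real. fst x < d} \<union> {x. snd x < d} \<union> {x. 1 - d < fst x + snd x}"
  have "open U" unfolding U_def by (intro open_Un open_Collect_less continuous_intros)
  have z: "v x = 0" if "x \<in> U" for x using that d(2)[of "fst x" "snd x"] by (auto simp: U_def)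
  have "vs (s, t) = 0 \<and> vt (s, t) = 0" if "(s, t) \<in> U" for s t
  proof -
    have "open ((\<lambda>s. (s, t)) -` U)" "open ((\<lambda>t. (s, t)) -` U)"
      using \<open>open U\<close> by (intro open_vimage continuous_intros; simp)+
    then have "((\<lambda>s. v (s, t)) has_real_derivative 0) (at s)" "((\<lambda>t. v (s, t)) has_real_derivative 0) (at t)"
      using that z has_field_derivative_transform_within_open[OF DERIV_const[of 0], where S="(\<lambda>s. (s, t)) -` U"]
        has_field_derivative_transform_within_open[OF DERIV_const[of 0], where S="(\<lambda>t. (s, t)) -` U"]
      by auto
    then show ?thesis using assms(1) unfolding C1_def by (metis DERIV_unique)
  qed
  with that[OF d(1)] z show ?thesis by (auto simp: U_def)
qed

text \<open>The quotient by a function that vanishes only on the sides is again continuously differentiable, since the numerator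
  vanishes near the sides.\<close>
lemma core_divide:
  assumes v: "C1 v vs vt" "core v" and w: "C1 w ws wt"
    and nz: "\<And>s t. 0 < s \<Longrightarrow> 0 < t \<Longrightarrow> s + t < 1 \<Longrightarrow> w (s, t) \<noteq> 0"
  shows "C1 (\<lambda>x. v x / w x) (\<lambda>x. vs x / w x - v x * ws x / (w x)\<^sup>2) (\<lambda>x. vt x / w x - v x * wt x / (w x)\<^sup>2)"
proof -
  obtain d where d: "d > 0" "\<And>s t. s < d \<or> t < d \<or> s + t > 1 - d \<Longrightarrow> v (s, t) = 0 \<and> vs (s, t) = 0 \<and> vt (s, t) = 0"
    using core_deriv_zero[OF v] by blast
  define U where "U = {x::real\<times>real. fst x < d} \<union> {x. snd x < d} \<union> {x. 1 - d < fst x + snd x}"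
  define V where "V = {x::real\<times>real. 0 < fst x} \<inter> {x. 0 < snd x} \<inter> {x. fst x + snd x < 1}"
  have oU: "open U" unfolding U_def by (intro open_Un open_Collect_less continuous_intros)
  have oV: "open V" unfolding V_def by (intro open_Int open_Collect_less continuous_intros)
  have UV: "U \<union> V = UNIV" using d(1) by (auto simp: U_def V_def)
  have z: "v x = 0" "vs x = 0" "vt x = 0" if "x \<in> U" for x
    using that d(2)[of "fst x" "snd x"] by (auto simp: U_def)
  have wV: "w x \<noteq> 0" if "x \<in> V" for x using nz[of "fst x" "snd x"] that by (auto simp: V_def)
  have cont: "continuous_on UNIV f" if "continuous_on V f" "\<And>x. x \<in> U \<Longrightarrow> f x = 0" for f :: "real\<times>real \<Rightarrow> real"
  proof -
    have "continuous_on U f" using that(2) by (simp cong: continuous_on_cong)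
    then show ?thesis using continuous_on_open_Un[OF oU oV _ that(1)] UV by simp
  qed
  have c: "continuous_on V v" "continuous_on V vs" "continuous_on V vt" "continuous_on V w"
     "continuous_on V ws" "continuous_on V wt"
    using v(1) w C1_cont continuous_on_subset[OF _ subset_UNIV] by blast+
  show ?thesis unfolding C1_def
  proof (intro conjI allI)
    show "continuous_on UNIV (\<lambda>x. v x / w x)"
      "continuous_on UNIV (\<lambda>x. vs x / w x - v x * ws x / (w x)\<^sup>2)"
      "continuous_on UNIV (\<lambda>x. vt x / w x - v x * wt x / (w x)\<^sup>2)"
      by (rule cont; use z wV in \<open>auto intro!: continuous_intros c\<close>)+
    fix s t
    show "((\<lambda>s. v (s, t) / w (s, t)) has_real_derivative vs (s, t) / w (s, t) - v (s, t) * ws (s, t) / (w (s, t))\<^sup>2) (at s)"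
    proof (cases "(s, t) \<in> U")
      case True
      have "open ((\<lambda>s. (s, t)) -` U)" using oU by (intro open_vimage continuous_intros)
      then have "((\<lambda>s. v (s, t) / w (s, t)) has_real_derivative 0) (at s)"
        by (rule has_field_derivative_transform_within_open[where f="\<lambda>_. 0", OF DERIV_const])
           (use True z in auto)
      then show ?thesis using z[OF True] by simp
    next
      case False
      then have "w (s, t) \<noteq> 0" using UV wV by blast
      moreover have "((\<lambda>s. v (s, t)) has_real_derivative vs (s, t)) (at s)" "((\<lambda>s. w (s, t)) has_real_derivative ws (s, t)) (at s)"
        using v(1) w by (auto simp: C1_def)
      ultimately show ?thesis
        by (auto intro!: derivative_eq_intros simp: field_simps power2_eq_square)
    qed
    show "((\<lambda>t. v (s, t) / w (s, t)) has_real_derivative vt (s, t) / w (s, t) - v (s, t) * wt (s, t) / (w (s, t))\<^sup>2) (at t)"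
    proof (cases "(s, t) \<in> U")
      case True
      have "open ((\<lambda>t. (s, t)) -` U)" using oU by (intro open_vimage continuous_intros)
      then have "((\<lambda>t. v (s, t) / w (s, t)) has_real_derivative 0) (at t)"
        by (rule has_field_derivative_transform_within_open[where f="\<lambda>_. 0", OF DERIV_const])
           (use True z in auto)
      then show ?thesis using z[OF True] by simp
    next
      case False
      then have "w (s, t) \<noteq> 0" using UV wV by blast
      moreover have "((\<lambda>t. v (s, t)) has_real_derivative vt (s, t)) (at t)" "((\<lambda>t. w (s, t)) has_real_derivative wt (s, t)) (at t)"
        using v(1) w by (auto simp: C1_def)
      ultimately show ?thesis
        by (auto intro!: derivative_eq_intros simp: field_simps power2_eq_square)
    qed
  qed
qed

lemma continuous_bil:
  assumes "continuous_on UNIV a" "continuous_on UNIV b" "continuous_on UNIV c" "continuous_on UNIV d"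
  shows "continuous_on UNIV (\<lambda>x. bil p q r (a x) (b x) (c x) (d x))"
  unfolding bil_def by (intro continuous_intros assms)

text \<open>Barta's principle. Write \<open>v = w z\<close>. Expanding the form, the cross terms combine with the differential equation of \<open>w\<close>
  to a divergence, and what remains is \<open>w\<^sup>2\<close> times the nonnegative form of the gradient of \<open>z\<close>.\<close>
lemma Barta:
  assumes w: "C1 w ws wt" "C1 ws wss wst" "C1 wt wst wtt"
    and pos: "\<And>s t. 0 < s \<Longrightarrow> 0 < t \<Longrightarrow> s + t < 1 \<Longrightarrow> w (s, t) > 0"
    and eq: "\<And>s t. p * wss (s, t) + (r - p - q) * wst (s, t) + q * wtt (s, t) = - \<mu> * w (s, t)"
    and psd: "psd p q r"
  shows "LB p q r \<mu>"
  unfolding LB_def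
proof (intro allI impI, elim conjE)
  fix v vs vt assume v: "C1 v vs vt" "core v"
  define \<beta> where "\<beta> = (r - p - q) / 2"
  define F where "F = (\<lambda>x. v x * (v x / w x))"
  define Fs where "Fs = (\<lambda>x. vs x * (v x / w x) + v x * (vs x / w x - v x * ws x / (w x)\<^sup>2))"
  define Ft where "Ft = (\<lambda>x. vt x * (v x / w x) + v x * (vt x / w x - v x * wt x / (w x)\<^sup>2))"
  have nz: "\<And>s t. 0 < s \<Longrightarrow> 0 < t \<Longrightarrow> s + t < 1 \<Longrightarrow> w (s, t) \<noteq> 0" using pos by force
  have F: "C1 F Fs Ft" unfolding F_def Fs_def Ft_def
    by (intro C1_mult v core_divide[OF v w(1) nz])
  have G1: "C1 (\<lambda>x. F x * (p * ws x + \<beta> * wt x)) (\<lambda>x. Fs x * (p * ws x + \<beta> * wt x) + F x * (p * wss x + \<beta> * wst x))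
      (\<lambda>x. Ft x * (p * ws x + \<beta> * wt x) + F x * (p * wst x + \<beta> * wtt x))" (is "C1 ?G1 ?G1s ?G1t")
    by (intro C1_mult C1_add C1_cmult w F)
  have G2: "C1 (\<lambda>x. F x * (q * wt x + \<beta> * ws x)) (\<lambda>x. Fs x * (q * wt x + \<beta> * ws x) + F x * (q * wst x + \<beta> * wss x))
      (\<lambda>x. Ft x * (q * wt x + \<beta> * ws x) + F x * (q * wtt x + \<beta> * wst x))" (is "C1 ?G2 ?G2s ?G2t")
    by (intro C1_mult C1_add C1_cmult w F)
  have zb: "zero_bdry ?G1" "zero_bdry ?G2" using core_zero_bdry[OF v(2)] by (auto simp: zero_bdry_def F_def)
  obtain d where d: "d > 0" "\<And>s t. s < d \<or> t < d \<or> s + t > 1 - d \<Longrightarrow> v (s, t) = 0 \<and> vs (s, t) = 0 \<and> vt (s, t) = 0"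
    using core_deriv_zero[OF v] by blast
  have ptw: "?G1s x + ?G2t x + \<mu> * (v x)\<^sup>2 \<le> bil p q r (vs x) (vt x) (vs x) (vt x)" for x
  proof (cases "fst x < d \<or> snd x < d \<or> fst x + snd x > 1 - d")
    case True
    then have "v x = 0" "vs x = 0" "vt x = 0" using d(2)[of "fst x" "snd x"] by auto
    then show ?thesis by (simp add: F_def Fs_def Ft_def bil_def)
  next
    case False
    then have nz: "w x \<noteq> 0" using pos[of "fst x" "snd x"] d(1) by (auto simp: not_less)
    define y where "y = v x / w x"
    have vx: "v x = y * w x" using nz by (simp add: y_def)
    have b2: "2 * \<beta> = r - p - q" by (simp add: \<beta>_def)
    have b3: "p * wss x + 2 * \<beta> * wst x + q * wtt x = - \<mu> * w x"
      unfolding b2 using eq[of "fst x" "snd x"] by (simp only: prod.collapse)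
    have e1: "y * v x * (p * wss x + 2 * \<beta> * wst x + q * wtt x) + \<mu> * (v x)\<^sup>2 = 0"
      unfolding b3 unfolding vx by (simp add: power2_eq_square)
    have Fe: "F x = y * v x" "Fs x = 2 * y * vs x - y\<^sup>2 * ws x" "Ft x = 2 * y * vt x - y\<^sup>2 * wt x"
      unfolding F_def Fs_def Ft_def y_def using nz by (simp_all add: field_simps power2_eq_square)
    have "?G1s x + ?G2t x + \<mu> * (v x)\<^sup>2 =
      (2 * y * vs x - y\<^sup>2 * ws x) * (p * ws x + \<beta> * wt x) + (2 * y * vt x - y\<^sup>2 * wt x) * (q * wt x + \<beta> * ws x)
      + (y * v x * (p * wss x + 2 * \<beta> * wst x + q * wtt x) + \<mu> * (v x)\<^sup>2)"
      unfolding Fe by algebra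
    also have "\<dots> = (2 * y * vs x - y\<^sup>2 * ws x) * (p * ws x + \<beta> * wt x) + (2 * y * vt x - y\<^sup>2 * wt x) * (q * wt x + \<beta> * ws x)"
      unfolding e1 by simp
    also have "\<dots> = bil p q r (vs x) (vt x) (vs x) (vt x)
        - bil p q r (vs x - y * ws x) (vt x - y * wt x) (vs x - y * ws x) (vt x - y * wt x)"
      unfolding bil_def \<beta>_def[symmetric] vx by algebra
    also have "\<dots> \<le> bil p q r (vs x) (vt x) (vs x) (vt x)" using bil_nonneg[OF psd] by simp
    finally show ?thesis .
  qed
  note c = C1_cont[OF v(1)] C1_cont[OF G1] C1_cont[OF G2]
  have "\<mu> * tri_int (\<lambda>x. (v x)\<^sup>2) = tri_int ?G1s + tri_int ?G2t + tri_int (\<lambda>x. \<mu> * (v x)\<^sup>2)"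
    using tri_int_derivative_zero[OF G1 zb(1)] tri_int_derivative_zero[OF G2 zb(2)] by (simp add: tri_int_cmult)
  also have "\<dots> = tri_int (\<lambda>x. ?G1s x + ?G2t x + \<mu> * (v x)\<^sup>2)"
    using tri_int_add[OF continuous_on_add[OF c(5) c(9)], of "\<lambda>x. \<mu> * (v x)\<^sup>2"] tri_int_add[OF c(5) c(9)] c(1)
    by (simp add: continuous_on_mult continuous_on_power)
  also have "\<dots> \<le> dform p q r vs vt vs vt"
    unfolding dform_def
    by (rule tri_int_mono[OF continuous_on_add[OF continuous_on_add[OF c(5) c(9)]] continuous_bil ptw])
       (intro c continuous_on_mult continuous_on_power continuous_on_const)+
  finally show "\<mu> * tri_int (\<lambda>x. (v x)\<^sup>2) \<le> dform p q r vs vt vs vt" .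
qed

section \<open>Explicit eigenfunctions\<close>

definition wave :: "real \<Rightarrow> real \<Rightarrow> real \<Rightarrow> real \<Rightarrow> (real \<times> real \<Rightarrow> real) \<Rightarrow> bool" where
  "wave p q r \<mu> w \<longleftrightarrow> (\<exists>ws wt wss wst wtt. C1 w ws wt \<and> C1 ws wss wst \<and> C1 wt wst wtt \<and>
     (\<forall>x. p * wss x + (r - p - q) * wst x + q * wtt x = - \<mu> * w x))"

lemma wave_add:
  assumes "wave p q r \<mu> f" "wave p q r \<mu> g" shows "wave p q r \<mu> (\<lambda>x. f x + g x)"
proof -
  obtain fs ft fss fst ftt where f: "C1 f fs ft" "C1 fs fss fst" "C1 ft fst ftt"
     "\<And>x. p * fss x + (r - p - q) * fst x + q * ftt x = - \<mu> * f x"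
    using assms(1) by (auto simp: wave_def)
  obtain gs gt gss gst gtt where g: "C1 g gs gt" "C1 gs gss gst" "C1 gt gst gtt"
     "\<And>x. p * gss x + (r - p - q) * gst x + q * gtt x = - \<mu> * g x"
    using assms(2) by (auto simp: wave_def)
  have "p * (fss x + gss x) + (r - p - q) * (fst x + gst x) + q * (ftt x + gtt x) = - \<mu> * (f x + g x)" for x
    using f(4)[of x] g(4)[of x] by (simp add: algebra_simps)
  then show ?thesis unfolding wave_def using C1_add[OF f(1) g(1)] C1_add[OF f(2) g(2)] C1_add[OF f(3) g(3)] by blast
qed

lemma wave_cmult:
  assumes "wave p q r \<mu> f" shows "wave p q r \<mu> (\<lambda>x. c * f x)"
proof -
  obtain fs ft fss fst ftt where f: "C1 f fs ft" "C1 fs fss fst" "C1 ft fst ftt"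
     "\<And>x. p * fss x + (r - p - q) * fst x + q * ftt x = - \<mu> * f x"
    using assms(1) by (auto simp: wave_def)
  have "p * (c * fss x) + (r - p - q) * (c * fst x) + q * (c * ftt x) = - \<mu> * (c * f x)" for x
    using arg_cong[OF f(4)[of x], of "\<lambda>y. c * y"] by (simp add: algebra_simps)
  then show ?thesis unfolding wave_def using C1_cmult[OF f(1)] C1_cmult[OF f(2)] C1_cmult[OF f(3)] by blast
qed

lemma wave_diff:
  assumes "wave p q r \<mu> f" "wave p q r \<mu> g" shows "wave p q r \<mu> (\<lambda>x. f x - g x)"
  using wave_add[OF assms(1) wave_cmult[OF assms(2), of "-1"]] by simp

lemma wave_cos:
  assumes "p * a\<^sup>2 + (r - p - q) * (a * b) + q * b\<^sup>2 = \<mu>"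
  shows "wave p q r \<mu> (\<lambda>x. cos (a * fst x + b * snd x + c))"
proof -
  note f = C1_affine_cos[of a b c]
  note fs = C1_cmult[OF C1_affine_sin[of a b c], of "- a"]
  note ft = C1_cmult[OF C1_affine_sin[of a b c], of "- b"]
  have ft': "C1 (\<lambda>x. - b * sin (a * fst x + b * snd x + c)) (\<lambda>x. - a * (b * cos (a * fst x + b * snd x + c)))
     (\<lambda>x. - b * (b * cos (a * fst x + b * snd x + c)))"
    using ft by (simp add: mult.left_commute)
  show ?thesis unfolding wave_def
    by (rule exI, rule exI, rule exI, rule exI, rule exI, rule conjI[OF f conjI[OF fs conjI[OF ft']]])
       (simp add: assms[symmetric] algebra_simps power2_eq_square)
qed

lemma wave_sin:
  assumes "p * a\<^sup>2 + (r - p - q) * (a * b) + q * b\<^sup>2 = \<mu>"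
  shows "wave p q r \<mu> (\<lambda>x. sin (a * fst x + b * snd x + c))"
proof -
  have "cos (y + (c - pi / 2)) = sin (y + c)" for y
    by (simp add: cos_diff add_diff_eq)
  with wave_cos[OF assms, of "c - pi/2"] show ?thesis by simp
qed

lemma Barta_wave:
  assumes "wave p q r \<mu> w" "psd p q r" "\<And>s t. 0 < s \<Longrightarrow> 0 < t \<Longrightarrow> s + t < 1 \<Longrightarrow> w (s, t) > 0"
  shows "LB p q r \<mu>"
proof -
  obtain ws wt wss wst wtt where w: "C1 w ws wt" "C1 ws wss wst" "C1 wt wst wtt"
     "\<And>x. p * wss x + (r - p - q) * wst x + q * wtt x = - \<mu> * w x"
    using assms(1) by (auto simp: wave_def)
  show ?thesis by (rule Barta[OF w(1-3) assms(3) w(4) assms(2)])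
qed

text \<open>The sine of \<open>\<pi>\<close> times a barycentric coordinate is positive: it is the ground state of the strip between a side
  and the opposite vertex.\<close>
lemma LB_altitude:
  assumes "psd p q r" shows "LB p q r (pi\<^sup>2 * p)" "LB p q r (pi\<^sup>2 * q)" "LB p q r (pi\<^sup>2 * r)"
proof -
  have "wave p q r (pi\<^sup>2 * p) (\<lambda>x. sin (pi * fst x + 0 * snd x + 0))" by (rule wave_sin) simp
  from Barta_wave[OF this assms] show "LB p q r (pi\<^sup>2 * p)" by (simp add: sin_gt_zero)
  have "wave p q r (pi\<^sup>2 * q) (\<lambda>x. sin (0 * fst x + pi * snd x + 0))" by (rule wave_sin) simp
  from Barta_wave[OF this assms] show "LB p q r (pi\<^sup>2 * q)" by (simp add: sin_gt_zero)
  have "wave p q r (pi\<^sup>2 * r) (\<lambda>x. sin (pi * fst x + pi * snd x + 0))"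
    by (rule wave_sin) (simp add: algebra_simps power2_eq_square)
  from Barta_wave[OF this assms] show "LB p q r (pi\<^sup>2 * r)"
    by (simp add: sin_gt_zero distrib_left[symmetric])
qed

text \<open>The positive function is the lowest eigenfunction of the square that is odd about the diagonal.\<close>
lemma LB_half_square: "LB 2 1 1 (5 * pi\<^sup>2)"
proof (rule Barta_wave)
  let ?w = "\<lambda>x::real\<times>real. cos (pi * fst x + (3 * pi) * snd x + (- pi)) - cos ((- pi) * fst x + pi * snd x + pi)
     + (cos ((2 * pi) * fst x + (3 * pi) * snd x + (- 2 * pi)) - cos ((- 2 * pi) * fst x + (- pi) * snd x + 2 * pi))"
  show "wave 2 1 1 (5 * pi\<^sup>2) ?w"
    by (intro wave_add wave_diff wave_cos) (simp_all add: power2_eq_square)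
  show "psd 2 1 1" by (simp add: psd_def)
  fix s t :: real assume st: "0 < s" "0 < t" "s + t < 1"
  define x y where "x = pi * t" and "y = pi * (1 - s - t)"
  have xy: "0 < x" "x < pi" "0 < y" "y < pi" "x + y < pi"
  proof -
    have "x + y = pi * (1 - s)" by (simp add: x_def y_def algebra_simps)
    also have "\<dots> < pi" using st by simp
    finally show "x + y < pi" .
    show "0 < x" "x < pi" "0 < y" "y < pi" using st by (auto simp: x_def y_def)
  qed
  have args: "pi * s + (3 * pi) * t + (- pi) = 2 * x - y" "(- pi) * s + pi * t + pi = 2 * x + y - 2 * pi * t + 2 * pi * t"
    "(2 * pi) * s + (3 * pi) * t + (- 2 * pi) = x - 2 * y" "(- 2 * pi) * s + (- pi) * t + 2 * pi = x + 2 * y"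
    by (simp_all add: x_def y_def algebra_simps)
  have "?w (s, t) = cos (2 * x - y) - cos (2 * x + y) + (cos (x - 2 * y) - cos (x + 2 * y))"
    unfolding fst_conv snd_conv args by simp
  also have "\<dots> = 2 * sin (2 * x) * sin y + 2 * sin x * sin (2 * y)"
    by (simp add: cos_add cos_diff)
  also have "\<dots> = 4 * sin x * sin y * (cos x + cos y)"
    unfolding sin_double by algebra
  also have "\<dots> > 0"
  proof -
    have "cos (pi - y) < cos x" by (rule cos_monotone_0_pi) (use xy in auto)
    then have "cos x + cos y > 0" by simp
    moreover have "sin x > 0" "sin y > 0" using xy by (auto intro: sin_gt_zero)
    ultimately show ?thesis by simp
  qed
  finally show "?w (s, t) > 0" .
qed

lemma sin_sum_three: "sin (2 * a) + sin (2 * b) - sin (2 * a + 2 * b) = 4 * sin a * sin b * sin (a + b)"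
  for a b :: real
proof -
  have "sin (2 * a + 2 * b) = sin (2 * a) * cos (2 * b) + cos (2 * a) * sin (2 * b)" by (rule sin_add)
  then show ?thesis unfolding sin_add[of a b] sin_double cos_double_sin by algebra
qed

text \<open>Half of an equilateral triangle: the lowest antisymmetric eigenfunction of the equilateral triangle is positive on one half.\<close>
lemma LB_half_equilateral: "LB 2 (3/2) (1/2) (14 / 3 * pi\<^sup>2)"
proof (rule Barta_wave)
  let ?w = "\<lambda>x::real\<times>real. cos ((3 * pi) * fst x + (8 * pi / 3) * snd x + 0) - cos ((2 * pi) * fst x + (2 * pi / 3) * snd x + 0)
     + (cos ((- pi) * fst x + (2 * pi / 3) * snd x + 0) - cos (pi * fst x + (8 * pi / 3) * snd x + 0))
     + (cos ((2 * pi) * fst x + (10 * pi / 3) * snd x + 0) - cos ((3 * pi) * fst x + (10 * pi / 3) * snd x + 0))"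
  show "wave 2 (3/2) (1/2) (14 / 3 * pi\<^sup>2) ?w"
    by (intro wave_add wave_diff wave_cos) (simp_all add: power2_eq_square)
  show "psd 2 (3/2) (1/2)" by (simp add: psd_def power2_eq_square)
  fix s t :: real assume st: "0 < s" "0 < t" "s + t < 1"
  define x y where "x = pi * s / 2" and "y = pi * t / 3"
  have e: "2 * x + 3 * y = pi * (s + t)" by (simp add: x_def y_def distrib_left)
  have xy: "0 < x" "0 < y" "2 * x + 3 * y < pi"
    using st unfolding e by (auto simp: x_def y_def)
  have P: "2 * (sin A * sin B) = cos (A - B) - cos (A + B)" for A B :: real
    by (simp add: cos_diff cos_add)
  have args: "(3 * pi) * s + (8 * pi / 3) * t + 0 = 6 * x + 8 * y" "(2 * pi) * s + (2 * pi / 3) * t + 0 = 4 * x + 2 * y"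
    "(- pi) * s + (2 * pi / 3) * t + 0 = 2 * y - 2 * x" "pi * s + (8 * pi / 3) * t + 0 = 2 * x + 8 * y"
    "(2 * pi) * s + (10 * pi / 3) * t + 0 = 4 * x + 10 * y" "(3 * pi) * s + (10 * pi / 3) * t + 0 = 6 * x + 10 * y"
    by (simp_all add: x_def y_def)
  have "?w (s, t) = cos (6 * x + 8 * y) - cos (4 * x + 2 * y) + (cos (2 * y - 2 * x) - cos (2 * x + 8 * y))
     + (cos (4 * x + 10 * y) - cos (6 * x + 10 * y))"
    unfolding fst_conv snd_conv args ..
  also have "\<dots> = 2 * ((sin (2 * x) + sin (2 * (x + 3 * y)) - sin (2 * x + 2 * (x + 3 * y)))
                    * (sin (2 * (x + y)) + sin (2 * y) - sin (2 * (x + y) + 2 * y)))"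
  proof -
    have ex: "2 * ((a + b - c) * (d + f - g)) = 2 * (a * d) + 2 * (a * f) - 2 * (a * g) + 2 * (b * d) + 2 * (b * f) - 2 * (b * g)
       - 2 * (c * d) - 2 * (c * f) + 2 * (c * g)" for a b c d f g :: real by algebra
    have m: "cos (2 * x - 2 * (x + y)) = cos (2 * y)" "cos (2 * x - (2 * (x + y) + 2 * y)) = cos (4 * y)"
      using cos_minus[of "2*y"] cos_minus[of "4*y"] by (simp_all add: algebra_simps)
    show ?thesis unfolding ex P m
      using cos_minus[of "2*y-2*x"] by (simp add: algebra_simps)
  qed
  also have "\<dots> = 2 * ((4 * sin x * sin (x + 3 * y) * sin (x + (x + 3 * y))) * (4 * sin (x + y) * sin y * sin (x + y + y)))"
    unfolding sin_sum_three ..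
  also have "\<dots> > 0"
    using xy by (auto intro!: mult_pos_pos sin_gt_zero)
  finally show "?w (s, t) > 0" .
qed

section \<open>Concavity and symmetry of the lower bound\<close>

lemma dform_linear:
  assumes "continuous_on UNIV vs" "continuous_on UNIV vt" "continuous_on UNIV ws" "continuous_on UNIV wt"
  shows "dform (a * p + b * p') (a * q + b * q') (a * r + b * r') vs vt ws wt =
     a * dform p q r vs vt ws wt + b * dform p' q' r' vs vt ws wt"
proof -
  have "dform (a * p + b * p') (a * q + b * q') (a * r + b * r') vs vt ws wt =
    tri_int (\<lambda>x. a * bil p q r (vs x) (vt x) (ws x) (wt x) + b * bil p' q' r' (vs x) (vt x) (ws x) (wt x))"
    unfolding dform_def by (rule tri_int_cong) (simp add: bil_def field_simps)
  also have "\<dots> = a * dform p q r vs vt ws wt + b * dform p' q' r' vs vt ws wt"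
    unfolding dform_def tri_int_cmult[symmetric]
    by (rule tri_int_add) (intro continuous_intros continuous_bil assms)+
  finally show ?thesis .
qed

text \<open>Concavity of the first eigenvalue in the coefficients, which enter the form linearly.\<close>
lemma LB_combine:
  assumes "LB p q r \<mu>" "LB p' q' r' \<mu>'" "0 \<le> a" "0 \<le> b"
  shows "LB (a * p + b * p') (a * q + b * q') (a * r + b * r') (a * \<mu> + b * \<mu>')"
  unfolding LB_def
proof (intro allI impI, elim conjE)
  fix v vs vt assume v: "C1 v vs vt" "core v"
  have "(a * \<mu> + b * \<mu>') * tri_int (\<lambda>x. (v x)\<^sup>2) = a * (\<mu> * tri_int (\<lambda>x. (v x)\<^sup>2)) + b * (\<mu>' * tri_int (\<lambda>x. (v x)\<^sup>2))"
    by (simp add: algebra_simps)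
  also have "\<dots> \<le> a * dform p q r vs vt vs vt + b * dform p' q' r' vs vt vs vt"
    using assms v by (intro add_mono mult_left_mono) (auto simp: LB_def)
  finally show "(a * \<mu> + b * \<mu>') * tri_int (\<lambda>x. (v x)\<^sup>2) \<le> dform (a * p + b * p') (a * q + b * q') (a * r + b * r') vs vt vs vt"
    by (simp add: dform_linear C1_cont[OF v(1)])
qed

lemma LB_mono: "LB p q r \<mu> \<Longrightarrow> \<mu>' \<le> \<mu> \<Longrightarrow> LB p q r \<mu>'"
  unfolding LB_def by (meson mult_right_mono order_trans tri_int_nonneg zero_le_power2)

lemma tri_int_swap:
  assumes "continuous_on UNIV f" shows "tri_int (\<lambda>x. f (prod.swap x)) = tri_int f"
proof -
  have c: "continuous_on UNIV (\<lambda>x. f (prod.swap x))"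
    by (rule continuous_on_compose2[OF assms]) (auto simp: prod.swap_def intro!: continuous_intros)
  show ?thesis unfolding tri_int_fubini(1)[OF c] tri_int_fubini(2)[OF assms] by simp
qed

lemma LB_swap:
  assumes "LB p q r \<mu>" shows "LB q p r \<mu>"
  unfolding LB_def
proof (intro allI impI, elim conjE)
  fix v vs vt assume v: "C1 v vs vt" "core v"
  have sw: "continuous_on UNIV (\<lambda>x. f (prod.swap x))" if "continuous_on UNIV f" for f :: "real\<times>real\<Rightarrow>real"
    by (rule continuous_on_compose2[OF that]) (auto simp: prod.swap_def intro!: continuous_intros)
  have 1: "C1 (\<lambda>x. v (prod.swap x)) (\<lambda>x. vt (prod.swap x)) (\<lambda>x. vs (prod.swap x))"
    using v(1) unfolding C1_def by (auto intro: sw)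
  have 2: "core (\<lambda>x. v (prod.swap x))"
  proof -
    obtain d where "d > 0" "\<And>s t. s < d \<or> t < d \<or> s + t > 1 - d \<Longrightarrow> v (s, t) = 0"
      using v(2) unfolding core_def by blast
    then have "\<forall>s t. s < d \<or> t < d \<or> s + t > 1 - d \<longrightarrow> v (prod.swap (s, t)) = 0"
      unfolding swap_simp by (metis add.commute)
    with \<open>d > 0\<close> show ?thesis unfolding core_def by blast
  qed
  have "\<mu> * tri_int (\<lambda>x. (v (prod.swap x))\<^sup>2) \<le>
     dform p q r (\<lambda>x. vt (prod.swap x)) (\<lambda>x. vs (prod.swap x)) (\<lambda>x. vt (prod.swap x)) (\<lambda>x. vs (prod.swap x))"
    using assms 1 2 unfolding LB_def by blast
  also have "tri_int (\<lambda>x. (v (prod.swap x))\<^sup>2) = tri_int (\<lambda>x. (v x)\<^sup>2)"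
    by (rule tri_int_swap) (intro continuous_intros C1_cont[OF v(1)])
  also have "dform p q r (\<lambda>x. vt (prod.swap x)) (\<lambda>x. vs (prod.swap x)) (\<lambda>x. vt (prod.swap x)) (\<lambda>x. vs (prod.swap x))
    = tri_int (\<lambda>x. (\<lambda>y. bil p q r (vt y) (vs y) (vt y) (vs y)) (prod.swap x))"
    by (simp add: dform_def)
  also have "\<dots> = tri_int (\<lambda>y. bil p q r (vt y) (vs y) (vt y) (vs y))"
    by (rule tri_int_swap) (intro continuous_bil C1_cont[OF v(1)])
  also have "\<dots> = dform q p r vs vt vs vt"
    unfolding dform_def by (rule tri_int_cong) (simp add: bil_def algebra_simps)
  finally show "\<mu> * tri_int (\<lambda>x. (v x)\<^sup>2) \<le> dform q p r vs vt vs vt" .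
qed

section \<open>Green's identity and orthogonality\<close>

definition tri_inner :: "(real \<times> real \<Rightarrow> real) \<Rightarrow> (real \<times> real \<Rightarrow> real) \<Rightarrow> real" where
  "tri_inner f g = tri_int (\<lambda>x. f x * g x)"

lemma tri_inner_commute: "tri_inner f g = tri_inner g f"
  by (simp add: tri_inner_def mult.commute)

lemma tri_inner_add_left:
  assumes "continuous_on UNIV f" "continuous_on UNIV g" "continuous_on UNIV h"
  shows "tri_inner (\<lambda>x. f x + g x) h = tri_inner f h + tri_inner g h"
  unfolding tri_inner_def distrib_right by (intro tri_int_add continuous_intros assms)

lemma tri_inner_diff_left:
  assumes "continuous_on UNIV f" "continuous_on UNIV g" "continuous_on UNIV h"
  shows "tri_inner (\<lambda>x. f x - g x) h = tri_inner f h - tri_inner g h"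
  unfolding tri_inner_def left_diff_distrib by (intro tri_int_diff continuous_intros assms)

lemma tri_inner_cmult_left: "tri_inner (\<lambda>x. c * f x) h = c * tri_inner f h"
  unfolding tri_inner_def mult.assoc by (rule tri_int_cmult)

lemma tri_inner_add_right:
  assumes "continuous_on UNIV f" "continuous_on UNIV g" "continuous_on UNIV h"
  shows "tri_inner h (\<lambda>x. f x + g x) = tri_inner h f + tri_inner h g"
  unfolding tri_inner_commute[of h] by (rule tri_inner_add_left[OF assms])

lemma tri_inner_diff_right:
  assumes "continuous_on UNIV f" "continuous_on UNIV g" "continuous_on UNIV h"
  shows "tri_inner h (\<lambda>x. f x - g x) = tri_inner h f - tri_inner h g"
  unfolding tri_inner_commute[of h] by (rule tri_inner_diff_left[OF assms])

lemma tri_inner_cmult_right: "tri_inner h (\<lambda>x. c * f x) = c * tri_inner h f"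
  unfolding tri_inner_commute[of h] by (rule tri_inner_cmult_left)

lemma tri_inner_sum_left:
  assumes "\<And>i. i \<in> I \<Longrightarrow> continuous_on UNIV (f i)" "continuous_on UNIV h"
  shows "tri_inner (\<lambda>x. \<Sum>i\<in>I. f i x) h = (\<Sum>i\<in>I. tri_inner (f i) h)"
  unfolding tri_inner_def sum_distrib_right by (intro tri_int_sum continuous_intros assms)

lemma tri_inner_nonneg: "0 \<le> tri_inner f f"
  unfolding tri_inner_def by (rule tri_int_nonneg) simp

lemma tri_int_square: "tri_int (\<lambda>x. (f x)\<^sup>2) = tri_inner f f"
  by (simp add: tri_inner_def power2_eq_square)

text \<open>All Cauchy-Schwarz inequalities below, as well as the weak eigenvalue equation of a minimiser, are instances of this fact.\<close>
lemma quadratic_nonneg_discriminant: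
  fixes A B C :: real
  assumes "\<And>t. 0 \<le> A + 2 * t * B + t\<^sup>2 * C" shows "B\<^sup>2 \<le> A * C"
proof (cases "C = 0")
  case True
  have "B = 0"
  proof (rule ccontr)
    assume "B \<noteq> 0"
    then show False using assms[of "- (A + 1) / (2 * B)"] True by (simp add: field_simps)
  qed
  then show ?thesis using True by simp
next
  case False
  have "C \<ge> 0"
  proof (rule ccontr)
    assume "\<not> C \<ge> 0"
    then have C: "C < 0" by simp
    define t where "t = 1 + \<bar>A\<bar> / - C"
    have t: "t \<ge> 1" using C by (simp add: t_def divide_le_0_iff)
    have "A + t\<^sup>2 * C < 0"
    proof -
      have "t\<^sup>2 \<ge> t" using t by (simp add: power2_eq_square)
      then have "t\<^sup>2 * C \<le> t * C" using C by (simp add: mult_right_mono_neg)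
      moreover have "t * C = C - \<bar>A\<bar>" using C by (simp add: t_def field_simps)
      ultimately show ?thesis using C by linarith
    qed
    moreover have "0 \<le> A + 2 * t * B + t\<^sup>2 * C" "0 \<le> A + 2 * (- t) * B + (- t)\<^sup>2 * C" using assms by blast+
    ultimately show False by simp
  qed
  then have C: "C > 0" using False by simp
  have "0 \<le> A + 2 * (- B / C) * B + (- B / C)\<^sup>2 * C" by (rule assms)
  also have "\<dots> = A - B\<^sup>2 / C" using C by (simp add: field_simps power2_eq_square)
  finally show ?thesis using C by (simp add: field_simps)
qed

lemma tri_inner_Cauchy_Schwarz:
  assumes "continuous_on UNIV f" "continuous_on UNIV g"
  shows "(tri_inner f g)\<^sup>2 \<le> tri_inner f f * tri_inner g g"
proof (rule quadratic_nonneg_discriminant)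
  fix t :: real
  have "0 \<le> tri_inner (\<lambda>x. f x + t * g x) (\<lambda>x. f x + t * g x)" by (rule tri_inner_nonneg)
  also have "\<dots> = tri_inner f f + 2 * t * tri_inner f g + t\<^sup>2 * tri_inner g g"
    using assms by (simp add: tri_inner_add_left tri_inner_add_right continuous_intros tri_inner_cmult_left
        tri_inner_cmult_right tri_inner_commute[of g f] power2_eq_square algebra_simps)
  finally show "0 \<le> tri_inner f f + 2 * t * tri_inner f g + t\<^sup>2 * tri_inner g g" .
qed

lemma dform_commute: "dform p q r vs vt ws wt = dform p q r ws wt vs vt"
  unfolding dform_def by (rule tri_int_cong) (simp add: bil_def algebra_simps)

lemma dform_nonneg: "psd p q r \<Longrightarrow> 0 \<le> dform p q r vs vt vs vt"
  unfolding dform_def by (rule tri_int_nonneg) (rule bil_nonneg)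

lemma dform_add_cmult_left:
  assumes "continuous_on UNIV vs" "continuous_on UNIV vt" "continuous_on UNIV ws" "continuous_on UNIV wt"
    "continuous_on UNIV zs" "continuous_on UNIV zt"
  shows "dform p q r (\<lambda>x. vs x + c * ws x) (\<lambda>x. vt x + c * wt x) zs zt =
     dform p q r vs vt zs zt + c * dform p q r ws wt zs zt"
proof -
  have "dform p q r (\<lambda>x. vs x + c * ws x) (\<lambda>x. vt x + c * wt x) zs zt =
    tri_int (\<lambda>x. bil p q r (vs x) (vt x) (zs x) (zt x) + c * bil p q r (ws x) (wt x) (zs x) (zt x))"
    unfolding dform_def by (rule tri_int_cong) (simp add: bil_def field_simps)
  also have "\<dots> = dform p q r vs vt zs zt + c * dform p q r ws wt zs zt"
    unfolding dform_def tri_int_cmult[symmetric]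
    by (rule tri_int_add) (intro continuous_intros continuous_bil assms)+
  finally show ?thesis .
qed

lemma dform_quadratic:
  assumes "continuous_on UNIV vs" "continuous_on UNIV vt" "continuous_on UNIV ws" "continuous_on UNIV wt"
  shows "dform p q r (\<lambda>x. vs x + c * ws x) (\<lambda>x. vt x + c * wt x) (\<lambda>x. vs x + c * ws x) (\<lambda>x. vt x + c * wt x) =
     dform p q r vs vt vs vt + 2 * c * dform p q r vs vt ws wt + c\<^sup>2 * dform p q r ws wt ws wt"
proof -
  have k: "continuous_on UNIV (\<lambda>x. vs x + c * ws x)" "continuous_on UNIV (\<lambda>x. vt x + c * wt x)"
    by (intro continuous_intros assms)+
  show ?thesis
    unfolding dform_add_cmult_left[OF assms k]
    unfolding dform_commute[of p q r _ _ "\<lambda>x. vs x + c * ws x"] dform_add_cmult_left[OF assms assms(1,2)]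
      dform_add_cmult_left[OF assms assms(3,4)]
    unfolding dform_commute[of p q r ws wt vs vt] by (simp add: algebra_simps power2_eq_square)
qed

lemma dform_Cauchy_Schwarz:
  assumes "psd p q r" "continuous_on UNIV vs" "continuous_on UNIV vt" "continuous_on UNIV ws" "continuous_on UNIV wt"
  shows "(dform p q r vs vt ws wt)\<^sup>2 \<le> dform p q r vs vt vs vt * dform p q r ws wt ws wt"
proof (rule quadratic_nonneg_discriminant)
  fix t :: real
  show "0 \<le> dform p q r vs vt vs vt + 2 * t * dform p q r vs vt ws wt + t\<^sup>2 * dform p q r ws wt ws wt"
    unfolding dform_quadratic[OF assms(2-5), symmetric] by (rule dform_nonneg[OF assms(1)])
qed

lemma C1_unique:
  assumes "C1 f fs ft" "C1 f gs gt" shows "fs = gs" "ft = gt"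
proof -
  have "fs x = gs x" "ft x = gt x" for x
    using assms DERIV_unique[of "\<lambda>s. f (s, snd x)" "fs x" "fst x" "gs x"]
      DERIV_unique[of "\<lambda>t. f (fst x, t)" "ft x" "snd x" "gt x"]
    unfolding C1_def by (metis prod.collapse)+
  then show "fs = gs" "ft = gt" by auto
qed

lemma Green:
  assumes w: "C1 w ws wt" "C1 ws wss wst" "C1 wt wst wtt" and v: "C1 v vs vt" "zero_bdry v"
  shows "dform p q r ws wt vs vt = - tri_inner (\<lambda>x. p * wss x + (r - p - q) * wst x + q * wtt x) v"
proof -
  define \<beta> where "\<beta> = (r - p - q) / 2"
  have b2: "r - p - q = 2 * \<beta>" by (simp add: \<beta>_def)
  have G1: "C1 (\<lambda>x. v x * (p * ws x + \<beta> * wt x)) (\<lambda>x. vs x * (p * ws x + \<beta> * wt x) + v x * (p * wss x + \<beta> * wst x))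
      (\<lambda>x. vt x * (p * ws x + \<beta> * wt x) + v x * (p * wst x + \<beta> * wtt x))" (is "C1 ?G1 ?G1s ?G1t")
    by (intro C1_mult C1_add C1_cmult w v)
  have G2: "C1 (\<lambda>x. v x * (q * wt x + \<beta> * ws x)) (\<lambda>x. vs x * (q * wt x + \<beta> * ws x) + v x * (q * wst x + \<beta> * wss x))
      (\<lambda>x. vt x * (q * wt x + \<beta> * ws x) + v x * (q * wtt x + \<beta> * wst x))" (is "C1 ?G2 ?G2s ?G2t")
    by (intro C1_mult C1_add C1_cmult w v)
  have zb: "zero_bdry ?G1" "zero_bdry ?G2" using v(2) by (auto simp: zero_bdry_def)
  note c = C1_cont[OF v(1)] C1_cont[OF w(1)] C1_cont[OF w(2)] C1_cont[OF w(3)]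
  have "dform p q r ws wt vs vt + tri_inner (\<lambda>x. p * wss x + (r - p - q) * wst x + q * wtt x) v
     = tri_int (\<lambda>x. bil p q r (ws x) (wt x) (vs x) (vt x) + (p * wss x + (r - p - q) * wst x + q * wtt x) * v x)"
    unfolding dform_def tri_inner_def by (rule tri_int_add[symmetric]) (intro continuous_intros continuous_bil c)+
  also have "\<dots> = tri_int (\<lambda>x. ?G1s x + ?G2t x)"
    unfolding bil_def b2 by (rule tri_int_cong) (simp add: algebra_simps)
  also have "\<dots> = 0"
    using tri_int_derivative_zero[OF G1 zb(1)] tri_int_derivative_zero[OF G2 zb(2)]
      tri_int_add[OF C1_cont(2)[OF G1] C1_cont(3)[OF G2]] by simp
  finally show ?thesis by simp
qed

lemma wave_Green:
  assumes "wave p q r \<mu> w" "C1 w ws wt" "C1 v vs vt" "zero_bdry v"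
  shows "dform p q r ws wt vs vt = \<mu> * tri_inner w v"
proof -
  obtain ws' wt' wss wst wtt where w: "C1 w ws' wt'" "C1 ws' wss wst" "C1 wt' wst wtt"
     "\<And>x. p * wss x + (r - p - q) * wst x + q * wtt x = - \<mu> * w x"
    using assms(1) by (auto simp: wave_def)
  have "ws' = ws" "wt' = wt" using C1_unique[OF w(1) assms(2)] by auto
  with Green[OF w(1-3) assms(3,4), of p q r] show ?thesis
    unfolding w(4) by (simp add: tri_inner_cmult_left[of "- \<mu>" w v, simplified])
qed

lemma wave_C1: "wave p q r \<mu> w \<Longrightarrow> \<exists>ws wt. C1 w ws wt"
  by (auto simp: wave_def)

lemma wave_cont: "wave p q r \<mu> w \<Longrightarrow> continuous_on UNIV w"
  by (auto simp: wave_def C1_def)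

text \<open>Symmetry of the form: by Green's identity both eigenvalues multiply the inner product to the same number.\<close>
lemma wave_orthogonal:
  assumes "wave p q r \<mu> f" "zero_bdry f" "wave p q r \<nu> g" "zero_bdry g" "\<mu> \<noteq> \<nu>"
  shows "tri_inner f g = 0"
proof -
  obtain fs ft gs gt where c: "C1 f fs ft" "C1 g gs gt"
    using wave_C1[OF assms(1)] wave_C1[OF assms(3)] by blast
  have "\<mu> * tri_inner f g = \<nu> * tri_inner g f"
    using wave_Green[OF assms(1) c(1) c(2) assms(4)] wave_Green[OF assms(3) c(2) c(1) assms(2)]
    by (simp add: dform_commute)
  then show ?thesis using assms(5) by (simp add: tri_inner_commute)
qed

section \<open>Lame's eigenfunctions of the equilateral triangle\<close>

text \<open>The phases of the three plane waves \<open>y1\<close>, \<open>y2\<close>, \<open>y3\<close>, whose sum is zero. Affine reflections in the sides of the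
  triangle permute the phases up to integers, so that antisymmetrising the plane waves gives functions vanishing on the sides.\<close>
definition chi1 :: "real \<times> real \<Rightarrow> real" where "chi1 x = (2 * fst x + snd x) / 3"
definition chi2 :: "real \<times> real \<Rightarrow> real" where "chi2 x = (snd x - fst x) / 3"
definition chi3 :: "real \<times> real \<Rightarrow> real" where "chi3 x = - (fst x + 2 * snd x) / 3"

definition y1 :: "real \<times> real \<Rightarrow> complex" where "y1 x = cis (2 * pi * chi1 x)"
definition y2 :: "real \<times> real \<Rightarrow> complex" where "y2 x = cis (2 * pi * chi2 x)"
definition y3 :: "real \<times> real \<Rightarrow> complex" where "y3 x = cis (2 * pi * chi3 x)"

lemmas y_defs = y1_def y2_def y3_def
lemmas chi_defs = chi1_def chi2_def chi3_def

text \<open>Lame's eigenfunctions: the determinant with rows \<open>(y\<^sup>k, y\<^sup>l, 1)\<close> for \<open>y = y1, y2, y3\<close>.\<close>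
definition lame :: "nat \<Rightarrow> nat \<Rightarrow> real \<times> real \<Rightarrow> complex" where
  "lame k l x = y1 x ^ k * y2 x ^ l - y1 x ^ k * y3 x ^ l - y2 x ^ k * y1 x ^ l
     + y2 x ^ k * y3 x ^ l + y3 x ^ k * y1 x ^ l - y3 x ^ k * y2 x ^ l"

text \<open>The ground state of the equilateral triangle, four times the product of the sines of \<open>\<pi>\<close> times the barycentric coordinates
  (see \<open>u1_product\<close>).\<close>
definition u1 :: "real \<times> real \<Rightarrow> real" where
  "u1 x = sin (2 * pi * fst x) + sin (2 * pi * snd x) - sin (2 * pi * (fst x + snd x))"

abbreviation eqwave :: "real \<Rightarrow> (real \<times> real \<Rightarrow> real) \<Rightarrow> bool" where
  "eqwave q \<equiv> wave (4/3) (4/3) (4/3) (16 * pi\<^sup>2 / 9 * q)"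

lemma y_prod: "y1 x * y2 x * y3 x = 1"
proof -
  have "2 * pi * chi1 x + 2 * pi * chi2 x + 2 * pi * chi3 x = 0" by (simp add: chi_defs field_simps)
  then show ?thesis unfolding y_defs cis_mult by simp
qed

lemma y_cnj: "cnj (y1 x) = y2 x * y3 x" "cnj (y2 x) = y1 x * y3 x" "cnj (y3 x) = y1 x * y2 x"
proof -
  have n: "- (2 * pi * chi1 x) = 2 * pi * chi2 x + 2 * pi * chi3 x" "- (2 * pi * chi2 x) = 2 * pi * chi1 x + 2 * pi * chi3 x"
    "- (2 * pi * chi3 x) = 2 * pi * chi1 x + 2 * pi * chi2 x" by (simp_all add: chi_defs field_simps)
  show "cnj (y1 x) = y2 x * y3 x" "cnj (y2 x) = y1 x * y3 x" "cnj (y3 x) = y1 x * y2 x"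
    unfolding y_defs cis_mult cis_cnj n by (rule refl)+
qed

lemma plane_wave:
  assumes "4 / 3 * (a\<^sup>2 - a * b + b\<^sup>2) = \<mu>"
  shows "wave (4/3) (4/3) (4/3) \<mu> (\<lambda>x. Re (c * cis (a * fst x + b * snd x)))"
proof -
  have s: "4/3 * a\<^sup>2 + (4/3 - 4/3 - 4/3) * (a * b) + 4/3 * b\<^sup>2 = \<mu>"
    using assms by (simp add: algebra_simps)
  have "wave (4/3) (4/3) (4/3) \<mu> (\<lambda>x. Re c * cos (a * fst x + b * snd x + 0) - Im c * sin (a * fst x + b * snd x + 0))"
    by (intro wave_diff wave_cmult wave_cos wave_sin s)
  then show ?thesis by simp
qed

lemma y_power:
  "y1 x ^ k * y2 x ^ l = cis ((2 * pi * (2 * k - l) / 3) * fst x + (2 * pi * (k + l) / 3) * snd x)"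
  "y1 x ^ k * y3 x ^ l = cis ((2 * pi * (2 * k - l) / 3) * fst x + (2 * pi * (k - 2 * l) / 3) * snd x)"
  "y2 x ^ k * y1 x ^ l = cis ((2 * pi * (2 * l - k) / 3) * fst x + (2 * pi * (k + l) / 3) * snd x)"
  "y2 x ^ k * y3 x ^ l = cis ((2 * pi * (- k - l) / 3) * fst x + (2 * pi * (k - 2 * l) / 3) * snd x)"
  "y3 x ^ k * y1 x ^ l = cis ((2 * pi * (2 * l - k) / 3) * fst x + (2 * pi * (l - 2 * k) / 3) * snd x)"
  "y3 x ^ k * y2 x ^ l = cis ((2 * pi * (- k - l) / 3) * fst x + (2 * pi * (l - 2 * k) / 3) * snd x)"
  by (simp only: y_defs Complex.DeMoivre cis_mult, rule arg_cong[of _ _ cis], simp add: chi_defs field_simps)+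

lemma lame_wave:
  assumes "q = (real k)\<^sup>2 - real k * real l + (real l)\<^sup>2"
  shows "eqwave q (\<lambda>x. Re (c * lame k l x))"
proof -
  have e: "(\<lambda>x. Re (c * lame k l x)) = (\<lambda>x. Re (c * (y1 x ^ k * y2 x ^ l)) - Re (c * (y1 x ^ k * y3 x ^ l)) - Re (c * (y2 x ^ k * y1 x ^ l))
     + Re (c * (y2 x ^ k * y3 x ^ l)) + Re (c * (y3 x ^ k * y1 x ^ l)) - Re (c * (y3 x ^ k * y2 x ^ l)))"
    unfolding lame_def by (rule ext) (simp add: right_diff_distrib distrib_left del: mult.assoc)
  show ?thesis unfolding e unfolding y_power
    by (intro wave_add wave_diff plane_wave; simp add: assms power2_eq_square field_simps)
qed

lemma lame_zero_bdry: "zero_bdry (\<lambda>x. Re (c * lame k l x))"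
proof -
  have "lame k l x = 0" if "y1 x = y2 x \<or> y2 x = y3 x \<or> y1 x = y3 x" for x
    using that by (auto simp: lame_def)
  moreover have "y1 (0, t) = y2 (0, t)" "y2 (t, 0) = y3 (t, 0)" for t by (simp_all add: y_defs chi_defs)
  moreover have "y1 (t, 1 - t) = y3 (t, 1 - t)" for t
  proof -
    have "2 * pi * chi1 (t, 1 - t) = 2 * pi * chi3 (t, 1 - t) + 2 * pi"
      by (simp add: chi_defs field_simps)
    then show ?thesis by (simp add: y_defs cis.ctr)
  qed
  ultimately show ?thesis unfolding zero_bdry_def by simp
qed

lemma lame_degenerate: "lame k k x = 0" "lame k 0 x = 0"
  by (simp_all add: lame_def)

lemma lame_times_sum:
  assumes "0 < l" "l < k"
  shows "(y1 x + y2 x + y3 x) * lame k l x = lame (Suc k) l x + lame k (Suc l) x + lame (k - 1) (l - 1) x"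
proof -
  obtain m n where kl: "k = Suc m" "l = Suc n" using assms by (metis Suc_lessE gr0_implies_Suc)
  have "(y1 x + y2 x + y3 x) * lame k l x = lame (Suc k) l x + lame k (Suc l) x + (y1 x * y2 x * y3 x) * lame m n x"
    unfolding lame_def kl power_Suc by (simp only: ring_distribs mult_ac add_ac diff_conv_add_uminus minus_add_distrib minus_minus mult_minus_left mult_minus_right)
  then show ?thesis by (simp add: y_prod kl)
qed

lemma lame_times_cnj_sum:
  assumes "0 < l" "l < k"
  shows "cnj (y1 x + y2 x + y3 x) * lame k l x = lame (k - 1) l x + lame k (l - 1) x + lame (Suc k) (Suc l) x"
proof -
  obtain m n where kl: "k = Suc m" "l = Suc n" using assms by (metis Suc_lessE gr0_implies_Suc)
  have "(y2 x * y3 x + y1 x * y3 x + y1 x * y2 x) * lame k l x = (y1 x * y2 x * y3 x) * lame m l x + (y1 x * y2 x * y3 x) * lame k n x + lame (Suc k) (Suc l) x"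
    unfolding lame_def kl power_Suc by (simp only: ring_distribs mult_ac add_ac diff_conv_add_uminus minus_add_distrib minus_minus mult_minus_left mult_minus_right)
  then show ?thesis by (simp add: y_prod y_cnj kl)
qed

lemma lame_21: "lame 2 1 x = - 2 * \<i> * u1 x"
proof -
  have "lame 2 1 x = cis (2 * pi * (fst x + snd x)) - cis (2 * pi * fst x) - cis (2 * pi * snd x) + cis (- (2 * pi * fst x)) + cis (- (2 * pi * snd x)) - cis (- (2 * pi * (fst x + snd x)))"
    unfolding lame_def y_power by (simp add: field_simps)
  then show ?thesis by (simp add: u1_def complex_eq_iff)
qed

lemma lame_32: "lame 3 2 x = - cnj (lame 3 1 x)"
proof -
  have "cnj (lame 3 1 x) = - ((y1 x * y2 x * y3 x) * lame 3 2 x)"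
    unfolding lame_def complex_cnj_diff complex_cnj_add complex_cnj_mult complex_cnj_power y_cnj
    by (simp add: algebra_simps power3_eq_cube power2_eq_square)
  then show ?thesis by (simp add: y_prod)
qed

lemma u1_product: "u1 (s, t) = 4 * sin (pi * s) * sin (pi * t) * sin (pi * (s + t))"
  using sin_sum_three[of "pi * s" "pi * t"] by (simp add: u1_def algebra_simps)

lemma u1_pos: "0 < s \<Longrightarrow> 0 < t \<Longrightarrow> s + t < 1 \<Longrightarrow> u1 (s, t) > 0"
  unfolding u1_product by (auto intro!: mult_pos_pos sin_gt_zero)

lemma u1_eq_lame: "u1 x = Re (\<i> / 2 * lame 2 1 x)"
  unfolding lame_21 by simp

lemma u1_wave: "eqwave 3 u1"
proof -
  have "eqwave 3 (\<lambda>x. Re (\<i> / 2 * lame 2 1 x))" by (rule lame_wave) simp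
  then show ?thesis by (simp only: u1_eq_lame[symmetric] eta_contract_eq)
qed

lemma u1_zero_bdry: "zero_bdry u1"
  using lame_zero_bdry[of "\<i>/2" 2 1] by (simp only: u1_eq_lame[symmetric] eta_contract_eq)

section \<open>Completeness of Lame's eigenfunctions\<close>

text \<open>Only indices \<open>0 < l < k\<close> are generators; the remaining functions \<open>lame k l\<close> vanish identically or differ by a sign.\<close>
inductive lame_span :: "(real \<times> real \<Rightarrow> real) \<Rightarrow> bool" where
  base: "0 < l \<Longrightarrow> l < k \<Longrightarrow> lame_span (\<lambda>x. Re (c * lame k l x))"
| add: "lame_span f \<Longrightarrow> lame_span g \<Longrightarrow> lame_span (\<lambda>x. f x + g x)"

lemma lame_span_zero: "lame_span (\<lambda>x. 0)"
  using base[of 1 2 0] by simp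

lemma lame_span_cmult: "lame_span f \<Longrightarrow> lame_span (\<lambda>x. a * f x)"
proof (induction rule: lame_span.induct)
  case (base l k c)
  have "(\<lambda>x. a * Re (c * lame k l x)) = (\<lambda>x. Re ((of_real a * c) * lame k l x))"
    by (simp add: algebra_simps)
  then show ?case using lame_span.base[OF base, of "of_real a * c"] by (simp only:)
next
  case (add f g)
  then show ?case unfolding distrib_left by (intro lame_span.add)
qed

lemma lame_span_degenerate:
  assumes "l \<le> k" shows "lame_span (\<lambda>x. Re (c * lame k l x))"
proof (cases "0 < l \<and> l < k")
  case True then show ?thesis using lame_span.base by blast
next
  case False
  then have "l = k \<or> l = 0" using assms by auto
  then have "lame k l x = 0" for x using lame_degenerate(1)[of k x] lame_degenerate(2)[of k x] by (elim disjE) simp_all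
  then show ?thesis by (simp add: lame_span_zero)
qed

definition orbit_sum :: "real \<times> real \<Rightarrow> complex" where
  "orbit_sum x = y1 x + y2 x + y3 x"

text \<open>Multiplication by \<open>y1 + y2 + y3\<close> sends one eigenfunction to the sum of three neighbours in the index lattice. This
  makes the span a module over the algebra generated by the sum of the plane waves, to which Stone-Weierstrass applies.\<close>
lemma lame_span_times_orbit_sum:
  assumes "0 < l" "l < k"
  shows "lame_span (\<lambda>x. Re (c * (orbit_sum x * lame k l x)))"
    and "lame_span (\<lambda>x. Re (c * (cnj (orbit_sum x) * lame k l x)))"
proof -
  have "lame_span (\<lambda>x. Re (c * lame (Suc k) l x) + Re (c * lame k (Suc l) x) + Re (c * lame (k - 1) (l - 1) x))"
    using assms by (intro lame_span.add lame_span_degenerate) auto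
  then show "lame_span (\<lambda>x. Re (c * (orbit_sum x * lame k l x)))"
    unfolding orbit_sum_def lame_times_sum[OF assms] by (simp only: distrib_left plus_complex.sel)
  have "lame_span (\<lambda>x. Re (c * lame (k - 1) l x) + Re (c * lame k (l - 1) x) + Re (c * lame (Suc k) (Suc l) x))"
    using assms by (intro lame_span.add lame_span_degenerate) auto
  then show "lame_span (\<lambda>x. Re (c * (cnj (orbit_sum x) * lame k l x)))"
    unfolding orbit_sum_def lame_times_cnj_sum[OF assms] by (simp only: distrib_left plus_complex.sel)
qed

lemma lame_span_times_Re_Im:
  assumes "lame_span f"
  shows "lame_span (\<lambda>x. Re (orbit_sum x) * f x) \<and> lame_span (\<lambda>x. Im (orbit_sum x) * f x)"
  using assms
proof (induction rule: lame_span.induct)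
  case (base l k c)
  have e1: "(\<lambda>x. Re (orbit_sum x) * Re (c * lame k l x)) =
     (\<lambda>x. Re ((c/2) * (orbit_sum x * lame k l x)) + Re ((c/2) * (cnj (orbit_sum x) * lame k l x)))"
    by (rule ext) (simp add: field_simps)
  have e2: "(\<lambda>x. Im (orbit_sum x) * Re (c * lame k l x)) =
     (\<lambda>x. Re ((- \<i> * c/2) * (orbit_sum x * lame k l x)) + Re ((\<i> * c/2) * (cnj (orbit_sum x) * lame k l x)))"
    by (rule ext) (simp add: field_simps)
  show ?case unfolding e1 e2 by (intro conjI lame_span.add lame_span_times_orbit_sum base)
next
  case (add f g)
  then show ?case unfolding distrib_left by (intro conjI lame_span.add) auto
qed

lemma continuous_y: "continuous_on UNIV y1" "continuous_on UNIV y2" "continuous_on UNIV y3"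
  unfolding y_defs chi_defs by (intro continuous_intros; simp)+

lemma continuous_orbit_sum: "continuous_on UNIV orbit_sum"
  unfolding orbit_sum_def by (intro continuous_intros continuous_y)

lemma cis_eq_int:
  assumes "cis (2 * pi * a) = cis (2 * pi * b)" "\<bar>a - b\<bar> < 2"
  shows "a = b - 1 \<or> a = b \<or> a = b + 1"
proof -
  have "cis (2 * pi * a - 2 * pi * b) = 1" using assms(1) by (simp flip: cis_divide)
  then have "cos (2 * pi * (a - b)) = 1" by (simp add: cis.ctr complex_eq_iff right_diff_distrib)
  then obtain n :: int where "2 * pi * (a - b) = real_of_int n * 2 * pi" unfolding cos_one_2pi_int by blast
  then have n: "a - b = n" by simp
  then have "\<bar>n\<bar> < 2" using assms(2) by linarith
  then have "n = -1 \<or> n = 0 \<or> n = 1" by linarith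
  then show ?thesis using n by auto
qed

lemma alcove_unique:
  fixes a b c a' b' c' :: real
  assumes "a \<ge> b" "b \<ge> c" "a - c \<le> 1" "a + b + c = 0" and "a' \<ge> b'" "b' \<ge> c'" "a' - c' \<le> 1" "a' + b' + c' = 0"
    and "(A, B) \<in> {(a', b'), (a', c'), (b', a'), (b', c'), (c', a'), (c', b')}"
    and "a = A - 1 \<or> a = A \<or> a = A + 1" "b = B - 1 \<or> b = B \<or> b = B + 1"
  shows "a = a' \<and> b = b'"
  using assms(9)
proof (elim insertE emptyE; clarify)
qed (use assms(1-8,10,11) in \<open>(elim disjE; linarith)+\<close>)

text \<open>The three unit numbers \<open>y1\<close>, \<open>y2\<close>, \<open>y3\<close> have product one, so their sum and its conjugate determine all elementary
  symmetric functions, hence the set of the three numbers. Comparing arguments then gives the point, because the triangle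
  is a fundamental alcove (\<open>alcove_unique\<close>).\<close>
lemma orbit_sum_inj:
  assumes x: "x \<in> std_triangle" and x': "x' \<in> std_triangle" and eq: "orbit_sum x = orbit_sum x'"
  shows "x = x'"
proof -
  note p = y_prod[of x] y_prod[of x']
  have s: "y1 x + y2 x + y3 x = y1 x' + y2 x' + y3 x'" using eq by (simp add: orbit_sum_def)
  have "cnj (y1 x + y2 x + y3 x) = cnj (y1 x' + y2 x' + y3 x')" using s by simp
  then have t: "y2 x * y3 x + y1 x * y3 x + y1 x * y2 x = y2 x' * y3 x' + y1 x' * y3 x' + y1 x' * y2 x'"
    by (simp add: y_cnj)
  have "(y1 x - y1 x') * (y1 x - y2 x') * (y1 x - y3 x') = 0" using p s t by algebra
  moreover have "y2 x = y2 x' \<or> y2 x = y3 x'" if "y1 x = y1 x'"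
  proof -
    have nz: "y1 x' \<noteq> 0" using p(2) by auto
    have "(y2 x - y2 x') * (y2 x - y3 x') = 0" using s t that by algebra
    then show ?thesis by simp
  qed
  moreover have "y2 x = y1 x' \<or> y2 x = y3 x'" if "y1 x = y2 x'"
  proof -
    have "(y2 x - y1 x') * (y2 x - y3 x') = 0" using s t that by algebra
    then show ?thesis by simp
  qed
  moreover have "y2 x = y1 x' \<or> y2 x = y2 x'" if "y1 x = y3 x'"
  proof -
    have "(y2 x - y1 x') * (y2 x - y2 x') = 0" using s t that by algebra
    then show ?thesis by simp
  qed
  ultimately have cases: "(y1 x = y1 x' \<and> y2 x = y2 x') \<or> (y1 x = y1 x' \<and> y2 x = y3 x') \<or> (y1 x = y2 x' \<and> y2 x = y1 x')
     \<or> (y1 x = y2 x' \<and> y2 x = y3 x') \<or> (y1 x = y3 x' \<and> y2 x = y1 x') \<or> (y1 x = y3 x' \<and> y2 x = y2 x')" by auto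
  have ch: "chi1 z \<ge> chi2 z \<and> chi2 z \<ge> chi3 z \<and> chi1 z - chi3 z \<le> 1 \<and> chi1 z + chi2 z + chi3 z = 0" if "z \<in> std_triangle" for z
    using that by (auto simp: chi_defs std_triangle_def field_simps)
  have bd: "\<bar>f x - g x'\<bar> < 2" if "f \<in> {chi1, chi2, chi3}" "g \<in> {chi1, chi2, chi3}" for f g
  proof -
    have "\<bar>f z\<bar> < 1" if "z \<in> std_triangle" "f \<in> {chi1, chi2, chi3}" for z f
      using that by (auto simp: chi_defs std_triangle_def field_simps abs_if)
    from this[OF x that(1)] this[OF x' that(2)] show ?thesis by linarith
  qed
  have "\<exists>A B. (A, B) \<in> {(chi1 x', chi2 x'), (chi1 x', chi3 x'), (chi2 x', chi1 x'), (chi2 x', chi3 x'), (chi3 x', chi1 x'), (chi3 x', chi2 x')}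
      \<and> (chi1 x = A - 1 \<or> chi1 x = A \<or> chi1 x = A + 1) \<and> (chi2 x = B - 1 \<or> chi2 x = B \<or> chi2 x = B + 1)"
    using cases
  proof (elim disjE conjE)
    assume "y1 x = y1 x'" "y2 x = y2 x'" then show ?thesis unfolding y_defs
      using cis_eq_int[OF _ bd, of chi1 chi1] cis_eq_int[OF _ bd, of chi2 chi2] by blast
  next
    assume "y1 x = y1 x'" "y2 x = y3 x'" then show ?thesis unfolding y_defs
      using cis_eq_int[OF _ bd, of chi1 chi1] cis_eq_int[OF _ bd, of chi2 chi3] by blast
  next
    assume "y1 x = y2 x'" "y2 x = y1 x'" then show ?thesis unfolding y_defs
      using cis_eq_int[OF _ bd, of chi1 chi2] cis_eq_int[OF _ bd, of chi2 chi1] by blast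
  next
    assume "y1 x = y2 x'" "y2 x = y3 x'" then show ?thesis unfolding y_defs
      using cis_eq_int[OF _ bd, of chi1 chi2] cis_eq_int[OF _ bd, of chi2 chi3] by blast
  next
    assume "y1 x = y3 x'" "y2 x = y1 x'" then show ?thesis unfolding y_defs
      using cis_eq_int[OF _ bd, of chi1 chi3] cis_eq_int[OF _ bd, of chi2 chi1] by blast
  next
    assume "y1 x = y3 x'" "y2 x = y2 x'" then show ?thesis unfolding y_defs
      using cis_eq_int[OF _ bd, of chi1 chi3] cis_eq_int[OF _ bd, of chi2 chi2] by blast
  qed
  then obtain A B where AB: "(A, B) \<in> {(chi1 x', chi2 x'), (chi1 x', chi3 x'), (chi2 x', chi1 x'), (chi2 x', chi3 x'), (chi3 x', chi1 x'), (chi3 x', chi2 x')}"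
      "chi1 x = A - 1 \<or> chi1 x = A \<or> chi1 x = A + 1" "chi2 x = B - 1 \<or> chi2 x = B \<or> chi2 x = B + 1" by blast
  have "chi1 x = chi1 x' \<and> chi2 x = chi2 x'"
    using alcove_unique[OF _ _ _ _ _ _ _ _ AB] ch[OF x] ch[OF x'] by blast
  then show ?thesis by (auto simp: chi_defs prod_eq_iff)
qed

lemma u1_C1: "C1 u1 (\<lambda>x. 2 * pi * cos (2 * pi * fst x) - 2 * pi * cos (2 * pi * (fst x + snd x)))
     (\<lambda>x. 2 * pi * cos (2 * pi * snd x) - 2 * pi * cos (2 * pi * (fst x + snd x)))"
proof -
  have "C1 (\<lambda>x. sin (2 * pi * fst x + 0 * snd x + 0) + sin (0 * fst x + 2 * pi * snd x + 0) - sin (2 * pi * fst x + 2 * pi * snd x + 0))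
    (\<lambda>x. 2 * pi * cos (2 * pi * fst x + 0 * snd x + 0) + 0 * cos (0 * fst x + 2 * pi * snd x + 0) - 2 * pi * cos (2 * pi * fst x + 2 * pi * snd x + 0))
    (\<lambda>x. 0 * cos (2 * pi * fst x + 0 * snd x + 0) + 2 * pi * cos (0 * fst x + 2 * pi * snd x + 0) - 2 * pi * cos (2 * pi * fst x + 2 * pi * snd x + 0))"
    by (intro C1_add C1_diff C1_affine_sin)
  moreover have "u1 = (\<lambda>x. sin (2 * pi * fst x + 0 * snd x + 0) + sin (0 * fst x + 2 * pi * snd x + 0) - sin (2 * pi * fst x + 2 * pi * snd x + 0))"
    by (rule ext) (simp add: u1_def distrib_left)
  ultimately show ?thesis by (simp add: distrib_left)
qed

text \<open>The quotient of \<open>v\<close> by the ground state is continuous, since \<open>v\<close> vanishes near the sides. By Stone-Weierstrass it is a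
  uniform limit of polynomials in the real and imaginary part of the injective function \<open>y1 + y2 + y3\<close>, and
  multiplying back by the ground state leads into the span.\<close>
lemma lame_span_dense:
  assumes v: "C1 v vs vt" "core v" and e: "0 < e"
  shows "\<exists>w. lame_span w \<and> (\<forall>x\<in>std_triangle. \<bar>v x - w x\<bar> \<le> e)"
proof -
  define P where "P = (\<lambda>g. continuous_on std_triangle g \<and> (\<forall>f. lame_span f \<longrightarrow> lame_span (\<lambda>x. g x * f x)))"
  have "continuous_on UNIV (\<lambda>x. v x / u1 x)"
    by (rule C1_cont(1)[OF core_divide[OF v u1_C1]]) (use u1_pos in force)
  then have c: "continuous_on std_triangle (\<lambda>x. v x / u1 x)" by (rule continuous_on_subset) simp
  have "\<exists>g. P g \<and> (\<forall>x\<in>std_triangle. \<bar>v x / u1 x - g x\<bar> < e / 3)"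
  proof (rule Stone_Weierstrass_HOL[OF compact_std_triangle _ _ _ _ _ c])
    show "P (\<lambda>x. c)" for c by (auto simp: P_def intro: lame_span_cmult)
    show "continuous_on std_triangle f" if "P f" for f using that by (simp add: P_def)
    show "P (\<lambda>x. f x + g x)" if "P f \<and> P g" for f g
      using that by (auto simp: P_def distrib_right intro!: continuous_intros lame_span.add)
    show "P (\<lambda>x. f x * g x)" if "P f \<and> P g" for f g
      using that by (auto simp: P_def mult.assoc intro!: continuous_intros)
    show "\<exists>f. P f \<and> f x \<noteq> f y" if "x \<in> std_triangle \<and> y \<in> std_triangle \<and> x \<noteq> y" for x y
    proof -
      have "orbit_sum x \<noteq> orbit_sum y" using orbit_sum_inj that by blast
      moreover have "P (\<lambda>x. Re (orbit_sum x))" "P (\<lambda>x. Im (orbit_sum x))"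
        unfolding P_def using lame_span_times_Re_Im continuous_on_subset[OF continuous_orbit_sum, of std_triangle]
        by (auto intro!: continuous_intros)
      ultimately show ?thesis using complex_eq_iff by metis
    qed
    show "0 < e / 3" using e by simp
  qed
  then obtain g where g: "P g" "\<And>x. x \<in> std_triangle \<Longrightarrow> \<bar>v x / u1 x - g x\<bar> < e / 3" by blast
  have "lame_span (\<lambda>x. Re (\<i>/2 * lame 2 1 x))" by (rule lame_span.base) auto
  then have "lame_span u1" by (simp only: u1_eq_lame[symmetric] eta_contract_eq)
  then have "lame_span (\<lambda>x. g x * u1 x)" using g(1) by (auto simp: P_def)
  moreover have "\<bar>v x - g x * u1 x\<bar> \<le> e" if x: "x \<in> std_triangle" for x
  proof -
    have u3: "\<bar>u1 x\<bar> \<le> 3" unfolding u1_def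
      using sin_le_one[of "2 * pi * fst x"] sin_le_one[of "2 * pi * snd x"] sin_le_one[of "2 * pi * (fst x + snd x)"]
       sin_ge_minus_one[of "2 * pi * fst x"] sin_ge_minus_one[of "2 * pi * snd x"] sin_ge_minus_one[of "2 * pi * (fst x + snd x)"]
      by linarith
    have "v x = v x / u1 x * u1 x"
    proof (cases "u1 x = 0")
      case True
      obtain d where "d > 0" "\<And>s t. s < d \<or> t < d \<or> s + t > 1 - d \<Longrightarrow> v (s, t) = 0"
        using v(2) by (auto simp: core_def)
      then have "v (fst x, snd x) = 0"
        using True u1_pos[of "fst x" "snd x"] by (smt (verit) prod.collapse)
      then show ?thesis by simp
    qed simp
    then have "\<bar>v x - g x * u1 x\<bar> = \<bar>v x / u1 x - g x\<bar> * \<bar>u1 x\<bar>"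
      by (metis abs_mult left_diff_distrib)
    also have "\<dots> \<le> e / 3 * 3" using g(2)[OF x] u3 e by (intro mult_mono) auto
    finally show ?thesis by simp
  qed
  ultimately show ?thesis by blast
qed

section \<open>The spectral gap of the equilateral triangle\<close>

definition eqeig :: "real \<Rightarrow> (real \<times> real \<Rightarrow> real) \<Rightarrow> bool" where
  "eqeig q h \<longleftrightarrow> eqwave q h \<and> zero_bdry h"

lemma eqeig_add: "eqeig q f \<Longrightarrow> eqeig q g \<Longrightarrow> eqeig q (\<lambda>x. f x + g x)"
  by (auto simp: eqeig_def zero_bdry_def intro: wave_add)

lemma eqeig_lame: "q = (real k)\<^sup>2 - real k * real l + (real l)\<^sup>2 \<Longrightarrow> eqeig q (\<lambda>x. Re (c * lame k l x))"
  unfolding eqeig_def using lame_wave lame_zero_bdry by blast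

lemma eqeig_zero: "eqeig q (\<lambda>x. 0)"
proof -
  have "C1 (\<lambda>x. 0) (\<lambda>x. 0) (\<lambda>x. 0)" by (rule C1_const)
  then show ?thesis unfolding eqeig_def wave_def zero_bdry_def by force
qed

lemma eqeig_u1: "eqeig 3 u1" unfolding eqeig_def using u1_wave u1_zero_bdry by blast

lemma eqeig_cont: "eqeig q f \<Longrightarrow> continuous_on UNIV f"
  unfolding eqeig_def using wave_cont by blast

lemma eqeig_orthogonal: "eqeig q f \<Longrightarrow> eqeig q' g \<Longrightarrow> q \<noteq> q' \<Longrightarrow> tri_inner f g = 0"
  unfolding eqeig_def by (auto intro: wave_orthogonal)

lemma lame_index_large:
  assumes "0 < l" "l < k" "4 \<le> (k::nat)" shows "12 \<le> k * (k - l) + l * l"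
proof -
  obtain m where m: "k = l + m" "m > 0" using assms(2) less_imp_add_positive by blast
  have "4 * (int l * int m) \<le> (int l + int m) * (int l + int m)"
    using zero_le_power2[of "int l - int m"] by (simp add: power2_eq_square algebra_simps)
  moreover have "4 * 4 \<le> (int l + int m) * (int l + int m)"
    using assms(3) unfolding m by (intro mult_mono) auto
  moreover have "int (k * (k - l) + l * l) = (int l + int m) * (int l + int m) - int l * int m"
    unfolding m by (simp add: algebra_simps)
  ultimately show ?thesis by linarith
qed

text \<open>Sorting by eigenvalue. The norm \<open>k\<^sup>2 - k l + l\<^sup>2\<close> is 3 for the ground state, 7 for the second eigenspace and at least 12
  for all other indices (\<open>lame_index_large\<close>).\<close>
lemma lame_span_decompose:
  assumes "lame_span f"
  shows "\<exists>a c F g. finite F \<and> (\<forall>q\<in>F. 12 \<le> q \<and> eqeig (real q) (g q)) \<and>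
     f = (\<lambda>x. a * u1 x + Re (c * lame 3 1 x) + (\<Sum>q\<in>F. g q x))"
  using assms
proof (induction rule: lame_span.induct)
  case (base l k c)
  consider "k = 2" "l = 1" | "k = 3" "l = 1" | "k = 3" "l = 2" | "4 \<le> k" using base by linarith
  then show ?case
  proof cases
    case 1
    have "(\<lambda>x. Re (c * lame k l x)) = (\<lambda>x. (2 * Im c) * u1 x + Re (0 * lame 3 1 x) + (\<Sum>q\<in>{}. (\<lambda>_. 0) x))"
      unfolding 1 by (simp add: lame_21[simplified] mult_ac)
    then show ?thesis by (intro exI[of _ "2 * Im c"] exI[of _ 0] exI[of _ "{}"] exI[of _ "\<lambda>q x. 0"]) simp
  next
    case 2
    then show ?thesis by (intro exI[of _ 0] exI[of _ c] exI[of _ "{}"] exI[of _ "\<lambda>q x. 0"]) simp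
  next
    case 3
    have "Re (c * lame k l x) = Re (- cnj c * lame 3 1 x)" for x
      unfolding 3 lame_32 by simp
    then show ?thesis by (intro exI[of _ 0] exI[of _ "- cnj c"] exI[of _ "{}"] exI[of _ "\<lambda>q x. 0"]) simp
  next
    case 4
    define q where "q = k * (k - l) + l * l"
    have "real q = (real k)\<^sup>2 - real k * real l + (real l)\<^sup>2"
    proof -
      obtain m where "k = l + m" using base(2) less_imp_add_positive by blast
      then show ?thesis by (simp add: q_def power2_eq_square algebra_simps)
    qed
    then have "eqeig (real q) (\<lambda>x. Re (c * lame k l x))" by (rule eqeig_lame)
    moreover have "12 \<le> q" unfolding q_def by (rule lame_index_large[OF base 4])
    ultimately show ?thesis
      by (intro exI[of _ 0] exI[of _ 0] exI[of _ "{q}"] exI[of _ "\<lambda>q x. Re (c * lame k l x)"]) (simp del: times_complex.sel)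
  qed
next
  case (add f f')
  obtain a c F g where 1: "finite F" "\<And>q. q \<in> F \<Longrightarrow> 12 \<le> q \<and> eqeig (real q) (g q)"
     "f = (\<lambda>x. a * u1 x + Re (c * lame 3 1 x) + (\<Sum>q\<in>F. g q x))" using add.IH(1) by blast
  obtain a' c' F' g' where 2: "finite F'" "\<And>q. q \<in> F' \<Longrightarrow> 12 \<le> q \<and> eqeig (real q) (g' q)"
     "f' = (\<lambda>x. a' * u1 x + Re (c' * lame 3 1 x) + (\<Sum>q\<in>F'. g' q x))" using add.IH(2) by blast
  define G where "G = (\<lambda>q x. (if q \<in> F then g q x else 0) + (if q \<in> F' then g' q x else 0))"
  have "eqeig (real q) (\<lambda>x. if q \<in> F then g q x else 0)" "eqeig (real q) (\<lambda>x. if q \<in> F' then g' q x else 0)" for q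
    using 1(2)[of q] 2(2)[of q] eqeig_zero by (cases "q \<in> F"; cases "q \<in> F'"; simp)+
  then have G: "eqeig (real q) (G q)" for q unfolding G_def by (rule eqeig_add)
  have "(\<Sum>q\<in>F \<union> F'. G q x) = (\<Sum>q\<in>F. g q x) + (\<Sum>q\<in>F'. g' q x)" for x
    unfolding G_def sum.distrib using 1(1) 2(1)
    by (simp add: sum.If_cases Int_absorb1 Int_absorb2)
  then have "(\<lambda>x. f x + f' x) = (\<lambda>x. (a + a') * u1 x + Re ((c + c') * lame 3 1 x) + (\<Sum>q\<in>F \<union> F'. G q x))"
    unfolding 1 2 by (simp add: algebra_simps)
  then show ?case using 1 2 G
    by (intro exI[of _ "a + a'"] exI[of _ "c + c'"] exI[of _ "F \<union> F'"] exI[of _ G]) auto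
qed


lemma tri_int_bound:
  assumes "continuous_on UNIV f" "continuous_on UNIV g" "continuous_on UNIV h"
    and "\<And>x. x \<in> std_triangle \<Longrightarrow> \<bar>f x - g x\<bar> \<le> e"
  shows "\<bar>tri_inner h f - tri_inner h g\<bar> \<le> e * tri_int (\<lambda>x. \<bar>h x\<bar>)"
proof -
  have 1: "tri_inner h f - tri_inner h g = tri_int (\<lambda>x. h x * (f x - g x))"
    unfolding tri_inner_diff_right[OF assms(1-3), symmetric] by (simp add: tri_inner_def)
  have c: "continuous_on UNIV (\<lambda>x. h x * (f x - g x))" "continuous_on UNIV (\<lambda>x. e * \<bar>h x\<bar>)"
    "continuous_on UNIV (\<lambda>x. - (e * \<bar>h x\<bar>))"
    by (intro continuous_intros assms)+
  have b: "\<bar>h x * (f x - g x)\<bar> \<le> e * \<bar>h x\<bar>" if "x \<in> std_triangle" for x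
    unfolding abs_mult using assms(4)[OF that] by (metis abs_ge_zero mult.commute mult_left_mono)
  have "tri_int (\<lambda>x. h x * (f x - g x)) \<le> tri_int (\<lambda>x. e * \<bar>h x\<bar>)"
    by (rule tri_int_mono[OF c(1,2)]) (use b in force)
  moreover have "tri_int (\<lambda>x. - (e * \<bar>h x\<bar>)) \<le> tri_int (\<lambda>x. h x * (f x - g x))"
    by (rule tri_int_mono[OF c(3,1)]) (use b in force)
  ultimately show ?thesis unfolding 1 by (simp add: tri_int_minus tri_int_cmult abs_le_iff)
qed

text \<open>Solve the Poisson equation with right-hand side the part of \<open>w\<close> in the eigenspaces beyond the second, by dividing each component
  by its eigenvalue. Green's identity turns \<open>(z, w)\<close> into the form of \<open>z\<close> and the solution, and the Cauchy-Schwarz inequality of the form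
  gives the bound. Bessel's inequality and the completeness of the eigenfunctions in the energy norm are thereby avoided.\<close>
lemma spectral_gap_aux:
  assumes z: "C1 z zs zt" "zero_bdry z"
    and orth: "tri_inner z u1 = 0" "\<And>c. tri_inner z (\<lambda>x. Re (c * lame 3 1 x)) = 0"
    and w: "lame_span w"
  shows "(tri_inner z w)\<^sup>2 \<le> 3 / (64 * pi\<^sup>2) * tri_inner w w * dform (4/3) (4/3) (4/3) zs zt zs zt"
proof -
  obtain a c F g where F: "finite F" "\<And>q. q \<in> F \<Longrightarrow> 12 \<le> q \<and> eqeig (real q) (g q)"
     and wF: "w = (\<lambda>x. a * u1 x + Re (c * lame 3 1 x) + (\<Sum>q\<in>F. g q x))"
    using lame_span_decompose[OF w] by blast
  define low where "low = (\<lambda>x. a * u1 x + Re (c * lame 3 1 x))"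
  define h where "h = (\<lambda>x. \<Sum>q\<in>F. g q x)"
  define \<nu> where "\<nu> = (\<lambda>q::nat. 16 * pi\<^sup>2 / 9 * real q)"
  have p31: "eqeig 7 (\<lambda>x. Re (c * lame 3 1 x))" for c by (rule eqeig_lame) simp
  note cu = eqeig_cont[OF eqeig_u1] and cp = eqeig_cont[OF p31[of c]] and cz = C1_cont[OF z(1)]
  have cg: "continuous_on UNIV (g q)" if "q \<in> F" for q using F(2)[OF that] eqeig_cont by blast
  have cl: "continuous_on UNIV low" unfolding low_def by (intro continuous_intros cu cp)
  have ch: "continuous_on UNIV h" unfolding h_def by (intro continuous_intros cg)
  have wl: "w = (\<lambda>x. low x + h x)" by (simp add: wF low_def h_def)
  have \<nu>: "\<nu> q > 0" if "q \<in> F" for q using F(2)[OF that] by (auto simp: \<nu>_def)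
  have zl: "tri_inner z low = 0"
    unfolding low_def tri_inner_add_right[OF continuous_on_mult[OF continuous_on_const cu] cp cz(1)] tri_inner_cmult_right orth
    by simp
  have lg: "tri_inner low (g q) = 0" if "q \<in> F" for q
  proof -
    have "tri_inner u1 (g q) = 0" "tri_inner (\<lambda>x. Re (c * lame 3 1 x)) (g q) = 0"
      using F(2)[OF that] eqeig_orthogonal[OF eqeig_u1, of "real q" "g q"] eqeig_orthogonal[OF p31, of "real q" "g q" c] by auto
    then show ?thesis
      unfolding low_def tri_inner_add_left[OF continuous_on_mult[OF continuous_on_const cu] cp cg[OF that]] tri_inner_cmult_left
      by (simp del: times_complex.sel)
  qed
  have lh: "tri_inner low h = 0"
    unfolding h_def tri_inner_commute[of low] using tri_inner_sum_left[of F g low] cg cl lg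
    by (simp add: tri_inner_commute[of _ low])
  have zw: "tri_inner z w = tri_inner z h"
    unfolding wl using zl by (simp add: tri_inner_add_right cl ch cz)
  have gg: "tri_inner (g q) h = tri_inner (g q) (g q)" if q: "q \<in> F" for q
  proof -
    have "tri_inner h (g q) = (\<Sum>q'\<in>F. tri_inner (g q') (g q))"
      unfolding h_def by (rule tri_inner_sum_left) (use cg q in auto)
    also have "\<dots> = (\<Sum>q'\<in>F. if q' = q then tri_inner (g q) (g q) else 0)"
      by (rule sum.cong) (use F(2) q eqeig_orthogonal in force)+
    also have "\<dots> = tri_inner (g q) (g q)" using F(1) q by simp
    finally show ?thesis by (simp add: tri_inner_commute)
  qed
  have hh: "tri_inner h h = (\<Sum>q\<in>F. tri_inner (g q) (g q))"
    using tri_inner_sum_left[of F g h] cg ch gg by (simp add: h_def[symmetric])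
  have hw: "tri_inner h h \<le> tri_inner w w"
  proof -
    have "tri_inner w w = tri_inner low low + 2 * tri_inner low h + tri_inner h h"
      unfolding wl using tri_inner_commute[of h low]
      by (simp add: tri_inner_add_right tri_inner_add_left continuous_intros cl ch)
    then show ?thesis using lh tri_inner_nonneg[of low] by simp
  qed
  \<comment> \<open>\<open>y\<close> solves \<open>- \<Delta> y = h\<close>\<close>
  obtain gs gt where gC: "\<And>q. q \<in> F \<Longrightarrow> C1 (g q) (gs q) (gt q)"
  proof -
    have "\<forall>q. \<exists>a b. q \<in> F \<longrightarrow> C1 (g q) a b" using F(2) wave_C1 unfolding eqeig_def by blast
    then show ?thesis using that by metis
  qed
  define ys where "ys = (\<lambda>x. \<Sum>q\<in>F. 1 / \<nu> q * gs q x)"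
  define yt where "yt = (\<lambda>x. \<Sum>q\<in>F. 1 / \<nu> q * gt q x)"
  have cgst: "continuous_on UNIV (gs q)" "continuous_on UNIV (gt q)" if "q \<in> F" for q
    using C1_cont[OF gC[OF that]] by auto
  have cy: "continuous_on UNIV ys" "continuous_on UNIV yt"
    unfolding ys_def yt_def by (intro continuous_intros cgst; simp)+
  have dsum: "dform (4/3) (4/3) (4/3) ys yt vs vt = (\<Sum>q\<in>F. 1 / \<nu> q * dform (4/3) (4/3) (4/3) (gs q) (gt q) vs vt)"
    if "continuous_on UNIV vs" "continuous_on UNIV vt" for vs vt
  proof -
    have "dform (4/3) (4/3) (4/3) ys yt vs vt = tri_int (\<lambda>x. \<Sum>q\<in>F. 1 / \<nu> q * bil (4/3) (4/3) (4/3) (gs q x) (gt q x) (vs x) (vt x))"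
      unfolding dform_def ys_def yt_def bil_def
      by (rule tri_int_cong) (simp add: sum_distrib_left sum_distrib_right sum.distrib sum_subtractf sum_negf distrib_left diff_divide_distrib algebra_simps)
    also have "\<dots> = (\<Sum>q\<in>F. tri_int (\<lambda>x. 1 / \<nu> q * bil (4/3) (4/3) (4/3) (gs q x) (gt q x) (vs x) (vt x)))"
      by (rule tri_int_sum) (intro continuous_intros continuous_bil cgst that; simp)
    finally show ?thesis unfolding tri_int_cmult dform_def .
  qed
  have dz: "dform (4/3) (4/3) (4/3) (gs q) (gt q) vs vt = \<nu> q * tri_inner (g q) v"
    if "q \<in> F" "C1 v vs vt" "zero_bdry v" for q v vs vt
    unfolding \<nu>_def using F(2)[OF that(1)] by (intro wave_Green that gC) (auto simp: eqeig_def)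
  have "dform (4/3) (4/3) (4/3) ys yt zs zt = (\<Sum>q\<in>F. tri_inner (g q) z)"
    unfolding dsum[OF cz(2,3)] by (rule sum.cong[OF refl]) (use dz[OF _ z] \<nu> in force)
  also have "\<dots> = tri_inner h z" unfolding h_def by (rule tri_inner_sum_left[symmetric]) (use cg cz in auto)
  finally have yz: "dform (4/3) (4/3) (4/3) ys yt zs zt = tri_inner z w" by (simp only: zw tri_inner_commute[of h z])
  have yg: "dform (4/3) (4/3) (4/3) ys yt (gs q) (gt q) = tri_inner (g q) (g q)" if q: "q \<in> F" for q
  proof -
    have zb: "zero_bdry (g q)" using F(2)[OF q] by (simp add: eqeig_def)
    have "dform (4/3) (4/3) (4/3) ys yt (gs q) (gt q) = (\<Sum>q'\<in>F. tri_inner (g q') (g q))"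
      unfolding dsum[OF cgst[OF q]] by (rule sum.cong[OF refl]) (use dz[OF _ gC[OF q] zb] \<nu> in force)
    also have "\<dots> = tri_inner h (g q)" unfolding h_def by (rule tri_inner_sum_left[symmetric]) (use cg q in auto)
    finally show ?thesis using gg[OF q] by (simp only: tri_inner_commute[of h "g q"])
  qed
  have "dform (4/3) (4/3) (4/3) ys yt ys yt = (\<Sum>q\<in>F. 1 / \<nu> q * tri_inner (g q) (g q))"
    unfolding dsum[OF cy] by (rule sum.cong[OF refl]) (simp add: dform_commute[of _ _ _ _ _ ys yt] yg)
  also have "\<dots> \<le> (\<Sum>q\<in>F. 3 / (64 * pi\<^sup>2) * tri_inner (g q) (g q))"
  proof (rule sum_mono)
    fix q assume q: "q \<in> F"
    have "64 * pi\<^sup>2 / 3 \<le> \<nu> q" using F(2)[OF q] mult_left_mono[of 12 "real q" "pi\<^sup>2"] by (simp add: \<nu>_def field_simps)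
    then have "1 / \<nu> q \<le> 3 / (64 * pi\<^sup>2)" using \<nu>[OF q] by (simp add: field_simps)
    then show "1 / \<nu> q * tri_inner (g q) (g q) \<le> 3 / (64 * pi\<^sup>2) * tri_inner (g q) (g q)"
      by (intro mult_right_mono tri_inner_nonneg)
  qed
  also have "\<dots> = 3 / (64 * pi\<^sup>2) * tri_inner h h" unfolding hh sum_distrib_left ..
  also have "\<dots> \<le> 3 / (64 * pi\<^sup>2) * tri_inner w w" using hw by (intro mult_left_mono) auto
  finally have yy: "dform (4/3) (4/3) (4/3) ys yt ys yt \<le> 3 / (64 * pi\<^sup>2) * tri_inner w w" .
  have psd: "psd (4/3) (4/3) (4/3)" by (simp add: psd_def power2_eq_square)
  have "(tri_inner z w)\<^sup>2 \<le> dform (4/3) (4/3) (4/3) ys yt ys yt * dform (4/3) (4/3) (4/3) zs zt zs zt"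
    unfolding yz[symmetric] by (rule dform_Cauchy_Schwarz[OF psd cy cz(2,3)])
  also have "\<dots> \<le> 3 / (64 * pi\<^sup>2) * tri_inner w w * dform (4/3) (4/3) (4/3) zs zt zs zt"
    by (rule mult_right_mono[OF yy dform_nonneg[OF psd]])
  finally show ?thesis .
qed

text \<open>Let \<open>w\<close> tend to \<open>z\<close> in the preceding estimate.\<close>
lemma spectral_gap:
  assumes z: "C1 z zs zt" "zero_bdry z"
    and orth: "tri_inner z u1 = 0" "\<And>c. tri_inner z (\<lambda>x. Re (c * lame 3 1 x)) = 0"
    and dense: "\<And>e. 0 < e \<Longrightarrow> \<exists>w. lame_span w \<and> (\<forall>x\<in>std_triangle. \<bar>z x - w x\<bar> \<le> e)"
  shows "64 * pi\<^sup>2 / 3 * tri_inner z z \<le> dform (4/3) (4/3) (4/3) zs zt zs zt"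
proof -
  define A where "A = dform (4/3) (4/3) (4/3) zs zt zs zt"
  define B where "B = tri_inner z z"
  define M where "M = tri_int (\<lambda>x. \<bar>z x\<bar>)"
  define K where "K = tri_int (\<lambda>x. 1)"
  have A0: "A \<ge> 0" unfolding A_def by (rule dform_nonneg) (simp add: psd_def power2_eq_square)
  note cz = C1_cont(1)[OF z(1)]
  have "\<exists>w. lame_span w \<and> (\<forall>x\<in>std_triangle. \<bar>z x - w x\<bar> \<le> 1 / real (Suc n))" for n by (rule dense) simp
  then obtain w where w: "\<And>n. lame_span (w n)" "\<And>n x. x \<in> std_triangle \<Longrightarrow> \<bar>z x - w n x\<bar> \<le> 1 / real (Suc n)"
    by metis
  have cw: "continuous_on UNIV (w n)" for n
  proof -
    have "continuous_on UNIV f" if "lame_span f" for f using that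
    proof (induction rule: lame_span.induct)
      case (base l k c)
      show ?case by (rule wave_cont[OF lame_wave[OF refl]])
    qed (intro continuous_intros)
    then show ?thesis using w(1) by blast
  qed
  have e0: "(\<lambda>n. 1 / real (Suc n)) \<longlonglongrightarrow> 0" using LIMSEQ_inverse_real_of_nat by (simp add: inverse_eq_divide)
  have lim1: "(\<lambda>n. tri_inner z (w n)) \<longlonglongrightarrow> B"
  proof (rule LIM_zero_cancel)
    show "(\<lambda>n. tri_inner z (w n) - B) \<longlonglongrightarrow> 0"
    proof (rule tendsto_rabs_zero_cancel, rule tendsto_sandwich[OF _ _ tendsto_const[of 0]])
      show "\<forall>\<^sub>F n in sequentially. 0 \<le> \<bar>tri_inner z (w n) - B\<bar>" by simp
      show "\<forall>\<^sub>F n in sequentially. \<bar>tri_inner z (w n) - B\<bar> \<le> 1 / real (Suc n) * M"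
        using tri_int_bound[OF cz cw cz w(2)] unfolding B_def M_def by (simp add: abs_minus_commute)
      show "(\<lambda>n. 1 / real (Suc n) * M) \<longlonglongrightarrow> 0" using tendsto_mult_right[OF e0, of M] by simp
    qed
  qed
  have lim2: "(\<lambda>n. tri_inner (w n) (w n)) \<longlonglongrightarrow> B"
  proof -
    have "tri_inner (w n) (w n) = 2 * tri_inner z (w n) - B + tri_inner (\<lambda>x. z x - w n x) (\<lambda>x. z x - w n x)" for n
      unfolding B_def using cz cw[of n] tri_inner_commute[of "w n" z]
      by (simp add: tri_inner_diff_left tri_inner_diff_right continuous_intros)
    moreover have "(\<lambda>n. tri_inner (\<lambda>x. z x - w n x) (\<lambda>x. z x - w n x)) \<longlonglongrightarrow> 0"
    proof (rule tendsto_sandwich[OF _ _ tendsto_const[of 0]])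
      show "\<forall>\<^sub>F n in sequentially. 0 \<le> tri_inner (\<lambda>x. z x - w n x) (\<lambda>x. z x - w n x)"
        by (simp add: tri_inner_nonneg)
      have "tri_inner (\<lambda>x. z x - w n x) (\<lambda>x. z x - w n x) \<le> (1 / real (Suc n))\<^sup>2 * K" for n
        unfolding K_def tri_int_cmult[symmetric] tri_int_square[symmetric]
        by (rule tri_int_mono) (use w(2)[of _ n] cz cw[of n] in \<open>auto intro!: continuous_intros simp: abs_le_square_iff[symmetric] simp flip: power_divide\<close>)
      then show "\<forall>\<^sub>F n in sequentially. tri_inner (\<lambda>x. z x - w n x) (\<lambda>x. z x - w n x) \<le> (1 / real (Suc n))\<^sup>2 * K" by simp
      show "(\<lambda>n. (1 / real (Suc n))\<^sup>2 * K) \<longlonglongrightarrow> 0"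
        using tendsto_mult_right[OF tendsto_power[OF e0, of 2], of K] by simp
    qed
    ultimately show ?thesis
      using tendsto_add[OF tendsto_diff[OF tendsto_mult_left[OF lim1, of 2] tendsto_const[of B]],
          of "\<lambda>n. tri_inner (\<lambda>x. z x - w n x) (\<lambda>x. z x - w n x)" 0] by simp
  qed
  have "(tri_inner z (w n))\<^sup>2 \<le> 3 / (64 * pi\<^sup>2) * tri_inner (w n) (w n) * A" for n
    unfolding A_def by (rule spectral_gap_aux[OF z orth w(1)])
  then have "B\<^sup>2 \<le> 3 / (64 * pi\<^sup>2) * B * A"
    by (intro LIMSEQ_le[OF tendsto_power[OF lim1] tendsto_mult_right[OF tendsto_mult_left[OF lim2]]]) auto
  then have "B * (64 * pi\<^sup>2 * B) \<le> B * (3 * A)" by (simp add: field_simps power2_eq_square)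
  moreover have "B \<ge> 0" unfolding B_def by (rule tri_inner_nonneg)
  ultimately have "64 * pi\<^sup>2 * B \<le> 3 * A"
    using A0 by (cases "B = 0") auto
  then show ?thesis unfolding A_def B_def by simp
qed

section \<open>Explicit integrals\<close>

lemma lborel_integral_reflect: "(LINT t:{0..c}|lborel. f (c - t)) = (LINT t:{0..c}|lborel. f (t::real) :: real)"
proof -
  have "(LINT t:{0..c}|lborel. f t) = (\<integral>t. indicator {0..c} (c + (-1) * t) *\<^sub>R f (c + (-1) * t) \<partial>lborel)"
    unfolding set_lebesgue_integral_def
    by (subst lborel_integral_real_affine[where c="-1" and t=c]) simp_all
  also have "\<dots> = (LINT t:{0..c}|lborel. f (c - t))"
    unfolding set_lebesgue_integral_def by (rule Bochner_Integration.integral_cong) (auto simp: indicator_def)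
  finally show ?thesis ..
qed

lemma tri_int_reflect:
  assumes "continuous_on UNIV f" shows "tri_int (\<lambda>x. f (fst x, 1 - fst x - snd x)) = tri_int f"
proof -
  have c: "continuous_on UNIV (\<lambda>x. f (fst x, 1 - fst x - snd x))"
    by (rule continuous_on_compose2[OF assms]) (auto intro!: continuous_intros)
  show ?thesis unfolding tri_int_fubini(1)[OF c] tri_int_fubini(1)[OF assms]
    using lborel_integral_reflect[of "1 - s" "\<lambda>t. f (s, t)" for s] by simp
qed

lemma tri_int_one: "tri_int (\<lambda>x. 1) = 1 / 2"
proof -
  have c: "continuous_on UNIV (\<lambda>x::real\<times>real. 1::real)" by simp
  have "tri_int (\<lambda>x. 1) = (LINT s:{0..1}|lborel. 1 - s)"
    unfolding tri_int_fubini(1)[OF c] by (intro set_lebesgue_integral_cong) (auto simp: set_lebesgue_integral_def)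
  also have "\<dots> = (1 - 1\<^sup>2 / 2) - (0 - 0\<^sup>2 / 2)"
    unfolding set_lebesgue_integral_def
    by (rule integral_FTC_atLeastAtMost[where F="\<lambda>s. s - s\<^sup>2 / 2"])
       (auto intro!: derivative_eq_intros continuous_intros simp flip: has_real_derivative_iff_has_vector_derivative)
  finally show ?thesis by simp
qed

lemma LINT_cos_affine:
  fixes a b :: real
  assumes "a \<noteq> 0" shows "(LINT s:{0..1}|lborel. sin (a * s + b)) = (cos b - cos (a + b)) / a"
proof -
  have "(LINT s:{0..1}|lborel. sin (a * s + b)) = - cos (a * 1 + b) / a - (- cos (a * 0 + b) / a)"
    unfolding set_lebesgue_integral_def using assms
    by (intro integral_FTC_atLeastAtMost[where F="\<lambda>s. - cos (a * s + b) / a"])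
       (auto intro!: derivative_eq_intros continuous_intros simp flip: has_real_derivative_iff_has_vector_derivative)
  then show ?thesis by (simp add: diff_divide_distrib)
qed

lemma sin_set_integrable: "set_integrable lborel {0..1} (\<lambda>s. sin (a * s + b :: real))"
  by (rule borel_integrable_atLeastAtMost') (intro continuous_intros)

lemma tri_int_cos_aux:
  assumes "b \<noteq> 0"
  shows "tri_int (\<lambda>x. cos (a * fst x + b * snd x)) =
     ((LINT s:{0..1}|lborel. sin ((a - b) * s + b)) - (LINT s:{0..1}|lborel. sin (a * s + 0))) / b"
proof -
  have "b * tri_int (\<lambda>x. cos (a * fst x + b * snd x)) = (LINT s:{0..1}|lborel. sin ((a - b) * s + b) - sin (a * s + 0))"
    using tri_int_derivative(2)[OF C1_affine_sin[of a b 0]] by (simp add: tri_int_cmult algebra_simps)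
  also have "\<dots> = (LINT s:{0..1}|lborel. sin ((a - b) * s + b)) - (LINT s:{0..1}|lborel. sin (a * s + 0))"
    by (rule set_integral_diff; rule sin_set_integrable)
  finally show ?thesis using assms by (simp add: field_simps)
qed

lemma tri_int_cos:
  assumes "a \<noteq> 0" "b \<noteq> 0" "a \<noteq> b"
  shows "tri_int (\<lambda>x. cos (a * fst x + b * snd x)) = ((cos b - cos a) / (a - b) - (1 - cos a) / a) / b"
  using assms by (simp add: tri_int_cos_aux LINT_cos_affine[of "a - b" b] LINT_cos_affine[of a 0, simplified])

lemma cos_int_period: "cos (2 * pi * real_of_int m) = 1" "sin (2 * pi * real_of_int m) = 0"
  by (simp_all add: mult.commute sin_int_times_real sin_times_pi_eq_0 cos_one_2pi_int) (metis mult.commute sin_times_pi_eq_0 Ints_of_int Ints_mult Ints_numeral mult.assoc)?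

lemma tri_int_cos_integer:
  fixes m n :: int
  assumes "(m, n) \<noteq> (0, 0)"
  shows "tri_int (\<lambda>x. cos (2 * pi * (real_of_int m * fst x + real_of_int n * snd x))) = 0"
proof -
  have one: "tri_int (\<lambda>x. cos (2 * pi * (real_of_int m * fst x + real_of_int n * snd x))) = 0" if n: "n \<noteq> 0" for m n
  proof -
    have A: "(LINT s:{0..1}|lborel. sin (2 * pi * real_of_int k * s + 2 * pi * real_of_int j)) = 0" for k j :: int
    proof (cases "k = 0")
      case True then show ?thesis by (simp add: cos_int_period set_lebesgue_integral_def)
    next
      case False
      then show ?thesis using LINT_cos_affine[of "2 * pi * real_of_int k" "2 * pi * real_of_int j"] cos_int_period(1)[of "k + j"] cos_int_period(1)[of j]
        by (simp add: distrib_left)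
    qed
    have B: "2 * pi * real_of_int m - 2 * pi * real_of_int n = 2 * pi * real_of_int (m - n)" by (simp add: right_diff_distrib)
    have "tri_int (\<lambda>x. cos ((2 * pi * real_of_int m) * fst x + (2 * pi * real_of_int n) * snd x)) = 0"
      using n A[of "m - n" n] A[of m 0] unfolding B[symmetric] by (subst tri_int_cos_aux) simp_all
    then show ?thesis by (simp add: distrib_left mult.assoc)
  qed
  show ?thesis
  proof (cases "n = 0")
    case False then show ?thesis by (rule one)
  next
    case True
    then have m: "m \<noteq> 0" using assms by simp
    have "tri_int (\<lambda>x. (\<lambda>y. cos (2 * pi * (real_of_int n * fst y + real_of_int m * snd y))) (prod.swap x)) =
       tri_int (\<lambda>y. cos (2 * pi * (real_of_int n * fst y + real_of_int m * snd y)))"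
      by (rule tri_int_swap) (intro continuous_intros)
    also have "\<dots> = 0" by (rule one[OF m])
    finally show ?thesis by (simp add: add.commute)
  qed
qed

definition s1 :: "real \<times> real \<Rightarrow> real" where "s1 x = sin (2 * pi * fst x)"
definition s2 :: "real \<times> real \<Rightarrow> real" where "s2 x = sin (2 * pi * snd x)"
definition s3 :: "real \<times> real \<Rightarrow> real" where "s3 x = - sin (2 * pi * (fst x + snd x))"

lemma continuous_s: "continuous_on UNIV s1" "continuous_on UNIV s2" "continuous_on UNIV s3"
  unfolding s1_def s2_def s3_def by (intro continuous_intros)+

lemma s_reflect: "s1 (fst x, 1 - fst x - snd x) = s1 x" "s2 (fst x, 1 - fst x - snd x) = s3 x"
  "s3 (fst x, 1 - fst x - snd x) = s2 x"
proof -
  show "s1 (fst x, 1 - fst x - snd x) = s1 x" by (simp add: s1_def)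
  have "2 * pi * (1 - fst x - snd x) = 2 * pi - 2 * pi * (fst x + snd x)" by (simp add: algebra_simps)
  then show "s2 (fst x, 1 - fst x - snd x) = s3 x" by (simp add: s2_def s3_def sin_diff)
  have "2 * pi * (fst x + (1 - fst x - snd x)) = 2 * pi - 2 * pi * snd x" by (simp add: algebra_simps)
  then show "s3 (fst x, 1 - fst x - snd x) = s2 x" by (simp only: s2_def s3_def fst_conv snd_conv sin_diff) simp
qed

lemma s_swap: "s1 (prod.swap x) = s2 x" "s2 (prod.swap x) = s1 x" "s3 (prod.swap x) = s3 x"
  by (simp_all add: s1_def s2_def s3_def add.commute)

lemma tri_inner_reflect:
  assumes "continuous_on UNIV f" "continuous_on UNIV g"
  shows "tri_inner (\<lambda>x. f (fst x, 1 - fst x - snd x)) (\<lambda>x. g (fst x, 1 - fst x - snd x)) = tri_inner f g"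
  unfolding tri_inner_def using tri_int_reflect[of "\<lambda>x. f x * g x"] assms by (simp add: continuous_intros)

lemma tri_inner_swap:
  assumes "continuous_on UNIV f" "continuous_on UNIV g"
  shows "tri_inner (\<lambda>x. f (prod.swap x)) (\<lambda>x. g (prod.swap x)) = tri_inner f g"
  unfolding tri_inner_def using tri_int_swap[of "\<lambda>x. f x * g x"] assms by (simp add: continuous_intros)

lemma s_inner:
  "tri_inner s1 s1 = 1/4" "tri_inner s2 s2 = 1/4" "tri_inner s3 s3 = 1/4"
  "tri_inner s1 s2 = 0" "tri_inner s1 s3 = 0" "tri_inner s2 s3 = 0"
proof -
  have "tri_inner s1 s1 = tri_int (\<lambda>x. (1/2) * 1 - (1/2) * cos (2 * pi * (real_of_int 2 * fst x + real_of_int 0 * snd x)))"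
    unfolding tri_inner_def s1_def by (rule tri_int_cong) (simp add: sin_times_sin)
  also have "\<dots> = (1/2) * tri_int (\<lambda>x. 1) - (1/2) * tri_int (\<lambda>x. cos (2 * pi * (real_of_int 2 * fst x + real_of_int 0 * snd x)))"
    unfolding tri_int_cmult[symmetric] by (rule tri_int_diff) (intro continuous_intros)+
  also have "\<dots> = 1/4" by (subst tri_int_cos_integer) (simp_all add: tri_int_one)
  finally show 11: "tri_inner s1 s1 = 1/4" .
  show 22: "tri_inner s2 s2 = 1/4" using tri_inner_swap[OF continuous_s(1,1)] 11 by (simp add: s_swap)
  show "tri_inner s3 s3 = 1/4" using tri_inner_reflect[OF continuous_s(2,2)] 22 by (simp add: s_reflect)
  have "tri_inner s1 s2 = tri_int (\<lambda>x. (1/2) * cos (2 * pi * (real_of_int 1 * fst x + real_of_int (-1) * snd x))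
       - (1/2) * cos (2 * pi * (real_of_int 1 * fst x + real_of_int 1 * snd x)))"
    unfolding tri_inner_def s1_def s2_def by (rule tri_int_cong) (simp add: sin_times_sin distrib_left right_diff_distrib diff_divide_distrib)
  also have "\<dots> = (1/2) * tri_int (\<lambda>x. cos (2 * pi * (real_of_int 1 * fst x + real_of_int (-1) * snd x)))
       - (1/2) * tri_int (\<lambda>x. cos (2 * pi * (real_of_int 1 * fst x + real_of_int 1 * snd x)))"
    unfolding tri_int_cmult[symmetric] by (rule tri_int_diff) (intro continuous_intros)+
  also have "\<dots> = 0"
    using tri_int_cos_integer[of 1 "-1"] tri_int_cos_integer[of 1 1] by (simp del: of_int_minus)
  finally show 12: "tri_inner s1 s2 = 0" .
  show 13: "tri_inner s1 s3 = 0" using tri_inner_reflect[OF continuous_s(1,2)] 12 by (simp add: s_reflect)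
  show "tri_inner s2 s3 = 0" using tri_inner_swap[OF continuous_s(1,3)] 13 by (simp add: s_swap)
qed

text \<open>Its real and imaginary part span the second eigenspace.\<close>
definition P31 :: "real \<times> real \<Rightarrow> complex" where "P31 x = \<i> / 2 * lame 3 1 x"
definition p1 :: "real \<times> real \<Rightarrow> real" where "p1 x = Re (P31 x)"
definition p2 :: "real \<times> real \<Rightarrow> real" where "p2 x = Im (P31 x)"

lemma eqeig_p: "eqeig 7 p1" "eqeig 7 p2"
proof -
  have "eqeig 7 (\<lambda>x. Re (\<i>/2 * lame 3 1 x))" "eqeig 7 (\<lambda>x. Re (1/2 * lame 3 1 x))" by (rule eqeig_lame, simp)+
  moreover have "p1 = (\<lambda>x. Re (\<i>/2 * lame 3 1 x))" "p2 = (\<lambda>x. Re (1/2 * lame 3 1 x))"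
    by (auto simp: p1_def p2_def P31_def)
  ultimately show "eqeig 7 p1" "eqeig 7 p2" by simp_all
qed

lemma lame_31_p: "Re (c * lame 3 1 x) = 2 * Im c * p1 x + 2 * Re c * p2 x"
  by (simp add: p1_def p2_def P31_def)

lemmas continuous_p = eqeig_cont[OF eqeig_p(1)] eqeig_cont[OF eqeig_p(2)]

lemma lame_31_expand: "lame 3 1 x = cis (2 * pi / 3 * (5 * fst x + 4 * snd x)) - cis (2 * pi / 3 * (5 * fst x + snd x))
   - cis (2 * pi / 3 * (4 * snd x - fst x)) + cis (2 * pi / 3 * (snd x - 4 * fst x))
   + cis (2 * pi / 3 * (- fst x - 5 * snd x)) - cis (2 * pi / 3 * (- 4 * fst x - 5 * snd x))"
  unfolding lame_def y_power by (simp add: algebra_simps)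

lemma p_swap: "p1 (prod.swap x) = p1 x" "p2 (prod.swap x) = - p2 x"
proof -
  have "lame 3 1 (prod.swap x) = - cnj (lame 3 1 x)"
  proof -
    have e: "- (2 * pi / 3 * (5 * fst x + 4 * snd x)) = 2 * pi / 3 * (- 4 * snd x - 5 * fst x)"
      "- (2 * pi / 3 * (5 * fst x + snd x)) = 2 * pi / 3 * (- snd x - 5 * fst x)"
      "- (2 * pi / 3 * (4 * snd x - fst x)) = 2 * pi / 3 * (fst x - 4 * snd x)"
      "- (2 * pi / 3 * (snd x - 4 * fst x)) = 2 * pi / 3 * (4 * fst x - snd x)"
      "- (2 * pi / 3 * (- fst x - 5 * snd x)) = 2 * pi / 3 * (5 * snd x + fst x)"
      "- (2 * pi / 3 * (- 4 * fst x - 5 * snd x)) = 2 * pi / 3 * (5 * snd x + 4 * fst x)"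
      by (simp_all add: algebra_simps)
    show ?thesis
      unfolding lame_31_expand complex_cnj_add complex_cnj_diff cis_cnj e fst_swap snd_swap by simp
  qed
  then show "p1 (prod.swap x) = p1 x" "p2 (prod.swap x) = - p2 x" by (simp_all add: p1_def p2_def P31_def)
qed

lemma p_reflect:
  "p1 (fst x, 1 - fst x - snd x) = - 1/2 * p1 x + sqrt 3 / 2 * p2 x"
  "p2 (fst x, 1 - fst x - snd x) = sqrt 3 / 2 * p1 x + 1/2 * p2 x"
proof -
  define x' where "x' = (fst x, 1 - fst x - snd x)"
  define w where "w = cis (2 * pi / 3)"
  have a: "2 * pi * chi1 x' = 2 * pi / 3 + - (2 * pi * chi2 x)" "2 * pi * chi2 x' = 2 * pi / 3 + - (2 * pi * chi1 x)"
    "2 * pi * chi3 x' + 2 * pi = 2 * pi / 3 + - (2 * pi * chi3 x)"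
    by (simp_all add: x'_def chi_defs field_simps)
  have per: "cis \<theta> = cis (\<theta> + 2 * pi)" for \<theta> by (simp add: cis.ctr)
  have y: "y1 x' = w * cnj (y2 x)" "y2 x' = w * cnj (y1 x)" "y3 x' = w * cnj (y3 x)"
    unfolding y_defs w_def cis_cnj cis_mult by (simp only: a, simp only: a, subst per, simp only: a)
  have w3: "w ^ 3 = 1" by (simp add: w_def Complex.DeMoivre)
  have "lame 3 1 x' = - (w ^ 4 * cnj (lame 3 1 x))"
    unfolding lame_def y power_mult_distrib by (simp add: algebra_simps power4_eq_xxxx power3_eq_cube)
  also have "w ^ 4 = w" using w3 by (simp add: power4_eq_xxxx power3_eq_cube)
  finally have "P31 x' = w * cnj (P31 x)" by (simp add: P31_def)
  moreover have "w = Complex (- 1/2) (sqrt 3 / 2)"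
    unfolding w_def using cos_120 sin_120 by (simp add: cis.ctr)
  ultimately show "p1 (fst x, 1 - fst x - snd x) = - 1/2 * p1 x + sqrt 3 / 2 * p2 x"
    "p2 (fst x, 1 - fst x - snd x) = sqrt 3 / 2 * p1 x + 1/2 * p2 x"
    unfolding x'_def by (simp_all add: p1_def p2_def)
qed

lemma cos_third: "cos (2 * pi / 3 * real_of_int k) = (if k mod 3 = 0 then 1 else - 1/2)"
proof -
  have "real_of_int k = real_of_int (3 * (k div 3) + k mod 3)" by simp
  then have e: "real_of_int k = 3 * real_of_int (k div 3) + real_of_int (k mod 3)" by (simp only: of_int_add of_int_mult of_int_numeral)
  have "2 * pi / 3 * real_of_int k = 2 * pi * real_of_int (k div 3) + 2 * pi / 3 * real_of_int (k mod 3)"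
  proof -
    have "2 * pi / 3 * (3 * a + b) = 2 * pi * a + 2 * pi / 3 * b" for a b :: real by (simp add: algebra_simps)
    then show ?thesis unfolding e .
  qed
  then have "cos (2 * pi / 3 * real_of_int k) = cos (2 * pi * real_of_int (k div 3) + 2 * pi / 3 * real_of_int (k mod 3))"
    by (rule arg_cong)
  also have "\<dots> = cos (2 * pi / 3 * real_of_int (k mod 3))" by (simp add: cos_add cos_int_period)
  finally have c: "cos (2 * pi / 3 * real_of_int k) = cos (2 * pi / 3 * real_of_int (k mod 3))" .
  have "k mod 3 = 0 \<or> k mod 3 = 1 \<or> k mod 3 = 2" by presburger
  moreover have "cos (2 * pi / 3 * 2) = - 1/2"
  proof -
    have "2 * pi / 3 * 2 = 2 * pi - 2 * pi / 3" by simp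
    then show ?thesis using cos_120 by (simp only: cos_diff) simp
  qed
  ultimately show ?thesis unfolding c using cos_120 by auto
qed

definition Jval :: "int \<Rightarrow> int \<Rightarrow> real" where
  "Jval m n = (((if n mod 3 = 0 then 1 else - 1/2) - (if m mod 3 = 0 then 1 else - 1/2)) / (m - n)
     - (1 - (if m mod 3 = 0 then 1 else - 1/2)) / m) / n"

lemma tri_int_cos_third:
  assumes "m \<noteq> 0" "n \<noteq> 0" "m \<noteq> n"
  shows "tri_int (\<lambda>x. cos (2 * pi / 3 * (real_of_int m * fst x + real_of_int n * snd x))) = 9 / (4 * pi\<^sup>2) * Jval m n"
proof -
  have "tri_int (\<lambda>x. cos (2 * pi / 3 * (real_of_int m * fst x + real_of_int n * snd x))) =
     tri_int (\<lambda>x. cos ((2 * pi / 3 * real_of_int m) * fst x + (2 * pi / 3 * real_of_int n) * snd x))"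
    by (simp add: algebra_simps)
  also have "\<dots> = ((cos (2 * pi / 3 * real_of_int n) - cos (2 * pi / 3 * real_of_int m)) / (2 * pi / 3 * real_of_int m - 2 * pi / 3 * real_of_int n)
     - (1 - cos (2 * pi / 3 * real_of_int m)) / (2 * pi / 3 * real_of_int m)) / (2 * pi / 3 * real_of_int n)"
    by (rule tri_int_cos) (use assms in auto)
  also have "\<dots> = 9 / (4 * pi\<^sup>2) * Jval m n"
  proof -
    have d: "2 * pi / 3 * real_of_int m - 2 * pi / 3 * real_of_int n = 2 * pi / 3 * (real_of_int m - real_of_int n)" by (simp add: algebra_simps)
    have "(A / (2 * pi / 3 * a) - B / (2 * pi / 3 * b)) / (2 * pi / 3 * c) = 9 / (4 * pi\<^sup>2) * ((A / a - B / b) / c)"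
      if "a \<noteq> 0" "b \<noteq> 0" "c \<noteq> 0" for A B a b c :: real
      using that by (simp add: field_simps power2_eq_square)
    note scale = this
    show ?thesis unfolding d cos_third Jval_def of_int_diff by (rule scale) (use assms in auto)
  qed
  finally show ?thesis .
qed

lemma s3_p1: "tri_inner s3 p1 = - 6561 / (3584 * pi\<^sup>2)"
proof -
  define C where "C = (\<lambda>m n x. cos (2 * pi / 3 * (real_of_int m * fst x + real_of_int n * snd x)))"
  have cC: "continuous_on UNIV (C m n)" for m n unfolding C_def by (intro continuous_intros)
  have P: "sin A * sin B = 1/2 * (cos (A - B) - cos (A + B))" for A B :: real by (simp add: cos_diff cos_add)
  have ptw: "s3 x * p1 x = 1/4 * (C (-2) (-1) x - C 8 7 x - C (-2) 2 x + C 8 4 x - C 4 (-1) x + C 2 7 x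
     + C 7 2 x - C (-1) 4 x - (C 2 (-2) x - C 4 8 x) + (C (-1) (-2) x - C 7 8 x))" for x
  proof -
    have "s3 x * p1 x = 1/2 * (sin (2 * pi / 3 * (3 * fst x + 3 * snd x)) * sin (2 * pi / 3 * (5 * fst x + 4 * snd x))
       - sin (2 * pi / 3 * (3 * fst x + 3 * snd x)) * sin (2 * pi / 3 * (5 * fst x + snd x))
       - sin (2 * pi / 3 * (3 * fst x + 3 * snd x)) * sin (2 * pi / 3 * (4 * snd x - fst x))
       + sin (2 * pi / 3 * (3 * fst x + 3 * snd x)) * sin (2 * pi / 3 * (snd x - 4 * fst x))
       + sin (2 * pi / 3 * (3 * fst x + 3 * snd x)) * sin (2 * pi / 3 * (- fst x - 5 * snd x))
       - sin (2 * pi / 3 * (3 * fst x + 3 * snd x)) * sin (2 * pi / 3 * (- 4 * fst x - 5 * snd x)))"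
      unfolding s3_def p1_def P31_def lame_31_expand by (simp add: algebra_simps)
    also have "\<dots> = 1/4 * (C (-2) (-1) x - C 8 7 x - C (-2) 2 x + C 8 4 x - C 4 (-1) x + C 2 7 x
     + C 7 2 x - C (-1) 4 x + (C 4 8 x - C 2 (-2) x) - (C 7 8 x - C (-1) (-2) x))"
      unfolding P C_def by (simp add: algebra_simps)
    finally show ?thesis by simp
  qed
  have J: "tri_int (C m n) = 9 / (4 * pi\<^sup>2) * Jval m n" if "m \<noteq> 0" "n \<noteq> 0" "m \<noteq> n" for m n
    unfolding C_def by (rule tri_int_cos_third[OF that])
  have "tri_inner s3 p1 = 1/4 * (tri_int (C (-2) (-1)) - tri_int (C 8 7) - tri_int (C (-2) 2) + tri_int (C 8 4) - tri_int (C 4 (-1)) + tri_int (C 2 7)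
     + tri_int (C 7 2) - tri_int (C (-1) 4) - (tri_int (C 2 (-2)) - tri_int (C 4 8)) + (tri_int (C (-1) (-2)) - tri_int (C 7 8)))"
    unfolding tri_inner_def ptw tri_int_cmult by (simp add: tri_int_add tri_int_diff continuous_intros cC)
  also have "\<dots> = - 6561 / (3584 * pi\<^sup>2)"
    by (simp add: J Jval_def)
  finally show ?thesis .
qed


lemma u1_eq_s: "u1 = (\<lambda>x. s1 x + s2 x + s3 x)"
  by (rule ext) (simp add: u1_def s1_def s2_def s3_def)

lemma u1_inner: "tri_inner s1 u1 = 1/4" "tri_inner s2 u1 = 1/4" "tri_inner s3 u1 = 1/4" "tri_inner u1 u1 = 3/4"
proof -
  note c = continuous_s
  have e: "tri_inner h u1 = tri_inner h s1 + tri_inner h s2 + tri_inner h s3" if "continuous_on UNIV h" for h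
    unfolding u1_eq_s by (simp add: tri_inner_add_right continuous_intros c that)
  show 1: "tri_inner s1 u1 = 1/4" "tri_inner s2 u1 = 1/4" "tri_inner s3 u1 = 1/4"
    unfolding e[OF c(1)] e[OF c(2)] e[OF c(3)]
    by (simp_all add: s_inner tri_inner_commute[of s2 s1] tri_inner_commute[of s3 s1] tri_inner_commute[of s3 s2])
  have "tri_inner u1 u1 = tri_inner u1 s1 + tri_inner u1 s2 + tri_inner u1 s3"
    by (rule e) (rule eqeig_cont[OF eqeig_u1])
  then show "tri_inner u1 u1 = 3/4" using 1 tri_inner_commute[of u1 s1] tri_inner_commute[of u1 s2] tri_inner_commute[of u1 s3] by linarith
qed

lemma s_p_inner:
  defines "K \<equiv> 6561 / (3584 * pi\<^sup>2)"
  shows "tri_inner s1 p1 = K / 2" "tri_inner s2 p1 = K / 2" "tri_inner s3 p1 = - K"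
    "tri_inner s1 p2 = sqrt 3 / 2 * K" "tri_inner s2 p2 = - (sqrt 3 / 2 * K)" "tri_inner s3 p2 = 0"
proof -
  note c = continuous_s continuous_p
  show 3: "tri_inner s3 p1 = - K" unfolding K_def using s3_p1 by simp
  have 12: "tri_inner s2 p1 = tri_inner s1 p1"
    using tri_inner_swap[OF c(1) c(4)] by (simp add: s_swap p_swap)
  have "tri_inner u1 p1 = 0" by (rule eqeig_orthogonal[OF eqeig_u1 eqeig_p(1)]) simp
  then have "tri_inner s1 p1 + tri_inner s2 p1 + tri_inner s3 p1 = 0"
    unfolding u1_eq_s by (simp add: tri_inner_add_left continuous_intros c)
  then show 1: "tri_inner s1 p1 = K / 2" "tri_inner s2 p1 = K / 2" using 3 12 by simp_all
  have m: "tri_inner s1 (\<lambda>x. - p2 x) = - tri_inner s1 p2" "tri_inner s3 (\<lambda>x. - p2 x) = - tri_inner s3 p2"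
    using tri_inner_cmult_right[of _ "-1" p2] by simp_all
  have "tri_inner s1 p1 = tri_inner s1 (\<lambda>x. - 1/2 * p1 x + sqrt 3 / 2 * p2 x)"
    using tri_inner_reflect[OF c(1) c(4)] by (simp only: s_reflect p_reflect)
  also have "\<dots> = - 1/2 * tri_inner s1 p1 + sqrt 3 / 2 * tri_inner s1 p2"
    unfolding tri_inner_cmult_right[symmetric] by (rule tri_inner_add_right) (intro continuous_intros c)+
  finally have "sqrt 3 * tri_inner s1 p2 = 3 * tri_inner s1 p1" by simp
  then have "sqrt 3 * (sqrt 3 * tri_inner s1 p2) = sqrt 3 * (3 * tri_inner s1 p1)" by simp
  then have "3 * tri_inner s1 p2 = sqrt 3 * (3 * tri_inner s1 p1)"
    by (simp add: mult.assoc[symmetric])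
  then show 4: "tri_inner s1 p2 = sqrt 3 / 2 * K" using 1 by (simp add: mult.commute)
  show "tri_inner s2 p2 = - (sqrt 3 / 2 * K)"
    using tri_inner_swap[OF c(2) c(5)] 4 m by (simp add: s_swap p_swap)
  show "tri_inner s3 p2 = 0"
    using tri_inner_swap[OF c(3) c(5)] m by (simp add: s_swap p_swap)
qed

lemma p_inner: "tri_inner p1 p1 = 3/8" "tri_inner p2 p2 = 3/8" "tri_inner p1 p2 = 0"
proof -
  note c = continuous_p
  have "tri_inner p1 (\<lambda>x. - p2 x) = - tri_inner p1 p2" using tri_inner_cmult_right[of _ "-1" p2] by simp
  then show 12: "tri_inner p1 p2 = 0" using tri_inner_swap[OF c] by (simp add: p_swap)
  have "tri_inner p1 p1 = tri_inner (\<lambda>x. - 1/2 * p1 x + sqrt 3 / 2 * p2 x) (\<lambda>x. - 1/2 * p1 x + sqrt 3 / 2 * p2 x)"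
    using tri_inner_reflect[OF c(1) c(1)] by (simp only: p_reflect)
  also have "\<dots> = (- 1/2) * ((- 1/2) * tri_inner p1 p1 + sqrt 3 / 2 * tri_inner p2 p1)
     + sqrt 3 / 2 * ((- 1/2) * tri_inner p1 p2 + sqrt 3 / 2 * tri_inner p2 p2)"
  proof -
    have k: "continuous_on UNIV (\<lambda>x. a * p1 x)" "continuous_on UNIV (\<lambda>x. a * p2 x)" "continuous_on UNIV (\<lambda>x. a * p1 x + b * p2 x)" for a b
      by (intro continuous_intros c)+
    show ?thesis unfolding tri_inner_add_right[OF k(1,2,3)] tri_inner_cmult_right
       tri_inner_add_left[OF k(1) k(2) c(1)] tri_inner_add_left[OF k(1) k(2) c(2)] tri_inner_cmult_left ..
  qed
  also have "\<dots> = 1/4 * tri_inner p1 p1 + 3/4 * tri_inner p2 p2"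
    using 12 tri_inner_commute[of p2 p1] by simp
  finally have eq: "tri_inner p1 p1 = tri_inner p2 p2" by simp
  define D where "D = (\<lambda>m n x. cos (2 * pi * (real_of_int m * fst x + real_of_int n * snd x)))"
  have cD: "continuous_on UNIV (D m n)" for m n unfolding D_def by (intro continuous_intros)
  have D0: "tri_int (D m n) = 0" if "(m, n) \<noteq> (0, 0)" for m n unfolding D_def by (rule tri_int_cos_integer[OF that])
  have ptw: "p1 x * p1 x + p2 x * p2 x = 1/4 * (6 * 1 + 2 * (- D 0 1 x - D 2 0 x + D 3 1 x + D 2 3 x - D 3 3 x
      + D 2 (-1) x - D 3 0 x - D 2 2 x + D 3 2 x - D 1 1 x - D 0 3 x + D 1 3 x + D (-1) 2 x - D 0 2 x - D 1 0 x))" for x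
  proof -
    define A B C E F G where ab: "A = 2 * pi / 3 * (5 * fst x + 4 * snd x)" "B = 2 * pi / 3 * (5 * fst x + snd x)"
      "C = 2 * pi / 3 * (4 * snd x - fst x)" "E = 2 * pi / 3 * (snd x - 4 * fst x)"
      "F = 2 * pi / 3 * (- fst x - 5 * snd x)" "G = 2 * pi / 3 * (- 4 * fst x - 5 * snd x)"
    define c s where "c = cos A - cos B - cos C + cos E + cos F - cos G"
      and "s = sin A - sin B - sin C + sin E + sin F - sin G"
    have "lame 3 1 x = Complex c s"
      unfolding lame_31_expand ab[symmetric] by (simp add: complex_eq_iff c_def s_def)
    then have "p1 x * p1 x + p2 x * p2 x = 1/4 * (c * c + s * s)"
      by (simp add: p1_def p2_def P31_def algebra_simps)
    also have "c * c + s * s = 6 * 1 + 2 * (- cos (A - B) - cos (A - C) + cos (A - E) + cos (A - F) - cos (A - G)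
       + cos (B - C) - cos (B - E) - cos (B - F) + cos (B - G) - cos (C - E) - cos (C - F) + cos (C - G)
       + cos (E - F) - cos (E - G) - cos (F - G))"
    proof -
      note q = sin_cos_squared_add[of A] sin_cos_squared_add[of B] sin_cos_squared_add[of C]
        sin_cos_squared_add[of E] sin_cos_squared_add[of F] sin_cos_squared_add[of G]
      show ?thesis unfolding c_def s_def cos_diff using q by algebra
    qed
    finally show ?thesis unfolding D_def ab by (simp add: algebra_simps)
  qed
  have "tri_inner p1 p1 + tri_inner p2 p2 = tri_int (\<lambda>x. p1 x * p1 x + p2 x * p2 x)"
    unfolding tri_inner_def by (rule tri_int_add[symmetric]) (intro continuous_intros c)+
  also have "\<dots> = 3/4"
  proof -
    have k: "continuous_on UNIV (\<lambda>x::real\<times>real. 6 * 1 :: real)" by simp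
    show ?thesis unfolding ptw tri_int_cmult
      by (simp add: tri_int_add tri_int_diff tri_int_minus continuous_intros cD k tri_int_cmult D0
         tri_int_cmult[of 6 "\<lambda>x. 1", simplified] tri_int_one)
  qed
  finally show "tri_inner p1 p1 = 3/8" "tri_inner p2 p2 = 3/8" using eq by simp_all
qed

section \<open>Smooth cut-off of the ground state\<close>

text \<open>The functions \<open>exp (-1/t) / t\<^sup>k\<close>, extended by zero; derivatives of one are combinations of others.\<close>
definition flat :: "nat \<Rightarrow> real \<Rightarrow> real" where
  "flat k t = (if 0 < t then exp (- 1 / t) / t ^ k else 0)"

lemma flat_nonneg: "0 \<le> flat k t" by (simp add: flat_def)

lemma exp_neg_inverse_le:
  fixes t :: real
  assumes "0 < t" "0 < n" shows "exp (- 1 / t) \<le> real n ^ n * t ^ n"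
proof -
  have "1 / (t * n) \<le> exp (1 / (t * n))" using exp_ge_add_one_self[of "1 / (t * n)"] by linarith
  then have "(1 / (t * n)) ^ n \<le> exp (1 / (t * n)) ^ n"
    using assms by (intro power_mono) auto
  also have "\<dots> = exp (1 / t)" using assms by (simp flip: exp_of_nat_mult)
  finally have 1: "(1 / (t * n)) ^ n \<le> exp (1 / t)" .
  have p: "0 < (1 / (t * n)) ^ n" using assms by simp
  have "exp (- 1 / t) = inverse (exp (1 / t))" by (simp flip: exp_minus)
  also have "\<dots> \<le> inverse ((1 / (t * n)) ^ n)" by (rule le_imp_inverse_le[OF 1 p])
  also have "\<dots> = real n ^ n * t ^ n" by (simp add: power_divide power_mult_distrib)
  finally show ?thesis .
qed

lemma flat_quadratic: "\<bar>flat k t\<bar> \<le> real (k + 2) ^ (k + 2) * t\<^sup>2"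
proof (cases "0 < t")
  case True
  have "exp (- 1 / t) \<le> real (k + 2) ^ (k + 2) * t ^ (k + 2)" by (rule exp_neg_inverse_le[OF True]) simp
  then show ?thesis using True by (simp add: flat_def pos_divide_le_eq power_add power2_eq_square algebra_simps)
next
  case False
  have "0 \<le> real (k + 2) ^ (k + 2) * t\<^sup>2" by (intro mult_nonneg_nonneg) auto
  with False show ?thesis by (simp only: flat_def if_False abs_zero)
qed

lemma flat_deriv: "(flat k has_real_derivative flat (k + 2) t - real k * flat (k + 1) t) (at t)"
proof (cases "t = 0")
  case True
  define C where "C = real (k + 2) ^ (k + 2)"
  have "(\<lambda>y. (flat k y - flat k 0) / (y - 0)) \<midarrow>0\<rightarrow> 0"
  proof (rule Lim_null_comparison)
    show "\<forall>\<^sub>F y in at 0. norm ((flat k y - flat k 0) / (y - 0)) \<le> C * \<bar>y\<bar>"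
    proof (rule always_eventually, rule allI)
      fix y show "norm ((flat k y - flat k 0) / (y - 0)) \<le> C * \<bar>y\<bar>"
      proof (cases "y = 0")
        case False
        have "\<bar>flat k y\<bar> \<le> C * \<bar>y\<bar> * \<bar>y\<bar>" using flat_quadratic[of k y] by (simp add: C_def power2_eq_square mult.assoc)
        then show ?thesis using False by (simp add: flat_def[of k 0] abs_divide pos_divide_le_eq)
      qed (simp add: flat_def C_def)
    qed
    show "((\<lambda>y. C * \<bar>y\<bar>) \<longlongrightarrow> 0) (at 0)"
      by (rule tendsto_eq_intros refl | simp)+
  qed
  then show ?thesis using True by (simp add: has_field_derivative_iff flat_def)
next
  case False
  show ?thesis
  proof (cases "0 < t")
    case True
    have "((\<lambda>t. exp (- 1 / t) / t ^ k) has_real_derivative flat (k + 2) t - real k * flat (k + 1) t) (at t)"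
    proof -
      have "((\<lambda>t. exp (- 1 / t) / t ^ k) has_real_derivative
         (exp (- 1 / t) * (1 / t\<^sup>2) * t ^ k - exp (- 1 / t) * (real k * t ^ (k - 1))) / (t ^ k * t ^ k)) (at t)"
        using True by (auto intro!: derivative_eq_intros simp: power2_eq_square)
      moreover have "(exp (- 1 / t) * (1 / t\<^sup>2) * t ^ k - exp (- 1 / t) * (real k * t ^ (k - 1))) / (t ^ k * t ^ k) = flat (k + 2) t - real k * flat (k + 1) t"
        using True by (cases k) (auto simp: flat_def field_simps power2_eq_square)
      ultimately show ?thesis by simp
    qed
    then show ?thesis
      by (rule has_field_derivative_transform_within_open[where S="{0<..}"]) (use True in \<open>auto simp: flat_def\<close>)
  next
    case False
    then have "t \<in> {..<0}" using \<open>t \<noteq> 0\<close> by auto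
    then have "(flat k has_real_derivative 0) (at t)"
      by (intro has_field_derivative_transform_within_open[OF DERIV_const[of 0], where S="{..<0}"]) (auto simp: flat_def)
    then show ?thesis using False by (simp add: flat_def)
  qed
qed

lemma flat_cont: "continuous_on UNIV (flat k)"
  by (meson DERIV_isCont continuous_at_imp_continuous_on flat_deriv)

lemma flat0_deriv: "(flat 0 has_real_derivative flat 2 t) (at t)"
  using flat_deriv[of 0 t] by (simp add: numeral_2_eq_2)

definition interior_tri :: "(real \<times> real) set" where
  "interior_tri = {(s, t). 0 < s \<and> 0 < t \<and> s + t < 1}"

text \<open>Wherever the ground state is below \<open>e\<close>, the cut-off vanishes, and it tends to the ground state as \<open>e\<close> tends to zero.\<close>
definition cutoff :: "real \<Rightarrow> real \<times> real \<Rightarrow> real" where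
  "cutoff e x = (if x \<in> interior_tri then u1 x * flat 0 (u1 x / e - 1) else 0)"

text \<open>The factor by which the gradient of the ground state is multiplied in the gradient of its cut-off.\<close>
definition cutoff_slope :: "real \<Rightarrow> real \<times> real \<Rightarrow> real" where
  "cutoff_slope e x = (if x \<in> interior_tri then flat 0 (u1 x / e - 1) + u1 x / e * flat 2 (u1 x / e - 1) else 0)"

definition u1s :: "real \<times> real \<Rightarrow> real" where
  "u1s x = 2 * pi * cos (2 * pi * fst x) - 2 * pi * cos (2 * pi * (fst x + snd x))"
definition u1t :: "real \<times> real \<Rightarrow> real" where
  "u1t x = 2 * pi * cos (2 * pi * snd x) - 2 * pi * cos (2 * pi * (fst x + snd x))"

lemma u1_C1': "C1 u1 u1s u1t"
  using u1_C1 unfolding u1s_def u1t_def .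

lemma open_interior_tri: "open interior_tri"
proof -
  have "interior_tri = {x. 0 < fst x} \<inter> {x. 0 < snd x} \<inter> {x. fst x + snd x < 1}" by (auto simp: interior_tri_def)
  moreover have "open \<dots>" by (intro open_Int open_Collect_less continuous_intros)
  ultimately show ?thesis by simp
qed

lemma interior_tri_pos: "x \<in> interior_tri \<Longrightarrow> u1 x > 0"
  using u1_pos by (auto simp: interior_tri_def)

lemma interior_tri_subset: "interior_tri \<subseteq> std_triangle"
  by (auto simp: interior_tri_def std_triangle_def)

lemma u1_boundary: "x \<in> std_triangle \<Longrightarrow> x \<notin> interior_tri \<Longrightarrow> u1 x = 0"
proof -
  assume a: "x \<in> std_triangle" "x \<notin> interior_tri"
  obtain s t where x: "x = (s, t)" by (cases x)
  have "s = 0 \<or> t = 0 \<or> s + t = 1" using a by (auto simp: x interior_tri_def std_triangle_def)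
  then show ?thesis using u1_zero_bdry by (auto simp: x u1_product)
qed

lemma cutoff_zero:
  assumes "0 < e" "x \<in> - std_triangle \<union> {x. u1 x < e}" shows "cutoff e x = 0" "cutoff_slope e x = 0"
proof -
  have "u1 x / e - 1 \<le> 0" if "x \<in> interior_tri" using assms interior_tri_subset that by auto
  then show "cutoff e x = 0" "cutoff_slope e x = 0" by (auto simp: cutoff_def cutoff_slope_def flat_def)
qed

lemma cutoff_C1:
  assumes e: "0 < e"
  shows "C1 (cutoff e) (\<lambda>x. u1s x * cutoff_slope e x) (\<lambda>x. u1t x * cutoff_slope e x)"
proof -
  define U where "U = - std_triangle \<union> {x. u1 x < e}"
  have cu: "continuous_on UNIV u1" "continuous_on UNIV u1s" "continuous_on UNIV u1t" using C1_cont[OF u1_C1'] by auto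
  have oU: "open U" unfolding U_def
    using compact_std_triangle by (intro open_Un open_Collect_less cu continuous_intros) (auto simp: compact_imp_closed open_closed[symmetric] closed_def[symmetric])
  have UV: "U \<union> interior_tri = UNIV" using u1_boundary e by (force simp: U_def)
  have z: "cutoff e x = 0" "cutoff_slope e x = 0" if "x \<in> U" for x using cutoff_zero[OF e] that by (auto simp: U_def)
  have cont: "continuous_on UNIV f" if "continuous_on interior_tri f" "\<And>x. x \<in> U \<Longrightarrow> f x = 0" for f :: "real\<times>real \<Rightarrow> real"
  proof -
    have "continuous_on U f" using that(2) by (simp cong: continuous_on_cong)
    then show ?thesis using continuous_on_open_Un[OF oU open_interior_tri _ that(1)] UV by simp
  qed
  have fl: "continuous_on interior_tri (\<lambda>x. flat k (u1 x / e - 1))" for k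
    by (rule continuous_on_compose2[OF flat_cont]) (auto intro!: continuous_intros continuous_on_subset[OF cu(1)] simp: e order_less_imp_not_eq2)
  have cu': "continuous_on interior_tri u1" "continuous_on interior_tri u1s" "continuous_on interior_tri u1t"
    using cu continuous_on_subset by blast+
  have c1: "continuous_on interior_tri (cutoff e)"
    by (rule continuous_on_eq[of _ "\<lambda>x. u1 x * flat 0 (u1 x / e - 1)"]) (auto intro!: continuous_intros fl cu' simp: cutoff_def)
  have c2: "continuous_on interior_tri (cutoff_slope e)"
    by (rule continuous_on_eq[of _ "\<lambda>x. flat 0 (u1 x / e - 1) + u1 x / e * flat 2 (u1 x / e - 1)"])
       (use e in \<open>auto intro!: continuous_intros fl cu' simp: cutoff_slope_def\<close>)
  have der: "((\<lambda>y. y * flat 0 (y / e - 1)) has_real_derivative flat 0 (y / e - 1) + y / e * flat 2 (y / e - 1)) (at y)" for y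
    using e by (auto intro!: derivative_eq_intros DERIV_chain2[OF flat0_deriv] simp: field_simps)
  show ?thesis unfolding C1_def
  proof (intro conjI allI)
    show "continuous_on UNIV (cutoff e)" by (rule cont[OF c1 z(1)])
    show "continuous_on UNIV (\<lambda>x. u1s x * cutoff_slope e x)" "continuous_on UNIV (\<lambda>x. u1t x * cutoff_slope e x)"
      by (rule cont; use z(2) in \<open>auto intro!: continuous_intros c2 cu'\<close>)+
    fix s t
    show "((\<lambda>s. cutoff e (s, t)) has_real_derivative u1s (s, t) * cutoff_slope e (s, t)) (at s)"
    proof (cases "(s, t) \<in> U")
      case True
      have "open ((\<lambda>s. (s, t)) -` U)" using oU by (intro open_vimage continuous_intros)
      then have "((\<lambda>s. cutoff e (s, t)) has_real_derivative 0) (at s)"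
        by (rule has_field_derivative_transform_within_open[where f="\<lambda>_. 0", OF DERIV_const])
           (use True z in auto)
      then show ?thesis using z[OF True] by simp
    next
      case False
      then have i: "(s, t) \<in> interior_tri" using UV by blast
      have o: "open ((\<lambda>s. (s, t)) -` interior_tri)" using open_interior_tri by (intro open_vimage continuous_intros)
      have "((\<lambda>s. u1 (s, t)) has_real_derivative u1s (s, t)) (at s)" using u1_C1' by (simp add: C1_def)
      from DERIV_chain2[OF der this]
      have "((\<lambda>s. u1 (s, t) * flat 0 (u1 (s, t) / e - 1)) has_real_derivative u1s (s, t) * cutoff_slope e (s, t)) (at s)"
        using i by (simp add: cutoff_slope_def mult.commute)
      then show ?thesis
        by (rule has_field_derivative_transform_within_open[OF _ o]) (use i in \<open>auto simp: cutoff_def\<close>)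
    qed
    show "((\<lambda>t. cutoff e (s, t)) has_real_derivative u1t (s, t) * cutoff_slope e (s, t)) (at t)"
    proof (cases "(s, t) \<in> U")
      case True
      have "open ((\<lambda>t. (s, t)) -` U)" using oU by (intro open_vimage continuous_intros)
      then have "((\<lambda>t. cutoff e (s, t)) has_real_derivative 0) (at t)"
        by (rule has_field_derivative_transform_within_open[where f="\<lambda>_. 0", OF DERIV_const])
           (use True z in auto)
      then show ?thesis using z[OF True] by simp
    next
      case False
      then have i: "(s, t) \<in> interior_tri" using UV by blast
      have o: "open ((\<lambda>t. (s, t)) -` interior_tri)" using open_interior_tri by (intro open_vimage continuous_intros)
      have "((\<lambda>t. u1 (s, t)) has_real_derivative u1t (s, t)) (at t)" using u1_C1' by (simp add: C1_def)
      from DERIV_chain2[OF der this]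
      have "((\<lambda>t. u1 (s, t) * flat 0 (u1 (s, t) / e - 1)) has_real_derivative u1t (s, t) * cutoff_slope e (s, t)) (at t)"
        using i by (simp add: cutoff_slope_def mult.commute)
      then show ?thesis
        by (rule has_field_derivative_transform_within_open[OF _ o]) (use i in \<open>auto simp: cutoff_def\<close>)
    qed
  qed
qed

lemma cutoff_core:
  assumes e: "0 < e" shows "core (cutoff e)"
proof -
  have small: "u1 (s, t) \<le> 4 * pi * s" "u1 (s, t) \<le> 4 * pi * t" "u1 (s, t) \<le> 4 * pi * (1 - s - t)" if "(s, t) \<in> interior_tri" for s t
  proof -
    have st: "0 < s" "0 < t" "s + t < 1" using that by (auto simp: interior_tri_def)
    have sx: "0 \<le> sin (pi * y) \<and> sin (pi * y) \<le> 1 \<and> sin (pi * y) \<le> pi * y" if "0 \<le> y" "y \<le> 1" for y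
      using that by (auto intro!: sin_ge_zero sin_x_le_x)
    have e3: "sin (pi * (s + t)) = sin (pi * (1 - s - t))"
      using sin_diff[of pi "pi * (s + t)"] by (simp add: algebra_simps)
    note A = sx[of s] sx[of t] sx[of "1 - s - t"]
    have m: "a * b * c \<le> a" "a * b * c \<le> b" "a * b * c \<le> c" if "0 \<le> a" "a \<le> 1" "0 \<le> b" "b \<le> 1" "0 \<le> c" "c \<le> 1" for a b c :: real
      using that mult_left_le[of c "a * b"] mult_left_le[of b a] mult_left_le_one_le[of b a] mult_le_one[of a b] mult_left_le_one_le[of c "a * b"]
      by (smt (verit) mult_nonneg_nonneg)+
    have u: "u1 (s, t) = 4 * (sin (pi * s) * sin (pi * t) * sin (pi * (1 - s - t)))" by (simp add: u1_product e3)
    show "u1 (s, t) \<le> 4 * pi * s" "u1 (s, t) \<le> 4 * pi * t" "u1 (s, t) \<le> 4 * pi * (1 - s - t)"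
      unfolding u using m[of "sin (pi * s)" "sin (pi * t)" "sin (pi * (1 - s - t))"] A st by auto
  qed
  define d where "d = e / (4 * pi)"
  have d: "d > 0" "4 * pi * d = e" using e by (auto simp: d_def)
  have "cutoff e (s, t) = 0" if "s < d \<or> t < d \<or> s + t > 1 - d" for s t
  proof (cases "(s, t) \<in> interior_tri")
    case True
    have "4 * pi * s < e \<or> 4 * pi * t < e \<or> 4 * pi * (1 - s - t) < e"
      using that mult_strict_left_mono[of s d "4 * pi"] mult_strict_left_mono[of t d "4 * pi"]
        mult_strict_left_mono[of "1 - s - t" d "4 * pi"] unfolding d(2) by auto
    then have "u1 (s, t) < e" using small[OF True] by linarith
    then show ?thesis using cutoff_zero(1)[OF e] by simp
  qed (simp add: cutoff_def)
  then show ?thesis unfolding core_def using d(1) by blast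
qed

lemma flat0_le_1: "flat 0 y \<le> 1" by (simp add: flat_def)

lemma slope_bound: "\<bar>(y + 1) * flat 2 y\<bar> \<le> 8"
proof (cases "0 < y")
  case True
  have "exp (- 1 / y) \<le> y\<^sup>2 * 4" "exp (- 1 / y) \<le> y" using exp_neg_inverse_le[OF True, of 2] exp_neg_inverse_le[OF True, of 1] by simp_all
  have "(y + 1) * exp (- 1 / y) = y * exp (- 1 / y) + exp (- 1 / y)" by (simp add: algebra_simps)
  also have "\<dots> \<le> y * y + y\<^sup>2 * 4"
    using \<open>exp (- 1 / y) \<le> y\<^sup>2 * 4\<close> \<open>exp (- 1 / y) \<le> y\<close> True by (intro add_mono mult_left_mono) auto
  also have "\<dots> \<le> 8 * y\<^sup>2" by (simp add: power2_eq_square)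
  finally show ?thesis using True by (simp add: flat_def pos_divide_le_eq)
qed (simp add: flat_def)

lemma cutoff_slope_bound: "\<bar>cutoff_slope e x\<bar> \<le> 9"
proof -
  define y where "y = u1 x / e - 1"
  have "\<bar>flat 0 y + (y + 1) * flat 2 y\<bar> \<le> 9"
    using slope_bound[of y] flat0_le_1[of y] flat_nonneg[of 0 y] by linarith
  moreover have "u1 x / e = y + 1" by (simp add: y_def)
  ultimately show ?thesis unfolding cutoff_slope_def y_def[symmetric] by simp
qed

lemma flat_at_top: "(flat 0 \<longlongrightarrow> 1) at_top" "((\<lambda>y. (y + 1) * flat 2 y) \<longlongrightarrow> 0) at_top"
proof -
  have 1: "((\<lambda>y::real. - 1 / y) \<longlongrightarrow> 0) at_top" by (intro tendsto_divide_0[OF tendsto_const] filterlim_at_top_imp_at_infinity filterlim_ident)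
  have "((\<lambda>y::real. exp (- 1 / y)) \<longlongrightarrow> 1) at_top" using tendsto_exp[OF 1] by simp
  then show "(flat 0 \<longlongrightarrow> 1) at_top"
    by (rule Lim_transform_eventually) (auto simp: flat_def eventually_at_top_dense intro!: exI[of _ 0])
  show "((\<lambda>y. (y + 1) * flat 2 y) \<longlongrightarrow> 0) at_top"
  proof (rule Lim_null_comparison[where g="\<lambda>y. 2 * (1 / y)"])
    show "\<forall>\<^sub>F y in at_top. norm ((y + 1) * flat 2 y) \<le> 2 * (1 / y)"
      using eventually_gt_at_top[of 1]
    proof eventually_elim
      fix y :: real assume y: "1 < y"
      have "(y + 1) * exp (- 1 / y) \<le> (2 * y) * 1" using y by (intro mult_mono) auto
      then have "(y + 1) * exp (- 1 / y) / y\<^sup>2 \<le> (2 * y) / y\<^sup>2" using y by (intro divide_right_mono) auto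
      then show "norm ((y + 1) * flat 2 y) \<le> 2 * (1 / y)" using y by (simp add: flat_def power2_eq_square)
    qed
    have "((\<lambda>y::real. 1 / y) \<longlongrightarrow> 0) at_top" by (intro tendsto_divide_0[OF tendsto_const] filterlim_at_top_imp_at_infinity filterlim_ident)
    from tendsto_mult_left[OF this, of 2] show "((\<lambda>y. 2 * (1 / y)) \<longlongrightarrow> (0::real)) at_top" by simp
  qed
qed

lemma cutoff_lim:
  assumes "x \<in> interior_tri"
  shows "(\<lambda>n. cutoff (1 / real (Suc n)) x) \<longlonglongrightarrow> u1 x" "(\<lambda>n. cutoff_slope (1 / real (Suc n)) x) \<longlonglongrightarrow> 1"
proof -
  have u: "u1 x > 0" by (rule interior_tri_pos[OF assms])
  have l: "filterlim (\<lambda>n. u1 x / (1 / real (Suc n)) - 1) at_top sequentially"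
  proof -
    have "filterlim (\<lambda>n. u1 x * real (Suc n)) at_top sequentially"
      using u by (intro filterlim_tendsto_pos_mult_at_top[OF tendsto_const] filterlim_compose[OF filterlim_real_sequentially] filterlim_Suc)
    then have "filterlim (\<lambda>n. - 1 + u1 x * real (Suc n)) at_top sequentially"
      by (rule filterlim_tendsto_add_at_top[OF tendsto_const])
    then show ?thesis by (simp add: algebra_simps)
  qed
  have a: "(\<lambda>n. flat 0 (u1 x / (1 / real (Suc n)) - 1)) \<longlonglongrightarrow> 1" by (rule filterlim_compose[OF flat_at_top(1) l])
  have b: "(\<lambda>n. (u1 x / (1 / real (Suc n)) - 1 + 1) * flat 2 (u1 x / (1 / real (Suc n)) - 1)) \<longlonglongrightarrow> 0"
    by (rule filterlim_compose[OF flat_at_top(2) l])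
  show "(\<lambda>n. cutoff (1 / real (Suc n)) x) \<longlonglongrightarrow> u1 x"
    using tendsto_mult_left[OF a, of "u1 x"] assms by (simp add: cutoff_def)
  show "(\<lambda>n. cutoff_slope (1 / real (Suc n)) x) \<longlonglongrightarrow> 1"
    using tendsto_add[OF a b] assms by (simp add: cutoff_slope_def)
qed

lemma AE_interior_tri: "AE x in lborel. x \<in> std_triangle \<longrightarrow> x \<in> interior_tri"
proof -
  have n: "negligible {x::real\<times>real. (1, 0) \<bullet> x = 0}" "negligible {x::real\<times>real. (0, 1) \<bullet> x = 0}" "negligible {x::real\<times>real. (1, 1) \<bullet> x = 1}"
    by (rule negligible_hyperplane, simp add: zero_prod_def)+
  have "std_triangle - interior_tri \<subseteq> {x. (1, 0) \<bullet> x = 0} \<union> {x. (0, 1) \<bullet> x = 0} \<union> {x. (1, 1) \<bullet> x = 1}"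
    by (auto simp: std_triangle_def interior_tri_def inner_prod_def)
  then have "negligible (std_triangle - interior_tri)"
    using n by (meson negligible_Un negligible_subset)
  moreover have "std_triangle - interior_tri \<in> sets borel"
    using compact_std_triangle open_interior_tri by (simp add: borel_closed compact_imp_closed borel_open sets.Diff)
  ultimately have "std_triangle - interior_tri \<in> null_sets lborel"
    by (simp add: negligible_iff_null_sets null_sets_completion_iff)
  then have "AE x in lborel. x \<notin> std_triangle - interior_tri" by (rule AE_not_in)
  then show ?thesis by eventually_elim auto
qed

lemma tri_int_dominated:
  assumes f: "\<And>n. continuous_on UNIV (f n)" and g: "continuous_on UNIV g"
    and B: "\<And>n x. x \<in> std_triangle \<Longrightarrow> \<bar>f n x\<bar> \<le> B"
    and lim: "\<And>x. x \<in> interior_tri \<Longrightarrow> (\<lambda>n. f n x) \<longlonglongrightarrow> g x"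
  shows "(\<lambda>n. tri_int (f n)) \<longlonglongrightarrow> tri_int g"
  unfolding tri_int_def set_lebesgue_integral_def
proof (rule integral_dominated_convergence[where w="\<lambda>x. indicator std_triangle x *\<^sub>R B"])
  show "integrable lborel (\<lambda>x. indicator std_triangle x *\<^sub>R B)"
    using tri_integrable[of "\<lambda>x. B"] by (simp add: set_integrable_def)
  show "(\<lambda>x. indicator std_triangle x *\<^sub>R g x) \<in> borel_measurable lborel"
    using tri_integrable[OF g] unfolding set_integrable_def by (rule borel_measurable_integrable)
  show "(\<lambda>x. indicator std_triangle x *\<^sub>R f n x) \<in> borel_measurable lborel" for n
    using tri_integrable[OF f] unfolding set_integrable_def by (rule borel_measurable_integrable)
  show "AE x in lborel. (\<lambda>n. indicator std_triangle x *\<^sub>R f n x) \<longlonglongrightarrow> indicator std_triangle x *\<^sub>R g x"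
    using AE_interior_tri by eventually_elim (use lim in \<open>auto simp: indicator_def\<close>)
  show "AE x in lborel. norm (indicator std_triangle x *\<^sub>R f n x) \<le> indicator std_triangle x *\<^sub>R B" for n
    using B by (auto simp: indicator_def)
qed

lemma u1_bounds: "\<bar>u1 x\<bar> \<le> 3" "\<bar>u1s x\<bar> \<le> 4 * pi" "\<bar>u1t x\<bar> \<le> 4 * pi" "\<bar>cutoff e x\<bar> \<le> 3"
proof -
  have s: "\<bar>sin y\<bar> \<le> 1" "\<bar>cos y\<bar> \<le> 1" for y :: real by auto
  show u: "\<bar>u1 x\<bar> \<le> 3" unfolding u1_def
    using s(1)[of "2 * pi * fst x"] s(1)[of "2 * pi * snd x"] s(1)[of "2 * pi * (fst x + snd x)"] by linarith
  have d: "\<bar>2 * pi * cos a - 2 * pi * cos b\<bar> \<le> 4 * pi" for a b :: real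
  proof -
    have "\<bar>2 * pi * cos a\<bar> \<le> 2 * pi" "\<bar>2 * pi * cos b\<bar> \<le> 2 * pi" using s(2)[of a] s(2)[of b] by (simp_all add: abs_mult)
    then show ?thesis by linarith
  qed
  show "\<bar>u1s x\<bar> \<le> 4 * pi" "\<bar>u1t x\<bar> \<le> 4 * pi" unfolding u1s_def u1t_def by (rule d)+
  have "\<bar>u1 x * flat 0 y\<bar> \<le> 3 * 1" for y unfolding abs_mult
    using u flat0_le_1[of y] flat_nonneg[of 0 y] by (intro mult_mono) auto
  then show "\<bar>cutoff e x\<bar> \<le> 3" by (auto simp: cutoff_def)
qed

text \<open>The ground state is not compactly supported, but it is a limit in the energy norm of its cut-offs, so lower bounds extend to
  differences with its multiples.\<close>
lemma LB_minus_u1: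
  assumes LB: "LB p q r \<mu>" and v: "C1 v vs vt" "core v"
  shows "\<mu> * tri_inner (\<lambda>x. v x - c * u1 x) (\<lambda>x. v x - c * u1 x) \<le>
     dform p q r (\<lambda>x. vs x - c * u1s x) (\<lambda>x. vt x - c * u1t x) (\<lambda>x. vs x - c * u1s x) (\<lambda>x. vt x - c * u1t x)"
proof -
  define e where "e = (\<lambda>n. 1 / real (Suc n))"
  have e: "e n > 0" for n by (simp add: e_def)
  have lim: "x \<in> interior_tri \<Longrightarrow> (\<lambda>n. cutoff (e n) x) \<longlonglongrightarrow> u1 x" "x \<in> interior_tri \<Longrightarrow> (\<lambda>n. cutoff_slope (e n) x) \<longlonglongrightarrow> 1" for x
    using cutoff_lim unfolding e_def by auto
  define z where "z = (\<lambda>n x. v x - c * cutoff (e n) x)"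
  define zs where "zs = (\<lambda>n x. vs x - c * (u1s x * cutoff_slope (e n) x))"
  define zt where "zt = (\<lambda>n x. vt x - c * (u1t x * cutoff_slope (e n) x))"
  have zC: "C1 (z n) (zs n) (zt n)" for n
    unfolding z_def zs_def zt_def by (intro C1_diff C1_cmult v cutoff_C1 e)
  have zc: "core (z n)" for n
  proof -
    obtain d d' where "d > 0" "\<And>s t. s < d \<or> t < d \<or> s + t > 1 - d \<Longrightarrow> v (s, t) = 0"
      "d' > 0" "\<And>s t. s < d' \<or> t < d' \<or> s + t > 1 - d' \<Longrightarrow> cutoff (e n) (s, t) = 0"
      using v(2) cutoff_core[OF e[of n]] unfolding core_def by metis
    moreover have "(s < d \<or> t < d \<or> s + t > 1 - d) \<and> (s < d' \<or> t < d' \<or> s + t > 1 - d')"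
      if "s < min d d' \<or> t < min d d' \<or> s + t > 1 - min d d'" for s t using that by (auto simp: min_def split: if_splits)
    ultimately have "\<forall>s t. s < min d d' \<or> t < min d d' \<or> s + t > 1 - min d d' \<longrightarrow> z n (s, t) = 0" "min d d' > 0"
      unfolding z_def by fastforce+
    then show ?thesis unfolding core_def by blast
  qed
  have ineq: "\<mu> * tri_int (\<lambda>x. (z n x)\<^sup>2) \<le> tri_int (\<lambda>x. bil p q r (zs n x) (zt n x) (zs n x) (zt n x))" for n
    using LB zC zc unfolding LB_def dform_def by blast
  have bdd: "\<exists>B. \<forall>x\<in>std_triangle. \<bar>f x\<bar> \<le> B" if "continuous_on UNIV f" for f :: "real\<times>real\<Rightarrow>real"
    using compact_continuous_image[OF continuous_on_subset[OF that subset_UNIV] compact_std_triangle, THEN compact_imp_bounded]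
    by (auto simp: bounded_iff)
  obtain V where V: "\<And>x. x \<in> std_triangle \<Longrightarrow> \<bar>v x\<bar> \<le> V" using bdd[OF C1_cont(1)[OF v(1)]] by blast
  obtain Vs where Vs: "\<And>x. x \<in> std_triangle \<Longrightarrow> \<bar>vs x\<bar> \<le> Vs" using bdd[OF C1_cont(2)[OF v(1)]] by blast
  obtain Vt where Vt: "\<And>x. x \<in> std_triangle \<Longrightarrow> \<bar>vt x\<bar> \<le> Vt" using bdd[OF C1_cont(3)[OF v(1)]] by blast
  define A where "A = V + \<bar>c\<bar> * 3"
  define B where "B = max Vs Vt + \<bar>c\<bar> * (4 * pi * 9)"
  have zb: "\<bar>z n x\<bar> \<le> A" if "x \<in> std_triangle" for n x
  proof -
    have "\<bar>c * cutoff (e n) x\<bar> \<le> \<bar>c\<bar> * 3" unfolding abs_mult by (intro mult_left_mono u1_bounds) simp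
    then show ?thesis unfolding z_def A_def using V[OF that] by linarith
  qed
  have sl: "\<bar>c * (w * cutoff_slope (e n) x)\<bar> \<le> \<bar>c\<bar> * (4 * pi * 9)" if "\<bar>w\<bar> \<le> 4 * pi" for w n x
    unfolding abs_mult using that cutoff_slope_bound by (intro mult_left_mono mult_mono) auto
  have zsb: "\<bar>zs n x\<bar> \<le> B" "\<bar>zt n x\<bar> \<le> B" if "x \<in> std_triangle" for n x
    using sl[OF u1_bounds(2), of x n x] sl[OF u1_bounds(3), of x n x] Vs[OF that] Vt[OF that]
    unfolding zs_def zt_def B_def by linarith+
  note cz = C1_cont[OF zC] and cv = C1_cont[OF v(1)] and cu = C1_cont[OF u1_C1']
  have L1: "(\<lambda>n. tri_int (\<lambda>x. (z n x)\<^sup>2)) \<longlonglongrightarrow> tri_int (\<lambda>x. (v x - c * u1 x)\<^sup>2)"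
  proof (rule tri_int_dominated[where B="A\<^sup>2"])
    show "\<bar>(z n x)\<^sup>2\<bar> \<le> A\<^sup>2" if "x \<in> std_triangle" for n x
      using zb[OF that, of n] by (simp add: abs_le_square_iff[symmetric])
    show "(\<lambda>n. (z n x)\<^sup>2) \<longlonglongrightarrow> (v x - c * u1 x)\<^sup>2" if "x \<in> interior_tri" for x
      unfolding z_def by (intro tendsto_intros lim that)
  qed (intro continuous_intros cz cv cu)+
  have prod: "\<bar>a * b\<bar> \<le> B * B" if "\<bar>a\<bar> \<le> B" "\<bar>b\<bar> \<le> B" for a b
    unfolding abs_mult using that by (intro mult_mono) auto
  have L2: "(\<lambda>n. tri_int (\<lambda>x. bil p q r (zs n x) (zt n x) (zs n x) (zt n x))) \<longlonglongrightarrow>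
     tri_int (\<lambda>x. bil p q r (vs x - c * u1s x) (vt x - c * u1t x) (vs x - c * u1s x) (vt x - c * u1t x))"
  proof (rule tri_int_dominated[where B="\<bar>p\<bar> * (B * B) + \<bar>q\<bar> * (B * B) + \<bar>r - p - q\<bar> * (B * B)"])
    show "\<bar>bil p q r (zs n x) (zt n x) (zs n x) (zt n x)\<bar> \<le> \<bar>p\<bar> * (B * B) + \<bar>q\<bar> * (B * B) + \<bar>r - p - q\<bar> * (B * B)" if "x \<in> std_triangle" for n x
    proof -
      have "bil p q r (zs n x) (zt n x) (zs n x) (zt n x) = p * (zs n x * zs n x) + q * (zt n x * zt n x) + (r - p - q) * (zs n x * zt n x)"
        by (simp add: bil_def field_simps)
      moreover have "\<bar>p * (zs n x * zs n x)\<bar> \<le> \<bar>p\<bar> * (B * B)" "\<bar>q * (zt n x * zt n x)\<bar> \<le> \<bar>q\<bar> * (B * B)"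
        "\<bar>(r - p - q) * (zs n x * zt n x)\<bar> \<le> \<bar>r - p - q\<bar> * (B * B)"
        unfolding abs_mult[of p] abs_mult[of q] abs_mult[of "r - p - q"]
        by (intro mult_left_mono prod zsb that; simp)+
      ultimately show ?thesis by linarith
    qed
    show "(\<lambda>n. bil p q r (zs n x) (zt n x) (zs n x) (zt n x)) \<longlonglongrightarrow>
      bil p q r (vs x - c * u1s x) (vt x - c * u1t x) (vs x - c * u1s x) (vt x - c * u1t x)" if i: "x \<in> interior_tri" for x
    proof -
      have "(\<lambda>n. zs n x) \<longlonglongrightarrow> vs x - c * (u1s x * 1)" "(\<lambda>n. zt n x) \<longlonglongrightarrow> vt x - c * (u1t x * 1)"
        unfolding zs_def zt_def by (intro tendsto_intros lim i)+
      then show ?thesis unfolding bil_def by (intro tendsto_intros) auto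
    qed
  qed (intro continuous_bil continuous_intros cz cv cu)+
  show ?thesis unfolding dform_def tri_int_square[symmetric]
    by (rule LIMSEQ_le[OF tendsto_mult_left[OF L1] L2]) (use ineq in blast)
qed

section \<open>Stability near the equilateral triangle\<close>

text \<open>Normalised so that the equilateral triangle \<open>x1 = x2 = x3 = 0\<close> has the sharp value \<open>M = 1\<close>.\<close>
definition LBx :: "real \<Rightarrow> real \<Rightarrow> real \<Rightarrow> real \<Rightarrow> bool" where
  "LBx x1 x2 x3 M \<longleftrightarrow> LB (4/3 * (1 + x1)) (4/3 * (1 + x2)) (4/3 * (1 + x3)) (16 * pi\<^sup>2 / 3 * M)"

lemma psd_x:
  assumes "x1 + x2 + x3 = 0" "2/3 * (x1\<^sup>2 + x2\<^sup>2 + x3\<^sup>2) \<le> 1"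
  shows "psd (4/3 * (1 + x1)) (4/3 * (1 + x2)) (4/3 * (1 + x3))"
proof -
  have x3: "x3 = - x1 - x2" using assms(1) by simp
  have le: "4 * (x1\<^sup>2 + x1 * x2 + x2\<^sup>2) \<le> 3" using assms(2) unfolding x3 by (simp add: power2_eq_square algebra_simps)
  have "-1 \<le> x1"
  proof -
    have "4 * (x1\<^sup>2 + x1 * x2 + x2\<^sup>2) = 3 * x1\<^sup>2 + (x1 + 2 * x2)\<^sup>2" by (simp add: power2_eq_square algebra_simps)
    then have "x1\<^sup>2 \<le> 1" using le by (smt (verit) zero_le_power2)
    then show ?thesis by (simp add: abs_square_le_1)
  qed
  moreover have "-1 \<le> x2"
  proof -
    have "4 * (x1\<^sup>2 + x1 * x2 + x2\<^sup>2) = 3 * x2\<^sup>2 + (x2 + 2 * x1)\<^sup>2" by (simp add: power2_eq_square algebra_simps)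
    then have "x2\<^sup>2 \<le> 1" using le by (smt (verit) zero_le_power2)
    then show ?thesis by (simp add: abs_square_le_1)
  qed
  moreover have "(4/3 * (1 + x3) - 4/3 * (1 + x1) - 4/3 * (1 + x2))\<^sup>2 \<le> 4 * (4/3 * (1 + x1)) * (4/3 * (1 + x2))"
    using le unfolding x3 by (simp add: power2_eq_square field_simps)
  ultimately show ?thesis by (simp add: psd_def)
qed

lemma LBx_altitude:
  assumes "x1 + x2 + x3 = 0" "2/3 * (x1\<^sup>2 + x2\<^sup>2 + x3\<^sup>2) \<le> 1"
  shows "LBx x1 x2 x3 ((1 + x1) / 4)" "LBx x1 x2 x3 ((1 + x2) / 4)" "LBx x1 x2 x3 ((1 + x3) / 4)"
proof -
  have e: "16 * pi\<^sup>2 / 3 * ((1 + x) / 4) = pi\<^sup>2 * (4/3 * (1 + x))" for x by simp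
  show "LBx x1 x2 x3 ((1 + x1) / 4)" "LBx x1 x2 x3 ((1 + x2) / 4)" "LBx x1 x2 x3 ((1 + x3) / 4)"
    unfolding LBx_def e by (rule LB_altitude[OF psd_x[OF assms]])+
qed

lemma LBx_combine:
  assumes "LBx x1 x2 x3 M" "LBx w1 w2 w3 N" "0 \<le> a" "0 \<le> b" "a + b = 1"
  shows "LBx (a * x1 + b * w1) (a * x2 + b * w2) (a * x3 + b * w3) (a * M + b * N)"
proof -
  have b: "b = 1 - a" using assms(5) by simp
  have e: "a * (4/3 * (1 + x)) + (1 - a) * (4/3 * (1 + w)) = 4/3 * (1 + (a * x + (1 - a) * w))" for x w
    by (simp add: field_simps)
  have f: "a * (16 * pi\<^sup>2 / 3 * M) + (1 - a) * (16 * pi\<^sup>2 / 3 * N) = 16 * pi\<^sup>2 / 3 * (a * M + (1 - a) * N)"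
    by (simp add: field_simps)
  show ?thesis using LB_combine[OF assms(1,2)[unfolded LBx_def] assms(3,4)]
    unfolding LBx_def b e f .
qed

lemma LBx_mono: "LBx x1 x2 x3 M \<Longrightarrow> N \<le> M \<Longrightarrow> LBx x1 x2 x3 N"
  unfolding LBx_def by (erule LB_mono) simp

lemma LBx_swap: "LBx x1 x2 x3 M \<Longrightarrow> LBx x2 x1 x3 M"
  unfolding LBx_def by (rule LB_swap)

lemma LBx_half_square: "LBx (1/2) (-1/4) (-1/4) (15/16)"
  unfolding LBx_def using LB_half_square by simp

lemma LBx_half_equilateral: "LBx (1/2) (1/8) (-5/8) (7/8)"
  unfolding LBx_def using LB_half_equilateral by simp

lemma LBx_equilateral: "LBx 0 0 0 1"
proof -
  have "LB (4/3) (4/3) (4/3) (16 * pi\<^sup>2 / 9 * 3)"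
    by (rule Barta_wave[OF u1_wave]) (auto simp: psd_def power2_eq_square u1_pos)
  then show ?thesis by (simp add: LBx_def)
qed

lemma dform_u1:
  assumes z: "C1 z zs zt" "zero_bdry z"
  shows "dform p q r u1s u1t zs zt = 4 * pi\<^sup>2 * (p * tri_inner s1 z + q * tri_inner s2 z + r * tri_inner s3 z)"
proof -
  have us: "C1 u1s (\<lambda>x. - 4 * pi\<^sup>2 * (s1 x + s3 x)) (\<lambda>x. - 4 * pi\<^sup>2 * s3 x)"
  proof -
    have "C1 (\<lambda>x. 2 * pi * cos (2 * pi * fst x + 0 * snd x + 0) - 2 * pi * cos (2 * pi * fst x + 2 * pi * snd x + 0))
      (\<lambda>x. 2 * pi * (- (2 * pi) * sin (2 * pi * fst x + 0 * snd x + 0)) - 2 * pi * (- (2 * pi) * sin (2 * pi * fst x + 2 * pi * snd x + 0)))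
      (\<lambda>x. 2 * pi * (- 0 * sin (2 * pi * fst x + 0 * snd x + 0)) - 2 * pi * (- (2 * pi) * sin (2 * pi * fst x + 2 * pi * snd x + 0)))"
      by (intro C1_diff C1_cmult C1_affine_cos)
    then show ?thesis
      by (simp add: u1s_def[abs_def] s1_def s3_def power2_eq_square algebra_simps)
  qed
  have ut: "C1 u1t (\<lambda>x. - 4 * pi\<^sup>2 * s3 x) (\<lambda>x. - 4 * pi\<^sup>2 * (s2 x + s3 x))"
  proof -
    have "C1 (\<lambda>x. 2 * pi * cos (0 * fst x + 2 * pi * snd x + 0) - 2 * pi * cos (2 * pi * fst x + 2 * pi * snd x + 0))
      (\<lambda>x. 2 * pi * (- 0 * sin (0 * fst x + 2 * pi * snd x + 0)) - 2 * pi * (- (2 * pi) * sin (2 * pi * fst x + 2 * pi * snd x + 0)))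
      (\<lambda>x. 2 * pi * (- (2 * pi) * sin (0 * fst x + 2 * pi * snd x + 0)) - 2 * pi * (- (2 * pi) * sin (2 * pi * fst x + 2 * pi * snd x + 0)))"
      by (intro C1_diff C1_cmult C1_affine_cos)
    then show ?thesis
      by (simp add: u1t_def[abs_def] s2_def s3_def power2_eq_square algebra_simps)
  qed
  note c = continuous_s C1_cont(1)[OF z(1)]
  have "dform p q r u1s u1t zs zt = - tri_inner (\<lambda>x. p * (- 4 * pi\<^sup>2 * (s1 x + s3 x)) + (r - p - q) * (- 4 * pi\<^sup>2 * s3 x) + q * (- 4 * pi\<^sup>2 * (s2 x + s3 x))) z"
    by (rule Green[OF u1_C1' us ut z])
  also have "(\<lambda>x. p * (- 4 * pi\<^sup>2 * (s1 x + s3 x)) + (r - p - q) * (- 4 * pi\<^sup>2 * s3 x) + q * (- 4 * pi\<^sup>2 * (s2 x + s3 x)))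
     = (\<lambda>x. (- 4 * pi\<^sup>2) * (p * s1 x + q * s2 x + r * s3 x))"
    by (rule ext) (simp add: algebra_simps)
  also have "tri_inner \<dots> z = (- 4 * pi\<^sup>2) * (p * tri_inner s1 z + q * tri_inner s2 z + r * tri_inner s3 z)"
    unfolding tri_inner_cmult_left by (simp add: tri_inner_add_left continuous_intros c tri_inner_cmult_left)
  finally show ?thesis by simp
qed

lemma weighted_am_gm:
  fixes g \<kappa> K B a :: real
  assumes "g\<^sup>2 \<le> \<kappa> * B" "0 < K" "0 \<le> B" "0 \<le> \<kappa>"
  shows "0 \<le> a\<^sup>2 * \<kappa> / K + 2 * a * g + K * B"
proof -
  have "(2 * K * a * g)\<^sup>2 = 4 * K\<^sup>2 * a\<^sup>2 * g\<^sup>2" by (simp add: power_mult_distrib)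
  also have "\<dots> \<le> 4 * K\<^sup>2 * a\<^sup>2 * (\<kappa> * B)" by (intro mult_left_mono assms) auto
  also have "\<dots> \<le> (K\<^sup>2 * B + a\<^sup>2 * \<kappa>)\<^sup>2"
    using zero_le_power2[of "K\<^sup>2 * B - a\<^sup>2 * \<kappa>"] by (simp add: power2_eq_square algebra_simps)
  finally have "\<bar>2 * K * a * g\<bar> \<le> \<bar>K\<^sup>2 * B + a\<^sup>2 * \<kappa>\<bar>" by (simp only: abs_le_square_iff)
  then have "0 \<le> K\<^sup>2 * B + a\<^sup>2 * \<kappa> + 2 * K * a * g" using assms by (simp add: abs_le_iff)
  then have "0 \<le> (K\<^sup>2 * B + a\<^sup>2 * \<kappa> + 2 * K * a * g) / K" using assms(2) by simp
  also have "\<dots> = a\<^sup>2 * \<kappa> / K + 2 * a * g + K * B" using assms(2) by (simp add: field_simps power2_eq_square)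
  finally show ?thesis .
qed

text \<open>Split \<open>v = \<alpha> u1 + z\<close> with \<open>z\<close> orthogonal to the ground state. The form of the ground state does not change with \<open>x\<close>; the cross term is a
  first variation linear in \<open>z\<close>. It pairs \<open>z\<close> with an explicit function, whose components in the second eigenspace and in its complement
  are compared separately with the eigenvalues \<open>7/3\<close> and at least \<open>4\<close> (relative to the first). Most of the perturbation lies in the complement,
  which makes the constant smaller than the \<open>1/2\<close> of \<open>\<surd>(1 - R)\<close>.\<close>
lemma LBx_near_pos:
  assumes sum: "x1 + x2 + x3 = 0" and R: "R = 2/3 * (x1\<^sup>2 + x2\<^sup>2 + x3\<^sup>2)" and R0: "0 < R" and R1: "R \<le> 1/16"
  shows "LBx x1 x2 x3 (1 - 12/25 * R)"
  unfolding LBx_def LB_def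
proof (intro allI impI, elim conjE)
  fix v vs vt assume v: "C1 v vs vt" "core v"
  define \<Lambda> where "\<Lambda> = 16 * pi\<^sup>2 / 3"
  define Q where "Q = dform (4/3 * (1 + x1)) (4/3 * (1 + x2)) (4/3 * (1 + x3))"
  define QI where "QI = dform (4/3) (4/3) (4/3)"
  define r where "r = sqrt R"
  have r: "0 < r" "r \<le> 1/4" "r\<^sup>2 = R"
  proof -
    show "0 < r" "r\<^sup>2 = R" using R0 by (simp_all add: r_def)
    show "r \<le> 1/4" unfolding r_def by (rule real_le_lsqrt) (use R0 R1 in \<open>simp_all add: power2_eq_square\<close>)
  qed
  define \<alpha> where "\<alpha> = 4/3 * tri_inner v u1"
  define z zs zt where "z = (\<lambda>x. v x - \<alpha> * u1 x)" and "zs = (\<lambda>x. vs x - \<alpha> * u1s x)" and "zt = (\<lambda>x. vt x - \<alpha> * u1t x)"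
  have zC: "C1 z zs zt" unfolding z_def zs_def zt_def by (intro C1_diff C1_cmult v u1_C1')
  have zb: "zero_bdry z" using core_zero_bdry[OF v(2)] u1_zero_bdry by (simp add: z_def zero_bdry_def)
  note cv = C1_cont[OF v(1)] and cu = C1_cont[OF u1_C1'] and cz = C1_cont[OF zC] and cs = continuous_s and cp = continuous_p
  have zu: "tri_inner z u1 = 0"
  proof -
    have "tri_inner z u1 = tri_inner v u1 - \<alpha> * tri_inner u1 u1"
      unfolding z_def by (simp add: tri_inner_diff_left continuous_intros cv cu tri_inner_cmult_left)
    then show ?thesis by (simp add: u1_inner \<alpha>_def)
  qed
  have vv: "tri_inner v v = tri_inner z z + 3/4 * \<alpha>\<^sup>2"
  proof -
    have "v = (\<lambda>x. z x + \<alpha> * u1 x)" by (auto simp: z_def)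
    then have "tri_inner v v = tri_inner z z + 2 * \<alpha> * tri_inner z u1 + \<alpha>\<^sup>2 * tri_inner u1 u1"
      by (simp add: tri_inner_add_left tri_inner_add_right continuous_intros cz cu tri_inner_cmult_left tri_inner_cmult_right
          tri_inner_commute[of u1 z] power2_eq_square algebra_simps)
    then show ?thesis using zu u1_inner(4) by simp
  qed
  \<comment> \<open>the components of \<open>z\<close> along the second eigenspace\<close>
  define b1 b2 where "b1 = 8/3 * tri_inner z p1" and "b2 = 8/3 * tri_inner z p2"
  obtain p1s p1t p2s p2t where pC: "C1 p1 p1s p1t" "C1 p2 p2s p2t"
    using eqeig_p wave_C1 unfolding eqeig_def by metis
  have pb: "zero_bdry p1" "zero_bdry p2" using eqeig_p by (auto simp: eqeig_def)
  define \<zeta> \<zeta>s \<zeta>t where "\<zeta> = (\<lambda>x. z x - b1 * p1 x - b2 * p2 x)" and "\<zeta>s = (\<lambda>x. zs x - b1 * p1s x - b2 * p2s x)"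
    and "\<zeta>t = (\<lambda>x. zt x - b1 * p1t x - b2 * p2t x)"
  have \<zeta>C: "C1 \<zeta> \<zeta>s \<zeta>t" unfolding \<zeta>_def \<zeta>s_def \<zeta>t_def by (intro C1_diff C1_cmult zC pC)
  have \<zeta>b: "zero_bdry \<zeta>" using zb pb by (simp add: \<zeta>_def zero_bdry_def)
  note c\<zeta> = C1_cont[OF \<zeta>C] and cps = C1_cont[OF pC(1)] C1_cont[OF pC(2)]
  have in\<zeta>: "tri_inner \<zeta> h = tri_inner z h - b1 * tri_inner p1 h - b2 * tri_inner p2 h" if "continuous_on UNIV h" for h
    unfolding \<zeta>_def by (simp add: tri_inner_diff_left continuous_intros cz cp that tri_inner_cmult_left)
  have p21: "tri_inner p2 p1 = 0" using p_inner(3) by (simp add: tri_inner_commute)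
  have pu: "tri_inner p1 u1 = 0" "tri_inner p2 u1 = 0"
    using eqeig_orthogonal[OF eqeig_p(1) eqeig_u1] eqeig_orthogonal[OF eqeig_p(2) eqeig_u1] by simp_all
  have \<zeta>u: "tri_inner \<zeta> u1 = 0" unfolding in\<zeta>[OF cu(1)] zu pu by simp
  have \<zeta>p: "tri_inner \<zeta> p1 = 0" "tri_inner \<zeta> p2 = 0"
    unfolding in\<zeta>[OF cp(1)] in\<zeta>[OF cp(2)] p_inner p21 b1_def b2_def by simp_all
  define Y where "Y = tri_inner \<zeta> \<zeta>"
  define B where "B = 3/8 * (b1\<^sup>2 + b2\<^sup>2)"
  have Y0: "Y \<ge> 0" unfolding Y_def by (rule tri_inner_nonneg)
  have B0: "B \<ge> 0" by (simp add: B_def)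
  have z\<zeta>: "z = (\<lambda>x. \<zeta> x + (b1 * p1 x + b2 * p2 x))" by (auto simp: \<zeta>_def)
  have inz: "tri_inner h z = tri_inner h \<zeta> + (b1 * tri_inner h p1 + b2 * tri_inner h p2)" if "continuous_on UNIV h" for h
    unfolding z\<zeta> by (simp add: tri_inner_add_right continuous_intros c\<zeta> cp that tri_inner_cmult_right)
  have ZBY: "tri_inner z z = B + Y"
  proof -
    have "tri_inner z z = tri_inner z \<zeta> + (b1 * tri_inner z p1 + b2 * tri_inner z p2)" by (rule inz[OF cz(1)])
    also have "tri_inner z \<zeta> = Y"
      using inz[OF c\<zeta>(1)] \<zeta>p by (simp add: Y_def tri_inner_commute[of z \<zeta>])
    finally show ?thesis by (simp add: B_def b1_def b2_def power2_eq_square)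
  qed
  have QIz: "\<Lambda> * (7/3 * B + 4 * Y) \<le> QI zs zt zs zt"
  proof -
    have dp: "QI p1s p1t ws wt = 7/3 * \<Lambda> * tri_inner p1 w" "QI p2s p2t ws wt = 7/3 * \<Lambda> * tri_inner p2 w"
      if "C1 w ws wt" "zero_bdry w" for w ws wt
      using wave_Green[OF _ pC(1) that, of "4/3" "4/3" "4/3" "16 * pi\<^sup>2 / 9 * 7"]
        wave_Green[OF _ pC(2) that, of "4/3" "4/3" "4/3" "16 * pi\<^sup>2 / 9 * 7"] eqeig_p
      unfolding QI_def \<Lambda>_def eqeig_def by simp_all
    define hs ht where "hs = (\<lambda>x. \<zeta>s x + b1 * p1s x)" and "ht = (\<lambda>x. \<zeta>t x + b1 * p1t x)"
    have ch: "continuous_on UNIV hs" "continuous_on UNIV ht" unfolding hs_def ht_def by (intro continuous_intros c\<zeta> cps)+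
    have zh: "zs = (\<lambda>x. hs x + b2 * p2s x)" "zt = (\<lambda>x. ht x + b2 * p2t x)" by (auto simp: hs_def ht_def \<zeta>s_def \<zeta>t_def)
    have "QI zs zt zs zt = QI hs ht hs ht + 2 * b2 * QI hs ht p2s p2t + b2\<^sup>2 * QI p2s p2t p2s p2t"
      unfolding zh QI_def by (rule dform_quadratic) (intro ch cps)+
    moreover have "QI hs ht p2s p2t = QI \<zeta>s \<zeta>t p2s p2t + b1 * QI p1s p1t p2s p2t"
      unfolding hs_def ht_def QI_def by (rule dform_add_cmult_left) (intro c\<zeta> cps)+
    moreover have "QI hs ht hs ht = QI \<zeta>s \<zeta>t \<zeta>s \<zeta>t + 2 * b1 * QI \<zeta>s \<zeta>t p1s p1t + b1\<^sup>2 * QI p1s p1t p1s p1t"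
      unfolding hs_def ht_def QI_def by (rule dform_quadratic) (intro c\<zeta> cps)+
    moreover have "QI \<zeta>s \<zeta>t p1s p1t = 0" "QI \<zeta>s \<zeta>t p2s p2t = 0"
      using dp[OF \<zeta>C \<zeta>b] \<zeta>p unfolding QI_def dform_commute[of _ _ _ \<zeta>s \<zeta>t p1s p1t] dform_commute[of _ _ _ \<zeta>s \<zeta>t p2s p2t] tri_inner_commute[of p1 \<zeta>] tri_inner_commute[of p2 \<zeta>] by simp_all
    ultimately have "QI zs zt zs zt = QI \<zeta>s \<zeta>t \<zeta>s \<zeta>t + 7/3 * \<Lambda> * B"
      using dp[OF pC(1) pb(1)] dp[OF pC(2) pb(2)] p_inner p21 by (simp add: B_def algebra_simps)
    moreover have "4 * \<Lambda> * Y \<le> QI \<zeta>s \<zeta>t \<zeta>s \<zeta>t"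
    proof -
      have "64 * pi\<^sup>2 / 3 * tri_inner \<zeta> \<zeta> \<le> dform (4/3) (4/3) (4/3) \<zeta>s \<zeta>t \<zeta>s \<zeta>t"
      proof (rule spectral_gap[OF \<zeta>C \<zeta>b \<zeta>u])
        fix c
        show "tri_inner \<zeta> (\<lambda>x. Re (c * lame 3 1 x)) = 0"
          unfolding lame_31_p by (simp add: tri_inner_add_right continuous_intros c\<zeta> cp tri_inner_cmult_right \<zeta>p)
      next
        fix e :: real assume "0 < e"
        then obtain w where w: "lame_span w" "\<And>x. x \<in> std_triangle \<Longrightarrow> \<bar>v x - w x\<bar> \<le> e"
          using lame_span_dense[OF v] by blast
        define low where "low = (\<lambda>x. (- \<alpha>) * u1 x + Re ((\<i>/2 * (- b1) + 1/2 * (- b2)) * lame 3 1 x))"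
        have "lame_span (\<lambda>x. Re (\<i>/2 * lame 2 1 x))" by (rule lame_span.base) auto
        then have "lame_span u1" by (simp only: u1_eq_lame[symmetric] eta_contract_eq)
        then have "lame_span low" unfolding low_def by (intro lame_span.add lame_span_cmult lame_span.base) auto
        then have "lame_span (\<lambda>x. w x + low x)" by (rule lame_span.add[OF w(1)])
        moreover have zw: "\<zeta> x - (w x + low x) = v x - w x" for x
          unfolding \<zeta>_def z_def low_def lame_31_p by simp
        have "\<bar>\<zeta> x - (w x + low x)\<bar> \<le> e" if "x \<in> std_triangle" for x
          unfolding zw by (rule w(2)[OF that])
        ultimately show "\<exists>w. lame_span w \<and> (\<forall>x\<in>std_triangle. \<bar>\<zeta> x - w x\<bar> \<le> e)" by blast
      qed
      then show ?thesis by (simp add: QI_def \<Lambda>_def Y_def)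
    qed
    ultimately show ?thesis by (simp add: algebra_simps)
  qed
  \<comment> \<open>the second variation on the orthogonal complement\<close>
  have Qz: "\<Lambda> * ((1 - r) * (7/3 * B + 4 * Y) + 3/8 * r * (B + Y)) \<le> Q zs zt zs zt"
  proof -
    define e1 e2 e3 where y: "e1 = x1 / r" "e2 = x2 / r" "e3 = x3 / r"
    have ysum: "e1 + e2 + e3 = 0" unfolding y using sum r(1) by (simp flip: add_divide_distrib)
    have yR: "2/3 * (e1\<^sup>2 + e2\<^sup>2 + e3\<^sup>2) = 1"
    proof -
      have "2/3 * (e1\<^sup>2 + e2\<^sup>2 + e3\<^sup>2) = R / r\<^sup>2" unfolding y R by (simp add: power_divide add_divide_distrib)
      then show ?thesis using r R0 by simp
    qed
    have "\<exists>y\<in>{e1, e2, e3}. 1/2 \<le> y"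
    proof (rule ccontr)
      assume a: "\<not> (\<exists>y\<in>{e1, e2, e3}. 1/2 \<le> y)"
      have e3: "e3 = - e1 - e2" using ysum by simp
      have "e1 < 1/2" "e2 < 1/2" "e1 + e2 > - 1/2" using a e3 by auto
      then have "0 < (1/2 - e1) * (1/2 - e2)" "0 < (1/2 - e1) * (1/2 + e1 + e2)" "0 < (1/2 - e2) * (1/2 + e1 + e2)" by auto
      moreover have "4 * (e1\<^sup>2 + e1 * e2 + e2\<^sup>2) = 3" using yR unfolding e3 by (simp add: power2_eq_square algebra_simps)
      ultimately show False by (simp add: power2_eq_square algebra_simps)
    qed
    then have "LBx e1 e2 e3 (3/8)"
      using LBx_altitude[OF ysum, unfolded yR] LBx_mono[of e1 e2 e3 _ "3/8"] by fastforce
    then have "16 * pi\<^sup>2 / 3 * (3/8) * tri_inner z z \<le> dform (4/3 * (1 + e1)) (4/3 * (1 + e2)) (4/3 * (1 + e3)) zs zt zs zt"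
      unfolding LBx_def z_def zs_def zt_def by (rule LB_minus_u1[OF _ v])
    then have eb: "\<Lambda> * (3/8 * (B + Y)) \<le> dform (4/3 * (1 + e1)) (4/3 * (1 + e2)) (4/3 * (1 + e3)) zs zt zs zt"
      by (simp only: ZBY \<Lambda>_def mult.assoc)
    have "Q zs zt zs zt = dform ((1 - r) * (4/3) + r * (4/3 * (1 + e1))) ((1 - r) * (4/3) + r * (4/3 * (1 + e2))) ((1 - r) * (4/3) + r * (4/3 * (1 + e3))) zs zt zs zt"
    proof -
      have eq: "(1 - r) * (4/3) + r * (4/3 * (1 + x / r)) = 4/3 * (1 + x)" for x using r(1) by (simp add: field_simps)
      show ?thesis unfolding Q_def y eq ..
    qed
    also have "\<dots> = (1 - r) * QI zs zt zs zt + r * dform (4/3 * (1 + e1)) (4/3 * (1 + e2)) (4/3 * (1 + e3)) zs zt zs zt"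
      unfolding QI_def by (rule dform_linear[OF cz(2,3) cz(2,3)])
    also have "\<dots> \<ge> (1 - r) * (\<Lambda> * (7/3 * B + 4 * Y)) + r * (\<Lambda> * (3/8 * (B + Y)))"
      using r QIz eb by (intro add_mono mult_left_mono) auto
    finally show ?thesis by (simp add: algebra_simps)
  qed
  \<comment> \<open>the first variation\<close>
  define G where "G = x1 * tri_inner s1 z + x2 * tri_inner s2 z + x3 * tri_inner s3 z"
  have Quz: "Q u1s u1t zs zt = \<Lambda> * G"
  proof -
    have "tri_inner s1 z + tri_inner s2 z + tri_inner s3 z = tri_inner u1 z"
      unfolding u1_eq_s by (simp add: tri_inner_add_left continuous_intros cs cz)
    then have s0: "tri_inner s1 z + tri_inner s2 z + tri_inner s3 z = 0" using zu by (simp add: tri_inner_commute)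
    have "Q u1s u1t zs zt = \<Lambda> * ((tri_inner s1 z + tri_inner s2 z + tri_inner s3 z) + G)"
      unfolding Q_def dform_u1[OF zC zb] G_def \<Lambda>_def by (simp add: field_simps)
    then show ?thesis unfolding s0 by simp
  qed
  have Quu: "Q u1s u1t u1s u1t = 3/4 * \<Lambda>"
  proof -
    have x3: "x3 = - x1 - x2" using sum by simp
    show ?thesis unfolding Q_def dform_u1[OF u1_C1' u1_zero_bdry] u1_inner \<Lambda>_def x3 by (simp add: field_simps)
  qed
  have Qv: "Q vs vt vs vt = Q zs zt zs zt + 2 * \<alpha> * (\<Lambda> * G) + \<alpha>\<^sup>2 * (3/4 * \<Lambda>)"
  proof -
    have e: "vs = (\<lambda>x. zs x + \<alpha> * u1s x)" "vt = (\<lambda>x. zt x + \<alpha> * u1t x)" by (auto simp: zs_def zt_def)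
    have "Q vs vt vs vt = Q zs zt zs zt + 2 * \<alpha> * Q zs zt u1s u1t + \<alpha>\<^sup>2 * Q u1s u1t u1s u1t"
      unfolding e Q_def by (rule dform_quadratic) (intro cz cu)+
    then show ?thesis unfolding Quu Q_def dform_commute[of _ _ _ zs zt u1s u1t] unfolding Q_def[symmetric] Quz Quu .
  qed
  define K where "K = 6561 / (3584 * pi\<^sup>2)"
  define k where "k = 6 * K\<^sup>2"
  have k: "0 \<le> k" "k \<le> 1/4"
  proof -
    have "9 \<le> pi\<^sup>2" using pi_gt3 power_mono[of 3 pi 2] by simp
    then have "K \<le> 6561 / (3584 * 9)" unfolding K_def by (intro divide_left_mono) auto
    moreover have "0 \<le> K" by (simp add: K_def)
    ultimately have "K\<^sup>2 \<le> (6561 / (3584 * 9))\<^sup>2" by (intro power_mono)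
    then show "k \<le> 1/4" by (simp add: k_def power2_eq_square)
    show "0 \<le> k" by (simp add: k_def)
  qed
  define g where "g = (\<lambda>x. x1 * s1 x + x2 * s2 x + x3 * s3 x)"
  have cg: "continuous_on UNIV g" unfolding g_def by (intro continuous_intros cs)
  have ing: "tri_inner g h = x1 * tri_inner s1 h + x2 * tri_inner s2 h + x3 * tri_inner s3 h" if "continuous_on UNIV h" for h
    unfolding g_def by (simp add: tri_inner_add_left continuous_intros cs that tri_inner_cmult_left)
  define g1 g2 where "g1 = tri_inner g p1" and "g2 = tri_inner g p2"
  have x3eq: "x3 = - x1 - x2" using sum by simp
  have g12: "g1 = - 3/2 * K * x3" "g2 = sqrt 3 / 2 * K * (x1 - x2)"
    unfolding g1_def g2_def ing[OF cp(1)] ing[OF cp(2)] s_p_inner K_def[symmetric]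
    using sum by (simp_all add: eq_neg_iff_add_eq_0 x3eq field_simps)
  have T: "8/3 * (g1\<^sup>2 + g2\<^sup>2) = k * R"
  proof -
    have x3: "x3 = - x1 - x2" using sum by simp
    show ?thesis unfolding g12 k_def R x3 power_mult_distrib power_divide by (simp add: field_simps power2_eq_square)
  qed
  have gg: "tri_inner g g = 3/8 * R"
    unfolding ing[OF cg] tri_inner_commute[of s1 g] tri_inner_commute[of s2 g] tri_inner_commute[of s3 g] ing[OF cs(1)] ing[OF cs(2)] ing[OF cs(3)]
    by (simp add: s_inner tri_inner_commute[of s2 s1] tri_inner_commute[of s3 s1] tri_inner_commute[of s3 s2] R power2_eq_square)
  define G1 where "G1 = b1 * g1 + b2 * g2"
  define G2 where "G2 = tri_inner g \<zeta>"
  have G12: "G = G1 + G2"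
    unfolding G_def ing[OF cz(1), symmetric] inz[OF cg] G1_def G2_def g1_def g2_def by simp
  have G1b: "G1\<^sup>2 \<le> (k * R) * B"
  proof -
    have "G1\<^sup>2 \<le> (b1\<^sup>2 + b2\<^sup>2) * (g1\<^sup>2 + g2\<^sup>2)"
      using zero_le_power2[of "b1 * g2 - b2 * g1"] unfolding G1_def by (simp add: power2_eq_square algebra_simps)
    also have "\<dots> = (k * R) * B" unfolding T[symmetric] B_def by (simp add: algebra_simps)
    finally show ?thesis .
  qed
  have G2b: "G2\<^sup>2 \<le> ((3/8 - k) * R) * Y"
  proof -
    define d1 d2 where d: "d1 = 8/3 * g1" "d2 = 8/3 * g2"
    define g' where "g' = (\<lambda>x. g x - d1 * p1 x - d2 * p2 x)"
    have cg': "continuous_on UNIV g'" unfolding g'_def by (intro continuous_intros cg cp)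
    have ig': "tri_inner g' h = tri_inner g h - d1 * tri_inner p1 h - d2 * tri_inner p2 h" if "continuous_on UNIV h" for h
      unfolding g'_def by (simp add: tri_inner_diff_left continuous_intros cg cp that tri_inner_cmult_left)
    have 1: "tri_inner g' \<zeta> = G2"
      unfolding ig'[OF c\<zeta>(1)] G2_def using \<zeta>p by (simp add: tri_inner_commute[of p1 \<zeta>] tri_inner_commute[of p2 \<zeta>])
    have 2: "tri_inner g' p1 = 0" "tri_inner g' p2 = 0"
      unfolding ig'[OF cp(1)] ig'[OF cp(2)] p_inner p21 d g1_def g2_def by simp_all
    have "tri_inner g' g' = tri_inner g g - d1 * tri_inner p1 g - d2 * tri_inner p2 g"
    proof -
      have "tri_inner g' g' = tri_inner g g' - d1 * tri_inner p1 g' - d2 * tri_inner p2 g'" by (rule ig'[OF cg'])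
      also have "\<dots> = tri_inner g' g" using 2 by (simp add: tri_inner_commute[of p1 g'] tri_inner_commute[of p2 g'] tri_inner_commute[of g g'])
      finally show ?thesis using ig'[OF cg] by simp
    qed
    also have "\<dots> = 3/8 * R - 8/3 * (g1\<^sup>2 + g2\<^sup>2)"
      unfolding gg d tri_inner_commute[of p1 g] tri_inner_commute[of p2 g] g1_def[symmetric] g2_def[symmetric]
      by (simp add: power2_eq_square algebra_simps)
    finally have 3: "tri_inner g' g' = (3/8 - k) * R" unfolding T by (simp add: algebra_simps)
    show ?thesis using tri_inner_Cauchy_Schwarz[OF cg' c\<zeta>(1)] unfolding 1 3 Y_def .
  qed
  define K1 K2 where "K1 = (27/32 :: real)" and "K2 = (67/32 :: real)"
  have m1: "0 \<le> \<alpha>\<^sup>2 * (k * R) / K1 + 2 * \<alpha> * G1 + K1 * B"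
    by (rule weighted_am_gm[OF G1b]) (use B0 k R0 in \<open>auto simp: K1_def\<close>)
  have m2: "0 \<le> \<alpha>\<^sup>2 * ((3/8 - k) * R) / K2 + 2 * \<alpha> * G2 + K2 * Y"
    by (rule weighted_am_gm[OF G2b]) (use Y0 k R0 in \<open>auto simp: K2_def\<close>)
  have m3: "\<alpha>\<^sup>2 * (k * R) / K1 + \<alpha>\<^sup>2 * ((3/8 - k) * R) / K2 \<le> 3/4 * (12/25) * R * \<alpha>\<^sup>2"
  proof -
    have "k / K1 + (3/8 - k) / K2 \<le> 3/4 * (12/25)" using k unfolding K1_def K2_def by (simp add: field_simps)
    then have "(\<alpha>\<^sup>2 * R) * (k / K1 + (3/8 - k) / K2) \<le> (\<alpha>\<^sup>2 * R) * (3/4 * (12/25))"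
      using R0 by (intro mult_left_mono) auto
    then show ?thesis by (simp add: algebra_simps)
  qed
  have "2 * \<alpha> * G = 2 * \<alpha> * G1 + 2 * \<alpha> * G2" unfolding G12 by (rule distrib_left)
  then have main: "0 \<le> 3/4 * (12/25) * R * \<alpha>\<^sup>2 + 2 * \<alpha> * G + K1 * B + K2 * Y"
    using m1 m2 m3 by linarith
  have kB: "K1 * B \<le> ((1 - r) * (7/3) + 3/8 * r - 1) * B"
    unfolding K1_def using r(2) B0 by (intro mult_right_mono) (auto simp: field_simps)
  have kY: "K2 * Y \<le> ((1 - r) * 4 + 3/8 * r - 1) * Y"
    unfolding K2_def using r(2) Y0 by (intro mult_right_mono) (auto simp: field_simps)
  have RBY: "0 \<le> 12/25 * R * (B + Y)" using R0 B0 Y0 by simp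
  have "(1 - 12/25 * R) * (B + Y + 3/4 * \<alpha>\<^sup>2) \<le> ((1 - r) * (7/3 * B + 4 * Y) + 3/8 * r * (B + Y)) + 2 * \<alpha> * G + 3/4 * \<alpha>\<^sup>2"
  proof -
    have "(1 - 12/25 * R) * (B + Y + 3/4 * \<alpha>\<^sup>2) = B + Y + 3/4 * \<alpha>\<^sup>2 - 12/25 * R * (B + Y) - 3/4 * (12/25) * R * \<alpha>\<^sup>2"
      by (simp add: field_simps)
    moreover have "((1 - r) * (7/3) + 3/8 * r - 1) * B + ((1 - r) * 4 + 3/8 * r - 1) * Y = ((1 - r) * (7/3 * B + 4 * Y) + 3/8 * r * (B + Y)) - B - Y"
      by (simp add: field_simps)
    ultimately show ?thesis using main kB kY RBY by linarith
  qed
  moreover have L0: "\<Lambda> > 0" by (simp add: \<Lambda>_def)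
  ultimately have "\<Lambda> * ((1 - 12/25 * R) * (B + Y + 3/4 * \<alpha>\<^sup>2)) \<le> \<Lambda> * (((1 - r) * (7/3 * B + 4 * Y) + 3/8 * r * (B + Y)) + 2 * \<alpha> * G + 3/4 * \<alpha>\<^sup>2)"
    by simp
  also have "\<dots> \<le> Q vs vt vs vt"
  proof -
    have "\<Lambda> * (((1 - r) * (7/3 * B + 4 * Y) + 3/8 * r * (B + Y)) + 2 * \<alpha> * G + 3/4 * \<alpha>\<^sup>2) =
       \<Lambda> * ((1 - r) * (7/3 * B + 4 * Y) + 3/8 * r * (B + Y)) + 2 * \<alpha> * (\<Lambda> * G) + \<alpha>\<^sup>2 * (3/4 * \<Lambda>)"
      by (simp add: field_simps)
    then show ?thesis unfolding Qv using Qz by linarith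
  qed
  finally have "\<Lambda> * ((1 - 12/25 * R) * (B + Y + 3/4 * \<alpha>\<^sup>2)) \<le> Q vs vt vs vt" .
  then show "16 * pi\<^sup>2 / 3 * (1 - 12/25 * R) * tri_int (\<lambda>x. (v x)\<^sup>2) \<le> dform (4/3 * (1 + x1)) (4/3 * (1 + x2)) (4/3 * (1 + x3)) vs vt vs vt"
    unfolding tri_int_square vv ZBY Q_def \<Lambda>_def by (simp only: mult.assoc)
qed

lemma LBx_near:
  assumes "x1 + x2 + x3 = 0" "R = 2/3 * (x1\<^sup>2 + x2\<^sup>2 + x3\<^sup>2)" "R \<le> 1/16"
  shows "LBx x1 x2 x3 (1 - 12/25 * R)"
proof (cases "R = 0")
  case True
  then have "x1\<^sup>2 + x2\<^sup>2 + x3\<^sup>2 = 0" using assms(2) by simp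
  then have "x1 = 0" "x2 = 0" "x3 = 0" using sum_power2_ge_zero by (smt (verit) zero_eq_power2 zero_le_power2)+
  then show ?thesis using LBx_equilateral True by simp
next
  case False
  moreover have "R \<ge> 0" unfolding assms(2) by simp
  ultimately show ?thesis using LBx_near_pos[OF assms(1,2) _ assms(3)] by simp
qed

section \<open>Triangles far from the equilateral one\<close>

text \<open>Concavity along a ray from the equilateral triangle preserves affine lower bounds.\<close>
lemma LBx_ray:
  assumes "LBx (r1 * d1) (r1 * d2) (r1 * d3) M1" "LBx (r2 * d1) (r2 * d2) (r2 * d3) M2"
    and "r1 \<le> r" "r \<le> r2" and A: "C \<le> A * r1 + B * M1" "C \<le> A * r2 + B * M2"
  shows "\<exists>M. LBx (r * d1) (r * d2) (r * d3) M \<and> C \<le> A * r + B * M"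
proof (cases "r1 = r2")
  case True
  then show ?thesis using assms by force
next
  case False
  define b where "b = (r - r1) / (r2 - r1)"
  have b: "0 \<le> b" "b \<le> 1" using assms(3,4) False by (auto simp: b_def divide_le_eq_1)
  have "b * (r2 - r1) = r - r1" using False by (simp add: b_def)
  then have r: "r = (1 - b) * r1 + b * r2" by (simp add: algebra_simps)
  have "LBx ((1 - b) * (r1 * d1) + b * (r2 * d1)) ((1 - b) * (r1 * d2) + b * (r2 * d2)) ((1 - b) * (r1 * d3) + b * (r2 * d3)) ((1 - b) * M1 + b * M2)"
    by (rule LBx_combine[OF assms(1,2)]) (use b in auto)
  then have "LBx (r * d1) (r * d2) (r * d3) ((1 - b) * M1 + b * M2)"
    unfolding r by (simp add: algebra_simps)
  moreover have "C \<le> A * r + B * ((1 - b) * M1 + b * M2)"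
  proof -
    have "C = (1 - b) * C + b * C" by (simp add: algebra_simps)
    also have "\<dots> \<le> (1 - b) * (A * r1 + B * M1) + b * (A * r2 + B * M2)"
      using b A by (intro add_mono mult_left_mono) auto
    also have "\<dots> = A * r + B * ((1 - b) * M1 + b * M2)" unfolding r by (simp add: algebra_simps)
    finally show ?thesis .
  qed
  ultimately show ?thesis by blast
qed

text \<open>The segment from the half square (\<open>u = 0\<close>) to the half equilateral triangle (\<open>u = 3/8\<close>).\<close>
lemma LBx_chain_right:
  assumes "0 \<le> u" "u \<le> 3/8"
  shows "LBx (1/2) (u - 1/4) (- u - 1/4) (15/16 - u/6)"
proof -
  define b where "b = 8/3 * u"
  have "LBx ((1 - b) * (1/2) + b * (1/2)) ((1 - b) * (-1/4) + b * (1/8)) ((1 - b) * (-1/4) + b * (-5/8)) ((1 - b) * (15/16) + b * (7/8))"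
    by (rule LBx_combine[OF LBx_half_square LBx_half_equilateral]) (use assms in \<open>auto simp: b_def\<close>)
  moreover have e: "(1 - b) * (1/2) + b * (1/2) = 1/2" "(1 - b) * (-1/4) + b * (1/8) = u - 1/4"
    "(1 - b) * (-1/4) + b * (-5/8) = - u - 1/4" "(1 - b) * (15/16) + b * (7/8) = 15/16 - u/6"
    by (simp_all add: b_def field_simps)
  ultimately show ?thesis by (simp only: e)
qed

text \<open>The segment from the half equilateral triangle to its mirror image.\<close>
lemma LBx_chain_left:
  assumes "1/8 \<le> w" "w \<le> 1/2"
  shows "LBx w (5/8 - w) (- 5/8) (7/8)"
proof -
  define b where "b = 8/3 * (1/2 - w)"
  have "LBx ((1 - b) * (1/2) + b * (1/8)) ((1 - b) * (1/8) + b * (1/2)) ((1 - b) * (-5/8) + b * (-5/8)) ((1 - b) * (7/8) + b * (7/8))"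
    by (rule LBx_combine[OF LBx_half_equilateral LBx_swap[OF LBx_half_equilateral]]) (use assms in \<open>auto simp: b_def field_simps\<close>)
  moreover have e: "(1 - b) * (1/2) + b * (1/8) = w" "(1 - b) * (1/8) + b * (1/2) = 5/8 - w"
    "(1 - b) * (-5/8) + b * (-5/8) = - 5/8" "(1 - b) * (7/8) + b * (7/8) = 7/8"
    by (simp_all add: b_def field_simps)
  ultimately show ?thesis by (simp only: e)
qed

lemma circle_line:
  fixes A B r :: real
  assumes "A\<^sup>2 + B\<^sup>2 \<le> C\<^sup>2" "0 \<le> C" "r\<^sup>2 \<le> 1"
  shows "A * r + B * sqrt (1 - r\<^sup>2) \<le> C"
proof (rule power2_le_imp_le[OF _ assms(2)])
  define t where "t = sqrt (1 - r\<^sup>2)"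
  have t: "t\<^sup>2 = 1 - r\<^sup>2" using assms(3) by (simp add: t_def)
  have "(A * r + B * t)\<^sup>2 \<le> (A\<^sup>2 + B\<^sup>2) * (r\<^sup>2 + t\<^sup>2)"
    using zero_le_power2[of "A * t - B * r"] by (simp add: power2_eq_square algebra_simps)
  then show "(A * r + B * sqrt (1 - r\<^sup>2))\<^sup>2 \<le> C\<^sup>2" using assms(1) unfolding t t_def[symmetric] by simp
qed

text \<open>On the ray through \<open>x\<close> a bound is known at radius \<open>1/4\<close> (second order perturbation), at \<open>\<rho>\<close> (the point on a segment between explicit
  triangles) and at \<open>1\<close> (the strip). Concavity gives chords between them; each chord stays above the circular arc \<open>\<surd>(1 - r\<^sup>2)\<close> because
  a line at distance greater than one from the origin does not meet the unit circle. The unit vector \<open>(A, B)\<close> is the normal of the line for the outer chord.\<close>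
lemma LBx_far:
  assumes sum: "x1 + x2 + x3 = 0" and r: "r\<^sup>2 = 2/3 * (x1\<^sup>2 + x2\<^sup>2 + x3\<^sup>2)" "1/4 \<le> r" "r \<le> 1"
    and \<rho>: "1/4 \<le> \<rho>" "\<rho> \<le> 1" and chain: "LBx (\<rho> * (x1 / r)) (\<rho> * (x2 / r)) (\<rho> * (x3 / r)) N"
    and i: "10335/10000 \<le> 254/1000 * \<rho> + 1 * N"
    and AB: "A\<^sup>2 + B\<^sup>2 = 1" "0 < B" "B \<le> 1"
    and o: "1007/1000 \<le> A * \<rho> + B * N" "1007/1000 \<le> A * 1 + B * ((1 + x1 / r) / 4)"
  shows "\<exists>M. LBx x1 x2 x3 M \<and> sqrt (1 - r\<^sup>2) + r\<^sup>2 / 1000 \<le> M"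
proof -
  define d1 d2 d3 where d: "d1 = x1 / r" "d2 = x2 / r" "d3 = x3 / r"
  have r0: "r > 0" using r by simp
  have x: "r * d1 = x1" "r * d2 = x2" "r * d3 = x3" using r0 by (auto simp: d)
  have r21: "r\<^sup>2 \<le> 1" using r r0 by (simp add: power_le_one)
  have ds: "c * d1 + c * d2 + c * d3 = 0" for c
    using sum by (simp add: d flip: add_divide_distrib distrib_left)
  have dR: "2/3 * ((c * d1)\<^sup>2 + (c * d2)\<^sup>2 + (c * d3)\<^sup>2) = c\<^sup>2" for c
  proof -
    have t: "(c * (x / r))\<^sup>2 = c\<^sup>2 / r\<^sup>2 * x\<^sup>2" for x by (simp add: power_mult_distrib power_divide)
    have "2/3 * ((c * d1)\<^sup>2 + (c * d2)\<^sup>2 + (c * d3)\<^sup>2) = c\<^sup>2 / r\<^sup>2 * (2/3 * (x1\<^sup>2 + x2\<^sup>2 + x3\<^sup>2))"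
      unfolding d t by (simp only: distrib_left mult.left_commute)
    also have "\<dots> = c\<^sup>2" unfolding r(1)[symmetric] using r0 by simp
    finally show ?thesis .
  qed
  show ?thesis
  proof (cases "r \<le> \<rho>")
    case True
    have "LBx (1/4 * d1) (1/4 * d2) (1/4 * d3) (1 - 12/25 * (1/4)\<^sup>2)"
      by (rule LBx_near[OF ds]) (simp_all only: dR, simp add: power2_eq_square)
    then have near: "LBx (1/4 * d1) (1/4 * d2) (1/4 * d3) (97/100)" by (simp add: power2_eq_square)
    have "\<exists>M. LBx (r * d1) (r * d2) (r * d3) M \<and> 10335/10000 \<le> 254/1000 * r + 1 * M"
      by (rule LBx_ray[OF near chain[folded d] r(2) True _ i]) simp
    then obtain M where M: "LBx x1 x2 x3 M" "10335/10000 \<le> 254/1000 * r + M" unfolding x by auto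
    have "254/1000 * r + 1 * sqrt (1 - r\<^sup>2) \<le> 10325/10000"
      by (rule circle_line[OF _ _ r21]) (simp_all add: power2_eq_square)
    then have "sqrt (1 - r\<^sup>2) + r\<^sup>2 / 1000 \<le> M" using M(2) r21 by linarith
    then show ?thesis using M by blast
  next
    case False
    have "LBx (1 * d1) (1 * d2) (1 * d3) ((1 + 1 * d1) / 4)"
      by (rule LBx_altitude(1)[OF ds]) (simp only: dR, simp)
    then have e: "LBx (1 * d1) (1 * d2) (1 * d3) ((1 + x1 / r) / 4)" by (simp add: d)
    have "\<exists>M. LBx (r * d1) (r * d2) (r * d3) M \<and> 1007/1000 \<le> A * r + B * M"
      by (rule LBx_ray[OF chain[folded d] e]) (use False r o in auto)
    then obtain M where M: "LBx x1 x2 x3 M" "1007/1000 \<le> A * r + B * M" unfolding x by auto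
    have "A * r + B * sqrt (1 - r\<^sup>2) \<le> 1"
      by (rule circle_line[OF _ _ r21]) (simp_all add: AB)
    then have "7/1000 \<le> B * (M - sqrt (1 - r\<^sup>2))" using M(2) by (simp add: algebra_simps)
    moreover have "B * (M - sqrt (1 - r\<^sup>2)) \<le> 1 * (M - sqrt (1 - r\<^sup>2))"
    proof (rule mult_right_mono[OF AB(3)])
      have "0 < B * (M - sqrt (1 - r\<^sup>2))" using calculation by linarith
      then show "0 \<le> M - sqrt (1 - r\<^sup>2)" using AB(2) by (simp add: zero_less_mult_iff)
    qed
    ultimately have "7/1000 \<le> M - sqrt (1 - r\<^sup>2)" by simp
    moreover have "r\<^sup>2 / 1000 \<le> 1 / 1000" using r21 by simp
    ultimately have "sqrt (1 - r\<^sup>2) + r\<^sup>2 / 1000 \<le> M" by simp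
    then show ?thesis using M by blast
  qed
qed

text \<open>Directions are split by the segment between explicit triangles that the ray meets: \<open>4 x2 \<le> x1\<close> for the one from the half square,
  \<open>4 x2 \<ge> x1\<close> for the one through the mirror images of the half equilateral triangle.\<close>
lemma LBx_stability:
  assumes sum: "x1 + x2 + x3 = 0" and ord: "x1 \<ge> x2" "x2 \<ge> x3" and R: "R = 2/3 * (x1\<^sup>2 + x2\<^sup>2 + x3\<^sup>2)" "R < 1"
  shows "\<exists>M. LBx x1 x2 x3 M \<and> sqrt (1 - R) + R / 1000 \<le> M"
proof (cases "R \<le> 1/16")
  case True
  have R0: "R \<ge> 0" unfolding R(1) by simp
  have "sqrt (1 - R) \<le> 1 - R / 2"
    by (rule real_le_lsqrt) (use R(2) R0 in \<open>auto simp: power2_eq_square algebra_simps\<close>)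
  then show ?thesis using LBx_near[OF sum R(1) True] R0 by (intro exI[of _ "1 - 12/25 * R"]) auto
next
  case False
  define r where "r = sqrt R"
  have r2: "r\<^sup>2 = R" using False by (simp add: r_def)
  have rR: "r\<^sup>2 = 2/3 * (x1\<^sup>2 + x2\<^sup>2 + x3\<^sup>2)" unfolding r2 by (rule R(1))
  have r: "1/4 \<le> r" "r \<le> 1"
  proof -
    show "1/4 \<le> r" unfolding r_def by (rule real_le_rsqrt) (use False in \<open>simp add: power2_eq_square\<close>)
    show "r \<le> 1" unfolding r_def using R(2) by simp
  qed
  have r0: "r > 0" using r by simp
  have x3: "x3 = - x1 - x2" using sum by simp
  have RR: "R = 4/3 * (x1\<^sup>2 + x1 * x2 + x2\<^sup>2)" unfolding R(1) x3 by (simp add: power2_eq_square algebra_simps)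
  have x1: "x1 > 0"
  proof (rule ccontr)
    assume "\<not> x1 > 0"
    then have "x1 = 0" "x2 = 0" using ord sum by auto
    then show False using RR False by simp
  qed
  have x3n: "x3 < 0" using x1 ord sum by linarith
  show ?thesis
  proof (cases "4 * x2 \<le> x1")
    case True
    define u where "u = x2 / (2 * x1) + 1/4"
    have u: "0 \<le> u" "u \<le> 3/8"
    proof -
      have "- x1 \<le> 2 * x2" using ord sum by linarith
      then show "0 \<le> u" using x1 by (simp add: u_def field_simps)
      show "u \<le> 3/8" using True x1 by (simp add: u_def field_simps)
    qed
    define \<rho> where "\<rho> = r / (2 * x1)"
    have xu: "x2 = 2 * x1 * (u - 1/4)" using x1 by (simp add: u_def)
    have \<rho>2: "\<rho>\<^sup>2 = 1/4 + 4/3 * u\<^sup>2"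
    proof -
      have "\<rho>\<^sup>2 = R / (4 * x1\<^sup>2)" by (simp add: \<rho>_def power_divide power_mult_distrib r2)
      also have "R = 4/3 * x1\<^sup>2 * (1 + 2 * (u - 1/4) + (2 * (u - 1/4))\<^sup>2)"
        unfolding RR xu by (simp add: power2_eq_square algebra_simps)
      also have "\<dots> / (4 * x1\<^sup>2) = 1/3 * (1 + 2 * (u - 1/4) + (2 * (u - 1/4))\<^sup>2)" using x1 by simp
      finally show ?thesis by (simp add: power2_eq_square field_simps)
    qed
    have \<rho>0: "0 < \<rho>" using r0 x1 by (simp add: \<rho>_def)
    have lower: "c \<le> \<rho>" if "c\<^sup>2 \<le> 1/4 + 4/3 * u\<^sup>2" for c
      by (rule power2_le_imp_le[of c]) (use that \<rho>2 \<rho>0 in auto)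
    have "u\<^sup>2 \<le> (3/8)\<^sup>2" using u by (intro power_mono)
    then have \<rho>u: "\<rho>\<^sup>2 \<le> 7/16" unfolding \<rho>2 by (simp add: power2_eq_square)
    then have upper: "\<rho> \<le> 66155/100000"
      by (intro power2_le_imp_le[of \<rho>]) (auto simp: power2_eq_square)
    have chain: "LBx (\<rho> * (x1 / r)) (\<rho> * (x2 / r)) (\<rho> * (x3 / r)) (15/16 - u/6)"
    proof -
      have 1: "\<rho> * (x1 / r) = 1/2" using x1 r0 by (simp add: \<rho>_def)
      have 2: "\<rho> * (x2 / r) = u - 1/4" using x1 r0 by (simp add: \<rho>_def u_def)
      have 3: "\<rho> * (x3 / r) = - u - 1/4" using x1 r0 unfolding x3 by (simp add: \<rho>_def u_def field_simps)
      show ?thesis unfolding 1 2 3 by (rule LBx_chain_right[OF u])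
    qed
    have i: "10335/10000 \<le> 254/1000 * \<rho> + 1 * (15/16 - u/6)"
    proof -
      have "(10335/10000 - 15/16 + u/6) / (254/1000) \<le> \<rho>"
      proof (rule lower)
        have "0 \<le> (u - 27/100)\<^sup>2" by simp
        then show "((10335/10000 - 15/16 + u/6) / (254/1000))\<^sup>2 \<le> 1/4 + 4/3 * u\<^sup>2"
          using u by (simp add: power2_eq_square field_simps)
      qed
      then show ?thesis by (simp add: field_simps)
    qed
    have o1: "1007/1000 \<le> 20/29 * \<rho> + 21/29 * (15/16 - u/6)"
    proof -
      have "29/20 * (1007/1000 - 21/29 * (15/16 - u/6)) \<le> \<rho>"
      proof (rule lower)
        have "0 \<le> (u - 64/1000)\<^sup>2" by simp
        then show "(29/20 * (1007/1000 - 21/29 * (15/16 - u/6)))\<^sup>2 \<le> 1/4 + 4/3 * u\<^sup>2"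
          using u by (simp add: power2_eq_square field_simps)
      qed
      then show ?thesis by (simp add: field_simps)
    qed
    have o2: "1007/1000 \<le> 20/29 * 1 + 21/29 * ((1 + x1 / r) / 4)"
    proof -
      have "x1 / r = 1 / (2 * \<rho>)" using x1 r0 by (simp add: \<rho>_def)
      moreover have "1 / (2 * (66155/100000)) \<le> 1 / (2 * \<rho>)" using upper \<rho>0 by (intro divide_left_mono) auto
      ultimately have k: "7558/10000 \<le> x1 / r" by simp
      have "1007/1000 \<le> 20/29 * 1 + 21/29 * ((1 + k) / 4)" if "7558/10000 \<le> k" for k :: real
        using that by (simp add: field_simps)
      then show ?thesis using k by blast
    qed
    have "\<exists>M. LBx x1 x2 x3 M \<and> sqrt (1 - r\<^sup>2) + r\<^sup>2 / 1000 \<le> M"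
      by (rule LBx_far[OF sum rR r _ _ chain i _ _ _ o1 o2])
         (use lower[of "1/4"] upper in \<open>auto simp: power2_eq_square\<close>)
    then show ?thesis unfolding r2 .
  next
    case False
    define \<tau> where "\<tau> = 5/8 / (- x3)"
    have \<tau>: "\<tau> > 0" using x3n by (simp add: \<tau>_def divide_pos_pos divide_pos_neg)
    have t3: "\<tau> * x3 = - 5/8" using x3n by (simp add: \<tau>_def)
    have t12: "\<tau> * x1 + \<tau> * x2 = 5/8" using t3 unfolding x3 by (simp add: algebra_simps)
    define w where "w = \<tau> * x1"
    have w2: "\<tau> * x2 = 5/8 - w" using t12 by (simp add: w_def)
    have w: "5/16 \<le> w" "w \<le> 1/2"
    proof -
      have "\<tau> * x2 \<le> \<tau> * x1" using \<tau> ord by simp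
      then show "5/16 \<le> w" using w2 by (simp add: w_def)
      have "\<tau> * x1 \<le> \<tau> * (4 * x2)" using \<tau> False by simp
      then show "w \<le> 1/2" using w2 by (simp add: w_def)
    qed
    define \<rho> where "\<rho> = \<tau> * r"
    have \<rho>0: "\<rho> > 0" using \<tau> r0 by (simp add: \<rho>_def)
    have \<rho>2: "\<rho>\<^sup>2 = 4/3 * (w\<^sup>2 + w * (5/8 - w) + (5/8 - w)\<^sup>2)"
    proof -
      have "\<rho>\<^sup>2 = 4/3 * ((\<tau> * x1)\<^sup>2 + (\<tau> * x1) * (\<tau> * x2) + (\<tau> * x2)\<^sup>2)"
        unfolding \<rho>_def power_mult_distrib r2 RR by (simp add: power2_eq_square algebra_simps)
      then show ?thesis unfolding w2 w_def .
    qed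
    have lo: "5/8 \<le> \<rho>"
    proof (rule power2_le_imp_le[of "5/8"])
      have "0 \<le> (w - 5/16)\<^sup>2" by simp
      then show "(5/8)\<^sup>2 \<le> \<rho>\<^sup>2" unfolding \<rho>2 by (simp add: power2_eq_square field_simps)
    qed (use \<rho>0 in simp)
    have hi: "\<rho> \<le> 1"
    proof (rule power2_le_imp_le)
      have "0 \<le> (w - 5/16) * (1/2 - w)" using w by (intro mult_nonneg_nonneg) auto
      then show "\<rho>\<^sup>2 \<le> 1\<^sup>2" unfolding \<rho>2 using w by (simp add: power2_eq_square field_simps)
    qed simp
    have chain: "LBx (\<rho> * (x1 / r)) (\<rho> * (x2 / r)) (\<rho> * (x3 / r)) (7/8)"
    proof -
      have s: "\<rho> * (x / r) = \<tau> * x" for x using r0 by (simp add: \<rho>_def)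
      show ?thesis unfolding s t3 w2 w_def[symmetric] by (rule LBx_chain_left) (use w in auto)
    qed
    have x1r: "1/2 \<le> x1 / r"
    proof -
      have "r \<le> 2 * x1"
      proof (rule power2_le_imp_le)
        have "0 \<le> (x1 - x2) * (2 * x1 + x2)" using ord x1 sum by (intro mult_nonneg_nonneg) auto
        then show "r\<^sup>2 \<le> (2 * x1)\<^sup>2" unfolding r2 RR by (simp add: power2_eq_square field_simps)
      qed (use x1 in simp)
      then show ?thesis using r0 by (simp add: field_simps)
    qed
    have "\<exists>M. LBx x1 x2 x3 M \<and> sqrt (1 - r\<^sup>2) + r\<^sup>2 / 1000 \<le> M"
      by (rule LBx_far[OF sum rR r _ hi chain, of "4/5" "3/5"])
         (use lo x1r in \<open>auto simp: power2_eq_square\<close>)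
    then show ?thesis unfolding r2 .
  qed
qed

section \<open>Smooth functions\<close>

lemma ktd_SucI:
  assumes "\<And>x. (f has_derivative f' x) (at x)" "\<And>b. b \<in> Basis \<Longrightarrow> k_times_differentiable k (\<lambda>x. f' x b)"
  shows "k_times_differentiable (Suc k) f"
proof -
  have "frechet_derivative f (at x) = f' x" for x using frechet_derivative_at[OF assms(1)] by simp
  then show ?thesis using assms by (auto simp: differentiable_def)
qed

lemma ktd_SucD:
  assumes "k_times_differentiable (Suc k) f"
  shows "(f has_derivative frechet_derivative f (at x)) (at x)"
    and "b \<in> Basis \<Longrightarrow> k_times_differentiable k (\<lambda>x. frechet_derivative f (at x) b)"
  using assms by (auto simp: frechet_derivative_works)

lemma ktd_cont: "k_times_differentiable k f \<Longrightarrow> continuous_on UNIV f"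
  by (cases k) (auto intro!: continuous_at_imp_continuous_on differentiable_imp_continuous_within)

lemma ktd_mono: "k_times_differentiable (Suc k) f \<Longrightarrow> k_times_differentiable k f"
proof (induction k arbitrary: f)
  case 0 then show ?case using ktd_cont[OF 0] by simp
next
  case (Suc k)
  have "k_times_differentiable k (\<lambda>x. frechet_derivative f (at x) b)" if "b \<in> Basis" for b
    by (rule Suc.IH, rule ktd_SucD(2)[OF Suc.prems that])
  then show ?case using ktd_SucD(1)[OF Suc.prems] by (intro ktd_SucI) auto
qed

lemma ktd_const: "k_times_differentiable k (\<lambda>x. c)"
proof (induction k arbitrary: c)
  case (Suc k)
  show ?case by (rule ktd_SucI[of _ "\<lambda>_ _. 0"]) (auto intro: Suc)
qed simp

lemma ktd_add: "k_times_differentiable k f \<Longrightarrow> k_times_differentiable k g \<Longrightarrow> k_times_differentiable k (\<lambda>x. f x + g x)"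
proof (induction k arbitrary: f g)
  case 0 then show ?case by (simp add: continuous_on_add)
next
  case (Suc k)
  show ?case
    by (rule ktd_SucI[where f'="\<lambda>x b. frechet_derivative f (at x) b + frechet_derivative g (at x) b"])
       (auto intro!: has_derivative_add Suc.IH ktd_SucD[OF Suc.prems(1)] ktd_SucD[OF Suc.prems(2)])
qed

lemma ktd_mult: "k_times_differentiable k f \<Longrightarrow> k_times_differentiable k g \<Longrightarrow> k_times_differentiable k (\<lambda>x. f x * g x)"
proof (induction k arbitrary: f g)
  case 0 then show ?case by (simp add: continuous_on_mult)
next
  case (Suc k)
  show ?case
    by (rule ktd_SucI[where f'="\<lambda>x b. f x * frechet_derivative g (at x) b + frechet_derivative f (at x) b * g x"])
       (auto intro!: has_derivative_mult ktd_add Suc.IH ktd_SucD[OF Suc.prems(1)] ktd_SucD[OF Suc.prems(2)]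
          ktd_mono[OF Suc.prems(1)] ktd_mono[OF Suc.prems(2)])
qed

lemma ktd_affine: "k_times_differentiable k (\<lambda>x. a \<bullet> x + c)"
proof (cases k)
  case 0 then show ?thesis by (auto intro!: continuous_intros)
next
  case (Suc m)
  show ?thesis unfolding Suc
    by (rule ktd_SucI[where f'="\<lambda>x b. a \<bullet> b"]) (auto intro!: derivative_eq_intros ktd_const)
qed

lemma ktd_compose_real:
  fixes h :: "nat \<Rightarrow> real \<Rightarrow> real"
  assumes d: "\<And>j y. \<exists>a m b n. (h j has_real_derivative h' j y) (at y) \<and> (\<forall>y. h' j y = a * h m y + b * h n y)"
  shows "k_times_differentiable k g \<Longrightarrow> k_times_differentiable k (\<lambda>x. h j (g x))"
proof (induction k arbitrary: g j)
  case 0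
  have "continuous_on UNIV (h j)"
    using d by (meson DERIV_isCont continuous_at_imp_continuous_on)
  then show ?case using 0 continuous_on_compose2[of UNIV "h j" UNIV g] by simp
next
  case (Suc k)
  obtain a m b n where h': "\<And>y. h' j y = a * h m y + b * h n y" using d by blast
  have dj: "(h j has_real_derivative h' j y) (at y)" for y using d by blast
  have gk: "k_times_differentiable k g" by (rule ktd_mono[OF Suc.prems])
  show ?case
  proof (rule ktd_SucI[where f'="\<lambda>x b. h' j (g x) * frechet_derivative g (at x) b"])
    fix x
    show "((\<lambda>x. h j (g x)) has_derivative (\<lambda>b. h' j (g x) * frechet_derivative g (at x) b)) (at x)"
      using diff_chain_at[OF ktd_SucD(1)[OF Suc.prems] dj[of "g x", unfolded has_field_derivative_def]]
      by (simp add: o_def)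
  next
    fix e :: 'a assume e: "e \<in> Basis"
    show "k_times_differentiable k (\<lambda>x. h' j (g x) * frechet_derivative g (at x) e)"
      unfolding h' by (intro ktd_mult ktd_add ktd_const Suc.IH gk ktd_SucD(2)[OF Suc.prems e])
  qed
qed

lemma ktd_flat: "k_times_differentiable k g \<Longrightarrow> k_times_differentiable k (\<lambda>x. flat j (g x))"
proof (rule ktd_compose_real[where h=flat and h'="\<lambda>j y. flat (j + 2) y - real j * flat (j + 1) y"])
  fix j :: nat and y :: real
  have "\<forall>y. flat (j + 2) y - real j * flat (j + 1) y = 1 * flat (j + 2) y + (- real j) * flat (j + 1) y" by simp
  then show "\<exists>a m b n. (flat j has_real_derivative flat (j + 2) y - real j * flat (j + 1) y) (at y) \<and>
      (\<forall>y. flat (j + 2) y - real j * flat (j + 1) y = a * flat m y + b * flat n y)"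
    using flat_deriv by blast
qed

lemma ktd_sin:
  assumes "k_times_differentiable k g" shows "k_times_differentiable k (\<lambda>x. sin (g x))"
proof -
  define h :: "nat \<Rightarrow> real \<Rightarrow> real" where "h = (\<lambda>j y. sin (y + real j * (pi / 2)))"
  have "k_times_differentiable k (\<lambda>x. h 0 (g x))"
  proof (rule ktd_compose_real[OF _ assms, where h'="\<lambda>j. h (Suc j)"])
    fix j :: nat and y :: real
    have "(h j has_real_derivative cos (y + real j * (pi / 2))) (at y)"
      unfolding h_def by (auto intro!: derivative_eq_intros)
    moreover have "h (Suc j) y = cos (y + real j * (pi / 2))"
    proof -
      have "y + real (Suc j) * (pi / 2) = (y + real j * (pi / 2)) + pi / 2" by (simp add: field_simps)
      then show ?thesis unfolding h_def by (simp only: sin_add) simp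
    qed
    ultimately have "(h j has_real_derivative h (Suc j) y) (at y)" by simp
    moreover have "\<forall>y. h (Suc j) y = 1 * h (Suc j) y + 0 * h 0 y" by simp
    ultimately show "\<exists>a m b n. (h j has_real_derivative h (Suc j) y) (at y) \<and> (\<forall>y. h (Suc j) y = a * h m y + b * h n y)"
      by blast
  qed
  then show ?thesis by (simp add: h_def)
qed

text \<open>Needed because a trial function is defined by cases, inside and outside the triangle, with overlapping open domains.\<close>
lemma ktd_local:
  assumes "\<And>x. \<exists>U g. open U \<and> x \<in> U \<and> k_times_differentiable k g \<and> (\<forall>y\<in>U. f y = g y)"
  shows "k_times_differentiable k f"
  using assms
proof (induction k arbitrary: f)
  case 0
  have "isCont f x" for x
  proof -
    obtain U g where U: "open U" "x \<in> U" "continuous_on UNIV g" "\<And>y. y \<in> U \<Longrightarrow> f y = g y" using 0[of x] by auto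
    have "isCont g x" using U(3) continuous_on_eq_continuous_at by blast
    moreover have "\<forall>\<^sub>F y in nhds x. f y = g y" using U eventually_nhds by blast
    ultimately show ?thesis using isCont_cong by blast
  qed
  then show ?case by (simp add: continuous_at_imp_continuous_on)
next
  case (Suc k)
  have der: "\<exists>U g. open U \<and> x \<in> U \<and> k_times_differentiable (Suc k) g \<and> (\<forall>y\<in>U. (f has_derivative frechet_derivative g (at y)) (at y))" for x
  proof -
    obtain U g where U: "open U" "x \<in> U" "k_times_differentiable (Suc k) g" "\<And>y. y \<in> U \<Longrightarrow> f y = g y" using Suc.prems[of x] by blast
    have "(f has_derivative frechet_derivative g (at y)) (at y)" if "y \<in> U" for y
      by (rule has_derivative_transform_within_open[OF ktd_SucD(1)[OF U(3)] U(1) that]) (use U(4) in auto)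
    then show ?thesis using U by blast
  qed
  show ?case
  proof (rule ktd_SucI)
    show "(f has_derivative frechet_derivative f (at x)) (at x)" for x
      using der[of x] by (auto simp: frechet_derivative_works[symmetric] differentiable_def)
    fix b :: 'a assume b: "b \<in> Basis"
    show "k_times_differentiable k (\<lambda>x. frechet_derivative f (at x) b)"
    proof (rule Suc.IH)
      fix x
      obtain U g where U: "open U" "x \<in> U" "k_times_differentiable (Suc k) g" "\<And>y. y \<in> U \<Longrightarrow> (f has_derivative frechet_derivative g (at y)) (at y)"
        using der[of x] by blast
      have "frechet_derivative f (at y) = frechet_derivative g (at y)" if "y \<in> U" for y
        using frechet_derivative_at[OF U(4)[OF that]] by simp
      then show "\<exists>U g. open U \<and> x \<in> U \<and> k_times_differentiable k g \<and> (\<forall>y\<in>U. frechet_derivative f (at y) b = g y)"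
        using U(1,2) ktd_SucD(2)[OF U(3) b] by (intro exI[of _ U] exI[of _ "\<lambda>x. frechet_derivative g (at x) b"]) auto
    qed
  qed
qed

lemma test_functionsD:
  assumes "\<phi> \<in> test_functions \<Omega>"
  shows "(\<phi> has_derivative frechet_derivative \<phi> (at x)) (at x)" "continuous_on UNIV \<phi>" "continuous_on UNIV (gradient \<phi>)"
    "x \<notin> closure {x. \<phi> x \<noteq> 0} \<Longrightarrow> \<phi> x = 0" "x \<notin> closure {x. \<phi> x \<noteq> 0} \<Longrightarrow> gradient \<phi> x = 0"
    "compact (closure {x. \<phi> x \<noteq> 0})" "closure {x. \<phi> x \<noteq> 0} \<subseteq> \<Omega>"
proof -
  have s: "k_times_differentiable k \<phi>" for k using assms by (simp add: test_functions_def smooth_def)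
  show d: "(\<phi> has_derivative frechet_derivative \<phi> (at x)) (at x)" for x by (rule ktd_SucD(1)[OF s])
  show "continuous_on UNIV \<phi>" by (rule ktd_cont[OF s])
  show "continuous_on UNIV (gradient \<phi>)" unfolding gradient_def[abs_def]
    by (intro continuous_intros ktd_cont[of 0] ktd_SucD(2)[OF s])
  have z: "\<phi> y = 0" if "y \<notin> closure {x. \<phi> x \<noteq> 0}" for y
    using that subsetD[OF closure_subset, of y "{x. \<phi> x \<noteq> 0}"] by blast
  show "x \<notin> closure {x. \<phi> x \<noteq> 0} \<Longrightarrow> \<phi> x = 0" by (rule z)
  show "gradient \<phi> x = 0" if "x \<notin> closure {x. \<phi> x \<noteq> 0}"
  proof -
    have "(\<phi> has_derivative (\<lambda>_. 0)) (at x)"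
    proof (rule has_derivative_transform_within_open[of "\<lambda>_. 0" "\<lambda>_. 0" x UNIV "- closure {x. \<phi> x \<noteq> 0}"])
      show "x \<in> - closure {x. \<phi> x \<noteq> 0}" using that by simp
      show "0 = \<phi> y" if "y \<in> - closure {x. \<phi> x \<noteq> 0}" for y using z[of y] that by simp
    qed (simp_all only: has_derivative_const open_Compl closed_closure)
    from frechet_derivative_at[OF this] have "frechet_derivative \<phi> (at x) = (\<lambda>_. 0)" by simp
    then show ?thesis by (simp add: gradient_def)
  qed
  show "compact (closure {x. \<phi> x \<noteq> 0})" "closure {x. \<phi> x \<noteq> 0} \<subseteq> \<Omega>" using assms by (auto simp: test_functions_def)
qed

lemma gradient_inner: 
  assumes "(\<phi> has_derivative \<phi>') (at x)" shows "gradient \<phi> x \<bullet> h = \<phi>' h"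
proof -
  have lin: "linear \<phi>'" using assms by (rule has_derivative_linear)
  have "frechet_derivative \<phi> (at x) = \<phi>'" using frechet_derivative_at[OF assms] by simp
  then have "gradient \<phi> x \<bullet> h = (\<Sum>b\<in>Basis. \<phi>' b * (b \<bullet> h))"
    by (simp add: gradient_def inner_sum_left)
  also have "\<dots> = (\<Sum>b\<in>Basis. (h \<bullet> b) *\<^sub>R \<phi>' b)"
    by (rule sum.cong[OF refl]) (metis inner_commute mult.commute real_scaleR_def)
  also have "\<dots> = \<phi>' (\<Sum>b\<in>Basis. (h \<bullet> b) *\<^sub>R b)" by (simp only: linear_sum[OF lin] linear_scale[OF lin])
  also have "\<dots> = \<phi>' h" by (simp only: euclidean_representation)
  finally show ?thesis .
qed

lemma test_functions_add_cmult:
  assumes "\<phi> \<in> test_functions \<Omega>" "\<psi> \<in> test_functions \<Omega>"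
  shows "(\<lambda>x. \<phi> x + c * \<psi> x) \<in> test_functions \<Omega>" "gradient (\<lambda>x. \<phi> x + c * \<psi> x) x = gradient \<phi> x + c *\<^sub>R gradient \<psi> x"
proof -
  have s: "k_times_differentiable k \<phi>" "k_times_differentiable k \<psi>" for k using assms by (auto simp: test_functions_def smooth_def)
  have sm: "smooth (\<lambda>x. \<phi> x + c * \<psi> x)" unfolding smooth_def by (intro allI ktd_add ktd_mult ktd_const s)
  have sub: "closure {x. \<phi> x + c * \<psi> x \<noteq> 0} \<subseteq> closure {x. \<phi> x \<noteq> 0} \<union> closure {x. \<psi> x \<noteq> 0}"
  proof -
    have "{x. \<phi> x + c * \<psi> x \<noteq> 0} \<subseteq> {x. \<phi> x \<noteq> 0} \<union> {x. \<psi> x \<noteq> 0}" by auto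
    from closure_mono[OF this] show ?thesis by (simp only: closure_Un)
  qed
  have "compact (closure {x. \<phi> x \<noteq> 0} \<union> closure {x. \<psi> x \<noteq> 0})"
    by (intro compact_Un test_functionsD(6)[OF assms(1)] test_functionsD(6)[OF assms(2)])
  from compact_Int_closed[OF this closed_closure[of "{x. \<phi> x + c * \<psi> x \<noteq> 0}"]] have cp: "compact (closure {x. \<phi> x + c * \<psi> x \<noteq> 0})"
    by (simp only: Int_absorb1[OF sub])
  have "closure {x. \<phi> x + c * \<psi> x \<noteq> 0} \<subseteq> \<Omega>"
    using sub test_functionsD(7)[OF assms(1)] test_functionsD(7)[OF assms(2)] by blast
  with cp sm show "(\<lambda>x. \<phi> x + c * \<psi> x) \<in> test_functions \<Omega>"
    unfolding test_functions_def by blast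
  have "((\<lambda>x. \<phi> x + c * \<psi> x) has_derivative (\<lambda>h. frechet_derivative \<phi> (at x) h + c * frechet_derivative \<psi> (at x) h)) (at x)"
    by (intro has_derivative_add has_derivative_mult_right test_functionsD(1)[OF assms(1)] test_functionsD(1)[OF assms(2)])
  from frechet_derivative_at[OF this]
  have "frechet_derivative (\<lambda>x. \<phi> x + c * \<psi> x) (at x) = (\<lambda>h. frechet_derivative \<phi> (at x) h + c * frechet_derivative \<psi> (at x) h)"
    by simp
  then show "gradient (\<lambda>x. \<phi> x + c * \<psi> x) x = gradient \<phi> x + c *\<^sub>R gradient \<psi> x"
    by (simp add: gradient_def scaleR_add_left sum.distrib scaleR_sum_right)
qed

section \<open>Square integrable functions\<close>

text \<open>Membership in \<open>L\<^sup>2\<close>, for vector-valued functions.\<close>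
definition sq :: "'a measure \<Rightarrow> ('a \<Rightarrow> 'b::euclidean_space) \<Rightarrow> bool" where
  "sq M f \<longleftrightarrow> f \<in> borel_measurable M \<and> integrable M (\<lambda>x. (norm (f x))\<^sup>2)"

lemma sq_measurable: "sq M f \<Longrightarrow> f \<in> borel_measurable M"
  unfolding sq_def by blast

lemma sq_norm_integrable: "sq M f \<Longrightarrow> integrable M (\<lambda>x. (norm (f x))\<^sup>2)"
  unfolding sq_def by blast

lemma sq_inner:
  assumes "sq M f" "sq M g" shows "integrable M (\<lambda>x. f x \<bullet> g x)"
proof (rule Bochner_Integration.integrable_bound[where f="\<lambda>x. (norm (f x))\<^sup>2 + (norm (g x))\<^sup>2"])
  show "integrable M (\<lambda>x. (norm (f x))\<^sup>2 + (norm (g x))\<^sup>2)" using assms by (simp add: sq_def)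
  show "(\<lambda>x. f x \<bullet> g x) \<in> borel_measurable M"
    by (intro borel_measurable_inner sq_measurable assms)
  have "\<bar>a \<bullet> b\<bar> \<le> (norm a)\<^sup>2 + (norm b)\<^sup>2" for a b :: 'b
  proof -
    have "2 * norm a * norm b \<le> (norm a)\<^sup>2 + (norm b)\<^sup>2" by (rule sum_squares_bound)
    moreover have "0 \<le> norm a * norm b" by (intro mult_nonneg_nonneg norm_ge_zero)
    ultimately show ?thesis using Cauchy_Schwarz_ineq2[of a b] by linarith
  qed
  note b = this
  have "norm (f x \<bullet> g x) \<le> norm ((norm (f x))\<^sup>2 + (norm (g x))\<^sup>2)" for x
    using b[of "f x" "g x"] unfolding real_norm_def by (rule order_trans[OF _ abs_ge_self])
  then show "AE x in M. norm (f x \<bullet> g x) \<le> norm ((norm (f x))\<^sup>2 + (norm (g x))\<^sup>2)" by (rule AE_I2)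
qed

lemma norm_add_scale_square: "(norm (a + c *\<^sub>R b))\<^sup>2 = (norm a)\<^sup>2 + 2 * c * (a \<bullet> b) + c\<^sup>2 * (norm b)\<^sup>2"
  for a b :: "'a::real_inner"
proof -
  have "2 * (a \<bullet> (c *\<^sub>R b)) = (norm (a + c *\<^sub>R b))\<^sup>2 - (norm a)\<^sup>2 - (norm (c *\<^sub>R b))\<^sup>2"
    using dot_norm[of a "c *\<^sub>R b"] by simp
  moreover have "(norm (c *\<^sub>R b))\<^sup>2 = c\<^sup>2 * (norm b)\<^sup>2" by (simp add: power_mult_distrib)
  ultimately show ?thesis by simp
qed

lemma sq_add_scale:
  assumes "sq M f" "sq M g" shows "sq M (\<lambda>x. f x + c *\<^sub>R g x)"
proof -
  have "(\<lambda>x. (norm (f x + c *\<^sub>R g x))\<^sup>2) = (\<lambda>x. (norm (f x))\<^sup>2 + 2 * c * (f x \<bullet> g x) + c\<^sup>2 * (norm (g x))\<^sup>2)"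
    by (rule ext) (rule norm_add_scale_square)
  moreover have "integrable M (\<lambda>x. (norm (f x))\<^sup>2 + 2 * c * (f x \<bullet> g x) + c\<^sup>2 * (norm (g x))\<^sup>2)"
    by (intro Bochner_Integration.integrable_add integrable_mult_right sq_norm_integrable sq_inner assms)
  moreover have "(\<lambda>x. f x + c *\<^sub>R g x) \<in> borel_measurable M"
    by (intro borel_measurable_add borel_measurable_scaleR borel_measurable_const sq_measurable assms)
  ultimately show ?thesis unfolding sq_def by (simp only:)
qed

lemma sq_diff: "sq M f \<Longrightarrow> sq M g \<Longrightarrow> sq M (\<lambda>x. f x - g x)"
  using sq_add_scale[of M f g "-1"] by simp

lemma sq_expand:
  assumes "sq M f" "sq M g"
  shows "(\<integral>x. (norm (f x + c *\<^sub>R g x))\<^sup>2 \<partial>M) = (\<integral>x. (norm (f x))\<^sup>2 \<partial>M) + 2 * c * (\<integral>x. f x \<bullet> g x \<partial>M) + c\<^sup>2 * (\<integral>x. (norm (g x))\<^sup>2 \<partial>M)"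
proof -
  have "(\<lambda>x. (norm (f x + c *\<^sub>R g x))\<^sup>2) = (\<lambda>x. (norm (f x))\<^sup>2 + 2 * c * (f x \<bullet> g x) + c\<^sup>2 * (norm (g x))\<^sup>2)"
    by (rule ext) (rule norm_add_scale_square)
  then show ?thesis using assms sq_inner[OF assms] by (simp add: sq_def)
qed

lemma sq_Cauchy_Schwarz:
  assumes "sq M f" "sq M g"
  shows "(\<integral>x. f x \<bullet> g x \<partial>M)\<^sup>2 \<le> (\<integral>x. (norm (f x))\<^sup>2 \<partial>M) * (\<integral>x. (norm (g x))\<^sup>2 \<partial>M)"
proof (rule quadratic_nonneg_discriminant)
  fix t :: real
  have "0 \<le> (\<integral>x. (norm (f x + t *\<^sub>R g x))\<^sup>2 \<partial>M)" by (rule Bochner_Integration.integral_nonneg) simp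
  then show "0 \<le> (\<integral>x. (norm (f x))\<^sup>2 \<partial>M) + 2 * t * (\<integral>x. f x \<bullet> g x \<partial>M) + t\<^sup>2 * (\<integral>x. (norm (g x))\<^sup>2 \<partial>M)"
    unfolding sq_expand[OF assms] .
qed

lemma sq_tendsto_inner:
  assumes F: "\<And>n. sq M (F n)" and f: "sq M f" and h: "sq M h"
    and lim: "(\<lambda>n. \<integral>x. (norm (F n x - f x))\<^sup>2 \<partial>M) \<longlonglongrightarrow> 0"
  shows "(\<lambda>n. \<integral>x. F n x \<bullet> h x \<partial>M) \<longlonglongrightarrow> (\<integral>x. f x \<bullet> h x \<partial>M)"
proof (rule LIM_zero_cancel, rule tendsto_rabs_zero_cancel)
  have b: "\<bar>(\<integral>x. F n x \<bullet> h x \<partial>M) - (\<integral>x. f x \<bullet> h x \<partial>M)\<bar> \<le>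
     sqrt ((\<integral>x. (norm (F n x - f x))\<^sup>2 \<partial>M) * (\<integral>x. (norm (h x))\<^sup>2 \<partial>M))" for n
  proof -
    have "(\<integral>x. F n x \<bullet> h x \<partial>M) - (\<integral>x. f x \<bullet> h x \<partial>M) = (\<integral>x. (F n x - f x) \<bullet> h x \<partial>M)"
      using sq_inner[OF F h] sq_inner[OF f h] by (simp add: inner_diff_left)
    then show ?thesis using sq_Cauchy_Schwarz[OF sq_diff[OF F f] h] by (intro real_le_rsqrt) (simp only: power2_abs)
  qed
  have "(\<lambda>n. sqrt ((\<integral>x. (norm (F n x - f x))\<^sup>2 \<partial>M) * (\<integral>x. (norm (h x))\<^sup>2 \<partial>M))) \<longlonglongrightarrow> sqrt (0 * (\<integral>x. (norm (h x))\<^sup>2 \<partial>M))"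
    by (intro tendsto_real_sqrt tendsto_mult lim tendsto_const)
  then have s: "(\<lambda>n. sqrt ((\<integral>x. (norm (F n x - f x))\<^sup>2 \<partial>M) * (\<integral>x. (norm (h x))\<^sup>2 \<partial>M))) \<longlonglongrightarrow> 0"
    by (simp only: mult_zero_left real_sqrt_zero)
  show "(\<lambda>n. \<bar>(\<integral>x. F n x \<bullet> h x \<partial>M) - (\<integral>x. f x \<bullet> h x \<partial>M)\<bar>) \<longlonglongrightarrow> 0"
    by (rule tendsto_sandwich[OF always_eventually always_eventually tendsto_const s]) (intro allI abs_ge_zero b)+
qed

lemma sq_tendsto_norm:
  assumes F: "\<And>n. sq M (F n)" and f: "sq M f"
    and lim: "(\<lambda>n. \<integral>x. (norm (F n x - f x))\<^sup>2 \<partial>M) \<longlonglongrightarrow> 0"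
  shows "(\<lambda>n. \<integral>x. (norm (F n x))\<^sup>2 \<partial>M) \<longlonglongrightarrow> (\<integral>x. (norm (f x))\<^sup>2 \<partial>M)"
proof -
  have "(\<integral>x. (norm (F n x))\<^sup>2 \<partial>M) = (\<integral>x. (norm (F n x - f x))\<^sup>2 \<partial>M) + 2 * (\<integral>x. F n x \<bullet> f x \<partial>M) - (\<integral>x. (norm (f x))\<^sup>2 \<partial>M)" for n
    using sq_expand[OF F f, of n "-1"] unfolding scaleR_minus1_left add_uminus_conv_diff power2_minus power_one by linarith
  moreover have "(\<lambda>n. (\<integral>x. (norm (F n x - f x))\<^sup>2 \<partial>M) + 2 * (\<integral>x. F n x \<bullet> f x \<partial>M) - (\<integral>x. (norm (f x))\<^sup>2 \<partial>M))
     \<longlonglongrightarrow> 0 + 2 * (\<integral>x. f x \<bullet> f x \<partial>M) - (\<integral>x. (norm (f x))\<^sup>2 \<partial>M)"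
    by (intro tendsto_add tendsto_diff tendsto_mult tendsto_const lim sq_tendsto_inner F f)
  moreover have "0 + 2 * (\<integral>x. f x \<bullet> f x \<partial>M) - (\<integral>x. (norm (f x))\<^sup>2 \<partial>M) = (\<integral>x. (norm (f x))\<^sup>2 \<partial>M)"
    unfolding power2_norm_eq_inner by linarith
  ultimately show ?thesis by (simp only:)
qed

lemma sq_complete:
  fixes F :: "nat \<Rightarrow> 'a \<Rightarrow> 'b::euclidean_space"
  assumes F: "\<And>n. sq M (F n)"
    and cau: "\<And>e. 0 < e \<Longrightarrow> \<exists>N. \<forall>m\<ge>N. \<forall>n\<ge>N. (\<integral>x. (norm (F m x - F n x))\<^sup>2 \<partial>M) < e"
  shows "\<exists>f. sq M f \<and> (\<lambda>n. \<integral>x. (norm (F n x - f x))\<^sup>2 \<partial>M) \<longlonglongrightarrow> 0"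
proof -
  define D where "D = (\<lambda>m n. \<integral>x. (norm (F m x - F n x))\<^sup>2 \<partial>M)"
  have [measurable]: "F n \<in> borel_measurable M" for n using F by (simp add: sq_def)
  have int: "integrable M (\<lambda>x. (norm (F m x - F n x))\<^sup>2)" for m n using sq_diff[OF F F] by (simp add: sq_def)
  have Dnn: "(\<integral>\<^sup>+ x. ennreal ((norm (F m x - F n x))\<^sup>2) \<partial>M) = ennreal (D m n)" for m n
    unfolding D_def by (rule nn_integral_eq_integral[OF int]) simp
  have "\<exists>N. \<forall>m\<ge>N. \<forall>n\<ge>N. D m n < (1/8) ^ k" for k using cau[of "(1/8)^k"] by (simp add: D_def)
  then obtain N where N: "\<And>k m n. m \<ge> N k \<Longrightarrow> n \<ge> N k \<Longrightarrow> D m n < (1/8) ^ k" by metis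
  define r where "r = (\<lambda>k. k + (\<Sum>j\<le>k. N j))"
  have rN: "N k \<le> r k" for k unfolding r_def using member_le_sum[of k "{..k}" N] by simp
  have rmono: "r k \<le> r (Suc k)" for k by (simp add: r_def)
  have rge: "k \<le> r k" for k by (simp add: r_def)
  define G where "G = (\<lambda>k x. (norm (F (r (Suc k)) x - F (r k) x))\<^sup>2)"
  have "(\<integral>\<^sup>+ x. (\<Sum>k. ennreal (2 ^ k * G k x)) \<partial>M) = (\<Sum>k. \<integral>\<^sup>+ x. ennreal (2 ^ k * G k x) \<partial>M)"
    by (rule nn_integral_suminf) (simp add: G_def)
  also have "\<dots> \<le> (\<Sum>k. ennreal ((1/4) ^ k))"
  proof (rule suminf_le)
    fix k
    have "(\<integral>\<^sup>+ x. ennreal (2 ^ k * G k x) \<partial>M) = ennreal (2 ^ k) * ennreal (D (r (Suc k)) (r k))"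
      unfolding Dnn[symmetric] G_def by (simp add: ennreal_mult nn_integral_cmult)
    also have "\<dots> = ennreal (2 ^ k * D (r (Suc k)) (r k))"
      by (rule ennreal_mult[symmetric]) (auto simp: D_def intro: Bochner_Integration.integral_nonneg)
    also have "\<dots> \<le> ennreal (2 ^ k * (1/8) ^ k)"
      using N[of k "r (Suc k)" "r k"] rN[of k] rmono[of k] by (intro ennreal_leI mult_left_mono) auto
    finally show "(\<integral>\<^sup>+ x. ennreal (2 ^ k * G k x) \<partial>M) \<le> ennreal ((1/4) ^ k)" by (simp flip: power_mult_distrib)
  qed auto
  also have "\<dots> < \<infinity>"
    by (subst suminf_ennreal2) (auto intro!: summable_geometric)
  finally have "AE x in M. (\<Sum>k. ennreal (2 ^ k * G k x)) \<noteq> \<infinity>"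
    by (intro nn_integral_noteq_infinite) (auto simp: G_def)
  then have conv: "AE x in M. convergent (\<lambda>k. F (r k) x)"
  proof eventually_elim
    case (elim x)
    then obtain C where C: "(\<Sum>k. ennreal (2 ^ k * G k x)) = ennreal C" "0 \<le> C"
      by (metis ennreal_cases infinity_ennreal_def)
    have b: "norm (F (r (Suc k)) x - F (r k) x) \<le> sqrt C * (1 / sqrt 2) ^ k" for k
    proof -
      have "ennreal (2 ^ k * G k x) \<le> ennreal C" unfolding C(1)[symmetric]
        using sum_le_suminf[of "\<lambda>k. ennreal (2 ^ k * G k x)" "{k}"] by simp
      then have "2 ^ k * G k x \<le> C" using C(2) by (simp add: ennreal_le_iff)
      then have "G k x \<le> C * (1/2) ^ k" by (simp add: field_simps power_divide)
      then have "norm (F (r (Suc k)) x - F (r k) x) \<le> sqrt (C * (1/2) ^ k)" unfolding G_def by (rule real_le_rsqrt)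
      then show ?thesis by (simp add: real_sqrt_mult real_sqrt_power real_sqrt_divide)
    qed
    have "summable (\<lambda>k. sqrt C * (1 / sqrt 2) ^ k)" by (intro summable_mult summable_geometric) simp
    then have "summable (\<lambda>k. F (r (Suc k)) x - F (r k) x)" by (rule summable_comparison_test') (use b in simp)
    then have "convergent (\<lambda>n. \<Sum>k<n. F (r (Suc k)) x - F (r k) x)" by (simp add: summable_iff_convergent)
    then have "convergent (\<lambda>n. F (r n) x - F (r 0) x)" unfolding sum_lessThan_telescope[of "\<lambda>k. F (r k) x"] .
    then have "convergent (\<lambda>n. (F (r n) x - F (r 0) x) + F (r 0) x)" by (intro convergent_add convergent_const)
    then show ?case by simp
  qed
  define f where "f = (\<lambda>x. lim (\<lambda>k. F (r k) x))"
  have fm [measurable]: "f \<in> borel_measurable M" unfolding f_def by measurable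
  have lim: "AE x in M. (\<lambda>k. F (r k) x) \<longlonglongrightarrow> f x" using conv by eventually_elim (simp add: f_def convergent_LIMSEQ_iff)
  have small: "(\<integral>\<^sup>+ x. ennreal ((norm (F n x - f x))\<^sup>2) \<partial>M) \<le> ennreal ((1/8) ^ k)" if n: "n \<ge> N k" for n k
  proof -
    have "(\<integral>\<^sup>+ x. ennreal ((norm (F n x - f x))\<^sup>2) \<partial>M) \<le> (\<integral>\<^sup>+ x. liminf (\<lambda>j. ennreal ((norm (F n x - F (r j) x))\<^sup>2)) \<partial>M)"
    proof (rule nn_integral_mono_AE)
      show "AE x in M. ennreal ((norm (F n x - f x))\<^sup>2) \<le> liminf (\<lambda>j. ennreal ((norm (F n x - F (r j) x))\<^sup>2))"
        using lim
      proof eventually_elim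
        case (elim x)
        have "(\<lambda>j. ennreal ((norm (F n x - F (r j) x))\<^sup>2)) \<longlonglongrightarrow> ennreal ((norm (F n x - f x))\<^sup>2)"
          by (intro tendsto_ennrealI tendsto_intros elim)
        from lim_imp_Liminf[OF trivial_limit_sequentially this] show ?case by (simp only: order_refl)
      qed
    qed
    also have "\<dots> \<le> liminf (\<lambda>j. \<integral>\<^sup>+ x. ennreal ((norm (F n x - F (r j) x))\<^sup>2) \<partial>M)"
      by (rule nn_integral_liminf) simp
    also have "\<dots> \<le> ennreal ((1/8) ^ k)"
    proof (rule Liminf_le)
      show "\<forall>\<^sub>F j in sequentially. (\<integral>\<^sup>+ x. ennreal ((norm (F n x - F (r j) x))\<^sup>2) \<partial>M) \<le> ennreal ((1/8) ^ k)"
        using eventually_ge_at_top[of "N k"]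
      proof eventually_elim
        case (elim j)
        then have "D n (r j) < (1/8) ^ k" using N n rge[of j] by (meson order_trans)
        then show ?case unfolding Dnn by (intro ennreal_leI) simp
      qed
    qed simp
    finally show ?thesis .
  qed
  have sqd: "sq M (\<lambda>x. F n x - f x)" if "n \<ge> N k" for n k
    unfolding sq_def
  proof (intro conjI integrableI_bounded)
    have "(\<integral>\<^sup>+ x. ennreal (norm ((norm (F n x - f x))\<^sup>2)) \<partial>M) \<le> ennreal ((1/8) ^ k)" using small[OF that] by simp
    then show "(\<integral>\<^sup>+ x. ennreal (norm ((norm (F n x - f x))\<^sup>2)) \<partial>M) < \<infinity>" by (rule order.strict_trans1) simp
  qed simp_all
  have sqf: "sq M f"
  proof -
    have "sq M (\<lambda>x. F (N 0) x - (F (N 0) x - f x))" by (rule sq_diff[OF F sqd[OF order_refl]])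
    then show ?thesis by simp
  qed
  have "(\<lambda>n. \<integral>x. (norm (F n x - f x))\<^sup>2 \<partial>M) \<longlonglongrightarrow> 0"
  proof (rule LIMSEQ_I)
    fix e :: real assume "0 < e"
    then obtain k where k: "(1/8) ^ k < e" using real_arch_pow_inv[of e "1/8"] by auto
    have "norm ((\<integral>x. (norm (F n x - f x))\<^sup>2 \<partial>M) - 0) < e" if n: "n \<ge> N k" for n
    proof -
      have "ennreal (\<integral>x. (norm (F n x - f x))\<^sup>2 \<partial>M) \<le> ennreal ((1/8) ^ k)"
        using small[OF n] nn_integral_eq_integral[of M "\<lambda>x. (norm (F n x - f x))\<^sup>2"] sqd[OF n] by (simp add: sq_def)
      then have "(\<integral>x. (norm (F n x - f x))\<^sup>2 \<partial>M) \<le> (1/8) ^ k" by (simp add: ennreal_le_iff)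
      then show ?thesis using k by (simp add: Bochner_Integration.integral_nonneg)
    qed
    then show "\<exists>no. \<forall>n\<ge>no. norm ((\<integral>x. (norm (F n x - f x))\<^sup>2 \<partial>M) - 0) < e" by blast
  qed
  then show ?thesis using sqf by blast
qed

section \<open>The first eigenvalue as a minimum of the Rayleigh quotient\<close>

lemma sq_continuous_compact:
  fixes g :: "'a::euclidean_space \<Rightarrow> 'b::euclidean_space"
  assumes "continuous_on UNIV g" "compact K" "\<And>x. x \<notin> K \<Longrightarrow> g x = 0"
  shows "sq lebesgue g"
proof -
  have m: "g \<in> borel_measurable lborel" using assms(1) by (simp add: borel_measurable_continuous_onI)
  have "integrable lborel (\<lambda>x. indicator K x *\<^sub>R (norm (g x))\<^sup>2)"
    by (rule borel_integrable_compact[OF assms(2)]) (intro continuous_intros continuous_on_subset[OF assms(1) subset_UNIV])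
  moreover have "(\<lambda>x. indicator K x *\<^sub>R (norm (g x))\<^sup>2) = (\<lambda>x. (norm (g x))\<^sup>2)"
  proof
    fix x show "indicator K x *\<^sub>R (norm (g x))\<^sup>2 = (norm (g x))\<^sup>2" using assms(3)[of x] by (cases "x \<in> K") simp_all
  qed
  ultimately have "integrable lborel (\<lambda>x. (norm (g x))\<^sup>2)" by simp
  moreover have "(\<lambda>x. (norm (g x))\<^sup>2) \<in> borel_measurable lborel" using m by measurable
  ultimately have "integrable lebesgue (\<lambda>x. (norm (g x))\<^sup>2)" by (simp only: integrable_completion)
  then show ?thesis unfolding sq_def using measurable_completion[OF m] by blast
qed

lemma test_functions_sq:
  assumes "\<phi> \<in> test_functions \<Omega>" shows "sq lebesgue \<phi>" "sq lebesgue (gradient \<phi>)"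
  by (rule sq_continuous_compact[OF _ test_functionsD(6)[OF assms]]; (intro test_functionsD(2,3)[OF assms])?;
      use test_functionsD(4,5)[OF assms] in blast)+

definition mass :: "('a::euclidean_space \<Rightarrow> real) \<Rightarrow> real" where
  "mass \<phi> = (LINT x|lebesgue. (norm (\<phi> x))\<^sup>2)"
definition energy :: "('a::euclidean_space \<Rightarrow> real) \<Rightarrow> real" where
  "energy \<phi> = (LINT x|lebesgue. (norm (gradient \<phi> x))\<^sup>2)"

lemma mass_nonneg: "0 \<le> mass \<phi>" and energy_nonneg: "0 \<le> energy \<phi>"
  unfolding mass_def energy_def by (intro Bochner_Integration.integral_nonneg; simp)+

lemma mass_energy_expand:
  assumes "\<phi> \<in> test_functions \<Omega>" "\<psi> \<in> test_functions \<Omega>"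
  shows "mass (\<lambda>x. \<phi> x + c * \<psi> x) = mass \<phi> + 2 * c * (LINT x|lebesgue. \<phi> x \<bullet> \<psi> x) + c\<^sup>2 * mass \<psi>"
    and "energy (\<lambda>x. \<phi> x + c * \<psi> x) = energy \<phi> + 2 * c * (LINT x|lebesgue. gradient \<phi> x \<bullet> gradient \<psi> x) + c\<^sup>2 * energy \<psi>"
  using sq_expand[OF test_functions_sq(1)[OF assms(1)] test_functions_sq(1)[OF assms(2)], of c]
    sq_expand[OF test_functions_sq(2)[OF assms(1)] test_functions_sq(2)[OF assms(2)], of c]
  unfolding mass_def energy_def test_functions_add_cmult(2)[OF assms] real_scaleR_def by blast+

definition Rayleigh_bound :: "'a::euclidean_space set \<Rightarrow> real \<Rightarrow> bool" where
  "Rayleigh_bound \<Omega> m \<longleftrightarrow> (\<forall>\<phi>\<in>test_functions \<Omega>. m * mass \<phi> \<le> energy \<phi>)"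

text \<open>Test the eigenvalue equation with the functions that approximate the eigenfunction; in the limit the eigenfunction is its own test function.\<close>
lemma dirichlet_eigenvalue_ge:
  assumes ev: "dirichlet_eigenvalue \<Omega> \<mu>" and m: "Rayleigh_bound \<Omega> m" shows "m \<le> \<mu>"
proof -
  obtain u g \<phi> where sq: "square_integrable \<Omega> u" "square_integrable \<Omega> g"
     and \<phi>: "\<And>n. \<phi> n \<in> test_functions \<Omega>" and lim: "tendsto_L2 \<Omega> \<phi> u" "tendsto_L2 \<Omega> (\<lambda>n. gradient (\<phi> n)) g"
     and nz: "\<not> (AE x in lebesgue. x \<in> \<Omega> \<longrightarrow> u x = 0)"
     and eq: "\<And>\<psi>. \<psi> \<in> test_functions \<Omega> \<Longrightarrow> (LINT x:\<Omega>|lebesgue. g x \<bullet> gradient \<psi> x) = \<mu> * (LINT x:\<Omega>|lebesgue. u x * \<psi> x)"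
    using ev unfolding dirichlet_eigenvalue_def H10_with_gradient_def by blast
  define U where "U = (\<lambda>x. indicator \<Omega> x *\<^sub>R u x)"
  define G where "G = (\<lambda>x. indicator \<Omega> x *\<^sub>R g x)"
  have n: "(norm (indicator \<Omega> x *\<^sub>R y))\<^sup>2 = indicator \<Omega> x *\<^sub>R (norm y)\<^sup>2" for x and y :: "'b::real_normed_vector"
    by (simp add: indicator_def)
  have sqU: "sq lebesgue U" and sqG: "sq lebesgue G"
    using sq unfolding sq_def U_def G_def n square_integrable_def set_borel_measurable_def set_integrable_def by blast+
  have out: "\<phi> n x = 0 \<and> gradient (\<phi> n) x = 0" if "x \<notin> \<Omega>" for n x
    using test_functionsD(4,5,7)[OF \<phi>[of n]] that by blast
  have "indicator \<Omega> x *\<^sub>R (norm (\<phi> n x - u x))\<^sup>2 = (norm (\<phi> n x - U x))\<^sup>2" for n x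
    using out[of x n] by (simp add: U_def indicator_def)
  then have limU: "(\<lambda>n. \<integral>x. (norm (\<phi> n x - U x))\<^sup>2 \<partial>lebesgue) \<longlonglongrightarrow> 0"
    using lim(1) unfolding tendsto_L2_def set_lebesgue_integral_def by (simp only:)
  have "indicator \<Omega> x *\<^sub>R (norm (gradient (\<phi> n) x - g x))\<^sup>2 = (norm (gradient (\<phi> n) x - G x))\<^sup>2" for n x
    using out[of x n] by (simp add: G_def indicator_def)
  then have limG: "(\<lambda>n. \<integral>x. (norm (gradient (\<phi> n) x - G x))\<^sup>2 \<partial>lebesgue) \<longlonglongrightarrow> 0"
    using lim(2) unfolding tendsto_L2_def set_lebesgue_integral_def by (simp only:)
  note s = test_functions_sq[OF \<phi>]
  have e: "(\<integral>x. gradient (\<phi> n) x \<bullet> G x \<partial>lebesgue) = \<mu> * (\<integral>x. \<phi> n x \<bullet> U x \<partial>lebesgue)" for n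
  proof -
    have "indicator \<Omega> x *\<^sub>R (g x \<bullet> gradient (\<phi> n) x) = gradient (\<phi> n) x \<bullet> G x" for x
      by (simp add: G_def inner_commute)
    moreover have "indicator \<Omega> x *\<^sub>R (u x * \<phi> n x) = \<phi> n x \<bullet> U x" for x by (simp add: U_def)
    ultimately show ?thesis using eq[OF \<phi>[of n]] unfolding set_lebesgue_integral_def by (simp only:)
  qed
  have L1: "(\<lambda>n. \<integral>x. gradient (\<phi> n) x \<bullet> G x \<partial>lebesgue) \<longlonglongrightarrow> (\<integral>x. G x \<bullet> G x \<partial>lebesgue)"
    by (rule sq_tendsto_inner[OF s(2) sqG sqG limG])
  have L2: "(\<lambda>n. \<integral>x. \<phi> n x \<bullet> U x \<partial>lebesgue) \<longlonglongrightarrow> (\<integral>x. U x \<bullet> U x \<partial>lebesgue)"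
    by (rule sq_tendsto_inner[OF s(1) sqU sqU limU])
  have GU: "(\<integral>x. G x \<bullet> G x \<partial>lebesgue) = \<mu> * (\<integral>x. U x \<bullet> U x \<partial>lebesgue)"
    by (rule LIMSEQ_unique[OF L1]) (unfold e, rule tendsto_mult_left[OF L2])
  have L3: "(\<lambda>n. mass (\<phi> n)) \<longlonglongrightarrow> (\<integral>x. U x \<bullet> U x \<partial>lebesgue)"
    using sq_tendsto_norm[OF s(1) sqU limU] unfolding mass_def power2_norm_eq_inner[of "U _"] .
  have L4: "(\<lambda>n. energy (\<phi> n)) \<longlonglongrightarrow> (\<integral>x. G x \<bullet> G x \<partial>lebesgue)"
    using sq_tendsto_norm[OF s(2) sqG limG] unfolding energy_def power2_norm_eq_inner[of "G _"] .
  have "m * (\<integral>x. U x \<bullet> U x \<partial>lebesgue) \<le> (\<integral>x. G x \<bullet> G x \<partial>lebesgue)"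
    by (rule LIMSEQ_le[OF tendsto_mult_left[OF L3] L4]) (use m \<phi> in \<open>auto simp: Rayleigh_bound_def\<close>)
  then have le: "m * (\<integral>x. U x \<bullet> U x \<partial>lebesgue) \<le> \<mu> * (\<integral>x. U x \<bullet> U x \<partial>lebesgue)" unfolding GU .
  have "(\<integral>x. U x \<bullet> U x \<partial>lebesgue) \<noteq> 0"
  proof
    assume "(\<integral>x. U x \<bullet> U x \<partial>lebesgue) = 0"
    then have "AE x in lebesgue. U x \<bullet> U x = 0"
      using integral_nonneg_eq_0_iff_AE[of lebesgue "\<lambda>x. U x \<bullet> U x"] sq_inner[OF sqU sqU] by simp
    then have "AE x in lebesgue. x \<in> \<Omega> \<longrightarrow> u x = 0" by eventually_elim (auto simp: U_def)
    then show False using nz by blast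
  qed
  moreover have "0 \<le> (\<integral>x. U x \<bullet> U x \<partial>lebesgue)" by (rule Bochner_Integration.integral_nonneg) simp
  ultimately have "0 < (\<integral>x. U x \<bullet> U x \<partial>lebesgue)" by linarith
  then show ?thesis using le by (simp only: mult_le_cancel_right_pos)
qed

text \<open>Compactness of the embedding into \<open>L\<^sup>2\<close>, as a statement about test functions only.\<close>
definition Rellich :: "'a::euclidean_space set \<Rightarrow> bool" where
  "Rellich \<Omega> \<longleftrightarrow> (\<forall>\<phi> K. (\<forall>n. \<phi> n \<in> test_functions \<Omega> \<and> mass (\<phi> n) \<le> K \<and> energy (\<phi> n) \<le> K) \<longrightarrow>
     (\<exists>r::nat\<Rightarrow>nat. strict_mono r \<and> (\<forall>e>0. \<exists>N. \<forall>i\<ge>N. \<forall>j\<ge>N. mass (\<lambda>x. \<phi> (r i) x + (- 1) * \<phi> (r j) x) < e)))"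

text \<open>The parallelogram identity turns a minimising sequence that is Cauchy in \<open>L\<^sup>2\<close> into one that is Cauchy in energy. The Rayleigh quotient of its limit,
  perturbed by a test function, is a nonnegative quadratic in the perturbation parameter, so that its linear term vanishes.\<close>
lemma minimiser_eigenvalue:
  assumes \<Omega>: "open \<Omega>" and \<phi>: "\<And>n::nat. \<phi> n \<in> test_functions \<Omega>" and one: "\<And>n. mass (\<phi> n) = 1"
    and en: "(\<lambda>n. energy (\<phi> n)) \<longlonglongrightarrow> m" and m: "Rayleigh_bound \<Omega> m"
    and cau: "\<And>e. 0 < e \<Longrightarrow> \<exists>N. \<forall>i\<ge>N. \<forall>j\<ge>N. mass (\<lambda>x. \<phi> i x + (- 1) * \<phi> j x) < e"
  shows "dirichlet_eigenvalue \<Omega> m"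
proof -
  note s = test_functions_sq[OF \<phi>]
  have dm: "mass (\<lambda>x. \<phi> i x + (- 1) * \<phi> j x) = (\<integral>x. (norm (\<phi> i x - \<phi> j x))\<^sup>2 \<partial>lebesgue)" for i j
    by (simp add: mass_def)
  have de: "energy (\<lambda>x. \<phi> i x + (- 1) * \<phi> j x) = (\<integral>x. (norm (gradient (\<phi> i) x - gradient (\<phi> j) x))\<^sup>2 \<partial>lebesgue)" for i j
    unfolding energy_def test_functions_add_cmult(2)[OF \<phi> \<phi>] by simp
  have par: "energy (\<lambda>x. \<phi> i x + (- 1) * \<phi> j x) \<le> 2 * (energy (\<phi> i) - m) + 2 * (energy (\<phi> j) - m) + m * mass (\<lambda>x. \<phi> i x + (- 1) * \<phi> j x)" for i j
  proof -
    have "m * mass (\<lambda>x. \<phi> i x + 1 * \<phi> j x) \<le> energy (\<lambda>x. \<phi> i x + 1 * \<phi> j x)"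
      using m test_functions_add_cmult(1)[OF \<phi> \<phi>] unfolding Rayleigh_bound_def by blast
    then show ?thesis
      unfolding mass_energy_expand[OF \<phi> \<phi>] one by (simp add: algebra_simps)
  qed
  have ar: "E < e" if "E \<le> 2 * a + 2 * b + c" "a < e / 6" "b < e / 6" "c \<le> e / 6" "0 < e" for E a b c e :: real
    using that by linarith
  have cauG: "\<exists>N. \<forall>i\<ge>N. \<forall>j\<ge>N. energy (\<lambda>x. \<phi> i x + (- 1) * \<phi> j x) < e" if e: "0 < e" for e
  proof -
    define k where "k = \<bar>m\<bar> + 1"
    have k: "k > 0" "m \<le> k" by (auto simp: k_def)
    define d where "d = e / (6 * k)"
    have d: "d > 0" using e k by (simp add: d_def)
    obtain N1 where N1: "\<And>i j. i \<ge> N1 \<Longrightarrow> j \<ge> N1 \<Longrightarrow> mass (\<lambda>x. \<phi> i x + (- 1) * \<phi> j x) < d" using cau[OF d] by blast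
    obtain N2 where N2: "\<And>i. i \<ge> N2 \<Longrightarrow> \<bar>energy (\<phi> i) - m\<bar> < e / 6"
      using LIMSEQ_D[OF en, of "e / 6"] e by (auto simp: real_norm_def)
    have "energy (\<lambda>x. \<phi> i x + (- 1) * \<phi> j x) < e" if "i \<ge> max N1 N2" "j \<ge> max N1 N2" for i j
    proof -
      have "m * mass (\<lambda>x. \<phi> i x + (- 1) * \<phi> j x) \<le> k * d"
        using N1[of i j] that k by (intro mult_mono) (auto simp: mass_nonneg)
      also have "\<dots> = e / 6" using k by (simp add: d_def)
      finally have 1: "m * mass (\<lambda>x. \<phi> i x + (- 1) * \<phi> j x) \<le> e / 6" .
      have "\<bar>energy (\<phi> i) - m\<bar> < e / 6" "\<bar>energy (\<phi> j) - m\<bar> < e / 6" using N2 that by auto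
      then have "energy (\<phi> i) - m < e / 6" "energy (\<phi> j) - m < e / 6" by (auto simp only: abs_less_iff)
      from ar[OF par this 1 e] show ?thesis .
    qed
    then show ?thesis by blast
  qed
  obtain u where u: "sq lebesgue u" "(\<lambda>n. \<integral>x. (norm (\<phi> n x - u x))\<^sup>2 \<partial>lebesgue) \<longlonglongrightarrow> 0"
    using sq_complete[of lebesgue \<phi>, OF s(1)] cau unfolding dm by blast
  obtain g where g: "sq lebesgue g" "(\<lambda>n. \<integral>x. (norm (gradient (\<phi> n) x - g x))\<^sup>2 \<partial>lebesgue) \<longlonglongrightarrow> 0"
    using sq_complete[of lebesgue "\<lambda>n. gradient (\<phi> n)", OF s(2)] cauG unfolding de by blast
  have mu: "\<Omega> \<in> sets lebesgue" using \<Omega> by (simp add: borel_open)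
  have sqi: "square_integrable \<Omega> f" if "sq lebesgue f" for f :: "'a \<Rightarrow> 'b::euclidean_space"
    unfolding square_integrable_def set_borel_measurable_def set_integrable_def
    using mu sq_measurable[OF that] integrable_mult_indicator[OF mu sq_norm_integrable[OF that]]
    by (intro conjI borel_measurable_scaleR borel_measurable_indicator) auto
  have tl: "tendsto_L2 \<Omega> F f" if "\<And>n. sq lebesgue (F n)" "sq lebesgue f" "(\<lambda>n. \<integral>x. (norm (F n x - f x))\<^sup>2 \<partial>lebesgue) \<longlonglongrightarrow> 0" for F and f :: "'a \<Rightarrow> 'b::euclidean_space"
    unfolding tendsto_L2_def
  proof (rule tendsto_sandwich[OF always_eventually always_eventually tendsto_const that(3)]; intro allI)
    fix n
    have i: "integrable lebesgue (\<lambda>x. (norm (F n x - f x))\<^sup>2)" by (rule sq_norm_integrable[OF sq_diff[OF that(1,2)]])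
    show "0 \<le> (LINT x:\<Omega>|lebesgue. (norm (F n x - f x))\<^sup>2)"
      unfolding set_lebesgue_integral_def by (rule Bochner_Integration.integral_nonneg) (simp add: indicator_def)
    show "(LINT x:\<Omega>|lebesgue. (norm (F n x - f x))\<^sup>2) \<le> (\<integral>x. (norm (F n x - f x))\<^sup>2 \<partial>lebesgue)"
      unfolding set_lebesgue_integral_def
      by (rule integral_mono[OF integrable_mult_indicator[OF mu i] i]) (simp add: indicator_def)
  qed
  have H: "H10_with_gradient \<Omega> u g"
    unfolding H10_with_gradient_def using sqi[OF u(1)] sqi[OF g(1)] \<phi> tl[OF s(1) u] tl[OF s(2) g] by blast
  have out: "\<psi> x = 0" "gradient \<psi> x = 0" if "\<psi> \<in> test_functions \<Omega>" "x \<notin> \<Omega>" for \<psi> x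
    using test_functionsD(4,5,7)[OF that(1)] that(2) by blast+
  have "(\<lambda>n::nat. 1::real) \<longlonglongrightarrow> (\<integral>x. (norm (u x))\<^sup>2 \<partial>lebesgue)"
    using sq_tendsto_norm[OF s(1) u] one unfolding mass_def by (simp only:)
  then have uu: "(\<integral>x. u x \<bullet> u x \<partial>lebesgue) = 1"
    unfolding power2_norm_eq_inner by (rule LIMSEQ_unique[OF _ tendsto_const])
  have gg: "(\<integral>x. (norm (g x))\<^sup>2 \<partial>lebesgue) = m"
    by (rule LIMSEQ_unique[OF sq_tendsto_norm[OF s(2) g] en[unfolded energy_def]])
  have nz: "\<not> (AE x in lebesgue. x \<in> \<Omega> \<longrightarrow> u x = 0)"
  proof
    assume a: "AE x in lebesgue. x \<in> \<Omega> \<longrightarrow> u x = 0"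
    have "(\<integral>x. \<phi> n x \<bullet> u x \<partial>lebesgue) = 0" for n
    proof (rule integral_eq_zero_AE)
      show "AE x in lebesgue. \<phi> n x \<bullet> u x = 0" using a
      proof eventually_elim
        case (elim x)
        then show ?case using out(1)[OF \<phi>, of x n] by (cases "x \<in> \<Omega>") simp_all
      qed
    qed
    then have "(\<lambda>n::nat. 0) \<longlonglongrightarrow> (\<integral>x. u x \<bullet> u x \<partial>lebesgue)"
      using sq_tendsto_inner[OF s(1) u(1) u(1) u(2)] by (simp only:)
    from LIMSEQ_unique[OF this tendsto_const] show False using uu by simp
  qed
  have weak: "(LINT x:\<Omega>|lebesgue. g x \<bullet> gradient \<psi> x) = m * (LINT x:\<Omega>|lebesgue. u x * \<psi> x)"
    if \<psi>: "\<psi> \<in> test_functions \<Omega>" for \<psi>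
  proof -
    note s\<psi> = test_functions_sq[OF \<psi>]
    define a where "a = (\<integral>x. u x \<bullet> \<psi> x \<partial>lebesgue)"
    define b where "b = (\<integral>x. g x \<bullet> gradient \<psi> x \<partial>lebesgue)"
    have La: "(\<lambda>n. \<integral>x. \<phi> n x \<bullet> \<psi> x \<partial>lebesgue) \<longlonglongrightarrow> a" unfolding a_def by (rule sq_tendsto_inner[OF s(1) u(1) s\<psi>(1) u(2)])
    have Lb: "(\<lambda>n. \<integral>x. gradient (\<phi> n) x \<bullet> gradient \<psi> x \<partial>lebesgue) \<longlonglongrightarrow> b" unfolding b_def by (rule sq_tendsto_inner[OF s(2) g(1) s\<psi>(2) g(2)])
    have q: "0 \<le> 0 + 2 * t * (b - m * a) + t\<^sup>2 * (energy \<psi> - m * mass \<psi>)" for t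
    proof -
      have ineq: "m * (1 + 2 * t * (LINT x|lebesgue. \<phi> n x \<bullet> \<psi> x) + t\<^sup>2 * mass \<psi>) \<le>
         energy (\<phi> n) + 2 * t * (LINT x|lebesgue. gradient (\<phi> n) x \<bullet> gradient \<psi> x) + t\<^sup>2 * energy \<psi>" for n
      proof -
        have "m * mass (\<lambda>x. \<phi> n x + t * \<psi> x) \<le> energy (\<lambda>x. \<phi> n x + t * \<psi> x)"
          using m test_functions_add_cmult(1)[OF \<phi> \<psi>] unfolding Rayleigh_bound_def by blast
        then show ?thesis unfolding mass_energy_expand[OF \<phi> \<psi>] one .
      qed
      have "m * (1 + 2 * t * a + t\<^sup>2 * mass \<psi>) \<le> m + 2 * t * b + t\<^sup>2 * energy \<psi>"
        by (rule LIMSEQ_le[where X="\<lambda>n. m * (1 + 2 * t * (LINT x|lebesgue. \<phi> n x \<bullet> \<psi> x) + t\<^sup>2 * mass \<psi>)"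
              and Y="\<lambda>n. energy (\<phi> n) + 2 * t * (LINT x|lebesgue. gradient (\<phi> n) x \<bullet> gradient \<psi> x) + t\<^sup>2 * energy \<psi>"])
           (intro tendsto_add tendsto_mult tendsto_const La Lb en exI[of _ 0] allI impI ineq)+
      then show ?thesis by (simp add: algebra_simps)
    qed
    have "(b - m * a)\<^sup>2 \<le> 0 * (energy \<psi> - m * mass \<psi>)" by (rule quadratic_nonneg_discriminant[OF q])
    then have ba: "b = m * a" by simp
    have "indicator \<Omega> x *\<^sub>R (g x \<bullet> gradient \<psi> x) = g x \<bullet> gradient \<psi> x" for x
      using out(2)[OF \<psi>, of x] by (auto simp: indicator_def)
    moreover have "indicator \<Omega> x *\<^sub>R (u x * \<psi> x) = u x \<bullet> \<psi> x" for x
      using out(1)[OF \<psi>, of x] by (auto simp: indicator_def)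
    ultimately show ?thesis using ba unfolding set_lebesgue_integral_def a_def b_def by (simp only:)
  qed
  show ?thesis unfolding dirichlet_eigenvalue_def using H nz weak by blast
qed

lemma test_functions_normalise:
  assumes "\<phi> \<in> test_functions \<Omega>" "0 < mass \<phi>"
  obtains \<psi> where "\<psi> \<in> test_functions \<Omega>" "mass \<psi> = 1" "energy \<psi> = energy \<phi> / mass \<phi>"
proof -
  define c where "c = 1 / sqrt (mass \<phi>)"
  have c2: "c\<^sup>2 = 1 / mass \<phi>" using assms(2) by (simp add: c_def power_divide)
  define \<psi> where "\<psi> = (\<lambda>x. \<phi> x + (c - 1) * \<phi> x)"
  have \<psi>: "\<psi> \<in> test_functions \<Omega>" unfolding \<psi>_def by (rule test_functions_add_cmult(1)[OF assms(1,1)])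
  have "mass \<psi> = mass \<phi> + 2 * (c - 1) * mass \<phi> + (c - 1)\<^sup>2 * mass \<phi>"
    unfolding \<psi>_def mass_energy_expand[OF assms(1,1)] by (simp only: mass_def power2_norm_eq_inner)
  also have "\<dots> = c\<^sup>2 * mass \<phi>" by (simp add: power2_eq_square algebra_simps)
  finally have 1: "mass \<psi> = 1" unfolding c2 using assms(2) by simp
  have "energy \<psi> = energy \<phi> + 2 * (c - 1) * energy \<phi> + (c - 1)\<^sup>2 * energy \<phi>"
    unfolding \<psi>_def mass_energy_expand[OF assms(1,1)] by (simp only: energy_def power2_norm_eq_inner)
  also have "\<dots> = c\<^sup>2 * energy \<phi>" by (simp add: power2_eq_square algebra_simps)
  finally have "energy \<psi> = energy \<phi> / mass \<phi>" unfolding c2 by simp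
  with that \<psi> 1 show ?thesis by blast
qed

text \<open>The infimum of the Rayleigh quotient is attained, and every eigenvalue is at least this infimum.\<close>
theorem first_dirichlet_eigenvalue_variational:
  assumes \<Omega>: "open \<Omega>" and ne: "\<phi>0 \<in> test_functions \<Omega>" "0 < mass \<phi>0" and R: "Rellich \<Omega>"
  shows "Rayleigh_bound \<Omega> (first_dirichlet_eigenvalue \<Omega>)"
    and "Rayleigh_bound \<Omega> \<mu> \<Longrightarrow> \<mu> \<le> first_dirichlet_eigenvalue \<Omega>"
proof -
  define S where "S = {energy \<phi> | \<phi>. \<phi> \<in> test_functions \<Omega> \<and> mass \<phi> = 1}"
  define m where "m = Inf S"
  have Sne: "S \<noteq> {}"
  proof -
    obtain \<psi> where "\<psi> \<in> test_functions \<Omega>" "mass \<psi> = 1" by (rule test_functions_normalise[OF ne])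
    then show ?thesis unfolding S_def by blast
  qed
  have bb: "bdd_below S" unfolding S_def by (rule bdd_belowI[of _ 0]) (auto simp: energy_nonneg)
  have m: "Rayleigh_bound \<Omega> m"
    unfolding Rayleigh_bound_def
  proof
    fix \<phi> assume \<phi>: "\<phi> \<in> test_functions \<Omega>"
    show "m * mass \<phi> \<le> energy \<phi>"
    proof (cases "mass \<phi> = 0")
      case True then show ?thesis by (simp add: energy_nonneg)
    next
      case False
      then have p: "0 < mass \<phi>" using mass_nonneg[of \<phi>] by simp
      obtain \<psi> where \<psi>: "\<psi> \<in> test_functions \<Omega>" "mass \<psi> = 1" "energy \<psi> = energy \<phi> / mass \<phi>"
        by (rule test_functions_normalise[OF \<phi> p])
      have "m \<le> energy \<psi>" unfolding m_def by (rule cInf_lower[OF _ bb]) (unfold S_def, use \<psi>(1,2) in blast)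
      then show ?thesis using p \<psi>(3) by (simp add: field_simps)
    qed
  qed
  have "\<exists>\<phi>. \<phi> \<in> test_functions \<Omega> \<and> mass \<phi> = 1 \<and> energy \<phi> < m + 1 / real (Suc n)" for n
  proof -
    have "\<exists>x\<in>S. x < m + 1 / real (Suc n)" unfolding m_def
      using cInf_lessD[OF Sne, of "Inf S + 1 / real (Suc n)"] by simp
    then show ?thesis unfolding S_def by blast
  qed
  then obtain \<phi> where \<phi>: "\<And>n. \<phi> n \<in> test_functions \<Omega>" "\<And>n. mass (\<phi> n) = 1" "\<And>n. energy (\<phi> n) < m + 1 / real (Suc n)"
    by metis
  have b1: "1 / real (Suc n) \<le> 1" for n by simp
  have "\<forall>n. \<phi> n \<in> test_functions \<Omega> \<and> mass (\<phi> n) \<le> max 1 (m + 1) \<and> energy (\<phi> n) \<le> max 1 (m + 1)"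
  proof (intro allI conjI)
    fix n
    show "\<phi> n \<in> test_functions \<Omega>" by (rule \<phi>(1))
    show "mass (\<phi> n) \<le> max 1 (m + 1)" by (simp add: \<phi>(2))
    show "energy (\<phi> n) \<le> max 1 (m + 1)" using \<phi>(3)[of n] b1[of n] by linarith
  qed
  then obtain r :: "nat \<Rightarrow> nat" where r: "strict_mono r"
     "\<And>e. e > 0 \<Longrightarrow> \<exists>N. \<forall>i\<ge>N. \<forall>j\<ge>N. mass (\<lambda>x. \<phi> (r i) x + (- 1) * \<phi> (r j) x) < e"
    using R unfolding Rellich_def by blast
  have en: "(\<lambda>n. energy (\<phi> n)) \<longlonglongrightarrow> m"
  proof -
    have "m \<le> energy (\<phi> n)" for n unfolding m_def by (rule cInf_lower[OF _ bb]) (unfold S_def, use \<phi>(1,2) in blast)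
    then have 1: "\<forall>\<^sub>F n in sequentially. m \<le> energy (\<phi> n)" by simp
    have "energy (\<phi> n) \<le> m + 1 / real (Suc n)" for n using \<phi>(3)[of n] by simp
    then have 2: "\<forall>\<^sub>F n in sequentially. energy (\<phi> n) \<le> m + 1 / real (Suc n)" by simp
    have 3: "(\<lambda>n. m + 1 / real (Suc n)) \<longlonglongrightarrow> m"
      using tendsto_add[OF tendsto_const[of m] LIMSEQ_inverse_real_of_nat] by (simp add: inverse_eq_divide)
    show ?thesis by (rule tendsto_sandwich[OF 1 2 tendsto_const 3])
  qed
  have "dirichlet_eigenvalue \<Omega> m"
  proof (rule minimiser_eigenvalue[OF \<Omega> _ _ _ m, of "\<lambda>n. \<phi> (r n)"])
    show "(\<lambda>n. energy (\<phi> (r n))) \<longlonglongrightarrow> m" using LIMSEQ_subseq_LIMSEQ[OF en r(1)] by (simp add: o_def)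
  qed (use \<phi> r(2) in auto)
  then have "first_dirichlet_eigenvalue \<Omega> = m"
    unfolding first_dirichlet_eigenvalue_def
    by (intro Least_equality) (auto intro: dirichlet_eigenvalue_ge[OF _ m])
  moreover have "\<mu> \<le> m" if "Rayleigh_bound \<Omega> \<mu>"
    using dirichlet_eigenvalue_ge[OF \<open>dirichlet_eigenvalue \<Omega> m\<close> that] .
  ultimately show "Rayleigh_bound \<Omega> (first_dirichlet_eigenvalue \<Omega>)" "Rayleigh_bound \<Omega> \<mu> \<Longrightarrow> \<mu> \<le> first_dirichlet_eigenvalue \<Omega>"
    using m by simp_all
qed

section \<open>Triangles as affine images of the standard triangle\<close>

definition tri_map :: "real^2 \<Rightarrow> real^2 \<Rightarrow> real^2 \<Rightarrow> real \<times> real \<Rightarrow> real^2" where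
  "tri_map c a b x = c + fst x *\<^sub>R a + snd x *\<^sub>R b"

definition cross2 :: "real^2 \<Rightarrow> real^2 \<Rightarrow> real" where
  "cross2 a b = a$1 * b$2 - a$2 * b$1"

lemma inner_real2: "a \<bullet> b = a$1 * b$1 + a$2 * (b$2::real)" for a b :: "real^2"
  by (simp add: inner_vec_def sum_2)

definition tri_coord :: "real^2 \<Rightarrow> real^2 \<Rightarrow> real^2 \<Rightarrow> real^2 \<Rightarrow> real \<times> real" where
  "tri_coord c a b y = (cross2 (y - c) b / cross2 a b, cross2 a (y - c) / cross2 a b)"

lemma cross2_add: "cross2 (a + b) c = cross2 a c + cross2 b c" "cross2 c (a + b) = cross2 c a + cross2 c b"
  by (simp_all add: cross2_def algebra_simps)

lemma cross2_scale: "cross2 (r *\<^sub>R a) c = r * cross2 a c" "cross2 c (r *\<^sub>R a) = r * cross2 c a"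
  by (simp_all add: cross2_def algebra_simps)

lemma cross2_self: "cross2 a a = 0"
  by (simp add: cross2_def)

lemma tri_coord_map:
  assumes "cross2 a b \<noteq> 0" shows "tri_coord c a b (tri_map c a b x) = x"
proof -
  have "tri_map c a b x - c = fst x *\<^sub>R a + snd x *\<^sub>R b" by (simp add: tri_map_def)
  then show ?thesis using assms unfolding tri_coord_def
    by (simp only: cross2_add cross2_scale cross2_self) simp
qed

lemma tri_map_coord:
  assumes "cross2 a b \<noteq> 0" shows "tri_map c a b (tri_coord c a b y) = y"
proof -
  define w where "w = y - c"
  have "cross2 w b *\<^sub>R a + cross2 a w *\<^sub>R b = cross2 a b *\<^sub>R w"
    unfolding vec_eq_iff forall_2 vector_add_component vector_scaleR_component real_scaleR_def cross2_def
    by (simp only: left_diff_distrib right_diff_distrib mult_ac) simp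
  then have "(1 / cross2 a b) *\<^sub>R (cross2 w b *\<^sub>R a + cross2 a w *\<^sub>R b) = w" using assms by simp
  then have "(cross2 w b / cross2 a b) *\<^sub>R a + (cross2 a w / cross2 a b) *\<^sub>R b = w"
    by (simp add: scaleR_add_right)
  then show ?thesis unfolding tri_map_def tri_coord_def fst_conv snd_conv w_def[symmetric] add.assoc
    by (simp add: w_def)
qed

lemma continuous_tri_map: "continuous_on S (tri_map c a b)"
  unfolding tri_map_def[abs_def] by (intro continuous_intros)

lemma lborel_real2: "distr lborel borel (\<lambda>x::real\<times>real. vector [fst x, snd x] :: real^2) = lborel" (is "distr _ _ ?v = _")
proof (rule lborel_eqI[symmetric])
  have v: "?v = (\<lambda>x. fst x *\<^sub>R axis 1 1 + snd x *\<^sub>R axis 2 1)"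
    by (simp add: fun_eq_iff vec_eq_iff forall_2 axis_def)
  have m: "?v \<in> borel_measurable borel" unfolding v by (intro borel_measurable_continuous_onI continuous_intros)
  fix l u :: "real^2" assume lu: "\<And>b. b \<in> Basis \<Longrightarrow> l \<bullet> b \<le> u \<bullet> b"
  have B: "(Basis :: (real^2) set) = {axis 1 1, axis 2 1}" unfolding Basis_vec_def UNIV_2 by auto
  have ne: "axis 1 1 \<noteq> (axis 2 1 :: real^2)" by (simp add: axis_eq_axis)
  have le: "l$1 \<le> u$1" "l$2 \<le> u$2" using lu[of "axis 1 1"] lu[of "axis 2 1"] by (auto simp: inner_axis)
  have "?v -` box l u = box (l$1, l$2) (u$1, u$2)"
    by (auto simp: mem_box_cart forall_2 mem_box Basis_prod_def inner_prod_def)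
  then have "emeasure (distr lborel borel ?v) (box l u) = emeasure lborel (box (l$1, l$2) (u$1, u$2))"
    using m by (simp add: emeasure_distr)
  also have "\<dots> = ennreal ((u$1 - l$1) * (u$2 - l$2))"
    using le by (subst emeasure_lborel_box) (auto simp: Basis_prod_def prod.union_disjoint inner_prod_def sum.union_disjoint)
  finally show "emeasure (distr lborel borel ?v) (box l u) = (\<Prod>b\<in>Basis. (u - l) \<bullet> b)"
    using ne by (simp add: B inner_axis)
qed simp

text \<open>Both sides agree on boxes, as the preimage of a box is its image under the inverse linear map.\<close>
lemma lborel_tri_map:
  assumes D: "cross2 a b \<noteq> 0"
  shows "lborel = density (distr lborel borel (tri_map c a b)) (\<lambda>_. ennreal \<bar>cross2 a b\<bar>)"
proof (rule lborel_eqI)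
  let ?v = "\<lambda>x::real\<times>real. vector [fst x, snd x] :: real^2"
  define L where "L = (\<lambda>v::real^2. v$1 *\<^sub>R a + v$2 *\<^sub>R b)"
  have lin: "linear L" unfolding L_def by (intro linearI) (auto simp: algebra_simps)
  have det: "det (matrix L) = cross2 a b"
    by (simp add: det_2 matrix_def L_def axis_def cross2_def)
  have vm: "?v \<in> borel_measurable borel"
  proof -
    have v: "?v = (\<lambda>x. fst x *\<^sub>R axis 1 1 + snd x *\<^sub>R axis 2 1)"
      by (simp add: fun_eq_iff vec_eq_iff forall_2 axis_def)
    show ?thesis unfolding v by (intro borel_measurable_continuous_onI continuous_intros)
  qed
  have Lm: "(\<lambda>v. c + L v) \<in> borel_measurable borel" unfolding L_def by (intro borel_measurable_continuous_onI continuous_intros)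
  have "distr lborel borel (tri_map c a b) = distr (distr lborel borel ?v) borel (\<lambda>v. c + L v)"
    using vm Lm by (subst distr_distr) (auto simp: o_def L_def tri_map_def[abs_def] algebra_simps)
  also have "\<dots> = distr lborel borel (\<lambda>v. c + L v)" unfolding lborel_real2 ..
  finally have dd: "distr lborel borel (tri_map c a b) = distr lborel borel (\<lambda>v. c + L v)" .
  define L' where "L' = (\<lambda>w. vector [cross2 w b / cross2 a b, cross2 a w / cross2 a b] :: real^2)"
  have lin': "linear L'" unfolding L'_def
    by (intro linearI) (simp_all add: vec_eq_iff forall_2 cross2_add cross2_scale add_divide_distrib)
  have LL: "L (L' w) = w" "L' (L w) = w" for w
    using tri_map_coord[OF D, of 0 w] tri_coord_map[OF D, of 0 "(w$1, w$2)"]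
    by (auto simp: L_def L'_def tri_map_def tri_coord_def vec_eq_iff forall_2)
  fix l u :: "real^2" assume lu: "\<And>b. b \<in> Basis \<Longrightarrow> l \<bullet> b \<le> u \<bullet> b"
  let ?B = "box (l - c) (u - c)"
  have S: "(\<lambda>v. c + L v) -` box l u = L' ` ?B"
  proof (intro set_eqI iffI)
    fix x assume "x \<in> (\<lambda>v. c + L v) -` box l u"
    then have "L x \<in> ?B" by (auto simp: mem_box algebra_simps)
    then show "x \<in> L' ` ?B" using LL(2) by (metis imageI)
  next
    fix x assume "x \<in> L' ` ?B"
    then have "L x \<in> ?B" using LL(1) by auto
    then show "x \<in> (\<lambda>v. c + L v) -` box l u" by (auto simp: mem_box algebra_simps)
  qed
  have Sm: "L' ` ?B \<in> lmeasurable" by (rule measurable_linear_image[OF lin']) simp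
  have "measure lebesgue (L ` (L' ` ?B)) = \<bar>cross2 a b\<bar> * measure lebesgue (L' ` ?B)"
    unfolding det[symmetric] by (rule measure_linear_image[OF lin Sm])
  moreover have "L ` (L' ` ?B) = ?B" using LL by (auto simp: image_image)
  ultimately have me: "\<bar>cross2 a b\<bar> * measure lebesgue (L' ` ?B) = measure lebesgue ?B" by simp
  have Sb: "L' ` ?B \<in> sets borel" unfolding S[symmetric] using measurable_sets[OF Lm, of "box l u"] by simp
  have "emeasure lborel (L' ` ?B) = emeasure lebesgue (L' ` ?B)" using Sb by simp
  also have "\<dots> = ennreal (measure lebesgue (L' ` ?B))" by (rule emeasure_eq_measure2[OF Sm])
  finally have e: "emeasure lborel (L' ` ?B) = ennreal (measure lebesgue (L' ` ?B))" .
  have "emeasure (density (distr lborel borel (tri_map c a b)) (\<lambda>_. ennreal \<bar>cross2 a b\<bar>)) (box l u)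
     = ennreal \<bar>cross2 a b\<bar> * emeasure lborel (L' ` ?B)"
    using Lm unfolding dd by (simp add: emeasure_density_const emeasure_distr S)
  also have "\<dots> = ennreal (measure lebesgue ?B)" unfolding e me[symmetric] by (simp add: ennreal_mult)
  also have "measure lebesgue ?B = (\<Prod>b\<in>Basis. (u - l) \<bullet> b)"
    using lu by (subst measure_completion) (auto simp: measure_lborel_box_eq inner_diff_left)
  finally show "emeasure (density (distr lborel borel (tri_map c a b)) (\<lambda>_. ennreal \<bar>cross2 a b\<bar>)) (box l u) = (\<Prod>b\<in>Basis. (u - l) \<bullet> b)" .
qed simp

lemma integral_tri_map:
  fixes F :: "real^2 \<Rightarrow> real"
  assumes D: "cross2 a b \<noteq> 0" and F: "F \<in> borel_measurable borel"
  shows "(LINT y|lebesgue. F y) = \<bar>cross2 a b\<bar> * (LINT x|lborel. F (tri_map c a b x))"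
proof -
  have m: "tri_map c a b \<in> borel_measurable borel" by (rule borel_measurable_continuous_onI[OF continuous_tri_map])
  have "(LINT y|lebesgue. F y) = (LINT y|lborel. F y)" using F by (intro integral_completion) simp
  also have "\<dots> = (LINT y|density (distr lborel borel (tri_map c a b)) (\<lambda>_. ennreal \<bar>cross2 a b\<bar>). F y)"
    using lborel_tri_map[OF D, of c] by simp
  also have "\<dots> = (LINT y|distr lborel borel (tri_map c a b). \<bar>cross2 a b\<bar> *\<^sub>R F y)"
    using F by (intro integral_density) auto
  also have "\<dots> = \<bar>cross2 a b\<bar> * (LINT y|distr lborel borel (tri_map c a b). F y)" by simp
  also have "(LINT y|distr lborel borel (tri_map c a b). F y) = (LINT x|lborel. F (tri_map c a b x))"
    using F m by (intro integral_distr) auto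
  finally show ?thesis .
qed

definition affine_triangle :: "real^2 \<Rightarrow> real^2 \<Rightarrow> real^2 \<Rightarrow> (real^2) set" where
  "affine_triangle c a b = tri_map c a b ` interior_tri"

lemma triangle_iff: "cross2 a b \<noteq> 0 \<Longrightarrow> tri_map c a b x \<in> affine_triangle c a b \<longleftrightarrow> x \<in> interior_tri"
  unfolding affine_triangle_def using tri_coord_map[of a b c x] tri_coord_map[of a b c] by (metis (no_types, lifting) image_iff)

lemma triangle_coord: "cross2 a b \<noteq> 0 \<Longrightarrow> y \<in> affine_triangle c a b \<longleftrightarrow> tri_coord c a b y \<in> interior_tri"
  using triangle_iff[of a b c "tri_coord c a b y"] tri_map_coord[of a b c y] by simp

lemma tri_int_eq_lborel:
  assumes "\<And>x. x \<notin> interior_tri \<Longrightarrow> f x = 0" shows "(LINT x|lborel. f x) = tri_int f"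
  unfolding tri_int_def set_lebesgue_integral_def
  by (rule Bochner_Integration.integral_cong) (use assms interior_tri_subset in \<open>auto simp: indicator_def\<close>)

lemma continuous_tri_coord: "continuous_on S (\<lambda>y. tri_coord c a b y)"
  unfolding tri_coord_def[abs_def] cross2_def divide_inverse vector_minus_component by (intro continuous_intros) 

lemma open_triangle: "cross2 a b \<noteq> 0 \<Longrightarrow> open (affine_triangle c a b)"
proof -
  assume D: "cross2 a b \<noteq> 0"
  have "affine_triangle c a b = tri_coord c a b -` interior_tri" using triangle_coord[OF D] by auto
  then show ?thesis using open_vimage[OF open_interior_tri continuous_tri_coord[of UNIV c a b]] by simp
qed

lemma integral_triangle:
  fixes F :: "real^2 \<Rightarrow> real"
  assumes D: "cross2 a b \<noteq> 0" and F: "F \<in> borel_measurable borel" "\<And>y. y \<notin> affine_triangle c a b \<Longrightarrow> F y = 0"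
  shows "(LINT y|lebesgue. F y) = \<bar>cross2 a b\<bar> * tri_int (\<lambda>x. F (tri_map c a b x))"
  unfolding integral_tri_map[OF D F(1), of c]
  by (subst tri_int_eq_lborel) (use F(2) triangle_iff[OF D] in auto)

lemma measure_triangle:
  assumes D: "cross2 a b \<noteq> 0" shows "measure lebesgue (affine_triangle c a b) = \<bar>cross2 a b\<bar> / 2"
proof -
  have o: "affine_triangle c a b \<in> sets borel" using open_triangle[OF D] by simp
  have "measure lebesgue (affine_triangle c a b) = (LINT y|lebesgue. indicator (affine_triangle c a b) y)" by simp
  also have "\<dots> = \<bar>cross2 a b\<bar> * tri_int (\<lambda>x. indicator (affine_triangle c a b) (tri_map c a b x))"
    using o by (intro integral_triangle[OF D]) auto
  also have "tri_int (\<lambda>x. indicator (affine_triangle c a b) (tri_map c a b x)) = tri_int (\<lambda>x. indicator interior_tri x)"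
    by (rule tri_int_cong) (simp add: indicator_def triangle_iff[OF D])
  also have "\<dots> = tri_int (\<lambda>x. 1)"
    unfolding tri_int_def set_lebesgue_integral_def
  proof (rule integral_cong_AE)
    have "interior_tri \<in> sets borel" "std_triangle \<in> sets borel"
      using open_interior_tri compact_std_triangle by (auto intro: borel_closed compact_imp_closed)
    then show "(\<lambda>x. indicator std_triangle x *\<^sub>R indicator interior_tri x :: real) \<in> borel_measurable lborel"
      "(\<lambda>x. indicator std_triangle x *\<^sub>R (1::real)) \<in> borel_measurable lborel" by simp_all
    show "AE x in lborel. indicator std_triangle x *\<^sub>R indicator interior_tri x = indicator std_triangle x *\<^sub>R (1::real)"
      using AE_interior_tri by eventually_elim (auto simp: indicator_def)
  qed
  finally show ?thesis by (simp add: tri_int_one)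
qed

lemma closure_in_core:
  assumes "compact K" "K \<subseteq> interior_tri" "\<And>x. x \<notin> K \<Longrightarrow> v x = 0" shows "core v"
proof (cases "K = {}")
  case True then show ?thesis using assms(3) by (auto simp: core_def intro!: exI[of _ 1])
next
  case False
  define m where "m = (\<lambda>x::real\<times>real. min (min (fst x) (snd x)) (1 - fst x - snd x))"
  have "continuous_on K m" unfolding m_def by (intro continuous_intros)
  then obtain x0 where x0: "x0 \<in> K" "\<forall>x\<in>K. m x0 \<le> m x" using continuous_attains_inf[OF assms(1) False] by blast
  have "0 < m x0" using x0(1) assms(2) by (auto simp: m_def interior_tri_def)
  moreover have "v (s, t) = 0" if "s < m x0 \<or> t < m x0 \<or> s + t > 1 - m x0" for s t
  proof (rule assms(3), rule notI)
    assume "(s, t) \<in> K"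
    then have "m x0 \<le> m (s, t)" using x0(2) by blast
    then have "m x0 \<le> s \<and> m x0 \<le> t \<and> m x0 \<le> 1 - s - t" by (simp add: m_def)
    then show False using that by linarith
  qed
  ultimately show ?thesis unfolding core_def by blast
qed

text \<open>The chain rule and the substitution rule. The coefficients of the form come from expressing the norm of a gradient through its products with
  the two edge vectors.\<close>
lemma pullback:
  assumes D: "cross2 a b \<noteq> 0" and \<psi>: "\<psi> \<in> test_functions (affine_triangle c a b)"
  defines "v \<equiv> \<lambda>x. \<psi> (tri_map c a b x)"
    and "vs \<equiv> \<lambda>x. gradient \<psi> (tri_map c a b x) \<bullet> a" and "vt \<equiv> \<lambda>x. gradient \<psi> (tri_map c a b x) \<bullet> b"
  shows "C1 v vs vt" "core v" "mass \<psi> = \<bar>cross2 a b\<bar> * tri_int (\<lambda>x. (v x)\<^sup>2)"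
    "energy \<psi> = \<bar>cross2 a b\<bar> * dform ((norm b)\<^sup>2 / (cross2 a b)\<^sup>2) ((norm a)\<^sup>2 / (cross2 a b)\<^sup>2) ((norm (a - b))\<^sup>2 / (cross2 a b)\<^sup>2) vs vt vs vt"
proof -
  note t = test_functionsD[OF \<psi>]
  have out: "\<psi> y = 0 \<and> gradient \<psi> y = 0" if "y \<notin> affine_triangle c a b" for y using t(4,5,7) that by blast
  have cm: "continuous_on UNIV (\<lambda>x. f (tri_map c a b x))" if "continuous_on UNIV f" for f :: "real^2 \<Rightarrow> 'x::topological_space"
    by (rule continuous_on_compose2[OF that continuous_tri_map]) auto
  have c: "continuous_on UNIV v" "continuous_on UNIV vs" "continuous_on UNIV vt"
    unfolding v_def vs_def vt_def by (intro continuous_intros cm t(2,3))+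
  have chain: "((\<lambda>z. \<psi> (g z)) has_real_derivative gradient \<psi> (g z) \<bullet> h) (at z)"
    if "(g has_vector_derivative h) (at z)" for g :: "real \<Rightarrow> real^2" and h z
  proof -
    have "((\<lambda>z. \<psi> (g z)) has_derivative (\<lambda>r. frechet_derivative \<psi> (at (g z)) (r *\<^sub>R h))) (at z)"
      using has_derivative_compose[OF that[unfolded has_vector_derivative_def] t(1)] by simp
    moreover have "frechet_derivative \<psi> (at (g z)) (r *\<^sub>R h) = (gradient \<psi> (g z) \<bullet> h) * r" for r
      using gradient_inner[OF t(1), of "g z" "r *\<^sub>R h"] by (simp add: mult.commute)
    ultimately show ?thesis by (simp add: has_field_derivative_def)
  qed
  show "C1 v vs vt" unfolding C1_def
  proof (intro conjI c allI)
    fix s t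
    have 1: "((\<lambda>s. c + s *\<^sub>R a + t *\<^sub>R b) has_vector_derivative a) (at s)" by (auto intro!: derivative_eq_intros)
    have 2: "((\<lambda>t. c + s *\<^sub>R a + t *\<^sub>R b) has_vector_derivative b) (at t)" by (auto intro!: derivative_eq_intros)
    show "((\<lambda>s. v (s, t)) has_real_derivative vs (s, t)) (at s)" using chain[OF 1] by (simp add: v_def vs_def tri_map_def)
    show "((\<lambda>t. v (s, t)) has_real_derivative vt (s, t)) (at t)" using chain[OF 2] by (simp add: v_def vt_def tri_map_def)
  qed
  show "core v"
  proof (rule closure_in_core)
    let ?K = "closure {x. \<psi> x \<noteq> 0}"
    show "compact (tri_coord c a b ` ?K)" by (rule compact_continuous_image[OF continuous_tri_coord t(6)])
    show "tri_coord c a b ` ?K \<subseteq> interior_tri" using t(7) triangle_coord[OF D] by blast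
    fix x assume x: "x \<notin> tri_coord c a b ` ?K"
    have "tri_map c a b x \<notin> ?K" using x tri_coord_map[OF D, of c x] by (metis image_eqI)
    then show "v x = 0" unfolding v_def by (rule t(4))
  qed
  have "mass \<psi> = \<bar>cross2 a b\<bar> * tri_int (\<lambda>x. (norm (\<psi> (tri_map c a b x)))\<^sup>2)"
    unfolding mass_def
    by (rule integral_triangle[OF D]) (use out in \<open>auto intro!: borel_measurable_continuous_onI continuous_intros t(2)\<close>)
  then show "mass \<psi> = \<bar>cross2 a b\<bar> * tri_int (\<lambda>x. (v x)\<^sup>2)" by (simp add: v_def)
  have bil_norm: "n = bil (B / (cross2 a b)\<^sup>2) (A / (cross2 a b)\<^sup>2) (C / (cross2 a b)\<^sup>2) x y x y"
    if "(cross2 a b)\<^sup>2 * n = B * x\<^sup>2 + A * y\<^sup>2 + (C - B - A) * (x * y)" for n A B C x y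
  proof -
    have "n = (B * x\<^sup>2 + A * y\<^sup>2 + (C - B - A) * (x * y)) / (cross2 a b)\<^sup>2" using D by (simp flip: that)
    then show ?thesis
      unfolding bil_def by (simp add: add_divide_distrib diff_divide_distrib power2_eq_square algebra_simps)
  qed
  have "energy \<psi> = \<bar>cross2 a b\<bar> * tri_int (\<lambda>x. (norm (gradient \<psi> (tri_map c a b x)))\<^sup>2)"
    unfolding energy_def
    by (rule integral_triangle[OF D]) (use out in \<open>auto intro!: borel_measurable_continuous_onI continuous_intros t(3)\<close>)
  also have "tri_int (\<lambda>x. (norm (gradient \<psi> (tri_map c a b x)))\<^sup>2) = dform ((norm b)\<^sup>2 / (cross2 a b)\<^sup>2) ((norm a)\<^sup>2 / (cross2 a b)\<^sup>2) ((norm (a - b))\<^sup>2 / (cross2 a b)\<^sup>2) vs vt vs vt"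
    unfolding dform_def
  proof (rule tri_int_cong)
    fix x
    define w where "w = gradient \<psi> (tri_map c a b x)"
    have "(cross2 a b)\<^sup>2 * (norm w)\<^sup>2 = (norm b)\<^sup>2 * (w \<bullet> a)\<^sup>2 + (norm a)\<^sup>2 * (w \<bullet> b)\<^sup>2 + ((norm (a - b))\<^sup>2 - (norm b)\<^sup>2 - (norm a)\<^sup>2) * ((w \<bullet> a) * (w \<bullet> b))"
      unfolding power2_norm_eq_inner inner_real2 cross2_def vector_minus_component by algebra
    then have "(norm w)\<^sup>2 = bil ((norm b)\<^sup>2 / (cross2 a b)\<^sup>2) ((norm a)\<^sup>2 / (cross2 a b)\<^sup>2) ((norm (a - b))\<^sup>2 / (cross2 a b)\<^sup>2) (w \<bullet> a) (w \<bullet> b) (w \<bullet> a) (w \<bullet> b)"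
      by (rule bil_norm)
    then show "(norm (gradient \<psi> (tri_map c a b x)))\<^sup>2 = bil ((norm b)\<^sup>2 / (cross2 a b)\<^sup>2) ((norm a)\<^sup>2 / (cross2 a b)\<^sup>2) ((norm (a - b))\<^sup>2 / (cross2 a b)\<^sup>2) (vs x) (vt x) (vs x) (vt x)"
      unfolding w_def vs_def vt_def .
  qed
  finally show "energy \<psi> = \<bar>cross2 a b\<bar> * dform ((norm b)\<^sup>2 / (cross2 a b)\<^sup>2) ((norm a)\<^sup>2 / (cross2 a b)\<^sup>2) ((norm (a - b))\<^sup>2 / (cross2 a b)\<^sup>2) vs vt vs vt" .
qed

section \<open>Compactness\<close>

lemma integral_shift_square:
  fixes f :: "real \<Rightarrow> real"
  assumes "continuous_on {a..b} f" "a \<le> b"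
  shows "integral {a..b} (\<lambda>x. (f x + t)\<^sup>2) = integral {a..b} (\<lambda>x. (f x)\<^sup>2) + 2 * t * integral {a..b} f + t\<^sup>2 * (b - a)"
proof (rule integral_unique)
  have i: "f integrable_on {a..b}" "(\<lambda>x. (f x)\<^sup>2) integrable_on {a..b}"
    by (intro integrable_continuous_interval continuous_intros assms(1))+
  have "((\<lambda>x. t\<^sup>2) has_integral t\<^sup>2 * (b - a)) {a..b}"
    using has_integral_const_real[of "t\<^sup>2" a b] assms(2) by (simp add: mult.commute)
  then have "((\<lambda>x. (f x)\<^sup>2 + 2 * t * f x + t\<^sup>2) has_integral
      integral {a..b} (\<lambda>x. (f x)\<^sup>2) + 2 * t * integral {a..b} f + t\<^sup>2 * (b - a)) {a..b}"
    by (intro has_integral_add has_integral_mult_right integrable_integral i)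
  then show "((\<lambda>x. (f x + t)\<^sup>2) has_integral
      integral {a..b} (\<lambda>x. (f x)\<^sup>2) + 2 * t * integral {a..b} f + t\<^sup>2 * (b - a)) {a..b}"
    by (rule has_integral_eq[rotated]) (simp add: power2_eq_square algebra_simps)
qed

lemma integral_square_le:
  fixes f :: "real \<Rightarrow> real"
  assumes "continuous_on {a..b} f" "a \<le> b"
  shows "(integral {a..b} f)\<^sup>2 \<le> (b - a) * integral {a..b} (\<lambda>x. (f x)\<^sup>2)"
proof -
  have "0 \<le> integral {a..b} (\<lambda>x. (f x)\<^sup>2) + 2 * t * integral {a..b} f + t\<^sup>2 * (b - a)" for t
  proof -
    have "0 \<le> integral {a..b} (\<lambda>x. (f x + t)\<^sup>2)" by (rule integral_nonneg) (auto intro!: integrable_continuous_interval continuous_intros assms(1))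
    also note integral_shift_square[OF assms]
    finally show ?thesis .
  qed
  then have "(integral {a..b} f)\<^sup>2 \<le> integral {a..b} (\<lambda>x. (f x)\<^sup>2) * (b - a)" by (rule quadratic_nonneg_discriminant)
  then show ?thesis by (simp add: mult.commute)
qed

text \<open>The function attains its mean value at some point, from which the deviation is bounded by integrating the derivative.\<close>
lemma Poincare_interval:
  fixes f :: "real \<Rightarrow> real"
  assumes d: "\<And>x. (f has_real_derivative f' x) (at x)" and c: "continuous_on UNIV f'" and ab: "a < b"
  shows "integral {a..b} (\<lambda>x. (f x)\<^sup>2) \<le> (integral {a..b} f)\<^sup>2 / (b - a) + (b - a)\<^sup>2 * integral {a..b} (\<lambda>x. (f' x)\<^sup>2)"
proof -
  have cf: "continuous_on S f" for S using d by (meson DERIV_continuous_on has_field_derivative_at_within)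
  have cf': "continuous_on S f'" for S using c continuous_on_subset by blast
  define m where "m = integral {a..b} f / (b - a)"
  define E where "E = integral {a..b} (\<lambda>x. (f' x)\<^sup>2)"
  have i2: "(\<lambda>x. (f' x)\<^sup>2) integrable_on {u..v}" for u v by (intro integrable_continuous_interval continuous_intros cf')
  have diff: "(f v - f u)\<^sup>2 \<le> (b - a) * E" if "a \<le> u" "u \<le> v" "v \<le> b" for u v
  proof -
    have "(f' has_integral (f v - f u)) {u..v}"
      using that by (intro fundamental_theorem_of_calculus) (auto intro!: has_field_derivative_imp_has_derivative[THEN has_derivative_at_withinI] d simp: has_real_derivative_iff_has_vector_derivative[symmetric] intro: has_field_derivative_at_within)
    then have "(f v - f u)\<^sup>2 = (integral {u..v} f')\<^sup>2" by (simp add: integral_unique)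
    also have "\<dots> \<le> (v - u) * integral {u..v} (\<lambda>x. (f' x)\<^sup>2)" by (rule integral_square_le[OF cf' that(2)])
    also have "\<dots> \<le> (b - a) * E" unfolding E_def using that
      by (intro mult_mono integral_subset_le integral_nonneg i2) auto
    finally show ?thesis .
  qed
  obtain \<xi> where \<xi>: "\<xi> \<in> {a..b}" "f \<xi> = m"
  proof -
    define F where "F = (\<lambda>u. integral {a..u} f)"
    have "(F has_real_derivative f z) (at z)" if "a < z" "z < b" for z
      unfolding F_def has_real_derivative_iff_has_vector_derivative
      using integral_has_vector_derivative[OF cf, of z a b] that by (simp add: at_within_Icc_at)
    moreover have "continuous_on {a..b} F" unfolding F_def by (intro indefinite_integral_continuous_1 integrable_continuous_interval cf)
    ultimately obtain z where z: "a < z" "z < b" "F b - F a = (b - a) * f z"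
      using MVT[of a b F] ab DERIV_unique by (metis real_differentiable_def)
    then have "f z = m" using ab by (simp add: F_def m_def)
    then show ?thesis using z by (intro that[of z]) auto
  qed
  have pt: "(f x - m)\<^sup>2 \<le> (b - a) * E" if "x \<in> {a..b}" for x
    using diff[of x \<xi>] diff[of \<xi> x] \<xi> that by (cases "x \<le> \<xi>") (auto simp: power2_commute)
  have "integral {a..b} (\<lambda>x. (f x)\<^sup>2) - (integral {a..b} f)\<^sup>2 / (b - a) = integral {a..b} (\<lambda>x. (f x - m)\<^sup>2)"
  proof -
    have "integral {a..b} (\<lambda>x. (f x - m)\<^sup>2) = integral {a..b} (\<lambda>x. (f x)\<^sup>2) + ((- 2 * m) * integral {a..b} f + m\<^sup>2 * (b - a))"
      using integral_shift_square[OF cf, of a b "- m"] ab by simp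
    also have "(- 2 * m) * integral {a..b} f + m\<^sup>2 * (b - a) = - (integral {a..b} f)\<^sup>2 / (b - a)"
    proof -
      have "(- 2 * (I / h)) * I + (I / h)\<^sup>2 * h = - I\<^sup>2 / h" if "h \<noteq> 0" for I h :: real
        using that by (simp add: power2_eq_square divide_simps)
      then show ?thesis using ab unfolding m_def by simp
    qed
    finally show ?thesis by simp
  qed
  also have "\<dots> \<le> integral {a..b} (\<lambda>x. (b - a) * E)"
    by (intro integral_le integrable_continuous_interval continuous_intros cf) (rule pt)
  also have "\<dots> = (b - a)\<^sup>2 * E" using ab by (simp add: power2_eq_square)
  finally show ?thesis unfolding E_def by simp
qed

abbreviation cell :: "nat \<Rightarrow> nat \<Rightarrow> real set" where
  "cell N i \<equiv> {real i / real N..real (Suc i) / real N}"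

lemma integral_cells:
  fixes f :: "real \<Rightarrow> real"
  assumes f: "continuous_on UNIV f" and N: "0 < N"
  shows "integral {0..1} f = (\<Sum>i<N. integral (cell N i) f)"
proof -
  have c: "continuous_on S f" for S using f continuous_on_subset by blast
  have "n \<le> N \<Longrightarrow> integral {0..real n / real N} f = (\<Sum>i<n. integral (cell N i) f)" for n
  proof (induction n)
    case (Suc n)
    have "integral {0..real n / real N} f + integral (cell N n) f = integral {0..real (Suc n) / real N} f"
      using N by (intro Henstock_Kurzweil_Integration.integral_combine integrable_continuous_interval c) (auto simp: divide_right_mono)
    with Suc show ?case by simp
  qed simp
  from this[of N] N show ?thesis by simp
qed

lemma Poincare_cells:
  fixes f :: "real \<Rightarrow> real"
  assumes d: "\<And>x. (f has_real_derivative f' x) (at x)" and c: "continuous_on UNIV f'" and N: "0 < N"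
  shows "integral {0..1} (\<lambda>x. (f x)\<^sup>2) \<le> N * (\<Sum>i<N. (integral (cell N i) f)\<^sup>2) + integral {0..1} (\<lambda>x. (f' x)\<^sup>2) / (real N)\<^sup>2"
proof -
  have cf: "continuous_on UNIV f" using d by (meson DERIV_continuous_on has_field_derivative_at_within)
  have l: "real (Suc i) / N - real i / N = 1 / N" for i by (simp add: diff_divide_distrib[symmetric])
  have "integral {0..1} (\<lambda>x. (f x)\<^sup>2) = (\<Sum>i<N. integral (cell N i) (\<lambda>x. (f x)\<^sup>2))"
    by (rule integral_cells[OF _ N]) (intro continuous_intros cf)
  also have "\<dots> \<le> (\<Sum>i<N. N * (integral (cell N i) f)\<^sup>2 + integral (cell N i) (\<lambda>x. (f' x)\<^sup>2) / (real N)\<^sup>2)"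
  proof (rule sum_mono)
    fix i
    have "real i / N < real (Suc i) / N" using N by (simp add: divide_strict_right_mono)
    from Poincare_interval[OF d c this]
    show "integral (cell N i) (\<lambda>x. (f x)\<^sup>2) \<le> N * (integral (cell N i) f)\<^sup>2 + integral (cell N i) (\<lambda>x. (f' x)\<^sup>2) / (real N)\<^sup>2"
      unfolding l by (simp add: power_divide mult.commute)
  qed
  also have "\<dots> = N * (\<Sum>i<N. (integral (cell N i) f)\<^sup>2) + (\<Sum>i<N. integral (cell N i) (\<lambda>x. (f' x)\<^sup>2)) / (real N)\<^sup>2"
    by (simp add: sum.distrib sum_distrib_left sum_divide_distrib)
  also have "(\<Sum>i<N. integral (cell N i) (\<lambda>x. (f' x)\<^sup>2)) = integral {0..1} (\<lambda>x. (f' x)\<^sup>2)"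
    by (rule integral_cells[OF _ N, symmetric]) (intro continuous_intros c)
  finally show ?thesis .
qed

definition cell_int :: "nat \<Rightarrow> nat \<Rightarrow> nat \<Rightarrow> (real \<times> real \<Rightarrow> real) \<Rightarrow> real" where
  "cell_int N i j w = integral (cell N j) (\<lambda>s. integral (cell N i) (\<lambda>t. w (s, t)))"

abbreviation square_int :: "(real \<times> real \<Rightarrow> real) \<Rightarrow> real" where
  "square_int w \<equiv> integral {0..1} (\<lambda>s. integral {0..1} (\<lambda>t. w (s, t)))"

lemma continuous_slice_integral:
  fixes w :: "real \<times> real \<Rightarrow> real"
  assumes "continuous_on UNIV w" shows "continuous_on S (\<lambda>s. integral {a..b} (\<lambda>t. w (s, t)))"
  using integral_continuous_on_param[of S a b "\<lambda>s t. w (s, t)"] continuous_on_subset[OF assms subset_UNIV]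
  by (simp add: case_prod_unfold cbox_interval)

lemma continuous_slice:
  fixes w :: "real \<times> real \<Rightarrow> real"
  assumes "continuous_on UNIV w" shows "continuous_on S (\<lambda>t. w (s, t))"
  by (rule continuous_on_compose2[OF assms]) (auto intro!: continuous_intros)

text \<open>The one-dimensional inequality is used first along vertical slices and then for the averages over the slices of a cell.\<close>
lemma Poincare_square:
  assumes w: "C1 w ws wt" and N: "0 < N"
  shows "square_int (\<lambda>x. (w x)\<^sup>2) \<le> (real N)\<^sup>2 * (\<Sum>i<N. \<Sum>j<N. (cell_int N i j w)\<^sup>2)
     + (square_int (\<lambda>x. (ws x)\<^sup>2) + square_int (\<lambda>x. (wt x)\<^sup>2)) / (real N)\<^sup>2"
proof -
  note c = C1_cont[OF w]
  have c2: "continuous_on UNIV (\<lambda>x. (w x)\<^sup>2)" "continuous_on UNIV (\<lambda>x. (ws x)\<^sup>2)" "continuous_on UNIV (\<lambda>x. (wt x)\<^sup>2)"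
    by (intro continuous_intros c)+
  define g where "g i s = integral (cell N i) (\<lambda>t. w (s, t))" for i s
  define g' where "g' i s = integral (cell N i) (\<lambda>t. ws (s, t))" for i s
  have cg: "continuous_on S (g i)" "continuous_on S (g' i)" for i S
    unfolding g_def[abs_def] g'_def[abs_def] by (intro continuous_slice_integral c)+
  have dg: "(g i has_real_derivative g' i s) (at s)" for i s
  proof -
    have "((\<lambda>s. integral (cbox (real i / real N) (real (Suc i) / real N)) (\<lambda>t. w (s, t))) has_real_derivative
        integral (cbox (real i / real N) (real (Suc i) / real N)) (\<lambda>t. ws (s, t))) (at s within UNIV)"
      by (rule leibniz_rule_field_derivative)
         (use w in \<open>auto simp: C1_def case_prod_unfold cbox_interval intro!: integrable_continuous_interval continuous_slice c(1) continuous_on_subset[OF c(2)]\<close>)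
    then show ?thesis by (simp add: g_def[abs_def] g'_def cbox_interval)
  qed
  have ii: "f integrable_on {0..1}" if "continuous_on UNIV f" for f :: "real \<Rightarrow> real"
    using that by (intro integrable_continuous_interval) (rule continuous_on_subset[OF _ subset_UNIV])
  have si: "(\<lambda>s. integral {a..b} (\<lambda>t. f (s, t))) integrable_on {0..1}" if "continuous_on UNIV f" for f :: "real \<times> real \<Rightarrow> real" and a b
    by (rule ii[OF continuous_slice_integral[OF that]])
  have gi: "(\<lambda>s. (g i s)\<^sup>2) integrable_on {0..1}" "(\<lambda>s. (g' i s)\<^sup>2) integrable_on {0..1}" for i
    by (intro ii continuous_intros cg)+
  have "square_int (\<lambda>x. (w x)\<^sup>2) \<le> integral {0..1} (\<lambda>s. N * (\<Sum>i<N. (g i s)\<^sup>2) + integral {0..1} (\<lambda>t. (wt (s, t))\<^sup>2) / (real N)\<^sup>2)"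
  proof (rule integral_le)
    show "(\<lambda>s. integral {0..1} (\<lambda>t. (w (s, t))\<^sup>2)) integrable_on {0..1}" by (rule si[OF c2(1)])
    show "(\<lambda>s. N * (\<Sum>i<N. (g i s)\<^sup>2) + integral {0..1} (\<lambda>t. (wt (s, t))\<^sup>2) / (real N)\<^sup>2) integrable_on {0..1}"
      by (intro ii continuous_intros cg continuous_slice_integral[OF c2(3)]) (use N in auto)
    fix s :: real
    show "integral {0..1} (\<lambda>t. (w (s, t))\<^sup>2) \<le> N * (\<Sum>i<N. (g i s)\<^sup>2) + integral {0..1} (\<lambda>t. (wt (s, t))\<^sup>2) / (real N)\<^sup>2"
      unfolding g_def by (rule Poincare_cells[OF _ _ N]) (use w in \<open>auto simp: C1_def intro!: continuous_slice c(3)\<close>)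
  qed
  also have "\<dots> = N * (\<Sum>i<N. integral {0..1} (\<lambda>s. (g i s)\<^sup>2)) + square_int (\<lambda>x. (wt x)\<^sup>2) / (real N)\<^sup>2"
    by (rule integral_unique, intro has_integral_add has_integral_mult_right has_integral_sum finite_lessThan
        has_integral_divide integrable_integral gi si[OF c2(3)])
  also have "(\<Sum>i<N. integral {0..1} (\<lambda>s. (g i s)\<^sup>2)) \<le> (\<Sum>i<N. N * (\<Sum>j<N. (cell_int N i j w)\<^sup>2) + integral {0..1} (\<lambda>s. (g' i s)\<^sup>2) / (real N)\<^sup>2)"
    unfolding cell_int_def g_def[symmetric]
    by (intro sum_mono Poincare_cells[OF dg _ N] cg)
  also have "\<dots> = N * (\<Sum>i<N. \<Sum>j<N. (cell_int N i j w)\<^sup>2) + (\<Sum>i<N. integral {0..1} (\<lambda>s. (g' i s)\<^sup>2)) / (real N)\<^sup>2"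
    by (simp add: sum.distrib sum_distrib_left sum_divide_distrib)
  also have "(\<Sum>i<N. integral {0..1} (\<lambda>s. (g' i s)\<^sup>2)) \<le> (\<Sum>i<N. integral {0..1} (\<lambda>s. integral (cell N i) (\<lambda>t. (ws (s, t))\<^sup>2) / N))"
  proof (rule sum_mono, rule integral_le[OF gi(2)])
    fix i and s :: real
    show "(\<lambda>s. integral (cell N i) (\<lambda>t. (ws (s, t))\<^sup>2) / N) integrable_on {0..1}" by (intro integrable_on_divide si[OF c2(2)])
    have "(g' i s)\<^sup>2 \<le> (real (Suc i) / N - real i / N) * integral (cell N i) (\<lambda>t. (ws (s, t))\<^sup>2)"
      unfolding g'_def by (rule integral_square_le) (auto intro!: continuous_slice c divide_right_mono)
    also have "real (Suc i) / N - real i / N = 1 / N" by (simp add: diff_divide_distrib[symmetric])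
    finally show "(g' i s)\<^sup>2 \<le> integral (cell N i) (\<lambda>t. (ws (s, t))\<^sup>2) / N" by simp
  qed
  also have "\<dots> = integral {0..1} (\<lambda>s. \<Sum>i<N. integral (cell N i) (\<lambda>t. (ws (s, t))\<^sup>2)) / N"
    by (subst integral_sum[OF finite_lessThan si[OF c2(2)]]) (simp add: sum_divide_distrib)
  also have "(\<lambda>s. \<Sum>i<N. integral (cell N i) (\<lambda>t. (ws (s, t))\<^sup>2)) = (\<lambda>s. integral {0..1} (\<lambda>t. (ws (s, t))\<^sup>2))"
    by (rule ext, rule integral_cells[OF _ N, symmetric]) (intro continuous_slice c2)
  finally have "square_int (\<lambda>x. (w x)\<^sup>2) \<le> N * (N * (\<Sum>i<N. \<Sum>j<N. (cell_int N i j w)\<^sup>2) + square_int (\<lambda>x. (ws x)\<^sup>2) / N / (real N)\<^sup>2) + square_int (\<lambda>x. (wt x)\<^sup>2) / (real N)\<^sup>2"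
    by (simp add: mult_left_mono divide_right_mono)
  also have "\<dots> = (real N)\<^sup>2 * (\<Sum>i<N. \<Sum>j<N. (cell_int N i j w)\<^sup>2) + (square_int (\<lambda>x. (ws x)\<^sup>2) + square_int (\<lambda>x. (wt x)\<^sup>2)) / (real N)\<^sup>2"
    using N by (simp add: power2_eq_square field_simps)
  finally show ?thesis .
qed

lemma square_int_tri_int:
  assumes c: "continuous_on UNIV f" and z: "\<And>x. x \<notin> interior_tri \<Longrightarrow> f x = 0"
  shows "square_int f = tri_int f"
proof -
  let ?Q = "cbox (0::real, 0::real) (1, 1)"
  have i: "set_integrable lborel ?Q f"
    unfolding set_integrable_def by (rule borel_integrable_compact[OF compact_cbox]) (rule continuous_on_subset[OF c subset_UNIV])
  have "tri_int f = (LINT x|lborel. f x)" by (rule tri_int_eq_lborel[OF z, symmetric])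
  also have "\<dots> = (LINT x:?Q|lborel. f x)"
    unfolding set_lebesgue_integral_def
  proof (rule Bochner_Integration.integral_cong)
    fix x show "f x = indicator ?Q x *\<^sub>R f x"
    proof (cases "x \<in> ?Q")
      case False
      moreover have "interior_tri \<subseteq> ?Q" by (auto simp: interior_tri_def cbox_Pair_eq)
      ultimately have "f x = 0" using z by blast
      then show ?thesis by simp
    qed simp
  qed simp
  also have "\<dots> = integral ?Q f" by (rule set_borel_integral_eq_integral(2)[OF i])
  also have "\<dots> = square_int f"
    using integral_prod_continuous[of "0::real" "0::real" 1 1 f, OF continuous_on_subset[OF c subset_UNIV]]
    unfolding box_real .
  finally show ?thesis by simp
qed

lemma square_int_mono:
  assumes "continuous_on UNIV f" "continuous_on UNIV g" "\<And>x. f x \<le> g x"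
  shows "square_int f \<le> square_int g"
  by (intro integral_le integrable_continuous_interval continuous_slice_integral continuous_slice assms)

lemma square_int_add_cmult:
  assumes "continuous_on UNIV f" "continuous_on UNIV g"
  shows "square_int (\<lambda>x. c * f x + d * g x) = c * square_int f + d * square_int g"
proof (rule integral_unique)
  have i: "h integrable_on {0..1}" if "continuous_on UNIV h" for h :: "real \<Rightarrow> real"
    using that by (intro integrable_continuous_interval) (rule continuous_on_subset[OF _ subset_UNIV])
  have "integral {0..1} (\<lambda>t. c * f (s, t) + d * g (s, t)) = c * integral {0..1} (\<lambda>t. f (s, t)) + d * integral {0..1} (\<lambda>t. g (s, t))" for s
    by (rule integral_unique, intro has_integral_add has_integral_mult_right integrable_integral i continuous_slice assms)
  then show "((\<lambda>s. integral {0..1} (\<lambda>t. c * f (s, t) + d * g (s, t))) has_integral c * square_int f + d * square_int g) {0..1}"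
    by (simp only:) (intro has_integral_add has_integral_mult_right integrable_integral i continuous_slice_integral assms)
qed

lemma cell_int_diff:
  assumes "continuous_on UNIV f" "continuous_on UNIV g"
  shows "cell_int N i j (\<lambda>x. f x + (- 1) * g x) = cell_int N i j f - cell_int N i j g"
proof -
  have "integral (cell N i) (\<lambda>t. f (s, t) + (- 1) * g (s, t)) = integral (cell N i) (\<lambda>t. f (s, t)) - integral (cell N i) (\<lambda>t. g (s, t))" for s
    using integral_diff[of "\<lambda>t. f (s, t)" "cell N i" "\<lambda>t. g (s, t)"] assms
    by (simp add: integrable_continuous_interval continuous_slice)
  then show ?thesis unfolding cell_int_def
    using integral_diff[of "\<lambda>s. integral (cell N i) (\<lambda>t. f (s, t))" "cell N j" "\<lambda>s. integral (cell N i) (\<lambda>t. g (s, t))"] assms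
    by (simp add: integrable_continuous_interval continuous_slice_integral)
qed

lemma cell_int_bound:
  assumes c: "continuous_on UNIV w" and ij: "i < N" "j < N"
  shows "(cell_int N i j w)\<^sup>2 \<le> square_int (\<lambda>x. (w x)\<^sup>2)"
proof -
  have c2: "continuous_on UNIV (\<lambda>x. (w x)\<^sup>2)" by (intro continuous_intros c)
  have sub: "cell N k \<subseteq> {0..1}" if "k < N" for k
    using that by (auto simp: divide_simps) 
  have one: "(integral (cell N k) f)\<^sup>2 \<le> integral {0..1} (\<lambda>x. (f x)\<^sup>2)" if f: "continuous_on UNIV f" and k: "k < N" for f :: "real \<Rightarrow> real" and k
  proof -
    have cf: "continuous_on S f" for S using f continuous_on_subset by blast
    have "(integral (cell N k) f)\<^sup>2 \<le> (real (Suc k) / N - real k / N) * integral (cell N k) (\<lambda>x. (f x)\<^sup>2)"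
      by (rule integral_square_le[OF cf]) (simp add: divide_right_mono)
    also have "\<dots> \<le> 1 * integral {0..1} (\<lambda>x. (f x)\<^sup>2)"
      using k sub[OF k]
      by (intro mult_mono integral_subset_le integral_nonneg integrable_continuous_interval continuous_intros cf)
         (auto simp: diff_divide_distrib[symmetric])
    finally show ?thesis by simp
  qed
  have "(cell_int N i j w)\<^sup>2 \<le> integral {0..1} (\<lambda>s. (integral (cell N i) (\<lambda>t. w (s, t)))\<^sup>2)"
    unfolding cell_int_def by (rule one[OF continuous_slice_integral[OF c] ij(2)])
  also have "\<dots> \<le> square_int (\<lambda>x. (w x)\<^sup>2)"
    by (intro integral_le integrable_continuous_interval continuous_intros continuous_slice_integral c c2 one continuous_slice ij)
  finally show ?thesis .
qed

text \<open>Choose a subsequence along which all averages over all rational grid cells converge. The Poincare inequality on a grid of mesh \<open>1/N\<close> bounds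
  the mass of differences by finitely many differences of averages plus an energy term that is as small as \<open>1/N\<^sup>2\<close>.\<close>
lemma Rellich_triangle:
  assumes D: "cross2 a b \<noteq> 0" shows "Rellich (affine_triangle c a b)"
  unfolding Rellich_def
proof (intro allI impI)
  fix \<phi> :: "nat \<Rightarrow> real^2 \<Rightarrow> real" and K
  assume H: "\<forall>n. \<phi> n \<in> test_functions (affine_triangle c a b) \<and> mass (\<phi> n) \<le> K \<and> energy (\<phi> n) \<le> K"
  then have \<phi>: "\<And>n. \<phi> n \<in> test_functions (affine_triangle c a b)" and mK: "\<And>n. mass (\<phi> n) \<le> K" and eK: "\<And>n. energy (\<phi> n) \<le> K" by auto
  define d where "d = \<bar>cross2 a b\<bar>"
  have d: "d > 0" using D by (simp add: d_def)
  define v where "v n x = \<phi> n (tri_map c a b x)" for n x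
  define vs where "vs n x = gradient (\<phi> n) (tri_map c a b x) \<bullet> a" for n x
  define vt where "vt n x = gradient (\<phi> n) (tri_map c a b x) \<bullet> b" for n x
  note pb = pullback[OF D \<phi>, folded v_def vs_def vt_def d_def]
  have C: "C1 (v n) (vs n) (vt n)" for n using pb(1)[of n] by (simp only: eta_contract_eq)
  note cv = C1_cont[OF C]
  have out: "v n x = 0" "gradient (\<phi> n) (tri_map c a b x) = 0" if "x \<notin> interior_tri" for n x
    using test_functionsD(4,5,7)[OF \<phi>[of n]] that triangle_iff[OF D, of c x] unfolding v_def by blast+
  have S: "square_int (\<lambda>x. (f x)\<^sup>2) = tri_int (\<lambda>x. (f x)\<^sup>2)" if "continuous_on UNIV f" "\<And>x. x \<notin> interior_tri \<Longrightarrow> f x = 0" for f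
    using that by (intro square_int_tri_int continuous_intros) auto
  have K0: "0 \<le> K" using mass_nonneg[of "\<phi> 0"] mK[of 0] by simp
  define B where "B = (1 + (norm a)\<^sup>2 + (norm b)\<^sup>2) * K / d"
  have mv: "square_int (\<lambda>x. (v n x)\<^sup>2) \<le> B" for n
  proof -
    have "square_int (\<lambda>x. (v n x)\<^sup>2) = mass (\<phi> n) / d" using S[OF cv(1) out(1)] pb(3)[of n] d by simp
    also have "\<dots> \<le> 1 * K / d" using mK d by (simp add: divide_right_mono)
    also have "\<dots> \<le> B" unfolding B_def using K0 d by (intro divide_right_mono mult_right_mono) auto
    finally show ?thesis .
  qed
  have gv: "square_int (\<lambda>x. (vs n x)\<^sup>2) + square_int (\<lambda>x. (vt n x)\<^sup>2) \<le> B" for n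
  proof -
    let ?g = "\<lambda>x. (norm (gradient (\<phi> n) (tri_map c a b x)))\<^sup>2"
    have cg: "continuous_on UNIV ?g"
      by (intro continuous_intros continuous_on_compose2[OF test_functionsD(3)[OF \<phi>] continuous_tri_map]) auto
    have e: "energy (\<phi> n) = d * tri_int ?g"
      unfolding energy_def d_def
      by (rule integral_triangle[OF D]) (use test_functionsD(5,7)[OF \<phi>[of n]] in \<open>auto intro!: borel_measurable_continuous_onI continuous_intros test_functionsD(3)[OF \<phi>]\<close>)
    have CS: "(x \<bullet> y)\<^sup>2 \<le> (norm y)\<^sup>2 * (norm x)\<^sup>2" for x y :: "real^2"
      using Cauchy_Schwarz_ineq[of y x] by (simp only: power2_norm_eq_inner inner_commute[of x y])
    have le: "(vs n x)\<^sup>2 \<le> (norm a)\<^sup>2 * ?g x" "(vt n x)\<^sup>2 \<le> (norm b)\<^sup>2 * ?g x" for x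
      unfolding vs_def vt_def by (rule CS, rule CS)
    have 1: "tri_int (\<lambda>x. (vs n x)\<^sup>2) \<le> (norm a)\<^sup>2 * tri_int ?g" "tri_int (\<lambda>x. (vt n x)\<^sup>2) \<le> (norm b)\<^sup>2 * tri_int ?g"
      unfolding tri_int_cmult[symmetric]
      by (rule tri_int_mono[OF continuous_on_power[OF cv(2)] continuous_on_mult[OF continuous_on_const cg] le(1)],
          rule tri_int_mono[OF continuous_on_power[OF cv(3)] continuous_on_mult[OF continuous_on_const cg] le(2)])
    have o2: "vs n x = 0" "vt n x = 0" if "x \<notin> interior_tri" for x
      unfolding vs_def vt_def out(2)[OF that] by simp_all
    have "square_int (\<lambda>x. (vs n x)\<^sup>2) + square_int (\<lambda>x. (vt n x)\<^sup>2) \<le> ((norm a)\<^sup>2 + (norm b)\<^sup>2) * tri_int ?g"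
    proof -
      have 2: "square_int (\<lambda>x. (vs n x)\<^sup>2) = tri_int (\<lambda>x. (vs n x)\<^sup>2)" by (rule S[OF cv(2) o2(1)])
      have 3: "square_int (\<lambda>x. (vt n x)\<^sup>2) = tri_int (\<lambda>x. (vt n x)\<^sup>2)" by (rule S[OF cv(3) o2(2)])
      show ?thesis using add_mono[OF 1] by (simp only: 2 3 distrib_right)
    qed
    also have "tri_int ?g = energy (\<phi> n) / d" unfolding e using d by (simp only: nonzero_mult_div_cancel_left)
    also have "((norm a)\<^sup>2 + (norm b)\<^sup>2) * (energy (\<phi> n) / d) \<le> (1 + (norm a)\<^sup>2 + (norm b)\<^sup>2) * (K / d)"
      by (rule mult_mono[OF _ divide_right_mono[OF eK]]) (use d energy_nonneg[of "\<phi> n"] in \<open>simp_all add: add_nonneg_nonneg\<close>)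
    finally show ?thesis unfolding B_def by simp
  qed
  have B0: "0 \<le> B" unfolding B_def using K0 d by simp
  \<comment> \<open>all averages at once, so that one subsequence serves every mesh\<close>
  define S where "S = {(N, i, j). i < N \<and> j < (N::nat)}"
  have "norm (case z of (N, i, j) \<Rightarrow> cell_int N i j (v n)) \<le> sqrt B" if "z \<in> S" for n z
  proof -
    obtain N i j where z: "z = (N, i, j)" by (cases z)
    have "(cell_int N i j (v n))\<^sup>2 \<le> B" using cell_int_bound[OF cv(1), of i N j n] mv[of n] that by (auto simp: z S_def intro: order_trans)
    then show ?thesis by (simp add: z real_le_rsqrt)
  qed
  then obtain r :: "nat \<Rightarrow> nat" where r: "strict_mono r"
    "\<And>z. z \<in> S \<Longrightarrow> \<exists>l. (\<lambda>n. (case z of (N, i, j) \<Rightarrow> cell_int N i j (v (r n)))) \<longlonglongrightarrow> l"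
    using function_convergent_subsequence[of S "\<lambda>n z. case z of (N, i, j) \<Rightarrow> cell_int N i j (v n)" "sqrt B"] by blast
  show "\<exists>r::nat \<Rightarrow> nat. strict_mono r \<and> (\<forall>e>0. \<exists>M. \<forall>n\<ge>M. \<forall>m\<ge>M. mass (\<lambda>x. \<phi> (r n) x + (- 1) * \<phi> (r m) x) < e)"
  proof (rule exI[of _ r], intro conjI r(1) allI impI)
    fix e :: real assume e: "0 < e"
    \<comment> \<open>a mesh for which the energy term contributes less than half of the allowed mass\<close>
    obtain N0 :: nat where N0: "8 * B * d / e < real N0" using reals_Archimedean2 by blast
    define N where "N = Suc N0"
    have N: "0 < N" "8 * B * d / e < real N" using N0 by (auto simp: N_def)
    have NB: "4 * B / (real N)\<^sup>2 < e / (2 * d)"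
    proof -
      have "8 * B * d < e * real N" using N(2) e by (simp add: field_simps)
      also have "\<dots> \<le> e * (real N)\<^sup>2" using N(1) e by (simp add: power2_eq_square)
      finally show ?thesis using N(1) d by (simp add: field_simps)
    qed
    obtain l where l: "\<And>i j. i < N \<Longrightarrow> j < N \<Longrightarrow> (\<lambda>n. cell_int N i j (v (r n))) \<longlonglongrightarrow> l i j"
    proof -
      have "\<exists>l. (\<lambda>n. cell_int N i j (v (r n))) \<longlonglongrightarrow> l" if "i < N" "j < N" for i j using r(2)[of "(N, i, j)"] that by (simp add: S_def)
      then have "\<forall>i j. \<exists>l. i < N \<longrightarrow> j < N \<longrightarrow> (\<lambda>n. cell_int N i j (v (r n))) \<longlonglongrightarrow> l" by blast
      then obtain l where "\<forall>i j. i < N \<longrightarrow> j < N \<longrightarrow> (\<lambda>n. cell_int N i j (v (r n))) \<longlonglongrightarrow> l i j" by metis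
      with that show ?thesis by blast
    qed
    define E where "E n = (\<Sum>i<N. \<Sum>j<N. (cell_int N i j (v (r n)) - l i j)\<^sup>2)" for n
    have "E \<longlonglongrightarrow> (\<Sum>i<N. \<Sum>j<N. (l i j - l i j)\<^sup>2)"
      unfolding E_def[abs_def] by (intro tendsto_sum tendsto_power tendsto_diff tendsto_const l) auto
    then have "E \<longlonglongrightarrow> 0" by simp
    moreover define \<delta> where "\<delta> = e / (2 * d) / (4 * (real N)\<^sup>2)"
    moreover have "0 < \<delta>" using e d N by (simp add: \<delta>_def)
    ultimately obtain M where M: "\<And>n. n \<ge> M \<Longrightarrow> \<bar>E n\<bar> < \<delta>" using LIMSEQ_D[of E 0 \<delta>] by (auto simp: real_norm_def)
    show "\<exists>M. \<forall>n\<ge>M. \<forall>m\<ge>M. mass (\<lambda>x. \<phi> (r n) x + (- 1) * \<phi> (r m) x) < e"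
    proof (rule exI[of _ M], intro allI impI)
      fix n m assume nm: "n \<ge> M" "m \<ge> M"
      define w where "w x = v (r n) x + (- 1) * v (r m) x" for x
      define ws where "ws x = vs (r n) x + (- 1) * vs (r m) x" for x
      define wt where "wt x = vt (r n) x + (- 1) * vt (r m) x" for x
      have sum4: "P + Q \<le> 4 * B" if "P \<le> 2 * x + 2 * y" "Q \<le> 2 * x' + 2 * y'" "x + x' \<le> B" "y + y' \<le> B" for P Q x y x' y'
        using that by linarith
      have Cw: "C1 w ws wt" unfolding w_def[abs_def] ws_def[abs_def] wt_def[abs_def] by (intro C1_add C1_cmult C)
      have sq: "(x + (- 1) * y)\<^sup>2 \<le> 2 * x\<^sup>2 + 2 * y\<^sup>2" for x y :: real
        using zero_le_power2[of "x + y"] by (simp add: power2_eq_square algebra_simps)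
      have der: "square_int (\<lambda>x. (f n' x + (- 1) * f m' x)\<^sup>2) \<le> 2 * square_int (\<lambda>x. (f n' x)\<^sup>2) + 2 * square_int (\<lambda>x. (f m' x)\<^sup>2)"
        if "\<And>n. continuous_on UNIV (f n)" for f :: "nat \<Rightarrow> real \<times> real \<Rightarrow> real" and n' m'
        unfolding square_int_add_cmult[OF continuous_on_power[OF that] continuous_on_power[OF that], symmetric]
        by (rule square_int_mono[OF _ _ sq]) (intro continuous_intros that)+
      have "mass (\<lambda>x. \<phi> (r n) x + (- 1) * \<phi> (r m) x) = d * tri_int (\<lambda>x. (w x)\<^sup>2)"
        using pullback(3)[OF D test_functions_add_cmult(1)[OF \<phi> \<phi>, of "r n" "- 1" "r m"]] unfolding w_def v_def d_def .
      also have "tri_int (\<lambda>x. (w x)\<^sup>2) = square_int (\<lambda>x. (w x)\<^sup>2)"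
        using S[OF C1_cont(1)[OF Cw]] out(1) by (simp add: w_def)
      also have "\<dots> \<le> (real N)\<^sup>2 * (\<Sum>i<N. \<Sum>j<N. (cell_int N i j w)\<^sup>2) + (square_int (\<lambda>x. (ws x)\<^sup>2) + square_int (\<lambda>x. (wt x)\<^sup>2)) / (real N)\<^sup>2"
        by (rule Poincare_square[OF Cw N(1)])
      finally have 1: "mass (\<lambda>x. \<phi> (r n) x + (- 1) * \<phi> (r m) x) \<le> d * ((real N)\<^sup>2 * (\<Sum>i<N. \<Sum>j<N. (cell_int N i j w)\<^sup>2) + (square_int (\<lambda>x. (ws x)\<^sup>2) + square_int (\<lambda>x. (wt x)\<^sup>2)) / (real N)\<^sup>2)"
        using d by (simp only: mult_le_cancel_left_pos)
      have "square_int (\<lambda>x. (ws x)\<^sup>2) + square_int (\<lambda>x. (wt x)\<^sup>2) \<le> 4 * B"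
        unfolding ws_def wt_def
        by (rule sum4[OF der[of vs "r n" "r m", OF cv(2)] der[of vt "r n" "r m", OF cv(3)] gv[of "r n"] gv[of "r m"]])
      then have 2: "(square_int (\<lambda>x. (ws x)\<^sup>2) + square_int (\<lambda>x. (wt x)\<^sup>2)) / (real N)\<^sup>2 < e / (2 * d)"
        by (rule le_less_trans[OF divide_right_mono NB]) simp
      have "(\<Sum>i<N. \<Sum>j<N. (cell_int N i j w)\<^sup>2) \<le> (\<Sum>i<N. \<Sum>j<N. 2 * (cell_int N i j (v (r n)) - l i j)\<^sup>2 + 2 * (cell_int N i j (v (r m)) - l i j)\<^sup>2)"
      proof (intro sum_mono)
        fix i j
        have "cell_int N i j w = (cell_int N i j (v (r n)) - l i j) + (- 1) * (cell_int N i j (v (r m)) - l i j)"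
          unfolding w_def[abs_def] cell_int_diff[OF cv(1) cv(1)] by simp
        then show "(cell_int N i j w)\<^sup>2 \<le> 2 * (cell_int N i j (v (r n)) - l i j)\<^sup>2 + 2 * (cell_int N i j (v (r m)) - l i j)\<^sup>2"
          using sq by (simp only:)
      qed
      also have "\<dots> = 2 * E n + 2 * E m" by (simp add: E_def sum.distrib sum_distrib_left)
      also have "\<dots> < 4 * \<delta>" using M[OF nm(1)] M[OF nm(2)] by linarith
      finally have "(real N)\<^sup>2 * (\<Sum>i<N. \<Sum>j<N. (cell_int N i j w)\<^sup>2) < (real N)\<^sup>2 * (4 * \<delta>)"
        by (rule mult_strict_left_mono) (use N(1) in simp)
      also have "\<dots> = e / (2 * d)" using N(1) by (simp add: \<delta>_def)
      finally have 3: "(real N)\<^sup>2 * (\<Sum>i<N. \<Sum>j<N. (cell_int N i j w)\<^sup>2) < e / (2 * d)" .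
      have "d * ((real N)\<^sup>2 * (\<Sum>i<N. \<Sum>j<N. (cell_int N i j w)\<^sup>2) + (square_int (\<lambda>x. (ws x)\<^sup>2) + square_int (\<lambda>x. (wt x)\<^sup>2)) / (real N)\<^sup>2) < d * (e / (2 * d) + e / (2 * d))"
        by (rule mult_strict_left_mono[OF add_strict_mono[OF 3 2] d])
      also have "\<dots> = e" using d by (simp add: field_simps)
      finally show "mass (\<lambda>x. \<phi> (r n) x + (- 1) * \<phi> (r m) x) < e" by (rule le_less_trans[OF 1])
    qed
  qed
qed

section \<open>Eigenvalue bounds on a triangle\<close>

text \<open>Near a point of the triangle the function is a smooth expression in affine coordinates; near any other point it vanishes.\<close>
lemma trial_function:
  assumes D: "cross2 a b \<noteq> 0" and e: "0 < e"
  shows "(\<lambda>y. cutoff e (tri_coord c a b y)) \<in> test_functions (affine_triangle c a b)" (is "?\<phi> \<in> _")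
proof -
  let ?T = "affine_triangle c a b"
  obtain \<delta> where \<delta>: "0 < \<delta>" "\<And>s t. s < \<delta> \<or> t < \<delta> \<or> s + t > 1 - \<delta> \<Longrightarrow> cutoff e (s, t) = 0"
    using cutoff_core[OF e] unfolding core_def by blast
  define p where "p = (1 / cross2 a b) *\<^sub>R (vector [b$2, - b$1] :: real^2)"
  define q where "q = (1 / cross2 a b) *\<^sub>R (vector [- a$2, a$1] :: real^2)"
  have co: "tri_coord c a b y = (p \<bullet> y + - (p \<bullet> c), q \<bullet> y + - (q \<bullet> c))" for y
  proof -
    have "vector [b$2, - b$1] \<bullet> w = cross2 w b" "vector [- a$2, a$1] \<bullet> w = cross2 a w" for w :: "real^2"
      by (simp_all add: inner_real2 cross2_def)
    then have "p \<bullet> (y - c) = cross2 (y - c) b / cross2 a b" "q \<bullet> (y - c) = cross2 a (y - c) / cross2 a b"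
      unfolding p_def q_def inner_scaleR_left by simp_all
    then show ?thesis unfolding tri_coord_def by (simp add: inner_diff_right)
  qed
  define L1 where "L1 y = p \<bullet> y + - (p \<bullet> c)" for y
  define L2 where "L2 y = q \<bullet> y + - (q \<bullet> c)" for y
  have co': "tri_coord c a b y = (L1 y, L2 y)" for y unfolding co L1_def L2_def ..
  have aff: "k_times_differentiable k L1" "k_times_differentiable k L2" for k
    unfolding L1_def[abs_def] L2_def[abs_def] by (rule ktd_affine)+
  define U where "U y = sin (2 * pi * L1 y) + sin (2 * pi * L2 y) + (- 1) * sin (2 * pi * (L1 y + L2 y))" for y
  have U: "k_times_differentiable k U" for k
    unfolding U_def[abs_def] by (intro ktd_add ktd_mult ktd_const ktd_sin aff)
  have Uu: "u1 (tri_coord c a b y) = U y" for y by (simp add: u1_def co' U_def)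
  have "k_times_differentiable k ?\<phi>" for k
  proof (rule ktd_local)
    fix y
    show "\<exists>V g. open V \<and> y \<in> V \<and> k_times_differentiable k g \<and> (\<forall>z\<in>V. ?\<phi> z = g z)"
    proof (cases "y \<in> ?T")
      case True
      have "?\<phi> z = U z * flat 0 ((1 / e) * U z + (- 1))" if "z \<in> ?T" for z
        using that triangle_coord[OF D, of z c] by (simp add: cutoff_def Uu)
      moreover have "k_times_differentiable k (\<lambda>z. U z * flat 0 ((1 / e) * U z + (- 1)))"
        by (intro ktd_mult U ktd_flat ktd_add ktd_const)
      ultimately show ?thesis using True open_triangle[OF D] by blast
    next
      case False
      define V where "V = {z. L1 z < \<delta>} \<union> {z. L2 z < \<delta>} \<union> {z. 1 - \<delta> < L1 z + L2 z}"
      have cL: "continuous_on UNIV L1" "continuous_on UNIV L2" by (rule ktd_cont[OF aff(1)[of 0]], rule ktd_cont[OF aff(2)[of 0]])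
      have "open V" unfolding V_def by (intro open_Un open_Collect_less continuous_intros cL)
      moreover have "y \<in> V" using False \<delta>(1) unfolding triangle_coord[OF D] co' V_def by (auto simp: interior_tri_def)
      moreover have "?\<phi> z = 0" if "z \<in> V" for z using \<delta>(2) that unfolding co' V_def by auto
      ultimately show ?thesis using ktd_const[of k 0] by blast
    qed
  qed
  then have sm: "smooth ?\<phi>" by (simp add: smooth_def)
  define K where "K = {x :: real \<times> real. \<delta> \<le> fst x} \<inter> {x. \<delta> \<le> snd x} \<inter> {x. fst x + snd x \<le> 1 - \<delta>}"
  have "compact K"
  proof -
    have "closed K" unfolding K_def by (intro closed_Int closed_Collect_le continuous_intros)
    moreover have "K \<subseteq> std_triangle" using \<delta>(1) by (auto simp: K_def std_triangle_def)
    ultimately show ?thesis using compact_std_triangle by (metis compact_Int_closed inf.absorb_iff2)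
  qed
  then have cK: "compact (tri_map c a b ` K)" by (rule compact_continuous_image[OF continuous_tri_map])
  have "{y. ?\<phi> y \<noteq> 0} \<subseteq> tri_map c a b ` K"
  proof
    fix y assume y: "y \<in> {y. ?\<phi> y \<noteq> 0}"
    define z where "z = tri_coord c a b y"
    have "cutoff e (fst z, snd z) \<noteq> 0" using y by (simp add: z_def)
    then have "\<not> (fst z < \<delta> \<or> snd z < \<delta> \<or> fst z + snd z > 1 - \<delta>)" using \<delta>(2) by blast
    then have "z \<in> K" by (simp add: K_def not_less)
    moreover have "y = tri_map c a b z" by (simp add: z_def tri_map_coord[OF D])
    ultimately show "y \<in> tri_map c a b ` K" by blast
  qed
  then have cl: "closure {y. ?\<phi> y \<noteq> 0} \<subseteq> tri_map c a b ` K" by (rule closure_minimal[OF _ compact_imp_closed[OF cK]])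
  moreover have "K \<subseteq> interior_tri" using \<delta>(1) by (auto simp: K_def interior_tri_def)
  ultimately have "closure {y. ?\<phi> y \<noteq> 0} \<subseteq> ?T" unfolding affine_triangle_def by blast
  moreover have "compact (closure {y. ?\<phi> y \<noteq> 0})" unfolding compact_eq_bounded_closed
    using bounded_subset[OF compact_imp_bounded[OF cK] cl] by simp
  ultimately show ?thesis using sm unfolding test_functions_def by blast
qed

text \<open>The trial function is the ground state of the equilateral triangle transported by the affine map, approximated by its cut-offs.\<close>
lemma Rayleigh_upper:
  assumes D: "cross2 a b \<noteq> 0" and R: "Rayleigh_bound (affine_triangle c a b) \<mu>"
  shows "\<mu> \<le> 4 * pi\<^sup>2 / 3 * (((norm a)\<^sup>2 + (norm b)\<^sup>2 + (norm (a - b))\<^sup>2) / (cross2 a b)\<^sup>2)"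
    and "\<exists>\<phi>\<in>test_functions (affine_triangle c a b). 0 < mass \<phi>"
proof -
  define p where "p = (norm b)\<^sup>2 / (cross2 a b)\<^sup>2"
  define q where "q = (norm a)\<^sup>2 / (cross2 a b)\<^sup>2"
  define r where "r = (norm (a - b))\<^sup>2 / (cross2 a b)\<^sup>2"
  define e where "e = (\<lambda>n. 1 / real (Suc n))"
  have e: "e n > 0" for n by (simp add: e_def)
  define \<phi> where "\<phi> n = (\<lambda>y. cutoff (e n) (tri_coord c a b y))" for n
  have \<phi>: "\<phi> n \<in> test_functions (affine_triangle c a b)" for n unfolding \<phi>_def by (rule trial_function[OF D e])
  have pv: "\<phi> n (tri_map c a b x) = cutoff (e n) x" for n x unfolding \<phi>_def tri_coord_map[OF D] ..
  define A where "A n x = u1s x * cutoff_slope (e n) x" for n x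
  define A' where "A' n x = u1t x * cutoff_slope (e n) x" for n x
  define w where "w n x = bil p q r (A n x) (A' n x) (A n x) (A' n x)" for n x
  note cc = C1_cont[OF cutoff_C1[OF e]] and cu = C1_cont[OF u1_C1']
  have m: "mass (\<phi> n) = \<bar>cross2 a b\<bar> * tri_int (\<lambda>x. (cutoff (e n) x)\<^sup>2)" for n
    using pullback(3)[OF D \<phi>[of n]] unfolding pv .
  have en: "energy (\<phi> n) = \<bar>cross2 a b\<bar> * tri_int (w n)" for n
  proof -
    note pb = pullback[OF D \<phi>[of n]]
    note un = C1_unique[OF pb(1)[unfolded pv] cutoff_C1[OF e, of n]]
    show ?thesis using pb(4) unfolding un p_def[symmetric] q_def[symmetric] r_def[symmetric] dform_def w_def[abs_def] A_def A'_def .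
  qed
  have cw: "continuous_on UNIV (w n)" for n
  proof -
    have "continuous_on UNIV (A n)" "continuous_on UNIV (A' n)" unfolding A_def[abs_def] A'_def[abs_def] by (rule cc)+
    then show ?thesis unfolding w_def[abs_def] bil_def by (intro continuous_intros)
  qed
  define B where "B = \<bar>p\<bar> * (4*pi)\<^sup>2 * 81 + \<bar>q\<bar> * (4*pi)\<^sup>2 * 81 + \<bar>(r - p - q) / 2\<bar> * (2 * (4*pi)\<^sup>2 * 81)"
  have wB: "\<bar>w n x\<bar> \<le> B" for n x
  proof -
    have aa: "\<bar>A n x\<bar> \<le> 4 * pi * 9" "\<bar>A' n x\<bar> \<le> 4 * pi * 9"
      unfolding A_def A'_def abs_mult by (intro mult_mono u1_bounds cutoff_slope_bound; simp)+
    define H where "H = (4 * pi * 9) * (4 * pi * 9)"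
    have g: "\<bar>y * z\<bar> \<le> H" if "\<bar>y\<bar> \<le> 4 * pi * 9" "\<bar>z\<bar> \<le> 4 * pi * 9" for y z
      unfolding H_def abs_mult by (rule mult_mono[OF that]) simp_all
    have gs: "\<bar>A n x * A' n x + A' n x * A n x\<bar> \<le> 2 * H"
      using abs_triangle_ineq[of "A n x * A' n x" "A' n x * A n x"] g[OF aa] g[OF aa(2,1)] by linarith
    have "\<bar>w n x\<bar> \<le> \<bar>p * (A n x * A n x)\<bar> + \<bar>q * (A' n x * A' n x)\<bar> + \<bar>(r - p - q) / 2 * (A n x * A' n x + A' n x * A n x)\<bar>"
      unfolding w_def bil_def mult.assoc[of p] mult.assoc[of q]
      by (rule order_trans[OF abs_triangle_ineq add_mono[OF abs_triangle_ineq order_refl]])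
    also have "\<dots> \<le> \<bar>p\<bar> * H + \<bar>q\<bar> * H + \<bar>(r - p - q) / 2\<bar> * (2 * H)"
      unfolding abs_mult[of p] abs_mult[of q] abs_mult[of "(r - p - q) / 2"]
      by (intro add_mono mult_left_mono g[OF aa(1,1)] g[OF aa(2,2)] gs abs_ge_zero)
    also have "\<dots> = B" by (simp add: B_def H_def power2_eq_square)
    finally show ?thesis .
  qed
  have L1: "(\<lambda>n. tri_int (\<lambda>x. (cutoff (e n) x)\<^sup>2)) \<longlonglongrightarrow> tri_int (\<lambda>x. (u1 x)\<^sup>2)"
  proof (rule tri_int_dominated[where B=9])
    show "\<bar>(cutoff (e n) x)\<^sup>2\<bar> \<le> 9" for n x using abs_le_square_iff[of "cutoff (e n) x" 3] u1_bounds(4)[of "e n" x] by simp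
    show "(\<lambda>n. (cutoff (e n) x)\<^sup>2) \<longlonglongrightarrow> (u1 x)\<^sup>2" if "x \<in> interior_tri" for x
      unfolding e_def by (intro tendsto_power cutoff_lim[OF that])
  qed (intro continuous_intros cc cu)+
  have L2: "(\<lambda>n. tri_int (w n)) \<longlonglongrightarrow> dform p q r u1s u1t u1s u1t"
    unfolding dform_def
  proof (rule tri_int_dominated[where B=B])
    show "(\<lambda>n. w n x) \<longlonglongrightarrow> bil p q r (u1s x) (u1t x) (u1s x) (u1t x)" if "x \<in> interior_tri" for x
    proof -
      have "(\<lambda>n. w n x) \<longlonglongrightarrow> bil p q r (u1s x * 1) (u1t x * 1) (u1s x * 1) (u1t x * 1)"
        unfolding w_def bil_def A_def A'_def e_def by (intro tendsto_add tendsto_mult tendsto_const cutoff_lim[OF that])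
      then show ?thesis by simp
    qed
    show "continuous_on UNIV (\<lambda>x. bil p q r (u1s x) (u1t x) (u1s x) (u1t x))" unfolding bil_def by (intro continuous_intros cu)
  qed (use cw wB in auto)
  have u2: "tri_int (\<lambda>x. (u1 x)\<^sup>2) = 3 / 4" using u1_inner(4) by (simp add: tri_inner_def power2_eq_square)
  have le: "\<mu> * tri_int (\<lambda>x. (cutoff (e n) x)\<^sup>2) \<le> tri_int (w n)" for n
  proof -
    have "\<mu> * mass (\<phi> n) \<le> energy (\<phi> n)" using R \<phi> unfolding Rayleigh_bound_def by blast
    then have "\<bar>cross2 a b\<bar> * (\<mu> * tri_int (\<lambda>x. (cutoff (e n) x)\<^sup>2)) \<le> \<bar>cross2 a b\<bar> * tri_int (w n)" unfolding m en by (simp add: mult_ac)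
    then show ?thesis using D by simp
  qed
  have "\<mu> * (3 / 4) \<le> dform p q r u1s u1t u1s u1t"
    using LIMSEQ_le[OF tendsto_mult[OF tendsto_const[of \<mu>] L1] L2] le unfolding u2 by blast
  also have "\<dots> = pi\<^sup>2 * (p + q + r)"
    unfolding dform_u1[OF u1_C1' u1_zero_bdry] u1_inner by (simp add: algebra_simps)
  finally have "\<mu> \<le> 4 * pi\<^sup>2 / 3 * (p + q + r)" by simp
  also have "p + q + r = ((norm a)\<^sup>2 + (norm b)\<^sup>2 + (norm (a - b))\<^sup>2) / (cross2 a b)\<^sup>2"
    unfolding p_def q_def r_def by (simp add: add_divide_distrib)
  finally show "\<mu> \<le> 4 * pi\<^sup>2 / 3 * (((norm a)\<^sup>2 + (norm b)\<^sup>2 + (norm (a - b))\<^sup>2) / (cross2 a b)\<^sup>2)" .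
  have "\<forall>\<^sub>F n in sequentially. 0 < tri_int (\<lambda>x. (cutoff (e n) x)\<^sup>2)" by (rule order_tendstoD(1)[OF L1]) (simp add: u2)
  then obtain n where "0 < tri_int (\<lambda>x. (cutoff (e n) x)\<^sup>2)" using eventually_happens' sequentially_bot by blast
  then have "0 < mass (\<phi> n)" unfolding m using D by simp
  with \<phi> show "\<exists>\<phi>\<in>test_functions (affine_triangle c a b). 0 < mass \<phi>" by blast
qed

lemma Rayleigh_lower:
  assumes D: "cross2 a b \<noteq> 0"
    and LB: "LB ((norm b)\<^sup>2 / (cross2 a b)\<^sup>2) ((norm a)\<^sup>2 / (cross2 a b)\<^sup>2) ((norm (a - b))\<^sup>2 / (cross2 a b)\<^sup>2) \<mu>"
  shows "Rayleigh_bound (affine_triangle c a b) \<mu>"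
  unfolding Rayleigh_bound_def
proof
  fix \<psi> assume \<psi>: "\<psi> \<in> test_functions (affine_triangle c a b)"
  note pb = pullback[OF D \<psi>]
  note le = LB[unfolded LB_def, rule_format, OF conjI[OF pb(1,2)]]
  show "\<mu> * mass \<psi> \<le> energy \<psi>"
    unfolding pb(3,4) using mult_left_mono[OF le, of "\<bar>cross2 a b\<bar>"] by (simp only: abs_ge_zero mult_ac)
qed

theorem eigenvalue_triangle:
  assumes D: "cross2 a b \<noteq> 0"
  shows "first_dirichlet_eigenvalue (affine_triangle c a b) \<le> 4 * pi\<^sup>2 / 3 * (((norm a)\<^sup>2 + (norm b)\<^sup>2 + (norm (a - b))\<^sup>2) / (cross2 a b)\<^sup>2)"
    and "LB ((norm b)\<^sup>2 / (cross2 a b)\<^sup>2) ((norm a)\<^sup>2 / (cross2 a b)\<^sup>2) ((norm (a - b))\<^sup>2 / (cross2 a b)\<^sup>2) \<mu> \<Longrightarrow>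
      \<mu> \<le> first_dirichlet_eigenvalue (affine_triangle c a b)"
proof -
  have "Rayleigh_bound (affine_triangle c a b) 0" by (simp add: Rayleigh_bound_def energy_nonneg)
  then obtain \<phi> where \<phi>: "\<phi> \<in> test_functions (affine_triangle c a b)" "0 < mass \<phi>" using Rayleigh_upper(2)[OF D] by blast
  note var = first_dirichlet_eigenvalue_variational[OF open_triangle[OF D] \<phi> Rellich_triangle[OF D]]
  show "first_dirichlet_eigenvalue (affine_triangle c a b) \<le> 4 * pi\<^sup>2 / 3 * (((norm a)\<^sup>2 + (norm b)\<^sup>2 + (norm (a - b))\<^sup>2) / (cross2 a b)\<^sup>2)"
    by (rule Rayleigh_upper(1)[OF D var(1)])
  show "\<mu> \<le> first_dirichlet_eigenvalue (affine_triangle c a b)"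
    if "LB ((norm b)\<^sup>2 / (cross2 a b)\<^sup>2) ((norm a)\<^sup>2 / (cross2 a b)\<^sup>2) ((norm (a - b))\<^sup>2 / (cross2 a b)\<^sup>2) \<mu>"
    by (rule var(2)[OF Rayleigh_lower[OF D that]])
qed

section \<open>Triangles of the plane\<close>

lemma norm2_real2: "(norm a)\<^sup>2 = a$1 * a$1 + a$2 * a$2" for a :: "real^2"
  by (simp add: power2_norm_eq_inner inner_real2)

lemma cross2_square: "(cross2 a b)\<^sup>2 = (norm a)\<^sup>2 * (norm b)\<^sup>2 - (a \<bullet> b)\<^sup>2"
  unfolding norm2_real2 inner_real2 cross2_def by (simp add: power2_eq_square algebra_simps)

lemma norm_diff_square: "(norm (a - b))\<^sup>2 = (norm a)\<^sup>2 + (norm b)\<^sup>2 - 2 * (a \<bullet> b)" for a b :: "'a::real_inner"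
  unfolding power2_norm_eq_inner by (simp add: inner_diff_left inner_diff_right inner_commute[of b a])

text \<open>Equality in the Cauchy-Schwarz inequality, by Lagrange's identity.\<close>
lemma collinear_cross2: "collinear {x, y, z} \<longleftrightarrow> cross2 (y - x) (z - x) = 0"
proof -
  have "{x, y, z} = {y, x, z}" by blast
  then have "collinear {x, y, z} \<longleftrightarrow> collinear {0, y - x, z - x}" using collinear_3[of y x z] by (simp only: NO_MATCH_def)
  also have "\<dots> \<longleftrightarrow> \<bar>(y - x) \<bullet> (z - x)\<bar> = norm (y - x) * norm (z - x)" by (rule norm_cauchy_schwarz_equal[symmetric])
  also have "\<dots> \<longleftrightarrow> ((y - x) \<bullet> (z - x))\<^sup>2 = (norm (y - x) * norm (z - x))\<^sup>2"
    using power2_eq_iff_nonneg[of "\<bar>(y - x) \<bullet> (z - x)\<bar>" "norm (y - x) * norm (z - x)"] by simp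
  also have "\<dots> \<longleftrightarrow> (cross2 (y - x) (z - x))\<^sup>2 = 0" unfolding cross2_square power_mult_distrib by auto
  finally show ?thesis by simp
qed

lemma interior_hull_triangle:
  assumes D: "cross2 a b \<noteq> 0" shows "interior (convex hull {c, c + a, c + b}) = affine_triangle c a b"
proof -
  have hull: "convex hull {c, c + a, c + b} = tri_map c a b ` std_triangle"
    unfolding convex_hull_3_alt by (auto simp: tri_map_def std_triangle_def image_iff Bex_def) blast+
  have "affine_triangle c a b \<subseteq> tri_map c a b ` std_triangle"
    unfolding affine_triangle_def using interior_tri_subset by blast
  then have 1: "affine_triangle c a b \<subseteq> interior (tri_map c a b ` std_triangle)"
    by (rule interior_maximal[OF _ open_triangle[OF D]])
  have "y \<in> affine_triangle c a b" if y: "y \<in> interior (tri_map c a b ` std_triangle)" for y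
  proof -
    define x where "x = tri_coord c a b y"
    let ?V = "tri_map c a b -` interior (tri_map c a b ` std_triangle)"
    have "open ?V" by (rule open_vimage[OF open_interior continuous_tri_map])
    moreover have "x \<in> ?V" using y tri_map_coord[OF D] by (simp add: x_def)
    ultimately obtain e where e: "e > 0" "ball x e \<subseteq> ?V" using open_contains_ball by blast
    have V: "z \<in> std_triangle" if "z \<in> ?V" for z
    proof -
      have "tri_map c a b z \<in> tri_map c a b ` std_triangle" using that interior_subset by blast
      then obtain w where "w \<in> std_triangle" "tri_map c a b z = tri_map c a b w" by blast
      then show ?thesis using tri_coord_map[OF D, of c z] tri_coord_map[OF D, of c w] by metis
    qed
    have sh: "x + h \<in> std_triangle" if "norm h < e" for h
    proof -
      have "x + h \<in> ball x e" using that by (simp add: dist_norm)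
      then show ?thesis using V e(2) by blast
    qed
    have "x + (- (e/2), 0) \<in> std_triangle" "x + (0, - (e/2)) \<in> std_triangle" "x + (e/2, 0) \<in> std_triangle"
      using e(1) by (intro sh; simp add: norm_Pair)+
    then have "x \<in> interior_tri" using e(1) by (cases x) (auto simp: std_triangle_def interior_tri_def)
    then show ?thesis using triangle_coord[OF D] by (simp add: x_def)
  qed
  then show ?thesis using 1 unfolding hull by blast
qed

lemma plane_triangle_affine: "cross2 a b \<noteq> 0 \<Longrightarrow> plane_triangle (affine_triangle c a b)"
  unfolding plane_triangle_def
  by (rule exI[of _ c], rule exI[of _ "c + a"], rule exI[of _ "c + b"]) (simp add: collinear_cross2 interior_hull_triangle)

lemma hull_affine:
  assumes "\<not> collinear {x, y, z}"
  shows "cross2 (y - x) (z - x) \<noteq> 0" "interior (convex hull {x, y, z}) = affine_triangle x (y - x) (z - x)"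
  using assms interior_hull_triangle[of "y - x" "z - x" x] by (auto simp: collinear_cross2)

text \<open>The two longest sides meet in the base vertex.\<close>
lemma plane_triangle_sorted:
  assumes "plane_triangle T"
  obtains c a b where "cross2 a b \<noteq> 0" "T = affine_triangle c a b" "norm a \<le> norm b" "norm (a - b) \<le> norm a"
proof -
  obtain x y z where n: "\<not> collinear {x, y, z}" and T: "T = interior (convex hull {x, y, z})"
    using assms unfolding plane_triangle_def by blast
  note ob = that
  have *: thesis if "{c, p, q} = {x, y, z}" "dist c p \<le> dist c q" "dist p q \<le> dist c p" for c p q
  proof (rule ob)
    show "cross2 (p - c) (q - c) \<noteq> 0" "T = affine_triangle c (p - c) (q - c)"
      using hull_affine[of c p q] n T that(1) by auto
    show "norm (p - c) \<le> norm (q - c)" "norm ((p - c) - (q - c)) \<le> norm (p - c)"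
      using that(2,3) by (auto simp: dist_norm norm_minus_commute)
  qed
  have d: "dist y x = dist x y" "dist z x = dist x z" "dist z y = dist y z" by (simp_all add: dist_commute)
  consider "dist x y \<le> dist x z" "dist y z \<le> dist x y" | "dist x z \<le> dist x y" "dist y z \<le> dist x z"
    | "dist x y \<le> dist y z" "dist x z \<le> dist x y" | "dist y z \<le> dist x y" "dist x z \<le> dist y z"
    | "dist x z \<le> dist y z" "dist x y \<le> dist x z" | "dist y z \<le> dist x z" "dist x y \<le> dist y z" by linarith
  then show thesis
  proof cases
    case 1 then show ?thesis by (intro *[of x y z]) auto
  next case 2 then show ?thesis by (intro *[of x z y]) (auto simp: d)
  next case 3 then show ?thesis by (intro *[of y x z]) (auto simp: d)
  next case 4 then show ?thesis by (intro *[of y z x]) (auto simp: d)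
  next case 5 then show ?thesis by (intro *[of z x y]) (auto simp: d)
  next case 6 then show ?thesis by (intro *[of z y x]) (auto simp: d)
  qed
qed

lemma equilateral_affine:
  assumes "equilateral_triangle T"
  obtains c e f where "cross2 e f \<noteq> 0" "T = affine_triangle c e f" "(norm f)\<^sup>2 = (norm e)\<^sup>2" "e \<bullet> f = (norm e)\<^sup>2 / 2"
    "\<bar>cross2 e f\<bar> = sqrt 3 / 2 * (norm e)\<^sup>2"
proof -
  obtain x y z where n: "\<not> collinear {x, y, z}" "dist x y = dist y z" "dist y z = dist z x" and T: "T = interior (convex hull {x, y, z})"
    using assms unfolding equilateral_triangle_def by blast
  define e where "e = y - x"
  define f where "f = z - x"
  have nn: "norm f = norm e" "norm (e - f) = norm e" using n(2,3) unfolding e_def f_def by (simp_all add: dist_norm norm_minus_commute)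
  have ef: "e \<bullet> f = (norm e)\<^sup>2 / 2" using norm_diff_square[of e f] nn by simp
  have "(cross2 e f)\<^sup>2 = (sqrt 3 / 2 * (norm e)\<^sup>2)\<^sup>2"
    unfolding cross2_square ef nn(1) by (simp add: power_mult_distrib power_divide power2_eq_square field_simps)
  then have "\<bar>cross2 e f\<bar> = sqrt 3 / 2 * (norm e)\<^sup>2" using real_sqrt_abs[of "cross2 e f"] by simp
  with that hull_affine[OF n(1)] T ef nn show ?thesis unfolding e_def f_def by auto
qed

lemma lmeasurable_triangle: "cross2 a b \<noteq> 0 \<Longrightarrow> affine_triangle c a b \<in> lmeasurable"
proof (rule lmeasurable_open[OF _ open_triangle])
  have "compact (tri_map c a b ` std_triangle)" by (rule compact_continuous_image[OF continuous_tri_map compact_std_triangle])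
  then show "bounded (affine_triangle c a b)"
    unfolding affine_triangle_def using interior_tri_subset by (meson bounded_subset compact_imp_bounded image_mono)
qed

lemma measure_sym_diff:
  assumes A: "A \<in> lmeasurable" and B: "B \<in> lmeasurable"
  shows "measure lebesgue (sym_diff A B) = measure lebesgue A + measure lebesgue B - 2 * measure lebesgue (A \<inter> B)"
proof -
  have AB: "A \<inter> B \<in> lmeasurable" using A B by (rule fmeasurable.Int)
  have 1: "measure lebesgue (A - B) = measure lebesgue A - measure lebesgue (A \<inter> B)" if "A \<in> lmeasurable" "B \<in> lmeasurable" for A B :: "'a set"
    using measurable_measure_Diff[OF that(1), of "A \<inter> B"] that by (simp add: Diff_Int)
  have "measure lebesgue (sym_diff A B) = measure lebesgue (A - B) + measure lebesgue (B - A)"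
    using A B by (intro measure_Un2[THEN trans]) (auto simp: Diff_Int_distrib Diff_triv intro!: arg_cong[where f="measure lebesgue"])
  then show ?thesis using 1[OF A B] 1[OF B A] by (simp add: Int_commute)
qed

lemma image_triangle:
  assumes "linear f" shows "(\<lambda>x. f x + d) ` affine_triangle c a b = affine_triangle (f c + d) (f a) (f b)"
  unfolding affine_triangle_def image_image tri_map_def
  by (simp add: linear_add[OF assms] linear_scale[OF assms] add_ac)

lemma scale_triangle: "(\<lambda>x. s *\<^sub>R x) ` affine_triangle c a b = affine_triangle (s *\<^sub>R c) (s *\<^sub>R a) (s *\<^sub>R b)"
  using image_triangle[of "\<lambda>x. s *\<^sub>R x" 0] by (simp add: linear_scale_self)

text \<open>The linear map that sends the edges \<open>a\<close>, \<open>b\<close> to \<open>a'\<close>, \<open>b'\<close> preserves the norm, as norms are computed from the Gram matrix of the edges.\<close>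
lemma rigid_motion_congruent:
  assumes D: "cross2 a b \<noteq> 0" and eq: "norm a' = norm a" "norm b' = norm b" "a' \<bullet> b' = a \<bullet> b"
  obtains R where "rigid_motion R" "R ` affine_triangle c a b = affine_triangle c' a' b'"
proof -
  define f where "f v = (cross2 v b / cross2 a b) *\<^sub>R a' + (cross2 a v / cross2 a b) *\<^sub>R b'" for v
  have lin: "linear f" unfolding f_def
    by (intro linearI) (simp_all add: cross2_add cross2_scale add_divide_distrib scaleR_add_left scaleR_add_right add_ac)
  have "norm (f v) = norm v" for v
  proof -
    have q: "(norm (s *\<^sub>R p + t *\<^sub>R q))\<^sup>2 = s\<^sup>2 * (norm p)\<^sup>2 + 2 * s * t * (p \<bullet> q) + t\<^sup>2 * (norm q)\<^sup>2" for s t and p q :: "real^2"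
      unfolding power2_norm_eq_inner by (simp add: inner_add_left inner_add_right inner_commute[of q p] power2_eq_square algebra_simps)
    have v: "(cross2 v b / cross2 a b) *\<^sub>R a + (cross2 a v / cross2 a b) *\<^sub>R b = v"
      using tri_map_coord[OF D, of 0 v] by (simp add: tri_map_def tri_coord_def)
    have "(norm (f v))\<^sup>2 = (norm ((cross2 v b / cross2 a b) *\<^sub>R a + (cross2 a v / cross2 a b) *\<^sub>R b))\<^sup>2"
      unfolding f_def q eq ..
    then show ?thesis unfolding v by simp
  qed
  then have f: "orthogonal_transformation f" using lin by (simp add: orthogonal_transformation)
  have "f a = a'" "f b = b'" using D by (simp_all add: f_def cross2_self)
  then have "(\<lambda>x. f x + (c' - f c)) ` affine_triangle c a b = affine_triangle c' a' b'"
    unfolding image_triangle[OF lin] by simp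
  with that[of "\<lambda>x. f x + (c' - f c)"] f show ?thesis unfolding rigid_motion_def by blast
qed

section \<open>The deficit controls the shape\<close>

definition sides2 :: "real^2 \<Rightarrow> real^2 \<Rightarrow> real" where
  "sides2 a b = (norm a)\<^sup>2 + (norm b)\<^sup>2 + (norm (a - b))\<^sup>2"

lemma LB_scale:
  assumes "LB p q r \<mu>" "0 \<le> k" shows "LB (k * p) (k * q) (k * r) (k * \<mu>)"
  unfolding LB_def
proof (intro allI impI)
  fix v vs vt assume v: "C1 v vs vt \<and> core v"
  have "dform (k * p) (k * q) (k * r) vs vt vs vt = k * dform p q r vs vt vs vt"
    unfolding dform_def tri_int_cmult[symmetric] by (rule tri_int_cong) (simp add: bil_def field_simps)
  moreover have "k * (\<mu> * tri_int (\<lambda>x. (v x)\<^sup>2)) \<le> k * dform p q r vs vt vs vt"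
    using assms v unfolding LB_def by (intro mult_left_mono) auto
  ultimately show "k * \<mu> * tri_int (\<lambda>x. (v x)\<^sup>2) \<le> dform (k * p) (k * q) (k * r) vs vt vs vt" by (simp add: mult.assoc)
qed

lemma sides2_pos: "cross2 a b \<noteq> 0 \<Longrightarrow> 0 < sides2 a b"
proof -
  assume "cross2 a b \<noteq> 0"
  then have "a \<noteq> 0" by (auto simp: cross2_def)
  then show ?thesis unfolding sides2_def by (simp add: add_pos_nonneg)
qed

text \<open>Heron's formula in terms of the normalised squared side lengths.\<close>
lemma shape_identity:
  assumes D: "cross2 a b \<noteq> 0"
  defines "L \<equiv> sides2 a b"
  defines "x \<equiv> 3 * (norm b)\<^sup>2 / L - 1" and "y \<equiv> 3 * (norm a)\<^sup>2 / L - 1" and "z \<equiv> 3 * (norm (a - b))\<^sup>2 / L - 1"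
  shows "x + y + z = 0" "2/3 * (x\<^sup>2 + y\<^sup>2 + z\<^sup>2) = 1 - 12 * (cross2 a b)\<^sup>2 / L\<^sup>2"
proof -
  define A where "A = (norm a)\<^sup>2"
  define B where "B = (norm b)\<^sup>2"
  define C where "C = (norm (a - b))\<^sup>2"
  have L: "L = A + B + C" "L > 0" using sides2_pos[OF D] by (simp_all add: L_def sides2_def A_def B_def C_def)
  have ab: "a \<bullet> b = (A + B - C) / 2" unfolding A_def B_def C_def norm_diff_square by simp
  have D2: "4 * (cross2 a b)\<^sup>2 = 4 * A * B - (A + B - C)\<^sup>2"
    unfolding cross2_square ab A_def[symmetric] B_def[symmetric] by (simp add: power_divide)
  have "x + y + z = 3 * (A + B + C) / L - 3"
    unfolding x_def y_def z_def A_def[symmetric] B_def[symmetric] C_def[symmetric] by (simp add: add_divide_distrib)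
  also have "\<dots> = 0" unfolding L(1)[symmetric] using L(2) by simp
  finally show "x + y + z = 0" .
  have "L\<^sup>2 * (2/3 * (x\<^sup>2 + y\<^sup>2 + z\<^sup>2)) = 2/3 * ((L * x)\<^sup>2 + (L * y)\<^sup>2 + (L * z)\<^sup>2)" by (simp add: power_mult_distrib algebra_simps)
  also have "\<dots> = 2/3 * ((3 * B - L)\<^sup>2 + (3 * A - L)\<^sup>2 + (3 * C - L)\<^sup>2)"
    using L(2) by (simp add: x_def y_def z_def A_def B_def C_def right_diff_distrib)
  also have "\<dots> = L\<^sup>2 - 3 * (4 * (cross2 a b)\<^sup>2)" unfolding D2 L(1) by (simp add: power2_eq_square algebra_simps)
  finally show "2/3 * (x\<^sup>2 + y\<^sup>2 + z\<^sup>2) = 1 - 12 * (cross2 a b)\<^sup>2 / L\<^sup>2" using L(2) by (simp add: field_simps)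
qed

text \<open>The value of \<open>|T| \<lambda>(T)\<close> for equilateral triangles.\<close>
definition optimal :: real where "optimal = 4 * pi\<^sup>2 / sqrt 3"

lemma energy_upper:
  assumes D: "cross2 a b \<noteq> 0"
  shows "measure lebesgue (affine_triangle c a b) * first_dirichlet_eigenvalue (affine_triangle c a b) \<le> 2 * pi\<^sup>2 / 3 * (sides2 a b / \<bar>cross2 a b\<bar>)"
proof -
  have "measure lebesgue (affine_triangle c a b) * first_dirichlet_eigenvalue (affine_triangle c a b) \<le> \<bar>cross2 a b\<bar> / 2 * (4 * pi\<^sup>2 / 3 * (sides2 a b / (cross2 a b)\<^sup>2))"
    unfolding measure_triangle[OF D] sides2_def by (rule mult_left_mono[OF eigenvalue_triangle(1)[OF D]]) simp
  also have "(cross2 a b)\<^sup>2 = \<bar>cross2 a b\<bar> * \<bar>cross2 a b\<bar>" by (simp add: power2_eq_square)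
  also have "\<bar>cross2 a b\<bar> / 2 * (4 * pi\<^sup>2 / 3 * (sides2 a b / (\<bar>cross2 a b\<bar> * \<bar>cross2 a b\<bar>))) = 2 * pi\<^sup>2 / 3 * (sides2 a b / \<bar>cross2 a b\<bar>)"
    using D by (simp add: divide_simps)
  finally show ?thesis .
qed

text \<open>The edges are ordered by length, because \<open>LBx_stability\<close> treats ordered coefficients.\<close>
lemma energy_lower:
  assumes D: "cross2 a b \<noteq> 0" and ord: "norm a \<le> norm b" "norm (a - b) \<le> norm a"
  shows "optimal * (1 + (1 - 12 * (cross2 a b)\<^sup>2 / (sides2 a b)\<^sup>2) / 1000)
     \<le> measure lebesgue (affine_triangle c a b) * first_dirichlet_eigenvalue (affine_triangle c a b)"
proof -
  define L where "L = sides2 a b"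
  define d where "d = \<bar>cross2 a b\<bar>"
  have L: "L > 0" and d: "d > 0" using sides2_pos[OF D] D by (simp_all add: L_def d_def)
  have d2: "(cross2 a b)\<^sup>2 = d\<^sup>2" by (simp add: d_def)
  define R where "R = 1 - 12 * (cross2 a b)\<^sup>2 / L\<^sup>2"
  define x where "x = 3 * (norm b)\<^sup>2 / L - 1"
  define y where "y = 3 * (norm a)\<^sup>2 / L - 1"
  define z where "z = 3 * (norm (a - b))\<^sup>2 / L - 1"
  note si = shape_identity[OF D, folded L_def, folded x_def y_def z_def R_def]
  have xyz: "x \<ge> y" "y \<ge> z" unfolding x_def y_def z_def using L ord by (auto intro!: divide_right_mono power_mono)
  have R1: "R < 1" using D L by (simp add: R_def)
  have R0: "0 \<le> R" unfolding si(2)[symmetric] by simp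
  obtain M where M: "LBx x y z M" "sqrt (1 - R) + R / 1000 \<le> M"
    using LBx_stability[OF si(1) xyz si(2)[symmetric] R1] by blast
  define k where "k = L / (4 * d\<^sup>2)"
  have k: "k \<ge> 0" using L by (simp add: k_def)
  have sc: "k * (4/3 * (1 + (3 * n / L - 1))) = n / (cross2 a b)\<^sup>2" for n
    unfolding d2 k_def using L d by (simp add: field_simps)
  have "k * (16 * pi\<^sup>2 / 3 * M) \<le> first_dirichlet_eigenvalue (affine_triangle c a b)"
    by (rule eigenvalue_triangle(2)[OF D]) (use LB_scale[OF M(1)[unfolded LBx_def] k] in \<open>simp only: x_def y_def z_def sc\<close>)
  then have "d / 2 * (k * (16 * pi\<^sup>2 / 3 * M)) \<le> measure lebesgue (affine_triangle c a b) * first_dirichlet_eigenvalue (affine_triangle c a b)"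
    unfolding measure_triangle[OF D] d_def[symmetric] using d by (intro mult_left_mono) auto
  moreover have "d / 2 * (k * (16 * pi\<^sup>2 / 3 * M)) = 2 * pi\<^sup>2 / 3 * (L / d) * M"
    unfolding k_def using d by (simp add: power2_eq_square field_simps)
  moreover have "optimal * (1 + R / 1000) \<le> 2 * pi\<^sup>2 / 3 * (L / d) * M"
  proof -
    define \<sigma> where "\<sigma> = sqrt (1 - R)"
    have s12: "sqrt 12 = 2 * sqrt 3" using real_sqrt_mult[of 4 3] by simp
    have sg: "\<sigma> = 2 * sqrt 3 * d / L"
      unfolding \<sigma>_def R_def d2 using L d s12 by (simp add: real_sqrt_divide real_sqrt_mult)
    have s1: "0 < \<sigma>" "\<sigma> \<le> 1" using R0 R1 by (simp_all add: \<sigma>_def)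
    have "2 * pi\<^sup>2 / 3 * (L / d) = optimal / \<sigma>"
      unfolding sg optimal_def using L d by (simp add: field_simps)
    moreover have "optimal * (1 + R / 1000) \<le> optimal / \<sigma> * M"
    proof -
      have "\<sigma> * (1 + R / 1000) \<le> \<sigma> + R / 1000" using s1 R0 mult_right_mono[of \<sigma> 1 "R / 1000"] by (simp add: algebra_simps)
      also have "\<dots> \<le> M" using M(2) by (simp add: \<sigma>_def)
      finally have "1 + R / 1000 \<le> M / \<sigma>" using s1 by (simp add: field_simps)
      then have "optimal * (1 + R / 1000) \<le> optimal * (M / \<sigma>)" by (rule mult_left_mono) (simp add: optimal_def)
      then show ?thesis by simp
    qed
    ultimately show ?thesis by simp
  qed
  ultimately show ?thesis unfolding R_def L_def by linarith
qed

lemma energy_equilateral: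
  assumes "equilateral_triangle T" shows "measure lebesgue T * first_dirichlet_eigenvalue T = optimal"
proof -
  obtain c e f where ef: "cross2 e f \<noteq> 0" "T = affine_triangle c e f" "(norm f)\<^sup>2 = (norm e)\<^sup>2" "e \<bullet> f = (norm e)\<^sup>2 / 2"
    "\<bar>cross2 e f\<bar> = sqrt 3 / 2 * (norm e)\<^sup>2" by (rule equilateral_affine[OF assms])
  have n: "(norm (e - f))\<^sup>2 = (norm e)\<^sup>2" unfolding norm_diff_square ef(3,4) by simp
  have e0: "(norm e)\<^sup>2 > 0" using ef(1) by (auto simp: cross2_def)
  have s: "sides2 e f = 3 * (norm e)\<^sup>2" unfolding sides2_def n ef(3) by simp
  have eqn: "norm f = norm e" "norm (e - f) = norm e" using ef(3) n by simp_all
  have "(cross2 e f)\<^sup>2 = \<bar>cross2 e f\<bar>\<^sup>2" by simp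
  then have c2: "12 * (cross2 e f)\<^sup>2 / (sides2 e f)\<^sup>2 = 1" unfolding s ef(5) using e0 by (simp add: power_mult_distrib power_divide)
  have "optimal \<le> measure lebesgue T * first_dirichlet_eigenvalue T"
    using energy_lower[OF ef(1), of c] unfolding c2 eqn ef(2) by simp
  moreover have "measure lebesgue T * first_dirichlet_eigenvalue T \<le> 2 * pi\<^sup>2 / 3 * (3 * (norm e)\<^sup>2 / (sqrt 3 / 2 * (norm e)\<^sup>2))"
    using energy_upper[OF ef(1), of c] unfolding s ef(5) ef(2) .
  moreover have "2 * pi\<^sup>2 / 3 * (3 * (norm e)\<^sup>2 / (sqrt 3 / 2 * (norm e)\<^sup>2)) = optimal"
    using e0 by (simp add: optimal_def field_simps)
  ultimately show ?thesis by simp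
qed

section \<open>The asymmetry\<close>

text \<open>The coordinates of a point with respect to the two pairs of edges differ by at most \<open>k\<close> on the unit triangle. Points that keep distance \<open>k\<close> from the sides in the
  first coordinates therefore lie in both triangles; the factor \<open>1 - 4 k\<close> accounts for \<open>k\<close> at the two axes and \<open>2 k\<close> at the third side.\<close>
lemma affine_triangle_shrink:
  assumes D: "cross2 a b \<noteq> 0" and k: "0 \<le> k" "4 * k < 1"
    and near: "\<bar>l - 1\<bar> + \<bar>m\<bar> \<le> k" "\<bar>1 / l - 1\<bar> \<le> k" and l: "l > 0"
  defines "a' \<equiv> l *\<^sub>R a" and "b' \<equiv> m *\<^sub>R a + (1 / l) *\<^sub>R b"
  shows "affine_triangle (c + k *\<^sub>R a' + k *\<^sub>R b') ((1 - 4 * k) *\<^sub>R a') ((1 - 4 * k) *\<^sub>R b') \<subseteq> affine_triangle c a' b' \<inter> affine_triangle c a b"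
proof
  fix y assume "y \<in> affine_triangle (c + k *\<^sub>R a' + k *\<^sub>R b') ((1 - 4 * k) *\<^sub>R a') ((1 - 4 * k) *\<^sub>R b')"
  then obtain s t where st: "0 < s" "0 < t" "s + t < 1" and y: "y = (c + k *\<^sub>R a' + k *\<^sub>R b') + s *\<^sub>R (1 - 4 * k) *\<^sub>R a' + t *\<^sub>R (1 - 4 * k) *\<^sub>R b'"
    unfolding affine_triangle_def tri_map_def interior_tri_def by auto
  define S where "S = k + s * (1 - 4 * k)"
  define T where "T = k + t * (1 - 4 * k)"
  have p: "0 < s * (1 - 4 * k)" "0 < t * (1 - 4 * k)" using st k by simp_all
  have q: "(s + t) * (1 - 4 * k) < 1 * (1 - 4 * k)" using st k by (intro mult_strict_right_mono) auto
  have ST: "k < S" "k < T" "S + T < 1 - 2 * k" using p q by (simp_all add: S_def T_def algebra_simps)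
  have y1: "y = tri_map c a' b' (S, T)" unfolding y tri_map_def S_def T_def by (simp add: algebra_simps)
  then have "y \<in> affine_triangle c a' b'"
    unfolding affine_triangle_def using ST k by (auto simp: interior_tri_def)
  moreover have "y = tri_map c a b (l * S + m * T, T / l)"
    unfolding y1 tri_map_def a'_def b'_def by (simp add: algebra_simps)
  moreover have "(l * S + m * T, T / l) \<in> interior_tri"
  proof -
    have S1: "\<bar>S\<bar> \<le> 1" "\<bar>T\<bar> \<le> 1" using ST k by linarith+
    have "\<bar>(l - 1) * S + m * T\<bar> \<le> \<bar>(l - 1) * S\<bar> + \<bar>m * T\<bar>" by (rule abs_triangle_ineq)
    also have "\<dots> \<le> \<bar>l - 1\<bar> + \<bar>m\<bar>" unfolding abs_mult using S1 by (intro add_mono) (simp_all add: mult_left_le)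
    finally have 1: "\<bar>(l - 1) * S + m * T\<bar> \<le> k" using near(1) by linarith
    have "\<bar>(1 / l - 1) * T\<bar> \<le> \<bar>1 / l - 1\<bar>" unfolding abs_mult using S1 by (simp add: mult_left_le)
    then have 2: "\<bar>(1 / l - 1) * T\<bar> \<le> k" using near(2) by linarith
    have "l * S + m * T = S + ((l - 1) * S + m * T)" "T / l = T + (1 / l - 1) * T" by (simp_all add: algebra_simps)
    then have "\<bar>l * S + m * T - S\<bar> \<le> k" "\<bar>T / l - T\<bar> \<le> k" using 1 2 by simp_all
    then show ?thesis using ST unfolding interior_tri_def by auto
  qed
  ultimately show "y \<in> affine_triangle c a' b' \<inter> affine_triangle c a b" unfolding affine_triangle_def by blast
qed

text \<open>Two sets of equal area whose intersection contains a copy scaled by \<open>1 - 4 k\<close>.\<close>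
lemma sheared_triangle_sym_diff:
  assumes D: "cross2 a b \<noteq> 0" and k: "0 \<le> k"
    and near: "\<bar>l - 1\<bar> + \<bar>m\<bar> \<le> k" "\<bar>1 / l - 1\<bar> \<le> k" and l: "l > 0"
  defines "a' \<equiv> l *\<^sub>R a" and "b' \<equiv> m *\<^sub>R a + (1 / l) *\<^sub>R b"
  shows "cross2 a' b' = cross2 a b"
    "measure lebesgue (sym_diff (affine_triangle c a' b') (affine_triangle c a b)) \<le> 16 * k * measure lebesgue (affine_triangle c a b)"
proof -
  show D': "cross2 a' b' = cross2 a b"
    unfolding a'_def b'_def cross2_add cross2_scale cross2_self using l by simp
  have D2: "cross2 a' b' \<noteq> 0" using D D' by simp
  let ?A = "affine_triangle c a' b'" and ?B = "affine_triangle c a b"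
  define d where "d = \<bar>cross2 a b\<bar>"
  have d: "d > 0" using D by (simp add: d_def)
  have AB: "?A \<in> lmeasurable" "?B \<in> lmeasurable" using D D2 by (auto intro: lmeasurable_triangle)
  have m: "measure lebesgue ?A = d / 2" "measure lebesgue ?B = d / 2" unfolding measure_triangle[OF D] measure_triangle[OF D2] D' d_def by simp_all
  show "measure lebesgue (sym_diff ?A ?B) \<le> 16 * k * measure lebesgue ?B"
  proof (cases "4 * k < 1")
    case True
    let ?C = "affine_triangle (c + k *\<^sub>R a' + k *\<^sub>R b') ((1 - 4 * k) *\<^sub>R a') ((1 - 4 * k) *\<^sub>R b')"
    have c: "cross2 ((1 - 4 * k) *\<^sub>R a') ((1 - 4 * k) *\<^sub>R b') = (1 - 4 * k)\<^sup>2 * cross2 a b"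
      unfolding cross2_scale D' by (simp add: power2_eq_square)
    have c0: "cross2 ((1 - 4 * k) *\<^sub>R a') ((1 - 4 * k) *\<^sub>R b') \<noteq> 0" unfolding c using D True by simp
    have "measure lebesgue ?C \<le> measure lebesgue (?A \<inter> ?B)"
      using affine_triangle_shrink[OF D k True near l, of c] lmeasurable_triangle[OF c0] AB
      unfolding a'_def[symmetric] b'_def[symmetric] by (intro measure_mono_fmeasurable) auto
    moreover have "measure lebesgue ?C = (1 - 4 * k)\<^sup>2 * (d / 2)"
      unfolding measure_triangle[OF c0] c d_def by (simp add: abs_mult)
    moreover have "(1 - 8 * k) * (d / 2) \<le> (1 - 4 * k)\<^sup>2 * (d / 2)"
      using d by (intro mult_right_mono) (simp_all add: power2_eq_square algebra_simps)
    ultimately show ?thesis unfolding measure_sym_diff[OF AB] m by (simp add: algebra_simps)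
  next
    case False
    have "measure lebesgue (sym_diff ?A ?B) \<le> d" unfolding measure_sym_diff[OF AB] m by simp
    also have "\<dots> \<le> 16 * k * (d / 2)" using False d by simp
    finally show ?thesis unfolding m .
  qed
qed

text \<open>Here \<open>l\<close> and \<open>m\<close> are the entries of the shear that maps the equilateral triangle to a congruent copy of a triangle with shape
  parameters \<open>x\<close>, \<open>z\<close>; all of them are Lipschitz in \<open>r = \<surd>R\<close>.\<close>
lemma shape_parameters:
  fixes r \<sigma> x z l m :: real
  assumes r: "0 \<le> r" "r \<le> 1 / 10" and \<sigma>: "\<sigma>\<^sup>2 = 1 - r\<^sup>2" "0 < \<sigma>" and x: "\<bar>x\<bar> \<le> r" and z: "\<bar>z\<bar> \<le> r"
    and l: "l\<^sup>2 = (1 + x) / \<sigma>" "0 < l" and m: "m * l = (1 - 2 * z - \<sigma>) / (2 * \<sigma>)"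
  shows "\<bar>l - 1\<bar> + \<bar>m\<bar> \<le> 3 * r" "\<bar>1 / l - 1\<bar> \<le> 3 * r"
proof -
  have rr: "r\<^sup>2 \<le> r / 10" using r mult_left_mono[of r "1/10" r] by (simp add: power2_eq_square)
  have s1: "\<sigma> \<le> 1" using \<sigma> by (intro power2_le_imp_le[of \<sigma> 1]) auto
  have s2: "1 - r / 10 \<le> \<sigma>"
  proof -
    have "\<sigma>\<^sup>2 \<le> \<sigma>" using s1 \<sigma>(2) mult_left_mono[of \<sigma> 1 \<sigma>] by (simp add: power2_eq_square)
    then show ?thesis using \<sigma>(1) rr by linarith
  qed
  have s3: "99 / 100 \<le> \<sigma>" using s2 r by linarith
  have L: "\<bar>l\<^sup>2 - 1\<bar> \<le> 13 / 10 * r"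
  proof -
    have "1 + x \<le> (1 + 13/10 * r) * \<sigma>"
    proof -
      have "(1 + 13/10 * r) * (1 - r / 10) \<le> (1 + 13/10 * r) * \<sigma>" using s2 r by (intro mult_left_mono) auto
      moreover have "(1 + 13/10 * r) * (1 - r / 10) = 1 + 12/10 * r - 13/100 * r\<^sup>2" by (simp add: power2_eq_square field_simps)
      ultimately show ?thesis using x rr r by linarith
    qed
    moreover have "(1 - 13/10 * r) * \<sigma> \<le> 1 + x"
    proof -
      have "(1 - 13/10 * r) * \<sigma> \<le> 1 - 13/10 * r" using s1 r mult_left_mono[of \<sigma> 1 "1 - 13/10 * r"] by simp
      also have "\<dots> \<le> 1 + x" using x r by linarith
      finally show ?thesis .
    qed
    ultimately have "l\<^sup>2 \<le> 1 + 13/10 * r" "1 - 13/10 * r \<le> l\<^sup>2" unfolding l(1) using \<sigma>(2) by (simp_all add: pos_divide_le_eq pos_le_divide_eq)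
    then show ?thesis by linarith
  qed
  have l1: "\<bar>l - 1\<bar> \<le> 13 / 10 * r"
  proof -
    have "\<bar>l - 1\<bar> * 1 \<le> \<bar>l - 1\<bar> * \<bar>l + 1\<bar>" using l(2) by (intro mult_left_mono) auto
    also have "\<dots> = \<bar>l\<^sup>2 - 1\<bar>" unfolding abs_mult[symmetric] by (simp add: power2_eq_square algebra_simps)
    finally have "\<bar>l - 1\<bar> \<le> \<bar>l\<^sup>2 - 1\<bar>" by simp
    then show ?thesis using L by (rule order_trans)
  qed
  have l2: "87 / 100 \<le> l" using l1 r by linarith
  have "1 / l - 1 = (1 - l) / l" using l(2) by (simp add: diff_divide_distrib)
  then have "\<bar>1 / l - 1\<bar> = \<bar>l - 1\<bar> / l" using l(2) by (simp only: abs_divide abs_of_pos abs_minus_commute)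
  also have "\<dots> \<le> (13 / 10 * r) / (87 / 100)" using l1 l2 r by (intro frac_le) auto
  also have "\<dots> \<le> 3 * r" using r by simp
  finally show "\<bar>1 / l - 1\<bar> \<le> 3 * r" .
  have "\<bar>m\<bar> = \<bar>1 - 2 * z - \<sigma>\<bar> / (2 * \<sigma> * l)"
  proof -
    have "m = (1 - 2 * z - \<sigma>) / (2 * \<sigma>) / l"
      unfolding m[symmetric] using l(2) by simp
    then show ?thesis using l(2) \<sigma>(2) by (simp add: abs_divide abs_mult)
  qed
  also have "\<dots> \<le> (21 / 10 * r) / (2 * (99/100) * (87/100))"
  proof (rule frac_le)
    show "\<bar>1 - 2 * z - \<sigma>\<bar> \<le> 21 / 10 * r" using z s1 s2 by linarith
    show "2 * (99/100) * (87/100) \<le> 2 * \<sigma> * l" using s3 l2 by (intro mult_mono) auto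
  qed (use r in auto)
  also have "\<dots> \<le> 17 / 10 * r" using r by simp
  finally show "\<bar>l - 1\<bar> + \<bar>m\<bar> \<le> 3 * r" using l1 by linarith
qed

text \<open>Place the triangle with the first side along the first side of the equilateral triangle of equal area. It is then the image of the
  equilateral triangle under an upper triangular matrix of determinant one, whose entries are determined by the Gram matrix.\<close>
lemma asymmetry_upper:
  assumes D: "cross2 a b \<noteq> 0" and K: "cross2 e f \<noteq> 0" "(norm f)\<^sup>2 = (norm e)\<^sup>2" "e \<bullet> f = (norm e)\<^sup>2 / 2"
      "\<bar>cross2 e f\<bar> = sqrt 3 / 2 * (norm e)\<^sup>2" and area: "\<bar>cross2 e f\<bar> = \<bar>cross2 a b\<bar>"
  defines "R \<equiv> 1 - 12 * (cross2 a b)\<^sup>2 / (sides2 a b)\<^sup>2"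
  obtains M where "rigid_motion M"
    "measure lebesgue (sym_diff (M ` affine_triangle c a b) (affine_triangle k e f)) \<le> 48 * sqrt R * measure lebesgue (affine_triangle c a b)"
proof -
  define L where "L = sides2 a b"
  define d where "d = \<bar>cross2 a b\<bar>"
  define q where "q = (norm e)\<^sup>2"
  have L: "L > 0" and d: "d > 0" using sides2_pos[OF D] D by (simp_all add: L_def d_def)
  have d2: "(cross2 a b)\<^sup>2 = d\<^sup>2" by (simp add: d_def)
  define y where "y = 3 * (norm a)\<^sup>2 / L - 1"
  define x where "x = 3 * (norm b)\<^sup>2 / L - 1"
  define z where "z = 3 * (norm (a - b))\<^sup>2 / L - 1"
  note si = shape_identity[OF D, folded L_def, folded x_def y_def z_def, folded R_def[folded L_def]]
  have R1: "R < 1" using D L by (simp add: R_def L_def)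
  have R0: "0 \<le> R" unfolding si(2)[symmetric] by simp
  define r where "r = sqrt R"
  have r: "0 \<le> r" "r\<^sup>2 = R" using R0 by (simp_all add: r_def)
  define \<sigma> where "\<sigma> = sqrt (1 - R)"
  have s12: "sqrt 12 = 2 * sqrt 3" using real_sqrt_mult[of 4 3] by simp
  have sg: "\<sigma> = 2 * sqrt 3 * d / L"
    unfolding \<sigma>_def R_def d2 L_def[symmetric] using L d s12 by (simp add: real_sqrt_divide real_sqrt_mult)
  have \<sigma>: "\<sigma>\<^sup>2 = 1 - r\<^sup>2" "0 < \<sigma>" using R1 r by (simp_all add: \<sigma>_def)
  have dq: "d = sqrt 3 / 2 * q" using K(4) area by (simp add: d_def q_def)
  have "\<sigma> * L = 2 * sqrt 3 * d" unfolding sg using L by simp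
  also have "\<dots> = 3 * q" unfolding dq by simp
  finally have q: "q = \<sigma> * L / 3" by simp
  \<comment> \<open>the ratio of the length of \<open>a\<close> to that of \<open>e\<close>; the entry \<open>m\<close> then follows from the inner product \<open>a \<bullet> b\<close>\<close>
  define l where "l = sqrt ((1 + y) / \<sigma>)"
  have na: "(norm a)\<^sup>2 = L * (1 + y) / 3" and nc: "(norm (a - b))\<^sup>2 = L * (1 + z) / 3" and nb: "(norm b)\<^sup>2 = L * (1 + x) / 3"
    using L by (simp_all add: x_def y_def z_def)
  have "a \<noteq> 0" using D by (auto simp: cross2_def)
  then have "0 < L * (1 + y) / 3" unfolding na[symmetric] by simp
  then have y1: "0 < 1 + y" using L by (simp add: zero_less_mult_iff)
  have l: "l\<^sup>2 = (1 + y) / \<sigma>" "0 < l" using y1 \<sigma>(2) by (simp_all add: l_def)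
  define m where "m = (1 - 2 * z - \<sigma>) / (2 * \<sigma>) / l"
  have m: "m * l = (1 - 2 * z - \<sigma>) / (2 * \<sigma>)" using l(2) by (simp add: m_def)
  define a' where "a' = l *\<^sub>R e"
  define b' where "b' = m *\<^sub>R e + (1 / l) *\<^sub>R f"
  have l2q: "l\<^sup>2 * q = L * (1 + y) / 3" unfolding l(1) q using \<sigma>(2) by simp
  have eq1: "(norm a')\<^sup>2 = (norm a)\<^sup>2" unfolding a'_def na l2q[symmetric] q_def by (simp add: power_mult_distrib)
  have ab: "a \<bullet> b = L * (1 - 2 * z) / 6"
  proof -
    have "2 * (a \<bullet> b) = L * (1 + y) / 3 + L * (1 + x) / 3 - L * (1 + z) / 3" using norm_diff_square[of a b] unfolding na nb nc by linarith
    also have "\<dots> = L / 3 * (1 + (x + y + z) - 2 * z)" by (simp add: field_simps)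
    also have "\<dots> = L * (1 - 2 * z) / 3" unfolding si(1) by simp
    finally show ?thesis by simp
  qed
  have "a' \<bullet> b' = (m * l) * q + q / 2"
    unfolding a'_def b'_def q_def using l(2) K(3) by (simp add: inner_add_right power2_norm_eq_inner)
  also have "\<dots> = a \<bullet> b" unfolding m ab q using \<sigma>(2) by (simp add: field_simps)
  finally have eq3: "a' \<bullet> b' = a \<bullet> b" .
  have c': "cross2 a' b' = cross2 e f" unfolding a'_def b'_def cross2_add cross2_scale cross2_self using l(2) by simp
  have eq2: "(norm b')\<^sup>2 = (norm b)\<^sup>2"
  proof -
    have "(cross2 a' b')\<^sup>2 = (cross2 a b)\<^sup>2" unfolding c' using area by (metis power2_abs)
    then have "(norm a)\<^sup>2 * (norm b')\<^sup>2 = (norm a)\<^sup>2 * (norm b)\<^sup>2" unfolding cross2_square eq1 eq3 by simp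
    then show ?thesis using \<open>a \<noteq> 0\<close> by simp
  qed
  have nn: "norm a' = norm a" "norm b' = norm b" using eq1 eq2 by simp_all
  obtain M where M: "rigid_motion M" "M ` affine_triangle c a b = affine_triangle k a' b'"
    by (rule rigid_motion_congruent[OF D nn eq3])
  have ms: "measure lebesgue (affine_triangle k e f) = measure lebesgue (affine_triangle c a b)"
    unfolding measure_triangle[OF D] measure_triangle[OF K(1)] area ..
  have "measure lebesgue (sym_diff (M ` affine_triangle c a b) (affine_triangle k e f)) \<le> 48 * sqrt R * measure lebesgue (affine_triangle c a b)"
  proof (cases "r \<le> 1 / 10")
    case True
    have bd: "\<bar>y\<bar> \<le> r" "\<bar>z\<bar> \<le> r"
    proof -
      have x: "x = - y - z" using si(1) by linarith
      have e: "r\<^sup>2 = 4/3 * (y\<^sup>2 + y * z + z\<^sup>2)" unfolding r(2) si(2)[symmetric] x by (simp add: power2_eq_square algebra_simps)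
      have "r\<^sup>2 - y\<^sup>2 = 1/3 * (y + 2 * z)\<^sup>2" "r\<^sup>2 - z\<^sup>2 = 1/3 * (z + 2 * y)\<^sup>2" unfolding e by (simp_all add: power2_eq_square algebra_simps)
      then have "y\<^sup>2 \<le> r\<^sup>2" "z\<^sup>2 \<le> r\<^sup>2" using zero_le_power2[of "y + 2 * z"] zero_le_power2[of "z + 2 * y"] by linarith+
      then show "\<bar>y\<bar> \<le> r" "\<bar>z\<bar> \<le> r" using r(1) by (metis abs_le_square_iff abs_of_nonneg)+
    qed
    note sp = shape_parameters[OF r(1) True \<sigma> bd l m]
    show ?thesis
      using sheared_triangle_sym_diff(2)[OF K(1) _ sp l(2), of k] r(1) unfolding M(2) a'_def b'_def ms r_def[symmetric] by simp
  next
    case False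
    have D': "cross2 a' b' \<noteq> 0" using c' K(1) by simp
    have "measure lebesgue (sym_diff (affine_triangle k a' b') (affine_triangle k e f)) \<le> 2 * measure lebesgue (affine_triangle c a b)"
      unfolding measure_sym_diff[OF lmeasurable_triangle[OF D'] lmeasurable_triangle[OF K(1)]] ms
      by (simp add: measure_triangle[OF D'] measure_triangle[OF D] c' area)
    also have "\<dots> \<le> 48 * r * measure lebesgue (affine_triangle c a b)" using False by (intro mult_right_mono) auto
    finally show ?thesis unfolding M(2) r_def .
  qed
  with M(1) that show ?thesis by blast
qed

section \<open>Computability of the constant\<close>

lemma total_recursive_const: "total_recursive (\<lambda>xs. n)"
proof (induction n)
  case 0 show ?case by (rule total_recursive.zero)
next
  case (Suc n)
  have "total_recursive (\<lambda>xs. (\<lambda>xs. case xs of [] \<Rightarrow> 1 | x # _ \<Rightarrow> Suc x) (map (\<lambda>g. g xs) [\<lambda>xs. n]))"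
    by (rule total_recursive.comp[OF total_recursive.succ]) (use Suc in simp)
  then show ?case by simp
qed

lemma computable_real_inverse: "computable_real (1 / (real n + 1))"
  unfolding computable_real_def
  by (rule exI[of _ "\<lambda>xs. 1"], rule exI[of _ "\<lambda>xs. 0"], rule exI[of _ "\<lambda>xs. n"]) (simp add: total_recursive_const)

section \<open>Stability\<close>

lemma optimal_ge: "20 \<le> optimal"
proof -
  have "sqrt 3 \<le> 9 / 5" by (rule real_le_lsqrt) (simp_all add: power2_eq_square)
  moreover have "3 * 3 \<le> pi * pi" using pi_gt3 by (intro mult_mono) auto
  ultimately have "20 * sqrt 3 \<le> 4 * pi\<^sup>2" unfolding power2_eq_square by linarith
  then show ?thesis by (simp add: optimal_def field_simps)
qed

text \<open>The deficit is at least \<open>20 R / 1000\<close> and the squared asymmetry at most \<open>48\<^sup>2 R\<close>, which leaves room for the constant \<open>1 / 200000\<close>.\<close>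
theorem stability:
  assumes TE: "equilateral_triangle TEq" "measure lebesgue TEq = 1" and T: "plane_triangle T"
  shows "\<exists>R. rigid_motion R \<and> measure lebesgue T * first_dirichlet_eigenvalue T - first_dirichlet_eigenvalue TEq
     \<ge> 1 / (real 199999 + 1) * (measure lebesgue (sym_diff (R ` T) ((\<lambda>x. sqrt (measure lebesgue T) *\<^sub>R x) ` TEq)) / measure lebesgue T)\<^sup>2"
proof -
  obtain c a b where T: "cross2 a b \<noteq> 0" "T = affine_triangle c a b" "norm a \<le> norm b" "norm (a - b) \<le> norm a"
    by (rule plane_triangle_sorted[OF T])
  obtain k e f where K: "cross2 e f \<noteq> 0" "TEq = affine_triangle k e f" "(norm f)\<^sup>2 = (norm e)\<^sup>2" "e \<bullet> f = (norm e)\<^sup>2 / 2"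
    "\<bar>cross2 e f\<bar> = sqrt 3 / 2 * (norm e)\<^sup>2" by (rule equilateral_affine[OF TE(1)])
  define A where "A = measure lebesgue T"
  have A: "A = \<bar>cross2 a b\<bar> / 2" "A > 0" unfolding A_def T(2) measure_triangle[OF T(1)] using T(1) by simp_all
  define s where "s = sqrt A"
  have s: "s > 0" "s\<^sup>2 = A" "s * s = A" using A(2) by (simp_all add: s_def)
  have K1: "\<bar>cross2 e f\<bar> = 2" using TE(2) unfolding K(2) measure_triangle[OF K(1)] by simp
  have sK: "(\<lambda>x. sqrt A *\<^sub>R x) ` TEq = affine_triangle (s *\<^sub>R k) (s *\<^sub>R e) (s *\<^sub>R f)" unfolding K(2) scale_triangle s_def ..
  have cs: "cross2 (s *\<^sub>R e) (s *\<^sub>R f) = A * cross2 e f" unfolding cross2_scale s(3)[symmetric] by simp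
  define R where "R = 1 - 12 * (cross2 a b)\<^sup>2 / (sides2 a b)\<^sup>2"
  have R0: "0 \<le> R" unfolding R_def shape_identity(2)[OF T(1), symmetric] by simp
  obtain M where M: "rigid_motion M"
    "measure lebesgue (sym_diff (M ` affine_triangle c a b) (affine_triangle (s *\<^sub>R k) (s *\<^sub>R e) (s *\<^sub>R f))) \<le> 48 * sqrt R * measure lebesgue (affine_triangle c a b)"
  proof (rule asymmetry_upper[OF T(1), of "s *\<^sub>R e" "s *\<^sub>R f" c "s *\<^sub>R k", folded R_def])
    show "cross2 (s *\<^sub>R e) (s *\<^sub>R f) \<noteq> 0" unfolding cs using A(2) K(1) by simp
    show "(norm (s *\<^sub>R f))\<^sup>2 = (norm (s *\<^sub>R e))\<^sup>2" "s *\<^sub>R e \<bullet> s *\<^sub>R f = (norm (s *\<^sub>R e))\<^sup>2 / 2"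
      unfolding inner_scaleR_left inner_scaleR_right norm_scaleR power_mult_distrib K(3,4) power2_abs
      by (simp_all add: power2_eq_square[of s])
    show "\<bar>cross2 (s *\<^sub>R e) (s *\<^sub>R f)\<bar> = sqrt 3 / 2 * (norm (s *\<^sub>R e))\<^sup>2"
      unfolding cs abs_mult K(5) using A(2) by (simp add: power_mult_distrib s(2))
    show "\<bar>cross2 (s *\<^sub>R e) (s *\<^sub>R f)\<bar> = \<bar>cross2 a b\<bar>" unfolding cs abs_mult K1 using A by simp
  qed
  define \<alpha> where "\<alpha> = measure lebesgue (sym_diff (M ` T) ((\<lambda>x. sqrt A *\<^sub>R x) ` TEq)) / A"
  have "\<alpha> \<le> 48 * sqrt R" unfolding \<alpha>_def sK using M(2) A(2) unfolding T(2)[symmetric] A_def[symmetric] by (simp add: pos_divide_le_eq)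
  moreover have "0 \<le> \<alpha>" unfolding \<alpha>_def using A(2) by simp
  ultimately have "\<alpha>\<^sup>2 \<le> (48 * sqrt R)\<^sup>2" by (rule power_mono)
  also have "\<dots> = 2304 * R" using R0 by (simp add: power_mult_distrib)
  finally have al: "\<alpha>\<^sup>2 \<le> 2304 * R" .
  have "first_dirichlet_eigenvalue TEq = optimal" using energy_equilateral[OF TE(1)] TE(2) by simp
  moreover have "optimal * (1 + R / 1000) \<le> A * first_dirichlet_eigenvalue T"
    unfolding R_def A_def T(2) by (rule energy_lower[OF T(1,3,4)])
  moreover have "20 * (R / 1000) \<le> optimal * (R / 1000)" using optimal_ge R0 by (intro mult_right_mono) auto
  ultimately have "1 / (real 199999 + 1) * \<alpha>\<^sup>2 \<le> A * first_dirichlet_eigenvalue T - first_dirichlet_eigenvalue TEq"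
    using al R0 by (simp add: distrib_left)
  then show ?thesis using M(1) unfolding \<alpha>_def A_def by blast
qed

section \<open>Sharpness of the exponent\<close>

text \<open>Steiner's decomposition: the value at the centroid and the second moments about it.\<close>
lemma tri_int_quadratic:
  "tri_int (\<lambda>x. (A + fst x * B + snd x * C)\<^sup>2) = ((A + (B + C) / 3)\<^sup>2 + (B\<^sup>2 + C\<^sup>2 + (B - C)\<^sup>2) / 36) / 2"
proof -
  have c: "continuous_on UNIV (\<lambda>x::real\<times>real. (A + fst x * B + snd x * C)\<^sup>2)" by (intro continuous_intros)
  have lint: "(LINT t:{0..b}|lborel. f t) = F b - F 0" if "0 \<le> b" "\<And>t. (F has_real_derivative f t) (at t)" "continuous_on UNIV f" for b :: real and f F :: "real \<Rightarrow> real"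
  proof -
    have si: "set_integrable lborel {0..b} f"
      unfolding set_integrable_def by (rule borel_integrable_compact) (auto intro: continuous_on_subset[OF that(3)])
    have "(f has_integral (F b - F 0)) {0..b}"
      by (rule fundamental_theorem_of_calculus[OF that(1)])
         (simp add: that(2)[THEN has_field_derivative_at_within] flip: has_real_derivative_iff_has_vector_derivative)
    then show ?thesis using set_borel_integral_eq_integral(2)[OF si] by (simp add: integral_unique)
  qed
  have i1: "(LINT t:{0..1 - s}|lborel. (A + fst (s, t) * B + snd (s, t) * C)\<^sup>2) =
     (A + s * B)\<^sup>2 * (1 - s) + (A + s * B) * C * (1 - s)\<^sup>2 + C\<^sup>2 / 3 * (1 - s)^3" if "s \<in> {0..1}" for s
  proof -
    have "((\<lambda>t. (A + s * B)\<^sup>2 * t + (A + s * B) * C * t\<^sup>2 + C\<^sup>2 / 3 * t^3) has_real_derivative (A + fst (s, t) * B + snd (s, t) * C)\<^sup>2) (at t)" for t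
      by (auto intro!: derivative_eq_intros simp: power2_eq_square algebra_simps)
    note lint[of "1 - s", OF _ this]
    moreover have "continuous_on UNIV (\<lambda>t. (A + fst (s, t) * B + snd (s, t) * C)\<^sup>2)" by (intro continuous_intros)
    ultimately show ?thesis using that by simp
  qed
  define F where "F s = A\<^sup>2 * (s - s\<^sup>2/2) + 2 * A * B * (s\<^sup>2/2 - s^3/3) + B\<^sup>2 * (s^3/3 - s^4/4)
    + A * C * (s - s\<^sup>2 + s^3/3) + B * C * (s\<^sup>2/2 - 2 * s^3/3 + s^4/4) + C\<^sup>2/3 * (s - 3 * s\<^sup>2/2 + s^3 - s^4/4)" for s
  have dF: "(F has_real_derivative (A + s * B)\<^sup>2 * (1 - s) + (A + s * B) * C * (1 - s)\<^sup>2 + C\<^sup>2 / 3 * (1 - s)^3) (at s)" for s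
    unfolding F_def[abs_def] by (rule derivative_eq_intros refl | simp)+ (simp add: power2_eq_square power3_eq_cube field_simps)
  have i2: "(LINT s:{0..1}|lborel. (A + s * B)\<^sup>2 * (1 - s) + (A + s * B) * C * (1 - s)\<^sup>2 + C\<^sup>2 / 3 * (1 - s)^3) = F 1 - F 0"
    by (rule lint[OF _ dF]) (simp, intro continuous_intros)
  have "tri_int (\<lambda>x. (A + fst x * B + snd x * C)\<^sup>2) = F 1 - F 0"
    unfolding tri_int_fubini(1)[OF c] i2[symmetric] by (rule set_lebesgue_integral_cong) (simp, use i1 in blast)
  also have "\<dots> = ((A + (B + C) / 3)\<^sup>2 + (B\<^sup>2 + C\<^sup>2 + (B - C)\<^sup>2) / 36) / 2"
    unfolding F_def by (simp add: power2_eq_square field_simps)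
  finally show ?thesis .
qed

definition moment :: "real^2 \<Rightarrow> real^2 \<Rightarrow> (real^2) set \<Rightarrow> real" where
  "moment u z S = (LINT y|lebesgue. indicator S y * (u \<bullet> (y - z))\<^sup>2)"

lemma integrable_moment:
  assumes D: "cross2 a b \<noteq> 0"
  shows "integrable lebesgue (\<lambda>y. indicator (affine_triangle c a b) y * (u \<bullet> (y - z))\<^sup>2)"
proof -
  let ?K = "tri_map c a b ` std_triangle"
  have K: "compact ?K" by (rule compact_continuous_image[OF continuous_tri_map compact_std_triangle])
  have "integrable lborel (\<lambda>y. indicator ?K y *\<^sub>R (u \<bullet> (y - z))\<^sup>2)"
    by (rule borel_integrable_compact[OF K]) (intro continuous_intros)
  then have "integrable lebesgue (\<lambda>y. indicator ?K y *\<^sub>R (u \<bullet> (y - z))\<^sup>2)"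
    by (subst integrable_completion) (auto intro: borel_measurable_integrable)
  then have "integrable lebesgue (\<lambda>y. indicator (affine_triangle c a b) y *\<^sub>R (indicator ?K y *\<^sub>R (u \<bullet> (y - z))\<^sup>2))"
    by (rule integrable_mult_indicator[OF fmeasurableD[OF lmeasurable_triangle[OF D]]])
  moreover have "affine_triangle c a b \<subseteq> ?K" unfolding affine_triangle_def using interior_tri_subset by blast
  then have "(\<lambda>y. indicator (affine_triangle c a b) y *\<^sub>R (indicator ?K y *\<^sub>R (u \<bullet> (y - z))\<^sup>2)) = (\<lambda>y. indicator (affine_triangle c a b) y * (u \<bullet> (y - z))\<^sup>2)"
    by (auto simp: indicator_def fun_eq_iff)
  ultimately show ?thesis by simp
qed

lemma moment_triangle:
  assumes D: "cross2 a b \<noteq> 0"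
  shows "moment u z (affine_triangle c a b) = \<bar>cross2 a b\<bar> / 2 *
     ((u \<bullet> (c - z) + (u \<bullet> a + u \<bullet> b) / 3)\<^sup>2 + ((u \<bullet> a)\<^sup>2 + (u \<bullet> b)\<^sup>2 + (u \<bullet> a - u \<bullet> b)\<^sup>2) / 36)"
proof -
  have mb: "affine_triangle c a b \<in> sets borel" using open_triangle[OF D] by simp
  have "moment u z (affine_triangle c a b) = \<bar>cross2 a b\<bar> * tri_int (\<lambda>x. indicator (affine_triangle c a b) (tri_map c a b x) * (u \<bullet> (tri_map c a b x - z))\<^sup>2)"
    unfolding moment_def
    by (rule integral_triangle[OF D]) (use mb in \<open>auto intro!: borel_measurable_times borel_measurable_indicator borel_measurable_continuous_onI continuous_intros\<close>)
  also have "tri_int (\<lambda>x. indicator (affine_triangle c a b) (tri_map c a b x) * (u \<bullet> (tri_map c a b x - z))\<^sup>2) =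
     tri_int (\<lambda>x. (u \<bullet> (c - z) + fst x * (u \<bullet> a) + snd x * (u \<bullet> b))\<^sup>2)"
    unfolding tri_int_def set_lebesgue_integral_def
  proof (rule integral_cong_AE)
    have "interior_tri \<in> sets borel" "std_triangle \<in> sets borel"
      using open_interior_tri compact_std_triangle by (auto intro: borel_closed compact_imp_closed)
    moreover have ind: "indicator (affine_triangle c a b) (tri_map c a b x) = (indicator interior_tri x :: real)" for x
      by (simp add: indicator_def triangle_iff[OF D])
    moreover have "(\<lambda>x. (u \<bullet> (tri_map c a b x - z))\<^sup>2) \<in> borel_measurable borel" "(\<lambda>x. (u \<bullet> (c - z) + fst x * (u \<bullet> a) + snd x * (u \<bullet> b))\<^sup>2) \<in> borel_measurable borel"
      unfolding tri_map_def by (intro borel_measurable_continuous_onI continuous_intros)+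
    ultimately show "(\<lambda>x. indicator std_triangle x *\<^sub>R (indicator (affine_triangle c a b) (tri_map c a b x) * (u \<bullet> (tri_map c a b x - z))\<^sup>2)) \<in> borel_measurable lborel"
      "(\<lambda>x. indicator std_triangle x *\<^sub>R (u \<bullet> (c - z) + fst x * (u \<bullet> a) + snd x * (u \<bullet> b))\<^sup>2) \<in> borel_measurable lborel"
      unfolding ind by (intro borel_measurable_scaleR borel_measurable_times borel_measurable_indicator; simp)+
    have e: "u \<bullet> (tri_map c a b x - z) = u \<bullet> (c - z) + fst x * (u \<bullet> a) + snd x * (u \<bullet> b)" for x
      unfolding tri_map_def by (simp add: inner_diff_right inner_add_right)
    show "AE x in lborel. indicator std_triangle x *\<^sub>R (indicator (affine_triangle c a b) (tri_map c a b x) * (u \<bullet> (tri_map c a b x - z))\<^sup>2) =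
       indicator std_triangle x *\<^sub>R (u \<bullet> (c - z) + fst x * (u \<bullet> a) + snd x * (u \<bullet> b))\<^sup>2"
      using AE_interior_tri unfolding e by eventually_elim (auto simp: indicator_def triangle_iff[OF D])
  qed
  finally show ?thesis unfolding tri_int_quadratic by simp
qed

text \<open>Moments of two sets differ at most by the supremum of the integrand times the measure of the part that is not common.\<close>
lemma moment_diff_le:
  assumes D: "cross2 a b \<noteq> 0" "cross2 a' b' \<noteq> 0"
    and B: "\<And>y. y \<in> affine_triangle c a b \<Longrightarrow> (u \<bullet> (y - z))\<^sup>2 \<le> B" and B0: "0 \<le> B"
  shows "moment u z (affine_triangle c a b) - moment u z (affine_triangle c' a' b') \<le>
     B * measure lebesgue (sym_diff (affine_triangle c' a' b') (affine_triangle c a b))"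
proof -
  let ?K = "affine_triangle c a b" and ?S = "affine_triangle c' a' b'"
  have m: "?K \<in> lmeasurable" "?S \<in> lmeasurable" using lmeasurable_triangle D by auto
  then have sd: "sym_diff ?S ?K \<in> lmeasurable" by (intro fmeasurable.Un fmeasurable.Diff)
  have "moment u z ?K - moment u z ?S = (LINT y|lebesgue. indicator ?K y * (u \<bullet> (y - z))\<^sup>2 - indicator ?S y * (u \<bullet> (y - z))\<^sup>2)"
    unfolding moment_def by (rule Bochner_Integration.integral_diff[symmetric]; rule integrable_moment; rule D)
  also have "\<dots> \<le> (LINT y|lebesgue. B * indicator (sym_diff ?S ?K) y)"
  proof (rule integral_mono)
    show "integrable lebesgue (\<lambda>y. indicator ?K y * (u \<bullet> (y - z))\<^sup>2 - indicator ?S y * (u \<bullet> (y - z))\<^sup>2)"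
      by (intro Bochner_Integration.integrable_diff integrable_moment D)
    show "integrable lebesgue (\<lambda>y. B * indicator (sym_diff ?S ?K) y)"
      by (intro integrable_mult_right) (use sd in \<open>simp only: lmeasurable_iff_integrable\<close>)
    show "indicator ?K y * (u \<bullet> (y - z))\<^sup>2 - indicator ?S y * (u \<bullet> (y - z))\<^sup>2 \<le> B * indicator (sym_diff ?S ?K) y" for y
    proof -
      have "- (u \<bullet> (y - z))\<^sup>2 \<le> B" using B0 zero_le_power2[of "u \<bullet> (y - z)"] by linarith
      then show ?thesis using B[of y] B0 by (auto simp: indicator_def)
    qed
  qed
  also have "\<dots> = B * measure lebesgue (sym_diff ?S ?K)" by simp
  finally show ?thesis .
qed

text \<open>The inertia tensor of an equilateral triangle is a multiple of the identity.\<close>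
lemma equilateral_isotropic:
  assumes K: "cross2 e f \<noteq> 0" "(norm f)\<^sup>2 = (norm e)\<^sup>2" "e \<bullet> f = (norm e)\<^sup>2 / 2"
  shows "(u \<bullet> e)\<^sup>2 + (u \<bullet> f)\<^sup>2 + (u \<bullet> e - u \<bullet> f)\<^sup>2 = 3 / 2 * (norm e)\<^sup>2 * (norm u)\<^sup>2"
proof -
  define s where "s = fst (tri_coord 0 e f u)"
  define t where "t = snd (tri_coord 0 e f u)"
  have u: "u = s *\<^sub>R e + t *\<^sub>R f" using tri_map_coord[OF K(1), of 0 u] by (simp add: tri_map_def s_def t_def)
  define q where "q = (norm e)\<^sup>2"
  have i: "e \<bullet> e = q" "f \<bullet> f = q" "e \<bullet> f = q / 2" "f \<bullet> e = q / 2"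
    using K(2,3) by (simp_all add: q_def power2_norm_eq_inner inner_commute)
  show ?thesis
    unfolding q_def[symmetric] power2_norm_eq_inner[of u]
    unfolding u inner_add_left inner_add_right inner_scaleR_left inner_scaleR_right i
    by (simp add: power2_eq_square field_simps)
qed

lemma triangle_diff_norm:
  assumes "x \<in> affine_triangle c a b" shows "norm (x - (c + (1/3) *\<^sub>R (a + b))) \<le> 2 * norm a + 2 * norm b"
    and "y \<in> affine_triangle c a b \<Longrightarrow> norm (x - y) \<le> 2 * norm a + 2 * norm b"
proof -
  have g: "norm (s *\<^sub>R a + t *\<^sub>R b) \<le> 2 * norm a + 2 * norm b" if "\<bar>s\<bar> \<le> 2" "\<bar>t\<bar> \<le> 2" for s t
    using norm_triangle_ineq[of "s *\<^sub>R a" "t *\<^sub>R b"] mult_right_mono[OF that(1), of "norm a"] mult_right_mono[OF that(2), of "norm b"] by simp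
  obtain s t where x: "x = c + s *\<^sub>R a + t *\<^sub>R b" "0 < s" "0 < t" "s + t < 1"
    using assms unfolding affine_triangle_def tri_map_def interior_tri_def by auto
  have "x - (c + (1/3) *\<^sub>R (a + b)) = (s - 1/3) *\<^sub>R a + (t - 1/3) *\<^sub>R b" unfolding x(1) by (simp add: algebra_simps)
  then show "norm (x - (c + (1/3) *\<^sub>R (a + b))) \<le> 2 * norm a + 2 * norm b" using x by (auto intro!: g)
  show "norm (x - y) \<le> 2 * norm a + 2 * norm b" if y: "y \<in> affine_triangle c a b"
  proof -
    obtain s' t' where y: "y = c + s' *\<^sub>R a + t' *\<^sub>R b" "0 < s'" "0 < t'" "s' + t' < 1"
      using y unfolding affine_triangle_def tri_map_def interior_tri_def by auto
    have "x - y = (s - s') *\<^sub>R a + (t - t') *\<^sub>R b" unfolding x(1) y(1) by (simp add: algebra_simps)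
    then show ?thesis using x y by (auto intro!: g)
  qed
qed

text \<open>Consider the direction in which the moved triangle is compressed and its second moment about its own centroid. The equilateral triangle is
  isotropic, so its moment about any point is at least the uncompressed value. The difference of the moments is of order \<open>t\<close> and is bounded by a multiple of
  the symmetric difference, provided that the triangles meet; if they do not, the symmetric difference has measure 2.\<close>
lemma stretched_asymmetry:
  assumes K: "cross2 e f \<noteq> 0" "(norm f)\<^sup>2 = (norm e)\<^sup>2" "e \<bullet> f = (norm e)\<^sup>2 / 2" "\<bar>cross2 e f\<bar> = 2"
    and t: "0 < t" "t \<le> 1" and M: "rigid_motion M"
  shows "t / 4800 \<le> measure lebesgue (sym_diff (M ` affine_triangle k ((1 + t) *\<^sub>R e) ((1 / (1 + t)) *\<^sub>R f)) (affine_triangle k e f))"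
    and "measure lebesgue (sym_diff (M ` affine_triangle k ((1 + t) *\<^sub>R e) ((1 / (1 + t)) *\<^sub>R f)) (affine_triangle k e f)) \<le> 2"
proof -
  obtain g d where g: "orthogonal_transformation g" and Md: "M = (\<lambda>x. g x + d)" using M unfolding rigid_motion_def by blast
  have lin: "linear g" and iso: "\<And>v w. g v \<bullet> g w = v \<bullet> w" using g by (auto simp: orthogonal_transformation_def)
  have ng: "norm (g v) = norm v" for v using g by (simp add: orthogonal_transformation_norm)
  define h where "h = 1 + t"
  have h: "1 < h" "h \<le> 2" using t by (simp_all add: h_def)
  define l where "l = norm e"
  have nf: "norm f = l" using K(2) by (simp add: l_def)
  have l0: "0 < l" using K(1) by (auto simp: l_def cross2_def)
  define a where "a = g (h *\<^sub>R e)"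
  define b where "b = g ((1 / h) *\<^sub>R f)"
  define c where "c = g k + d"
  have S: "M ` affine_triangle k ((1 + t) *\<^sub>R e) ((1 / (1 + t)) *\<^sub>R f) = affine_triangle c a b"
    unfolding Md image_triangle[OF lin] a_def b_def c_def h_def ..
  have cab: "\<bar>cross2 a b\<bar> = 2"
  proof -
    have "(cross2 a b)\<^sup>2 = (cross2 (h *\<^sub>R e) ((1 / h) *\<^sub>R f))\<^sup>2" unfolding a_def b_def cross2_square iso ng ..
    also have "\<dots> = (cross2 e f)\<^sup>2" unfolding cross2_scale using h by simp
    finally have "\<bar>cross2 a b\<bar> = \<bar>cross2 e f\<bar>" by (simp only: power2_eq_iff abs_eq_iff)
    then show ?thesis using K(4) by simp
  qed
  have D: "cross2 a b \<noteq> 0" using cab by auto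
  have mm: "measure lebesgue (affine_triangle c a b) = 1" "measure lebesgue (affine_triangle k e f) = 1"
    unfolding measure_triangle[OF D] measure_triangle[OF K(1)] cab K(4) by simp_all
  have lm: "affine_triangle c a b \<in> lmeasurable" "affine_triangle k e f \<in> lmeasurable" using D K(1) by (auto intro: lmeasurable_triangle)
  show "measure lebesgue (sym_diff (M ` affine_triangle k ((1 + t) *\<^sub>R e) ((1 / (1 + t)) *\<^sub>R f)) (affine_triangle k e f)) \<le> 2"
    unfolding S measure_sym_diff[OF lm] mm by simp
  show "t / 4800 \<le> measure lebesgue (sym_diff (M ` affine_triangle k ((1 + t) *\<^sub>R e) ((1 / (1 + t)) *\<^sub>R f)) (affine_triangle k e f))"
  proof (cases "affine_triangle c a b \<inter> affine_triangle k e f = {}")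
    case True
    show ?thesis unfolding S measure_sym_diff[OF lm] mm True using t by simp
  next
    case False
    then obtain y where y: "y \<in> affine_triangle c a b" "y \<in> affine_triangle k e f" by blast
    \<comment> \<open>perpendicular to the stretched side, hence a direction of compression\<close>
    define v where "v = (vector [- e$2, e$1] :: real^2)"
    have v: "v \<bullet> e = 0" "norm v = l" unfolding v_def l_def by (simp_all add: inner_real2 norm_eq_sqrt_inner)
    define u where "u = g v"
    have nu: "norm u = l" unfolding u_def ng v(2) ..
    define z where "z = c + (1/3) *\<^sub>R (a + b)"
    have ua: "u \<bullet> a = 0" "u \<bullet> b = (v \<bullet> f) / h" unfolding u_def a_def b_def iso using v(1) by simp_all
    have vf: "2 * (v \<bullet> f)\<^sup>2 = 3 / 2 * l\<^sup>2 * l\<^sup>2"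
      using equilateral_isotropic[OF K(1-3), of v] unfolding v l_def[symmetric] by simp
    have "u \<bullet> (c - z) + (u \<bullet> a + u \<bullet> b) / 3 = 0"
      unfolding z_def by (simp add: inner_diff_right inner_add_right)
    then have "moment u z (affine_triangle c a b) = (2 * (v \<bullet> f)\<^sup>2) / h\<^sup>2 / 36"
      unfolding moment_triangle[OF D] cab by (simp add: ua power_divide)
    then have mS: "moment u z (affine_triangle c a b) = l^4 / (24 * h\<^sup>2)"
      unfolding vf by (simp add: power4_eq_xxxx power2_eq_square)
    have mK: "l^4 / 24 \<le> moment u z (affine_triangle k e f)"
    proof -
      have "l^4 / 24 = (3 / 2 * l\<^sup>2 * l\<^sup>2) / 36" by (simp add: power4_eq_xxxx power2_eq_square)
      also have "3 / 2 * l\<^sup>2 * l\<^sup>2 = (u \<bullet> e)\<^sup>2 + (u \<bullet> f)\<^sup>2 + (u \<bullet> e - u \<bullet> f)\<^sup>2"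
        using equilateral_isotropic[OF K(1-3), of u] unfolding nu l_def[symmetric] by simp
      finally have fx: "l^4 / 24 = ((u \<bullet> e)\<^sup>2 + (u \<bullet> f)\<^sup>2 + (u \<bullet> e - u \<bullet> f)\<^sup>2) / 36" .
      show ?thesis unfolding moment_triangle[OF K(1)] K(4) fx by simp
    qed
    have B: "(u \<bullet> (x - z))\<^sup>2 \<le> 100 * l^4" if x: "x \<in> affine_triangle k e f" for x
    proof -
      have na: "norm a \<le> 2 * l" "norm b \<le> l" unfolding a_def b_def ng
        using h l0 nf by (simp_all add: l_def[symmetric] divide_le_eq)
      have "norm (x - z) \<le> norm (x - y) + norm (y - z)" using norm_triangle_ineq[of "x - y" "y - z"] by simp
      also have "\<dots> \<le> 10 * l"
        using triangle_diff_norm(2)[OF x y(2)] triangle_diff_norm(1)[OF y(1)] na nf unfolding z_def[symmetric] l_def[symmetric] by linarith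
      finally have "norm u * norm (x - z) \<le> l * (10 * l)" unfolding nu using l0 by simp
      then have "\<bar>u \<bullet> (x - z)\<bar> \<le> l * (10 * l)" using Cauchy_Schwarz_ineq2[of u "x - z"] by linarith
      then have "(u \<bullet> (x - z))\<^sup>2 \<le> (l * (10 * l))\<^sup>2" using power_mono[of "\<bar>u \<bullet> (x - z)\<bar>" _ 2] by simp
      then show ?thesis by (simp add: power4_eq_xxxx power2_eq_square)
    qed
    define \<Delta> where "\<Delta> = measure lebesgue (sym_diff (affine_triangle c a b) (affine_triangle k e f))"
    have "moment u z (affine_triangle k e f) - moment u z (affine_triangle c a b) \<le> 100 * l^4 * \<Delta>"
      unfolding \<Delta>_def by (rule moment_diff_le[OF K(1) D B]) simp_all
    then have "l^4 / 24 - l^4 / (24 * h\<^sup>2) \<le> 100 * l^4 * \<Delta>" using mS mK by linarith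
    then have "l^4 * (1 / 24 * (1 - 1 / h\<^sup>2)) \<le> l^4 * (100 * \<Delta>)" by (simp add: right_diff_distrib mult_ac)
    then have 1: "1 - 1 / h\<^sup>2 \<le> 2400 * \<Delta>" using l0 by simp
    have "t / 2 \<le> 1 - 1 / h\<^sup>2"
    proof -
      have "1 / h\<^sup>2 \<le> 1 / h" using h by (intro divide_left_mono) (auto simp: power2_eq_square)
      moreover have "1 - 1 / h = t / h" using h by (simp add: h_def field_simps)
      moreover have "t / 2 \<le> t / h" using h t by (intro divide_left_mono) auto
      ultimately show ?thesis by linarith
    qed
    then show ?thesis using 1 unfolding S \<Delta>_def[symmetric] by linarith
  qed
qed

text \<open>The sum of the squared side lengths is stationary at the equilateral triangle among triangles of equal area.\<close>
lemma stretched_energy: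
  fixes k e f :: "real^2" and t :: real
  assumes K: "cross2 e f \<noteq> 0" "(norm f)\<^sup>2 = (norm e)\<^sup>2" "e \<bullet> f = (norm e)\<^sup>2 / 2" "\<bar>cross2 e f\<bar> = sqrt 3 / 2 * (norm e)\<^sup>2" "\<bar>cross2 e f\<bar> = 2"
    and t: "0 < t" "t \<le> 1"
  defines "T \<equiv> affine_triangle k ((1 + t) *\<^sub>R e) ((1 / (1 + t)) *\<^sub>R f)"
  shows "plane_triangle T" "measure lebesgue T = 1" "first_dirichlet_eigenvalue T \<le> optimal + 3 * optimal * t\<^sup>2"
proof -
  define h where "h = 1 + t"
  have h: "1 < h" "h \<le> 2" using t by (simp_all add: h_def)
  have c: "cross2 (h *\<^sub>R e) ((1 / h) *\<^sub>R f) = cross2 e f" unfolding cross2_scale using h by simp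
  have D: "cross2 (h *\<^sub>R e) ((1 / h) *\<^sub>R f) \<noteq> 0" using c K(1) by simp
  have Th: "T = affine_triangle k (h *\<^sub>R e) ((1 / h) *\<^sub>R f)" unfolding T_def h_def ..
  show "plane_triangle T" unfolding Th by (rule plane_triangle_affine[OF D])
  show m: "measure lebesgue T = 1" unfolding Th measure_triangle[OF D] c K(5) by simp
  define q where "q = (norm e)\<^sup>2"
  have q: "q = 4 / sqrt 3" using K(4,5) by (simp add: q_def field_simps)
  have "sides2 (h *\<^sub>R e) ((1 / h) *\<^sub>R f) = q * (2 * (h\<^sup>2 + (1 / h)\<^sup>2) - 1)"
    unfolding sides2_def norm_diff_square norm_scaleR power_mult_distrib power2_abs inner_scaleR_left inner_scaleR_right K(2,3) q_def[symmetric]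
    using h by (simp add: field_simps)
  also have "h\<^sup>2 + (1 / h)\<^sup>2 = 2 + (h - 1 / h)\<^sup>2" using h by (simp add: power2_eq_square field_simps)
  also have "(h - 1 / h)\<^sup>2 \<le> (2 * t)\<^sup>2"
  proof (rule power_mono)
    have "1 - 1 / h = t / h" using h by (simp add: h_def field_simps)
    moreover have "t / h \<le> t / 1" using h t by (intro divide_left_mono) auto
    ultimately show "h - 1 / h \<le> 2 * t" by (simp add: h_def)
    have "1 / h \<le> 1" using h by simp
    then show "0 \<le> h - 1 / h" using h by linarith
  qed
  finally have s: "sides2 (h *\<^sub>R e) ((1 / h) *\<^sub>R f) \<le> q * (3 + 8 * t\<^sup>2)" by (simp add: q power_mult_distrib divide_right_mono)
  have "first_dirichlet_eigenvalue T \<le> 2 * pi\<^sup>2 / 3 * (sides2 (h *\<^sub>R e) ((1 / h) *\<^sub>R f) / 2)"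
    using energy_upper[OF D, of k] m unfolding Th c K(5) by simp
  also have "\<dots> \<le> 2 * pi\<^sup>2 / 3 * (q * (3 + 8 * t\<^sup>2) / 2)" by (intro mult_left_mono divide_right_mono s) auto
  also have "\<dots> = optimal + 8/3 * optimal * t\<^sup>2" unfolding q optimal_def by (simp add: field_simps)
  also have "\<dots> \<le> optimal + 3 * optimal * t\<^sup>2"
    by (intro add_left_mono mult_right_mono) (auto simp: optimal_def)
  finally show "first_dirichlet_eigenvalue T \<le> optimal + 3 * optimal * t\<^sup>2" .
qed

lemma no_smaller_power:
  fixes A C q :: real
  assumes A: "0 < A" and C: "0 \<le> C" and q: "q < 2" and le: "\<And>t. 0 < t \<Longrightarrow> t \<le> 1 \<Longrightarrow> A * t powr q \<le> C * t\<^sup>2"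
  shows False
proof -
  \<comment> \<open>so small that the right-hand side is at most half of the left-hand side\<close>
  define t where "t = min 1 ((A / (2 * (C + 1))) powr (1 / (2 - q)))"
  have t: "0 < t" "t \<le> 1" using A C by (simp_all add: t_def)
  have "t powr (2 - q) \<le> ((A / (2 * (C + 1))) powr (1 / (2 - q))) powr (2 - q)"
    using t q by (intro powr_mono2) (auto simp: t_def)
  also have "\<dots> = A / (2 * (C + 1))" using q A C by (simp add: powr_powr)
  finally have "(C + 1) * t powr (2 - q) \<le> A / 2" using C by (simp add: field_simps)
  moreover have "A \<le> C * t powr (2 - q)"
  proof -
    have "A * t powr q \<le> C * (t powr (2 - q) * t powr q)"
      using le[OF t] t by (simp add: powr_add[symmetric] powr_numeral)
    then have "A * t powr q \<le> (C * t powr (2 - q)) * t powr q" by (simp add: mult_ac)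
    then show ?thesis using t by simp
  qed
  moreover have "0 \<le> t powr (2 - q)" by simp
  ultimately show False using A by (simp add: distrib_right)
qed

text \<open>As the asymmetry lies between \<open>t / 4800\<close> and \<open>2\<close>, its power is at least a multiple of \<open>t\<close> to the power \<open>max p 0\<close>; negative exponents are
  covered by this as well.\<close>
theorem sharpness:
  assumes p: "p < 2" and TE: "equilateral_triangle TEq" "measure lebesgue TEq = 1" and a: "a > 0"
    and H: "\<forall>T. plane_triangle T \<longrightarrow> (\<exists>R. rigid_motion R \<and> measure lebesgue T * first_dirichlet_eigenvalue T - first_dirichlet_eigenvalue TEq
      \<ge> a * (measure lebesgue (sym_diff (R ` T) ((\<lambda>x. sqrt (measure lebesgue T) *\<^sub>R x) ` TEq)) / measure lebesgue T) powr p)"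
  shows False
proof -
  obtain k e f where K: "cross2 e f \<noteq> 0" "TEq = affine_triangle k e f" "(norm f)\<^sup>2 = (norm e)\<^sup>2" "e \<bullet> f = (norm e)\<^sup>2 / 2"
    "\<bar>cross2 e f\<bar> = sqrt 3 / 2 * (norm e)\<^sup>2" by (rule equilateral_affine[OF TE(1)])
  have K1: "\<bar>cross2 e f\<bar> = 2" using TE(2) unfolding K(2) measure_triangle[OF K(1)] by simp
  have opt: "first_dirichlet_eigenvalue TEq = optimal" using energy_equilateral[OF TE(1)] TE(2) by simp
  define q where "q = max p 0"
  have q: "q < 2" "0 \<le> q" "p \<le> q" using p by (auto simp: q_def)
  show False
  proof (rule no_smaller_power[OF _ _ q(1)])
    show "0 < a * (2 powr p * (1 / 9600) powr q)" using a by simp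
    show "0 \<le> 3 * optimal" by (simp add: optimal_def)
    fix t :: real assume t: "0 < t" "t \<le> 1"
    note st = stretched_energy[OF K(1,3,4,5) K1 t, of k]
    define T where "T = affine_triangle k ((1 + t) *\<^sub>R e) ((1 / (1 + t)) *\<^sub>R f)"
    obtain R where R: "rigid_motion R" "first_dirichlet_eigenvalue T - optimal
      \<ge> a * (measure lebesgue (sym_diff (R ` T) TEq)) powr p"
      using H[rule_format, OF st(1)] unfolding T_def st(2) opt by auto
    define \<alpha> where "\<alpha> = measure lebesgue (sym_diff (R ` T) TEq)"
    have al: "t / 4800 \<le> \<alpha>" "\<alpha> \<le> 2"
      using stretched_asymmetry[OF K(1,3,4) K1 t R(1), of k] unfolding \<alpha>_def T_def K(2) by simp_all
    have a0: "0 < \<alpha>" using al t by linarith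
    have "2 powr p * ((1 / 9600) powr q * t powr q) = 2 powr p * (t / 9600) powr q"
      using t by (simp add: powr_mult[symmetric])
    also have "\<dots> \<le> 2 powr p * (\<alpha> / 2) powr q" using al t q by (intro mult_left_mono powr_mono2) auto
    also have "\<dots> \<le> 2 powr p * (\<alpha> / 2) powr p" using al a0 q by (intro mult_left_mono powr_mono') auto
    also have "\<dots> = \<alpha> powr p" using a0 by (simp add: powr_mult[symmetric])
    finally have "a * (2 powr p * ((1 / 9600) powr q * t powr q)) \<le> a * \<alpha> powr p" using a by simp
    also have "\<dots> \<le> 3 * optimal * t\<^sup>2" using R(2) st(3) unfolding \<alpha>_def T_def by linarith
    finally show "a * (2 powr p * (1 / 9600) powr q) * t powr q \<le> 3 * optimal * t\<^sup>2" by (simp add: mult.assoc)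
  qed
qed

theorem corollary1p13:
  shows "(\<exists>a>0. computable_real a \<and>
      (\<forall>TEq T. equilateral_triangle TEq \<and> measure lebesgue TEq = 1 \<and> plane_triangle T \<longrightarrow>
        (\<exists>R. rigid_motion R \<and>
          measure lebesgue T * first_dirichlet_eigenvalue T - first_dirichlet_eigenvalue TEq
          \<ge> a * (measure lebesgue
                    (sym_diff (R ` T) ((\<lambda>x. sqrt (measure lebesgue T) *\<^sub>R x) ` TEq))
                  / measure lebesgue T)\<^sup>2)))
    \<and> (\<forall>p<2. \<forall>TEq. equilateral_triangle TEq \<and> measure lebesgue TEq = 1 \<longrightarrow>
        \<not> (\<exists>a>0. \<forall>T. plane_triangle T \<longrightarrow>
          (\<exists>R. rigid_motion R \<and>
            measure lebesgue T * first_dirichlet_eigenvalue T - first_dirichlet_eigenvalue TEq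
            \<ge> a * (measure lebesgue
                      (sym_diff (R ` T) ((\<lambda>x. sqrt (measure lebesgue T) *\<^sub>R x) ` TEq))
                    / measure lebesgue T) powr p)))"
proof (rule conjI)
  have "0 < 1 / (real 199999 + 1)" by simp
  then show "\<exists>a>0. computable_real a \<and>
      (\<forall>TEq T. equilateral_triangle TEq \<and> measure lebesgue TEq = 1 \<and> plane_triangle T \<longrightarrow>
        (\<exists>R. rigid_motion R \<and>
          measure lebesgue T * first_dirichlet_eigenvalue T - first_dirichlet_eigenvalue TEq
          \<ge> a * (measure lebesgue
                    (sym_diff (R ` T) ((\<lambda>x. sqrt (measure lebesgue T) *\<^sub>R x) ` TEq))
                  / measure lebesgue T)\<^sup>2))"
    using computable_real_inverse stability by blast
  show "\<forall>p<2. \<forall>TEq. equilateral_triangle TEq \<and> measure lebesgue TEq = 1 \<longrightarrow>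
        \<not> (\<exists>a>0. \<forall>T. plane_triangle T \<longrightarrow>
          (\<exists>R. rigid_motion R \<and>
            measure lebesgue T * first_dirichlet_eigenvalue T - first_dirichlet_eigenvalue TEq
            \<ge> a * (measure lebesgue
                      (sym_diff (R ` T) ((\<lambda>x. sqrt (measure lebesgue T) *\<^sub>R x) ` TEq))
                    / measure lebesgue T) powr p))"
    using sharpness by blast
qed

end
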